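(* Let $\Omega\subset\mathbb{R}^N$ ($N\ge 2$) be a bounded domain whose boundary is of class $C^\infty$, and let $u$ be the solution of $$\partial_t u=\Delta u \ \text{in } \Omega\times(0,\infty),\qquad u=1 \ \text{on } \Omega\times\{0\},\qquad u=0 \ \text{on } \partial\Omega\times(0,\infty).$$ Suppose there exist sequences $(t_n)_{n\in\mathbb{N}}\subset(0,\infty)$ and $(b_n)_{n\in\mathbb{N}}\subset\mathbb{R}$ such that $\partial_\nu u(t_n)\equiv b_n$ on $\partial\Omega$ for all $n\in\mathbb{N}$, and suppose that $0$ is an accumulation point of $(t_n)_n$. Then $\Omega$ is a ball.
   Context: $u(t)$ denotes $x\mapsto u(x,t)$; $\partial_\nu$ is the normal derivative with respect to the exterior unit normal $\nu$ on $\partial\Omega$ (understood as the weak conormal derivative $\langle\partial_\nu\varphi,\psi\rangle:=\int_\Omega\Delta\varphi\,\tilde\psi+\int_\Omega\nabla\varphi\cdot\nabla\tilde\psi$, $\tilde\psi$ the harmonic extension of $\psi\in H^{1/2}(\partial\Omega)$, which coincides with the classical one for smooth functions), and $\partial_\nu u(t_n)\equiv b_n$ means $\partial_\nu u(t_n)$ equals the constant $b_n$ on $\partial\Omega$. *)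

theory Defs
  imports "HOL-Analysis.Analysis"
begin

fun Ck_on :: "nat \<Rightarrow> 'a::euclidean_space set \<Rightarrow> ('a \<Rightarrow> real) \<Rightarrow> bool" where
  "Ck_on 0 U f = continuous_on U f"
| "Ck_on (Suc k) U f =
     (f differentiable_on U \<and> (\<forall>v. Ck_on k U (\<lambda>x. frechet_derivative f (at x) v)))"

definition smooth_on :: "'a::euclidean_space set \<Rightarrow> ('a \<Rightarrow> real) \<Rightarrow> bool" where
  "smooth_on U f \<longleftrightarrow> (\<forall>k. Ck_on k U f)"

definition smooth_bounded_domain :: "'a::euclidean_space set \<Rightarrow> bool" where
  "smooth_bounded_domain \<Omega> \<longleftrightarrow>
     open \<Omega> \<and> connected \<Omega> \<and> bounded \<Omega> \<and> \<Omega> \<noteq> {} \<and>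
     (\<forall>x\<in>frontier \<Omega>. \<exists>U \<rho>. open U \<and> x \<in> U \<and> smooth_on U \<rho> \<and>
         \<Omega> \<inter> U = {y\<in>U. \<rho> y < 0} \<and> (\<forall>y\<in>U. frechet_derivative \<rho> (at y) \<noteq> (\<lambda>h. 0)))"

definition outer_unit_normal :: "'a::euclidean_space set \<Rightarrow> 'a \<Rightarrow> 'a \<Rightarrow> bool" where
  "outer_unit_normal \<Omega> x \<nu> \<longleftrightarrow>
     (\<exists>U \<rho> v. open U \<and> x \<in> U \<and> \<Omega> \<inter> U = {y\<in>U. \<rho> y < 0} \<and> \<rho> x = 0 \<and>
        (\<rho> has_derivative (\<lambda>h. v \<bullet> h)) (at x) \<and> v \<noteq> 0 \<and> \<nu> = v /\<^sub>R norm v)"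

definition laplacian :: "('a::euclidean_space \<Rightarrow> real) \<Rightarrow> 'a \<Rightarrow> real" where
  "laplacian f x = (\<Sum>i\<in>Basis. frechet_derivative (\<lambda>y. frechet_derivative f (at y) i) (at x) i)"

definition heat_solution_one :: "'a::euclidean_space set \<Rightarrow> ('a \<Rightarrow> real \<Rightarrow> real) \<Rightarrow> bool" where
  "heat_solution_one \<Omega> u \<longleftrightarrow>
     (\<forall>t>0. Ck_on 2 \<Omega> (\<lambda>x. u x t)) \<and>
     (\<forall>x\<in>\<Omega>. \<forall>t>0. ((\<lambda>s. u x s) has_real_derivative laplacian (\<lambda>y. u y t) x) (at t)) \<and>
     continuous_on ((closure \<Omega> \<times> {0<..}) \<union> (\<Omega> \<times> {0..})) (\<lambda>(x,t). u x t) \<and>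
     (\<forall>x\<in>\<Omega>. u x 0 = 1) \<and>
     (\<forall>x\<in>frontier \<Omega>. \<forall>t>0. u x t = 0) \<and>
     bounded ((\<lambda>(x,t). u x t) ` ((closure \<Omega> \<times> {0<..}) \<union> (\<Omega> \<times> {0..})))"

definition normal_deriv_eq :: "'a::euclidean_space set \<Rightarrow> ('a \<Rightarrow> real) \<Rightarrow> 'a \<Rightarrow> real \<Rightarrow> bool" where
  "normal_deriv_eq \<Omega> f x b \<longleftrightarrow>
     (\<forall>\<nu>. outer_unit_normal \<Omega> x \<nu> \<longrightarrow>
        ((\<lambda>h. f (x + h *\<^sub>R \<nu>)) has_real_derivative b) (at_left 0))"

end

theory Submission
  imports Defs
begin

text \<open>
  Near a boundary point the solution behaves for small \<open>t\<close> like the one-dimensional boundary layer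
  in the distance to the boundary, and comparison with perturbations of that layer gives
  \<open>\<partial>\<^sub>\<nu> u(x, t) = - 1 / sqrt (\<pi> t) + H(x) / 2 + o(1)\<close>, where \<open>H\<close> is the sum of the principal curvatures.
  Since the normal derivative is constant on the boundary at times accumulating at \<open>0\<close>, the boundary
  has constant mean curvature.

  Move a plane orthogonal to a direction \<open>e\<close> until the reflected cap leaves the domain. The difference
  of \<open>u\<close> and its reflection is a nonnegative solution of the heat equation on the reflected cap. If the
  caps first touch at an interior point of the cap boundary, the constant normal derivative at a single time
  contradicts the Hopf lemma. If the plane becomes orthogonal to the boundary, Serrin's corner lemma
  is replaced by a geometric argument: the two pieces of the boundary are tangent, ordered and of the
  same constant mean curvature. Hence there is a symmetry plane in every direction. All of them pass
  through one point, since otherwise a composition of reflections would translate the bounded domain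
  into itself; and the reflection property beyond the critical plane shows that the domain contains
  with \<open>x\<close> everything that is closer to that point.
\<close>

section \<open>Second-order expansions along curves\<close>

text \<open>Little is known about \<open>u\<close> at the boundary: it is continuous there only for
  positive times, its initial and boundary values clash on the frontier at time 0, and the normal
  derivative is a one-sided limit. Hence comparison rests on a minimum principle that ignores a
  compact negligible set at time 0, and barriers enter through pointwise expansions along lines and
  parabolas (\<open>has_d2\<close>, \<open>jet2\<close>), which is exactly what a minimum point
  tests. Serrin's corner lemma would ask for second derivatives of \<open>u\<close> at the boundary;
  the constant mean curvature, gained from times tending to 0, moves the corner problem into the
  geometry of a smooth hypersurface. The asymptotic expansion is not stated as a limit: for each
  number on either side of minus the mean curvature there is a one-sided bound valid for small
  times. Both bounds have the same leading constant, so the unknown \<open>b n\<close> is eliminated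
  between two boundary points.\<close>

definition has_d2 :: "(real \<Rightarrow> real) \<Rightarrow> real \<Rightarrow> real \<Rightarrow> bool" where
  "has_d2 \<phi> a b \<longleftrightarrow>
     (\<exists>g. (\<forall>\<^sub>F s in nhds 0. (\<phi> has_real_derivative g s) (at s)) \<and> g 0 = a \<and>
          (g has_real_derivative b) (at 0))"

lemma has_d2I:
  assumes "\<And>s. (\<phi> has_real_derivative g s) (at s)" "g 0 = a" "(g has_real_derivative b) (at 0)"
  shows "has_d2 \<phi> a b"
  unfolding has_d2_def using assms by (intro exI[of _ g]) simp

lemma has_d2_deriv:
  assumes "has_d2 \<phi> a b" shows "(\<phi> has_real_derivative a) (at 0)"
  using assms unfolding has_d2_def by (auto dest: eventually_nhds_x_imp_x)

lemma has_d2_add: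
  assumes "has_d2 f a b" "has_d2 g c d" shows "has_d2 (\<lambda>s. f s + g s) (a + c) (b + d)"
proof -
  obtain f' g' where *: "\<forall>\<^sub>F s in nhds 0. (f has_real_derivative f' s) (at s)" "f' 0 = a"
      "(f' has_real_derivative b) (at 0)"
      "\<forall>\<^sub>F s in nhds 0. (g has_real_derivative g' s) (at s)" "g' 0 = c"
      "(g' has_real_derivative d) (at 0)"
    using assms unfolding has_d2_def by blast
  have "\<forall>\<^sub>F s in nhds 0. ((\<lambda>s. f s + g s) has_real_derivative (f' s + g' s)) (at s)"
    using *(1,4) by eventually_elim (rule DERIV_add)
  then show ?thesis unfolding has_d2_def
    using * DERIV_add[OF *(3) *(6)] by (intro exI[of _ "\<lambda>s. f' s + g' s"]) auto
qed

lemma has_d2_cmult: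
  assumes "has_d2 f a b" shows "has_d2 (\<lambda>s. k * f s) (k * a) (k * b)"
proof -
  obtain f' where *: "\<forall>\<^sub>F s in nhds 0. (f has_real_derivative f' s) (at s)" "f' 0 = a"
      "(f' has_real_derivative b) (at 0)"
    using assms unfolding has_d2_def by blast
  have "\<forall>\<^sub>F s in nhds 0. ((\<lambda>s. k * f s) has_real_derivative (k * f' s)) (at s)"
    using *(1) by eventually_elim (rule DERIV_cmult)
  then show ?thesis unfolding has_d2_def
    using * DERIV_cmult[OF *(3)] by (intro exI[of _ "\<lambda>s. k * f' s"]) auto
qed

lemma has_d2_const: "has_d2 (\<lambda>s. k) 0 0"
  by (rule has_d2I[where g="\<lambda>_. 0"]) auto

lemma has_d2_diff:
  assumes "has_d2 f a b" "has_d2 g c d" shows "has_d2 (\<lambda>s. f s - g s) (a - c) (b - d)"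
  using has_d2_add[OF assms(1) has_d2_cmult[OF assms(2), of "-1"]] by simp

lemma has_d2_mult:
  assumes "has_d2 f a b" "has_d2 g c d"
  shows "has_d2 (\<lambda>s. f s * g s) (a * g 0 + f 0 * c) (b * g 0 + 2 * a * c + f 0 * d)"
proof -
  obtain f' g' where *: "\<forall>\<^sub>F s in nhds 0. (f has_real_derivative f' s) (at s)" "f' 0 = a"
      "(f' has_real_derivative b) (at 0)"
      "\<forall>\<^sub>F s in nhds 0. (g has_real_derivative g' s) (at s)" "g' 0 = c"
      "(g' has_real_derivative d) (at 0)"
    using assms unfolding has_d2_def by blast
  have "\<forall>\<^sub>F s in nhds 0. ((\<lambda>s. f s * g s) has_real_derivative (f' s * g s + f s * g' s)) (at s)"
    using *(1,4) by eventually_elim (auto intro!: derivative_eq_intros)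
  moreover have "((\<lambda>s. f' s * g s + f s * g' s) has_real_derivative
      (b * g 0 + 2 * a * c + f 0 * d)) (at 0)"
    using * has_d2_deriv[OF assms(1)] has_d2_deriv[OF assms(2)]
    by (auto intro!: derivative_eq_intros simp: algebra_simps)
  ultimately show ?thesis unfolding has_d2_def
    using * by (intro exI[of _ "\<lambda>s. f' s * g s + f s * g' s"]) auto
qed

lemma has_d2_compose:
  assumes f: "has_d2 f a b"
    and p1: "\<forall>\<^sub>F z in nhds (f 0). (\<psi> has_real_derivative \<psi>' z) (at z)"
    and p2: "(\<psi>' has_real_derivative d) (at (f 0))"
  shows "has_d2 (\<lambda>s. \<psi> (f s)) (\<psi>' (f 0) * a) (d * a\<^sup>2 + \<psi>' (f 0) * b)"
proof -
  obtain f' where *: "\<forall>\<^sub>F s in nhds 0. (f has_real_derivative f' s) (at s)" "f' 0 = a"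
      "(f' has_real_derivative b) (at 0)"
    using assms unfolding has_d2_def by blast
  have f0: "(f has_real_derivative a) (at 0)" by (rule has_d2_deriv[OF f])
  have "(f \<longlongrightarrow> f 0) (nhds 0)"
    using DERIV_isCont[OF f0] by (simp add: isCont_def tendsto_nhds_iff)
  from eventually_compose_filterlim[OF p1 this]
  have "\<forall>\<^sub>F s in nhds 0. (\<psi> has_real_derivative \<psi>' (f s)) (at (f s))" .
  with *(1) have "\<forall>\<^sub>F s in nhds 0. ((\<lambda>s. \<psi> (f s)) has_real_derivative (\<psi>' (f s) * f' s)) (at s)"
    by eventually_elim (rule DERIV_chain2)
  moreover have "((\<lambda>s. \<psi>' (f s) * f' s) has_real_derivative (d * a\<^sup>2 + \<psi>' (f 0) * b)) (at 0)"
    using DERIV_mult[OF DERIV_chain2[OF p2 f0] *(3)] *(2)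
    by (simp add: power2_eq_square algebra_simps)
  ultimately show ?thesis unfolding has_d2_def
    using * by (intro exI[of _ "\<lambda>s. \<psi>' (f s) * f' s"]) auto
qed

text \<open>One side suffices because the first derivative vanishes: if \<open>b < 0\<close>, then
  \<open>f'\<close> is negative just to the right of 0 and the mean value theorem makes
  \<open>f\<close> drop below \<open>f 0\<close>.\<close>

lemma has_d2_right_min:
  assumes f: "has_d2 f 0 b" and m: "\<forall>\<^sub>F s in at_right 0. f s \<ge> f 0"
  shows "b \<ge> 0"
proof (rule ccontr)
  assume "\<not> b \<ge> 0"
  obtain f' where *: "\<forall>\<^sub>F s in nhds 0. (f has_real_derivative f' s) (at s)" "f' 0 = 0"
      "(f' has_real_derivative b) (at 0)"
    using f unfolding has_d2_def by blast
  obtain d where d: "d > 0" "\<And>s. \<bar>s\<bar> < d \<Longrightarrow> (f has_real_derivative f' s) (at s)"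
    using *(1) unfolding eventually_nhds_metric by (auto simp: dist_real_def)
  obtain d2 where d2: "d2 > 0" "\<And>h. h > 0 \<Longrightarrow> h < d2 \<Longrightarrow> f' (0 + h) < f' 0"
    using DERIV_neg_dec_right[OF *(3)] \<open>\<not> b \<ge> 0\<close> by (metis not_le)
  obtain d3 where d3: "d3 > 0" "\<And>s. s > 0 \<Longrightarrow> s < d3 \<Longrightarrow> f s \<ge> f 0"
    using m unfolding eventually_at_right_field by auto
  define s where "s = min d (min d2 d3) / 2"
  have s: "s > 0" "s < d" "s < d2" "s < d3" using d d2 d3 by (auto simp: s_def)
  have "\<exists>z. 0 < z \<and> z < s \<and> f s - f 0 = (s - 0) * f' z"
    by (rule MVT2) (use s d in auto)
  then obtain z where z: "0 < z" "z < s" "f s - f 0 = s * f' z" by auto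
  have "f' z < 0" using d2(2)[of z] z s *(2) by auto
  then have "s * f' z < 0" using s by (simp add: mult_pos_neg)
  then have "f s < f 0" using z by linarith
  then show False using d3(2)[of s] s by auto
qed

lemma has_d2_right_min_deriv:
  assumes f: "has_d2 f a b" and m: "\<forall>\<^sub>F s in at_right 0. f s \<ge> f 0"
  shows "a \<ge> 0"
proof (rule ccontr)
  assume "\<not> a \<ge> 0"
  then obtain d2 where d2: "d2 > 0" "\<And>h. h > 0 \<Longrightarrow> h < d2 \<Longrightarrow> f (0 + h) < f 0"
    using DERIV_neg_dec_right[OF has_d2_deriv[OF f]] by (metis not_le)
  obtain d3 where d3: "d3 > 0" "\<And>s. s > 0 \<Longrightarrow> s < d3 \<Longrightarrow> f s \<ge> f 0"
    using m unfolding eventually_at_right_field by auto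
  have "min d2 d3 / 2 > 0" "min d2 d3 / 2 < d2" "min d2 d3 / 2 < d3" using d2(1) d3(1) by auto
  then show False using d2(2)[of "min d2 d3 / 2"] d3(2)[of "min d2 d3 / 2"] by auto
qed

lemma has_d2_mirror:
  assumes "has_d2 f a b" shows "has_d2 (\<lambda>s. f (- s)) (- a) b"
proof -
  have "has_d2 (\<lambda>s::real. - s) (-1) 0"
    by (rule has_d2I[where g="\<lambda>_. -1"]) (auto intro!: derivative_eq_intros)
  moreover obtain f' where *: "\<forall>\<^sub>F s in nhds 0. (f has_real_derivative f' s) (at s)" "f' 0 = a"
      "(f' has_real_derivative b) (at 0)"
    using assms unfolding has_d2_def by blast
  ultimately show ?thesis
    using has_d2_compose[of "\<lambda>s. - s" "-1" 0 f f' b] by simp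
qed

lemma has_d2_local_min:
  assumes f: "has_d2 f a b" and m: "\<forall>\<^sub>F s in nhds 0. f s \<ge> f 0"
  shows "a = 0" "b \<ge> 0"
proof -
  have r: "\<forall>\<^sub>F s in at_right 0. f s \<ge> f 0"
    using m by (rule filter_leD[OF at_within_le_nhds])
  have "filterlim (\<lambda>s::real. - s) (nhds 0) (nhds 0)"
    using tendsto_minus[OF filterlim_ident, of "0::real"] by simp
  from eventually_compose_filterlim[OF m this]
  have "\<forall>\<^sub>F s in nhds 0. f (- s) \<ge> f 0" .
  then have "\<forall>\<^sub>F s in at_right 0. f (- s) \<ge> f (- 0)"
    unfolding minus_zero by (rule filter_leD[OF at_within_le_nhds])
  from has_d2_right_min_deriv[OF has_d2_mirror[OF f] this] has_d2_right_min_deriv[OF f r]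
  show "a = 0" by simp
  then show "b \<ge> 0" using has_d2_right_min f r by blast
qed

text \<open>Second-order information along all parabolas through the point; on these, \<open>p\<close> plays
  the role of the gradient and \<open>A\<close> that of the Hessian.\<close>

definition jet2 :: "('a::euclidean_space \<Rightarrow> real) \<Rightarrow> 'a \<Rightarrow> 'a \<Rightarrow> ('a \<Rightarrow> 'a \<Rightarrow> real) \<Rightarrow> bool" where
  "jet2 f x p A \<longleftrightarrow>
     (\<forall>v m. has_d2 (\<lambda>s. f (x + s *\<^sub>R v + s\<^sup>2 *\<^sub>R m)) (p \<bullet> v) (A v v + 2 * (p \<bullet> m)))"

lemma jet2_diff:
  assumes "jet2 f x p A" "jet2 g x q B"
  shows "jet2 (\<lambda>x. f x - g x) x (p - q) (\<lambda>v w. A v w - B v w)"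
  unfolding jet2_def
proof (intro allI)
  fix v m
  show "has_d2 (\<lambda>s. f (x + s *\<^sub>R v + s\<^sup>2 *\<^sub>R m) - g (x + s *\<^sub>R v + s\<^sup>2 *\<^sub>R m)) ((p - q) \<bullet> v)
         (A v v - B v v + 2 * ((p - q) \<bullet> m))"
    using has_d2_diff[OF assms(1)[unfolded jet2_def, rule_format, of v m]
        assms(2)[unfolded jet2_def, rule_format, of v m]]
    by (simp add: inner_diff_left algebra_simps)
qed

lemma jet2_cmult:
  assumes "jet2 f x p A"
  shows "jet2 (\<lambda>x. k * f x) x (k *\<^sub>R p) (\<lambda>v w. k * A v w)"
  unfolding jet2_def
proof (intro allI)
  fix v m
  show "has_d2 (\<lambda>s. k * f (x + s *\<^sub>R v + s\<^sup>2 *\<^sub>R m)) (k *\<^sub>R p \<bullet> v)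
         (k * A v v + 2 * (k *\<^sub>R p \<bullet> m))"
    using has_d2_cmult[of "\<lambda>s. f (x + s *\<^sub>R v + s\<^sup>2 *\<^sub>R m)" "p \<bullet> v" "A v v + 2 * (p \<bullet> m)" k] assms
    unfolding jet2_def by (simp add: algebra_simps)
qed

text \<open>A pointwise Laplacian that asks only for expansions along the coordinate axes. This is
  enough for the second-order test at a minimum, and explicit barriers can be handled by
  one-dimensional calculus.\<close>

definition has_lap :: "('a::euclidean_space \<Rightarrow> real) \<Rightarrow> real \<Rightarrow> 'a \<Rightarrow> bool" where
  "has_lap f L x \<longleftrightarrow>
     (\<exists>a d. (\<forall>i\<in>Basis. has_d2 (\<lambda>s. f (x + s *\<^sub>R i)) (a i) (d i)) \<and> L = (\<Sum>i\<in>Basis. d i))"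

lemma has_lap_add:
  assumes "has_lap f L x" "has_lap g K x" shows "has_lap (\<lambda>x. f x + g x) (L + K) x"
proof -
  obtain a d a' d' where
    "\<And>i. i\<in>Basis \<Longrightarrow> has_d2 (\<lambda>s. f (x + s *\<^sub>R i)) (a i) (d i)" "L = (\<Sum>i\<in>Basis. d i)"
    "\<And>i. i\<in>Basis \<Longrightarrow> has_d2 (\<lambda>s. g (x + s *\<^sub>R i)) (a' i) (d' i)" "K = (\<Sum>i\<in>Basis. d' i)"
    using assms unfolding has_lap_def by blast
  then show ?thesis unfolding has_lap_def
    by (intro exI[of _ "\<lambda>i. a i + a' i"] exI[of _ "\<lambda>i. d i + d' i"])
       (auto simp: sum.distrib intro: has_d2_add)
qed

lemma has_lap_cmult:
  assumes "has_lap f L x" shows "has_lap (\<lambda>x. k * f x) (k * L) x"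
proof -
  obtain a d where
    "\<And>i. i\<in>Basis \<Longrightarrow> has_d2 (\<lambda>s. f (x + s *\<^sub>R i)) (a i) (d i)" "L = (\<Sum>i\<in>Basis. d i)"
    using assms unfolding has_lap_def by blast
  then show ?thesis unfolding has_lap_def
    by (intro exI[of _ "\<lambda>i. k * a i"] exI[of _ "\<lambda>i. k * d i"])
       (auto simp: sum_distrib_left intro: has_d2_cmult)
qed

lemma has_lap_diff:
  assumes "has_lap f L x" "has_lap g K x" shows "has_lap (\<lambda>x. f x - g x) (L - K) x"
  using has_lap_add[OF assms(1) has_lap_cmult[OF assms(2), of "-1"]] by simp

lemma has_lap_const: "has_lap (\<lambda>x. k) 0 x"
  unfolding has_lap_def
  by (rule exI[of _ "\<lambda>_. 0"], rule exI[of _ "\<lambda>_. 0"]) (auto intro: has_d2_const)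

lemma has_lap_sum:
  assumes "finite S" "\<And>j. j \<in> S \<Longrightarrow> has_lap (f j) (L j) x"
  shows "has_lap (\<lambda>x. \<Sum>j\<in>S. f j x) (\<Sum>j\<in>S. L j) x"
  using assms by (induction S rule: finite_induct) (auto intro: has_lap_const has_lap_add)

lemma jet2_line:
  assumes "jet2 f x p A"
  shows "has_d2 (\<lambda>s. f (x + s *\<^sub>R v)) (p \<bullet> v) (A v v)"
  using assms[unfolded jet2_def, rule_format, of v 0] by simp

lemma jet2_has_lap:
  assumes "jet2 f x p A" shows "has_lap f (\<Sum>i\<in>Basis. A i i) x"
  unfolding has_lap_def
  by (rule exI[of _ "\<lambda>i. p \<bullet> i"], rule exI[of _ "\<lambda>i. A i i"])
     (use jet2_line[OF assms] in auto)

lemma has_lap_local_min: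
  assumes "has_lap f L x" "\<forall>\<^sub>F y in nhds x. f y \<ge> f x"
  shows "L \<ge> 0"
proof -
  obtain a d where ad:
    "\<And>i. i\<in>Basis \<Longrightarrow> has_d2 (\<lambda>s. f (x + s *\<^sub>R i)) (a i) (d i)" "L = (\<Sum>i\<in>Basis. d i)"
    using assms unfolding has_lap_def by blast
  have "d i \<ge> 0" if "i \<in> Basis" for i
  proof (rule has_d2_local_min(2)[OF ad(1)[OF that]])
    have "((\<lambda>s::real. x + s *\<^sub>R i) \<longlongrightarrow> x + 0 *\<^sub>R i) (nhds 0)"
      by (intro tendsto_intros filterlim_ident)
    then have "((\<lambda>s::real. x + s *\<^sub>R i) \<longlongrightarrow> x) (nhds 0)" by simp
    from eventually_compose_filterlim[OF assms(2) this]
    show "\<forall>\<^sub>F s in nhds 0. f (x + 0 *\<^sub>R i) \<le> f (x + s *\<^sub>R i)" by simp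
  qed
  then show ?thesis by (simp add: ad(2) sum_nonneg)
qed

text \<open>The chain rule for the Laplacian, with \<open>d\<close> for the second derivative of
  \<psi>. The Gaussians, the growing-ball barrier and the boundary layer all get their Laplacians
  from it.\<close>

lemma jet2_compose:
  assumes g: "jet2 g x p A"
    and p1: "\<forall>\<^sub>F z in nhds (g x). (\<psi> has_real_derivative \<psi>' z) (at z)"
    and p2: "(\<psi>' has_real_derivative d) (at (g x))"
  shows "has_lap (\<lambda>y. \<psi> (g y)) (d * (norm p)\<^sup>2 + \<psi>' (g x) * (\<Sum>i\<in>Basis. A i i)) x"
proof -
  have "has_d2 (\<lambda>s. \<psi> (g (x + s *\<^sub>R i))) (\<psi>' (g x) * (p \<bullet> i)) (d * (p \<bullet> i)\<^sup>2 + \<psi>' (g x) * A i i)" for i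
    using has_d2_compose[OF jet2_line[OF g, of i], of \<psi> \<psi>' d] p1 p2 by simp
  moreover have "(\<Sum>i\<in>Basis. d * (p \<bullet> i)\<^sup>2 + \<psi>' (g x) * A i i) =
      d * (norm p)\<^sup>2 + \<psi>' (g x) * (\<Sum>i\<in>Basis. A i i)"
  proof -
    have "(norm p)\<^sup>2 = (\<Sum>i\<in>Basis. (p \<bullet> i)\<^sup>2)"
      using euclidean_inner[of p p] unfolding power2_norm_eq_inner by (simp add: power2_eq_square)
    then show ?thesis by (simp only: sum.distrib sum_distrib_left)
  qed
  ultimately show ?thesis unfolding has_lap_def
    by (intro exI[of _ "\<lambda>i. \<psi>' (g x) * (p \<bullet> i)"]
        exI[of _ "\<lambda>i. d * (p \<bullet> i)\<^sup>2 + \<psi>' (g x) * A i i"]) simp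
qed

section \<open>Gradients, Hessians and second-order jets of functions of class C^2\<close>

definition grad :: "('a::euclidean_space \<Rightarrow> real) \<Rightarrow> 'a \<Rightarrow> 'a" where
  "grad f x = (\<Sum>i\<in>Basis. frechet_derivative f (at x) i *\<^sub>R i)"

definition hess :: "('a::euclidean_space \<Rightarrow> real) \<Rightarrow> 'a \<Rightarrow> 'a \<Rightarrow> 'a \<Rightarrow> real" where
  "hess f x v w = frechet_derivative (\<lambda>y. frechet_derivative f (at y) v) (at x) w"

lemma laplacian_hess: "laplacian f x = (\<Sum>i\<in>Basis. hess f x i i)"
  by (simp add: laplacian_def hess_def)

lemma grad_has_derivative:
  assumes "f differentiable (at x)" shows "(f has_derivative (\<lambda>h. grad f x \<bullet> h)) (at x)"
proof -
  have d: "(f has_derivative frechet_derivative f (at x)) (at x)"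
    using assms by (simp add: frechet_derivative_works)
  have "frechet_derivative f (at x) h = grad f x \<bullet> h" for h
  proof -
    have "frechet_derivative f (at x) h = frechet_derivative f (at x) (\<Sum>i\<in>Basis. (h \<bullet> i) *\<^sub>R i)"
      by (simp add: euclidean_representation)
    also have "\<dots> = (\<Sum>i\<in>Basis. (h \<bullet> i) * frechet_derivative f (at x) i)"
      using has_derivative_linear[OF d] by (simp add: linear_sum linear_cmul)
    finally show ?thesis
      by (simp add: grad_def inner_sum_left mult.commute inner_commute[of h])
  qed
  then have "frechet_derivative f (at x) = (\<lambda>h. grad f x \<bullet> h)" by (rule ext)
  with d show ?thesis by simp
qed

lemma frechet_derivative_grad:
  assumes "f differentiable (at x)" shows "frechet_derivative f (at x) h = grad f x \<bullet> h"
  using fun_cong[OF frechet_derivative_at[OF grad_has_derivative[OF assms]]] by simp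

lemma Ck_on_Suc_open:
  assumes "open U" "Ck_on (Suc k) U f" "x \<in> U"
  shows "f differentiable (at x)" "Ck_on k U (\<lambda>x. frechet_derivative f (at x) v)"
  using assms by (auto simp: differentiable_on_eq_differentiable_at)

lemma Ck_on_cont: "Ck_on k U f \<Longrightarrow> continuous_on U f"
  by (cases k) (auto intro: differentiable_imp_continuous_on)

lemma smooth_on_Ck: "smooth_on U f \<Longrightarrow> Ck_on k U f"
  by (simp add: smooth_on_def)

context
  fixes U :: "'a::euclidean_space set" and f :: "'a \<Rightarrow> real"
  assumes U: "open U" and C2: "Ck_on 2 U f"
begin

lemma C2_differentiable: "x \<in> U \<Longrightarrow> f differentiable (at x)"
  using Ck_on_Suc_open(1)[OF U, of 1 f] C2 by (simp add: numeral_2_eq_2)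

lemma C2_grad: "x \<in> U \<Longrightarrow> (f has_derivative (\<lambda>h. grad f x \<bullet> h)) (at x)"
  by (rule grad_has_derivative[OF C2_differentiable])

lemma C2_hess:
  assumes "x \<in> U" shows "((\<lambda>y. grad f y \<bullet> v) has_derivative hess f x v) (at x)"
proof -
  have "Ck_on 1 U (\<lambda>x. frechet_derivative f (at x) v)"
    using Ck_on_Suc_open(2)[OF U, of 1 f x v] C2 assms by (simp add: numeral_2_eq_2)
  then have "(\<lambda>x. frechet_derivative f (at x) v) differentiable (at x)"
    using Ck_on_Suc_open(1)[OF U, of 0 _ x] assms by simp
  then have "((\<lambda>x. frechet_derivative f (at x) v) has_derivative hess f x v) (at x)"
    unfolding hess_def[abs_def] by (simp add: frechet_derivative_works)
  then show ?thesis
    by (rule has_derivative_transform_within_open[OF _ U assms])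
       (simp add: C2_differentiable frechet_derivative_grad)
qed

lemma hess_linear_right: "x \<in> U \<Longrightarrow> linear (hess f x v)"
  using C2_hess by (rule has_derivative_linear)

text \<open>\<open>hess f x v\<close> is a derivative, hence linear in its second argument by
  construction. Linearity in \<open>v\<close> comes from uniqueness of the derivative, since the
  inner product of \<open>grad f y\<close> with \<open>v\<close> is linear in
  \<open>v\<close>.\<close>

lemma hess_linear_left:
  assumes "x \<in> U" shows "linear (\<lambda>v. hess f x v w)"
proof
  fix v v' :: 'a and r :: real
  have "((\<lambda>y. grad f y \<bullet> (v + v')) has_derivative (\<lambda>h. hess f x v h + hess f x v' h)) (at x)"
    unfolding inner_add_right by (intro has_derivative_add C2_hess assms)
  from has_derivative_unique[OF this C2_hess[OF assms]]
  show "hess f x (v + v') w = hess f x v w + hess f x v' w" by (rule fun_cong[THEN sym])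
  have "((\<lambda>y. grad f y \<bullet> (r *\<^sub>R v)) has_derivative (\<lambda>h. r * hess f x v h)) (at x)"
    unfolding inner_scaleR_right by (intro has_derivative_mult_right C2_hess assms)
  from has_derivative_unique[OF this C2_hess[OF assms]]
  show "hess f x (r *\<^sub>R v) w = r *\<^sub>R hess f x v w" unfolding real_scaleR_def by (rule fun_cong[THEN sym])
qed

lemma hess_bilinear: "x \<in> U \<Longrightarrow> bilinear (hess f x)"
  by (simp add: bilinear_def hess_linear_right hess_linear_left)

lemma C2_jet2:
  assumes x: "x \<in> U" shows "jet2 f x (grad f x) (hess f x)"
  unfolding jet2_def
proof (intro allI)
  fix v m
  define \<gamma> where "\<gamma> = (\<lambda>s::real. x + s *\<^sub>R v + s\<^sup>2 *\<^sub>R m)"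
  have g0: "\<gamma> 0 = x" by (simp add: \<gamma>_def)
  have dg: "(\<gamma> has_derivative (\<lambda>h. h *\<^sub>R (v + (2 * s) *\<^sub>R m))) (at s)" for s
    unfolding \<gamma>_def
    by (auto intro!: derivative_eq_intros simp: algebra_simps)
  have "isCont \<gamma> 0" using has_derivative_continuous[OF dg[of 0]] .
  then have "(\<gamma> \<longlongrightarrow> x) (nhds 0)" using g0 by (simp add: isCont_def tendsto_nhds_iff)
  then have ev: "\<forall>\<^sub>F s in nhds 0. \<gamma> s \<in> U" using topological_tendstoD[OF _ U x] by blast
  \<comment> \<open>The derivative along the parabola, whose velocity is v + 2 s m. Because the
    factor 2 s vanishes at 0, \<open>m\<close> enters the second derivative through the gradient
    only.\<close>
  define g where "g = (\<lambda>s. grad f (\<gamma> s) \<bullet> v + 2 * s * (grad f (\<gamma> s) \<bullet> m))"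
  have d1: "((\<lambda>s. grad f (\<gamma> s) \<bullet> w) has_real_derivative hess f x w v) (at 0)" for w
  proof -
    have "((\<lambda>s. grad f (\<gamma> s) \<bullet> w) has_derivative (\<lambda>h. hess f x w (h *\<^sub>R (v + (2 * 0) *\<^sub>R m)))) (at 0)"
      using has_derivative_compose[OF dg, of "\<lambda>y. grad f y \<bullet> w" "hess f x w" 0] C2_hess[OF x, of w] g0
      by (simp add: o_def)
    then show ?thesis
      using linear_cmul[OF hess_linear_right[OF x]]
      by (simp add: has_field_derivative_def mult_commute_abs)
  qed
  show "has_d2 (\<lambda>s. f (x + s *\<^sub>R v + s\<^sup>2 *\<^sub>R m)) (grad f x \<bullet> v) (hess f x v v + 2 * (grad f x \<bullet> m))"
    unfolding has_d2_def \<gamma>_def[symmetric]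
  proof (intro exI[of _ g] conjI)
    show "\<forall>\<^sub>F s in nhds 0. ((\<lambda>s. f (x + s *\<^sub>R v + s\<^sup>2 *\<^sub>R m)) has_real_derivative g s) (at s)"
      using ev
    proof eventually_elim
      case (elim s)
      from has_derivative_compose[OF dg C2_grad[OF elim]]
      have "((\<lambda>s. f (\<gamma> s)) has_derivative (\<lambda>h. grad f (\<gamma> s) \<bullet> (h *\<^sub>R (v + (2 * s) *\<^sub>R m)))) (at s)" .
      moreover have "(\<lambda>h. grad f (\<gamma> s) \<bullet> (h *\<^sub>R (v + (2 * s) *\<^sub>R m))) = (*) (g s)"
        by (rule ext) (simp add: g_def inner_add_right algebra_simps)
      ultimately show ?case
        by (simp add: has_field_derivative_def \<gamma>_def)
    qed
    show "g 0 = grad f x \<bullet> v" by (simp add: g_def g0)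
    show "(g has_real_derivative hess f x v v + 2 * (grad f x \<bullet> m)) (at 0)"
      unfolding g_def
      by (rule DERIV_cong[OF DERIV_add[OF d1[of v] DERIV_mult[OF DERIV_cmult[OF DERIV_ident, of 2] d1[of m]]]])
         (simp add: g0)
  qed
qed

lemma C2_has_lap: "x \<in> U \<Longrightarrow> has_lap f (laplacian f x) x"
  unfolding laplacian_hess by (rule jet2_has_lap[OF C2_jet2])

lemma C2_cont_grad: "continuous_on U (grad f)"
proof -
  have "continuous_on U (\<lambda>x. frechet_derivative f (at x) v)" for v
    using C2 by (auto simp: numeral_2_eq_2 intro: differentiable_imp_continuous_on)
  then show ?thesis unfolding grad_def[abs_def] by (intro continuous_intros)
qed

lemma C2_cont: "continuous_on U f"
  using C2 by (rule Ck_on_cont)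

end

text \<open>For a unit vector \<open>e\<close> the map is the orthogonal projection along
  \<open>e\<close> if k = 1 and the reflection if k = 2. The first gives the tangential trace in the
  mean curvature, the second the invariance of the Laplacian under reflections.\<close>

lemma bilinear_trace_reflect:
  fixes A :: "'a::euclidean_space \<Rightarrow> 'a \<Rightarrow> real"
  assumes A: "bilinear A"
  shows "(\<Sum>i\<in>Basis. A (i - (k * (i \<bullet> e)) *\<^sub>R e) (i - (k * (i \<bullet> e)) *\<^sub>R e)) =
         (\<Sum>i\<in>Basis. A i i) - (2 * k - k\<^sup>2 * (e \<bullet> e)) * A e e"
proof -
  have e: "(\<Sum>i\<in>Basis. (i \<bullet> e) *\<^sub>R i) = e"
    using euclidean_representation[of e] by (simp add: inner_commute)
  have l: "linear (A x)" "linear (\<lambda>x. A x y)" for x y using A by (auto simp: bilinear_def)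
  have 1: "(\<Sum>i\<in>Basis. (i \<bullet> e) * A i e) = A e e"
  proof -
    have "A (\<Sum>i\<in>Basis. (i \<bullet> e) *\<^sub>R i) e = (\<Sum>i\<in>Basis. A ((i \<bullet> e) *\<^sub>R i) e)"
      by (rule linear_sum[OF l(2)])
    then show ?thesis by (simp add: e bilinear_lmul[OF A])
  qed
  have 2: "(\<Sum>i\<in>Basis. (i \<bullet> e) * A e i) = A e e"
  proof -
    have "A e (\<Sum>i\<in>Basis. (i \<bullet> e) *\<^sub>R i) = (\<Sum>i\<in>Basis. A e ((i \<bullet> e) *\<^sub>R i))"
      by (rule linear_sum[OF l(1)])
    then show ?thesis by (simp add: e bilinear_rmul[OF A])
  qed
  have 3: "(\<Sum>i\<in>Basis. (i \<bullet> e) * (i \<bullet> e)) = e \<bullet> e"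
    using euclidean_inner[of e e] by (simp add: inner_commute)
  have "A (i - (k * (i \<bullet> e)) *\<^sub>R e) (i - (k * (i \<bullet> e)) *\<^sub>R e) =
      A i i - k * ((i \<bullet> e) * A i e) - k * ((i \<bullet> e) * A e i) + (k\<^sup>2 * A e e) * ((i \<bullet> e) * (i \<bullet> e))" for i
    by (simp add: bilinear_lsub[OF A] bilinear_rsub[OF A] bilinear_lmul[OF A] bilinear_rmul[OF A]
        power2_eq_square algebra_simps)
  then have "(\<Sum>i\<in>Basis. A (i - (k * (i \<bullet> e)) *\<^sub>R e) (i - (k * (i \<bullet> e)) *\<^sub>R e)) =
     (\<Sum>i\<in>Basis. A i i) - k * (\<Sum>i\<in>Basis. (i \<bullet> e) * A i e) - k * (\<Sum>i\<in>Basis. (i \<bullet> e) * A e i)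
      + (k\<^sup>2 * A e e) * (\<Sum>i\<in>Basis. (i \<bullet> e) * (i \<bullet> e))"
    by (simp add: sum.distrib sum_subtractf sum_distrib_left)
  then show ?thesis unfolding 1 2 3 by (simp add: algebra_simps)
qed

section \<open>A parabolic minimum principle with a negligible exceptional set\<close>

text \<open>Outer regularity puts \<open>Z\<close> into an open set of tiny volume. A Vitali
  selection among balls inside that set leaves disjoint balls, whose volumes add up to at most its
  volume, and blowing up the radii by 5 restores the cover.\<close>

lemma negligible_compact_cover:
  fixes Z :: "'a::euclidean_space set"
  assumes Z: "compact Z" "negligible Z" and \<delta>: "\<delta> > 0"
  obtains J :: "('a \<times> real) set" where "finite J" "\<And>z r. (z, r) \<in> J \<Longrightarrow> r > 0"
    "Z \<subseteq> (\<Union>(z, r)\<in>J. ball z r)" "(\<Sum>(z, r)\<in>J. r ^ DIM('a)) < \<delta>"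
proof -
  define \<omega> where "\<omega> = measure lborel (ball (0::'a) 1)"
  have \<omega>: "\<omega> > 0" unfolding \<omega>_def by (rule content_ball_pos) simp
  have vol: "measure lebesgue (cball z r) = r ^ DIM('a) * \<omega>" if "r \<ge> 0" for z :: 'a and r
    using that content_ball_conv_unit_ball[of r z] content_cball_conv_ball[of z r]
    by (simp add: \<omega>_def measure_completion)
  \<comment> \<open>\<open>\<omega>\<close> converts volumes into powers of radii, and the power of
    5 is the price of the enlarged radii.\<close>
  define d where "d = \<delta> * \<omega> / 5 ^ DIM('a)"
  have d: "d > 0" using \<delta> \<omega> by (simp add: d_def)
  obtain V where V: "open V" "Z \<subseteq> V" "(V - Z) \<in> lmeasurable" "emeasure lebesgue (V - Z) < ennreal d"
    using sets_lebesgue_outer_open[OF negligible_imp_sets[OF Z(2)] d] by blast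
  have Zm: "Z \<in> lmeasurable" "measure lebesgue Z = 0"
    using negligible_imp_measurable[OF Z(2)] negligible_imp_measure0[OF Z(2)] by auto
  have VZ: "measure lebesgue (V - Z) < d"
    using V(4) d emeasure_eq_measure2[OF V(3)] by (simp add: ennreal_less_iff)
  have Vm: "V \<in> lmeasurable" "measure lebesgue V < d"
  proof -
    have "V = (V - Z) \<union> Z" using V(2) by auto
    then show m: "V \<in> lmeasurable" using fmeasurable.Un[OF V(3) Zm(1)] by simp
    have "measure lebesgue V \<le> measure lebesgue (V - Z) + measure lebesgue Z"
      using measure_Un_le[of "V - Z" lebesgue Z] V(2,3) Zm(1) \<open>V = (V - Z) \<union> Z\<close> by (simp add: fmeasurableD)
    then show "measure lebesgue V < d" using VZ Zm by simp
  qed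
  have "\<forall>z\<in>Z. \<exists>r>0. cball z r \<subseteq> V" using V open_contains_cball by blast
  then obtain r0 where r0: "\<And>z. z \<in> Z \<Longrightarrow> r0 z > 0 \<and> cball z (r0 z) \<subseteq> V" by metis
  obtain K where K: "K \<subseteq> Z" "finite K" "Z \<subseteq> (\<Union>z\<in>K. ball z (r0 z))"
  proof (rule compactE_image[OF Z(1), of Z "\<lambda>z. ball z (r0 z)"])
    show "\<And>z. z \<in> Z \<Longrightarrow> open (ball z (r0 z))" by simp
    show "Z \<subseteq> (\<Union>z\<in>Z. ball z (r0 z))" using r0 by force
  qed (use that in blast)
  have Kr: "0 < r0 z \<and> r0 z \<le> Max (insert 1 (r0 ` K))" if "z \<in> K" for z
    using that K r0 by (auto intro: Max_ge)
  obtain C where C: "C \<subseteq> K"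
     "pairwise (\<lambda>i j. disjnt (cball i (r0 i)) (cball j (r0 j))) C"
     "\<And>i. i \<in> K \<Longrightarrow> \<exists>j. j \<in> C \<and> \<not> disjnt (cball i (r0 i)) (cball j (r0 j)) \<and>
                        cball i (r0 i) \<subseteq> ball j (5 * r0 j)"
    by (rule Vitali_covering_lemma_cballs_balls[of K r0 "Max (insert 1 (r0 ` K))" "\<lambda>z. z"])
      (use Kr in blast)+
  have fC: "finite C" using C(1) K(2) finite_subset by blast
  have r0C: "r0 z > 0" "cball z (r0 z) \<subseteq> V" if "z \<in> C" for z using that C(1) K(1) r0 by auto
  define J where "J = (\<lambda>z. (z, 5 * r0 z)) ` C"
  have inj: "inj_on (\<lambda>z. (z, 5 * r0 z)) C" by (auto intro: inj_onI)
  have "(\<Sum>z\<in>C. measure lebesgue (cball z (r0 z))) = measure lebesgue (\<Union>z\<in>C. cball z (r0 z))"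
    by (rule measure_negligible_finite_Union_image[symmetric, OF fC])
       (use C(2) in \<open>auto simp: pairwise_def disjnt_def\<close>)
  also have "\<dots> \<le> measure lebesgue V"
    by (rule measure_mono_fmeasurable) (use r0C Vm fC in auto)
  finally have "(\<Sum>z\<in>C. r0 z ^ DIM('a) * \<omega>) < d"
    using Vm vol r0C by (simp add: less_imp_le)
  then have "(\<Sum>z\<in>C. r0 z ^ DIM('a)) * \<omega> < \<delta> * \<omega> / 5 ^ DIM('a)"
    by (simp add: sum_distrib_right d_def)
  then have "5 ^ DIM('a) * (\<Sum>z\<in>C. r0 z ^ DIM('a)) < \<delta>"
    using \<omega> by (simp add: field_simps)
  then have sumJ: "(\<Sum>(z, r)\<in>J. r ^ DIM('a)) < \<delta>"
    unfolding J_def by (subst sum.reindex[OF inj]) (simp add: power_mult_distrib sum_distrib_left)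
  have "Z \<subseteq> (\<Union>(z, r)\<in>J. ball z r)"
  proof
    fix x assume "x \<in> Z"
    then obtain z where "z \<in> K" "x \<in> ball z (r0 z)" using K by auto
    then obtain j where "j \<in> C" "x \<in> ball j (5 * r0 j)"
      using C(3)[of z] ball_subset_cball by blast
    then show "x \<in> (\<Union>(z, r)\<in>J. ball z r)" by (auto simp: J_def)
  qed
  moreover have "r > 0" if "(z, r) \<in> J" for z r using that r0C by (auto simp: J_def)
  moreover have "finite J" using fC by (simp add: J_def)
  ultimately show ?thesis using that[of J] sumJ by blast
qed

text \<open>A Gaussian started at time \<open>-r\<^sup>2/4\<close>, normalised to be at least \<open>1\<close> on \<open>ball z r\<close> at time \<open>0\<close>.\<close>

definition bump :: "'a::euclidean_space \<Rightarrow> real \<Rightarrow> 'a \<Rightarrow> real \<Rightarrow> real" where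
  "bump z r x t = exp (1 + DIM('a) * ln r - DIM('a) / 2 * ln (r\<^sup>2 + 4 * t) - (norm (x - z))\<^sup>2 / (r\<^sup>2 + 4 * t))"

lemma jet2_norm_sq:
  fixes z :: "'a::euclidean_space"
  shows "jet2 (\<lambda>x. (norm (x - z))\<^sup>2) x (2 *\<^sub>R (x - z)) (\<lambda>v w. 2 * (v \<bullet> w))"
  unfolding jet2_def
proof (intro allI)
  fix v m :: 'a
  let ?y = "x - z"
  define g where "g = (\<lambda>s::real. 2 * (?y \<bullet> v) + 2 * s * (v \<bullet> v + 2 * (?y \<bullet> m)) + 6 * s\<^sup>2 * (v \<bullet> m) + 4 * s^3 * (m \<bullet> m))"
  have eq: "(\<lambda>s. (norm (x + s *\<^sub>R v + s\<^sup>2 *\<^sub>R m - z))\<^sup>2) =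
     (\<lambda>s. ?y \<bullet> ?y + 2 * s * (?y \<bullet> v) + s\<^sup>2 * (v \<bullet> v + 2 * (?y \<bullet> m)) + 2 * s^3 * (v \<bullet> m) + s^4 * (m \<bullet> m))"
    unfolding power2_norm_eq_inner
    by (rule ext) (simp add: inner_add_left inner_add_right inner_diff_left inner_diff_right
        inner_commute algebra_simps power2_eq_square power3_eq_cube power4_eq_xxxx)
  show "has_d2 (\<lambda>s. (norm (x + s *\<^sub>R v + s\<^sup>2 *\<^sub>R m - z))\<^sup>2) (2 *\<^sub>R (x - z) \<bullet> v) (2 * (v \<bullet> v) + 2 * (2 *\<^sub>R (x - z) \<bullet> m))"
    unfolding eq
  proof (rule has_d2I[where g = g])
    show "((\<lambda>s. ?y \<bullet> ?y + 2 * s * (?y \<bullet> v) + s\<^sup>2 * (v \<bullet> v + 2 * (?y \<bullet> m)) + 2 * s^3 * (v \<bullet> m) + s^4 * (m \<bullet> m))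
       has_real_derivative g s) (at s)" for s
      unfolding g_def by (auto intro!: derivative_eq_intros simp: algebra_simps)
    show "g 0 = 2 *\<^sub>R (x - z) \<bullet> v" by (simp add: g_def)
    show "(g has_real_derivative 2 * (v \<bullet> v) + 2 * (2 *\<^sub>R (x - z) \<bullet> m)) (at 0)"
      unfolding g_def by (auto intro!: derivative_eq_intros simp: algebra_simps)
  qed
qed

lemma bump_heat:
  fixes z :: "'a::euclidean_space"
  assumes "r > 0" "t \<ge> 0"
  shows "\<exists>d. has_lap (\<lambda>y. bump z r y t) d x \<and> ((\<lambda>s. bump z r x s) has_real_derivative d) (at t)"
proof -
  define \<sigma> where "\<sigma> = r\<^sup>2 + 4 * t"
  have \<sigma>: "\<sigma> > 0" using assms by (simp add: \<sigma>_def add_pos_nonneg)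
  define c where "c = 1 + DIM('a) * ln r - DIM('a) / 2 * ln \<sigma>"
  define \<psi> where "\<psi> = (\<lambda>y::real. exp (c - y / \<sigma>))"
  have d: "(\<psi> has_real_derivative (- (\<psi> y / \<sigma>))) (at y)" for y
    unfolding \<psi>_def using \<sigma> by (auto intro!: derivative_eq_intros)
  have d2: "((\<lambda>y. - (\<psi> y / \<sigma>)) has_real_derivative (\<psi> y / \<sigma>\<^sup>2)) (at y)" for y
    using \<sigma> by (auto intro!: derivative_eq_intros d simp: power2_eq_square)
  let ?N = "(norm (x - z))\<^sup>2"
  define D where "D = \<psi> ?N * (4 * ?N / \<sigma>\<^sup>2 - 2 * DIM('a) / \<sigma>)"
  have L0: "has_lap (\<lambda>y. \<psi> ((norm (y - z))\<^sup>2)) (\<psi> ?N / \<sigma>\<^sup>2 * (norm (2 *\<^sub>R (x - z)))\<^sup>2 + (- (\<psi> ?N / \<sigma>)) *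
         (\<Sum>i\<in>(Basis::'a set). 2 * (i \<bullet> i))) x"
    by (rule jet2_compose[OF jet2_norm_sq _ d2]) (simp add: d)
  have L1: "\<psi> ?N / \<sigma>\<^sup>2 * (norm (2 *\<^sub>R (x - z)))\<^sup>2 + (- (\<psi> ?N / \<sigma>)) * (\<Sum>i\<in>(Basis::'a set). 2 * (i \<bullet> i)) = D"
  proof -
    have "(norm (2 *\<^sub>R (x - z)))\<^sup>2 = 4 * ?N" by (simp add: power_mult_distrib)
    then show ?thesis by (simp add: D_def) (simp add: field_simps)
  qed
  have L2: "(\<lambda>y. bump z r y t) = (\<lambda>y. \<psi> ((norm (y - z))\<^sup>2))"
    by (rule ext) (simp add: bump_def \<psi>_def c_def \<sigma>_def)
  have L: "has_lap (\<lambda>y. bump z r y t) D x" using L0 unfolding L1 L2 .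
  have E: "bump z r x t = \<psi> ?N" by (simp add: bump_def \<psi>_def c_def \<sigma>_def)
  have "((\<lambda>s. bump z r x s) has_real_derivative
      bump z r x t * (- (DIM('a) / 2 * (4 / \<sigma>)) + ?N * 4 / \<sigma>\<^sup>2)) (at t)"
  proof -
    have ds: "((\<lambda>s. r\<^sup>2 + 4 * s) has_real_derivative 4) (at t)"
      by (auto intro!: derivative_eq_intros)
    have 1: "((\<lambda>s. ln (r\<^sup>2 + 4 * s)) has_real_derivative 4 / \<sigma>) (at t)"
      using DERIV_chain2[OF DERIV_ln ds] \<sigma> unfolding \<sigma>_def by (simp add: field_simps)
    have 2: "((\<lambda>s. ?N / (r\<^sup>2 + 4 * s)) has_real_derivative - (?N * 4 / \<sigma>\<^sup>2)) (at t)"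
      using DERIV_divide[OF DERIV_const[of ?N] ds] \<sigma> unfolding \<sigma>_def
      by (simp add: power2_eq_square)
    show ?thesis unfolding bump_def
      by (rule DERIV_cong[OF DERIV_fun_exp[OF DERIV_diff[OF DERIV_diff[OF DERIV_const DERIV_cmult[OF 1]] 2]]])
         simp
  qed
  moreover have "bump z r x t * (- (DIM('a) / 2 * (4 / \<sigma>)) + ?N * 4 / \<sigma>\<^sup>2) = D"
    unfolding E D_def by (simp add: algebra_simps)
  ultimately show ?thesis using L by auto
qed

lemma bump_continuous:
  assumes "r > 0"
  shows "continuous_on (UNIV \<times> {0..}) (\<lambda>(x, t). bump z r x t)"
proof -
  have "r\<^sup>2 + 4 * t > 0" if "t \<ge> 0" for t using that assms by (simp add: add_pos_nonneg)
  then have "r\<^sup>2 + 4 * t \<noteq> 0" if "t \<ge> 0" for t using that by (metis less_irrefl)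
  then show ?thesis unfolding bump_def split_beta by (intro continuous_intros) auto
qed

text \<open>At a fixed positive time a bump is at most a constant times \<open>r ^ DIM('a)\<close>,
  uniformly in \<open>x\<close>; so a cover of small total volume gives a small sum of
  bumps.\<close>

lemma bump_le:
  fixes z :: "'a::euclidean_space"
  assumes "r > 0" "t > 0"
  shows "bump z r x t \<le> exp (1 - DIM('a) / 2 * ln (4 * t)) * r ^ DIM('a)"
proof -
  have "ln (4 * t) \<le> ln (r\<^sup>2 + 4 * t)" using assms by (subst ln_le_cancel_iff) (auto simp: add_pos_pos)
  moreover have "(norm (x - z))\<^sup>2 / (r\<^sup>2 + 4 * t) \<ge> 0" using assms by (intro divide_nonneg_nonneg) auto
  ultimately have "1 + DIM('a) * ln r - DIM('a) / 2 * ln (r\<^sup>2 + 4 * t) - (norm (x - z))\<^sup>2 / (r\<^sup>2 + 4 * t)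
      \<le> (1 - DIM('a) / 2 * ln (4 * t)) + DIM('a) * ln r"
    using mult_left_mono[of "ln (4 * t)" "ln (r\<^sup>2 + 4 * t)" "DIM('a) / 2"] by linarith
  then have "bump z r x t \<le> exp ((1 - DIM('a) / 2 * ln (4 * t)) + DIM('a) * ln r)"
    unfolding bump_def by simp
  also have "\<dots> = exp (1 - DIM('a) / 2 * ln (4 * t)) * r ^ DIM('a)"
    using assms by (simp add: exp_add exp_of_nat_mult)
  finally show ?thesis .
qed

lemma bump_initial:
  assumes "r > 0" "x \<in> ball z r" shows "bump z r x 0 > 1"
proof -
  have "norm (x - z) < r" using assms by (simp add: dist_norm norm_minus_commute)
  then have "(norm (x - z))\<^sup>2 < r\<^sup>2" using assms by (intro power_strict_mono) auto
  moreover have "ln (r\<^sup>2) = 2 * ln r" using assms by (simp add: ln_realpow)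
  ultimately show ?thesis unfolding bump_def using assms by simp
qed

text \<open>The bumps on a cover of \<open>Z\<close> are added up. The sum exceeds 1 on
  \<open>Z\<close> initially, yet costs less than \<delta> at the one point where the minimum
  principle is to be proved; it plays the role of a solution that is infinite on the exceptional
  set.\<close>

lemma heat_barrier_negligible:
  fixes Z :: "'a::euclidean_space set"
  assumes Z: "compact Z" "negligible Z" and t1: "t1 > 0" and \<delta>: "\<delta> > 0"
  obtains B where "\<And>x t. t \<ge> 0 \<Longrightarrow> B x t \<ge> 0" "B x1 t1 < \<delta>"
    "\<And>x t. t > 0 \<Longrightarrow> \<exists>d. has_lap (\<lambda>y. B y t) d x \<and> ((\<lambda>s. B x s) has_real_derivative d) (at t)"
    "continuous_on (UNIV \<times> {0..}) (\<lambda>(x, t). B x t)"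
    "\<And>z. z \<in> Z \<Longrightarrow> B z 0 > 1"
proof -
  define K where "K = exp (1 - DIM('a) / 2 * ln (4 * t1))"
  have K: "K > 0" by (simp add: K_def)
  obtain J :: "('a \<times> real) set" where J: "finite J" "\<And>z r. (z, r) \<in> J \<Longrightarrow> r > 0"
    "Z \<subseteq> (\<Union>(z, r)\<in>J. ball z r)" "(\<Sum>(z, r)\<in>J. r ^ DIM('a)) < \<delta> / K"
    using negligible_compact_cover[OF Z, of "\<delta> / K"] \<delta> K by auto
  define B where "B = (\<lambda>x t. \<Sum>j\<in>J. bump (fst j) (snd j) x t)"
  have rJ: "snd j > 0" if "j \<in> J" for j using J(2)[of "fst j" "snd j"] that by simp
  show ?thesis
  proof (rule that[of B])
    show "B x t \<ge> 0" for x t unfolding B_def by (intro sum_nonneg) (simp add: bump_def)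
    have "B x1 t1 \<le> (\<Sum>j\<in>J. K * snd j ^ DIM('a))"
      unfolding B_def K_def by (intro sum_mono bump_le rJ t1)
    also have "\<dots> = K * (\<Sum>(z, r)\<in>J. r ^ DIM('a))" by (simp add: sum_distrib_left split_beta)
    also have "\<dots> < \<delta>" using J(4) K by (simp add: field_simps)
    finally show "B x1 t1 < \<delta>" .
    show "\<exists>d. has_lap (\<lambda>y. B y t) d x \<and> ((\<lambda>s. B x s) has_real_derivative d) (at t)" if "t > 0" for x t
    proof -
      have "\<forall>j\<in>J. \<exists>d. has_lap (\<lambda>y. bump (fst j) (snd j) y t) d x \<and>
          ((\<lambda>s. bump (fst j) (snd j) x s) has_real_derivative d) (at t)"
        by (intro ballI bump_heat rJ less_imp_le[OF that])
      from bchoice[OF this] obtain d where d: "\<And>j. j \<in> J \<Longrightarrow> has_lap (\<lambda>y. bump (fst j) (snd j) y t) (d j) x"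
          "\<And>j. j \<in> J \<Longrightarrow> ((\<lambda>s. bump (fst j) (snd j) x s) has_real_derivative d j) (at t)"
        by blast
      show ?thesis unfolding B_def
        by (rule exI[of _ "\<Sum>j\<in>J. d j"]) (intro conjI has_lap_sum DERIV_sum J(1) d)
    qed
    show "continuous_on (UNIV \<times> {0..}) (\<lambda>(x, t). B x t)"
      unfolding B_def split_beta
      by (intro continuous_on_sum) (use bump_continuous[OF rJ] in \<open>simp add: split_beta\<close>)
    show "B z 0 > 1" if zZ: "z \<in> Z" for z
    proof -
      obtain j where j: "j \<in> J" "z \<in> ball (fst j) (snd j)" using J(3) zZ by fastforce
      have "1 < bump (fst j) (snd j) z 0" using bump_initial rJ j by blast
      also have "\<dots> \<le> B z 0" unfolding B_def
        by (rule member_le_sum[OF j(1) _ J(1)]) (simp add: bump_def)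
      finally show ?thesis .
    qed
  qed
qed

lemma DERIV_left_min:
  assumes "(f has_real_derivative d) (at t within {..t})" "\<forall>\<^sub>F s in at_left t. f s \<ge> f t"
  shows "d \<le> 0"
proof -
  have "((\<lambda>s. (f s - f t) / (s - t)) \<longlongrightarrow> d) (at t within {..t})"
    using assms(1) by (simp add: has_field_derivative_iff)
  moreover have "at t within {..t} = at_left t"
  proof -
    have "at t within {..t} = at t within ({..t} - {t})" by (simp add: at_within_def)
    moreover have "{..t} - {t} = {..<t}" by auto
    ultimately show ?thesis by simp
  qed
  ultimately have lim: "((\<lambda>s. (f s - f t) / (s - t)) \<longlongrightarrow> d) (at_left t)" by simp
  have "\<forall>\<^sub>F s in at_left t. s < t" by (simp add: eventually_at_filter)
  with assms(2) have "\<forall>\<^sub>F s in at_left t. (f s - f t) / (s - t) \<le> 0"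
    by eventually_elim (simp add: divide_nonneg_neg)
  with lim show ?thesis by (intro tendsto_upperbound[OF lim]) auto
qed

text \<open>The time derivative is taken from below because the regions \<open>Q\<close> contain
  their final time.\<close>

definition heat_supersolution :: "('a::euclidean_space \<times> real) set \<Rightarrow> ('a \<Rightarrow> real \<Rightarrow> real) \<Rightarrow> bool" where
  "heat_supersolution Q w \<longleftrightarrow> (\<forall>x t. (x, t) \<in> Q \<longrightarrow> (\<exists>L d. has_lap (\<lambda>y. w y t) L x \<and>
     ((\<lambda>s. w x s) has_real_derivative d) (at t within {..t}) \<and> L \<le> d))"

text \<open>A negative infimum is not approached at the parabolic boundary, so by compactness it is
  attained in \<open>Q\<close>; there \<open>L \<ge> 0\<close> and \<open>d \<le> 0\<close>
  contradict \<open>L < d\<close>. \<open>Q\<close> is not restricted to cylinders because the Hopf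
  lemma will use a ball that grows with time.\<close>

lemma strict_heat_min_principle:
  fixes w :: "'a::euclidean_space \<Rightarrow> real \<Rightarrow> real"
  assumes Q: "open O'" "Q = O' \<inter> {p. 0 < snd p \<and> snd p \<le> T}" "bounded Q"
    and super: "\<And>x t. (x, t) \<in> Q \<Longrightarrow> \<exists>L d. has_lap (\<lambda>y. w y t) L x \<and>
      ((\<lambda>s. w x s) has_real_derivative d) (at t within {..t}) \<and> L < d"
    and cont: "continuous_on Q (\<lambda>(x, t). w x t)"
    and bdd: "\<And>x t. (x, t) \<in> Q \<Longrightarrow> - M \<le> w x t"
    and bdry: "\<And>x t e. (x, t) \<in> closure Q \<Longrightarrow> (x, t) \<notin> Q \<Longrightarrow> e > 0 \<Longrightarrow>
      \<forall>\<^sub>F p in at (x, t) within Q. w (fst p) (snd p) > - e"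
    and xt: "(x, t) \<in> Q"
  shows "w x t \<ge> 0"
proof (rule ccontr)
  assume neg: "\<not> w x t \<ge> 0"
  define W where "W = (\<lambda>p. w (fst p) (snd p))"
  define I where "I = Inf (W ` Q)"
  have bb: "bdd_below (W ` Q)" using bdd by (force simp: W_def bdd_below_def)
  have I: "I \<le> W p" if "p \<in> Q" for p unfolding I_def using that bb by (simp add: cINF_lower)
  have "I < 0" using I[OF xt] neg by (simp add: W_def)
  have "\<exists>p\<in>Q. W p < I + inverse (Suc n)" for n
  proof (rule ccontr)
    assume "\<not> ?thesis"
    then have "I + inverse (Suc n) \<le> I" unfolding I_def using xt
      by (intro cInf_greatest) (auto simp: not_less)
    then show False by simp
  qed
  then obtain p where p: "\<And>n. p n \<in> Q" "\<And>n. W (p n) < I + inverse (Suc n)" by metis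
  have "compact (closure Q)" using Q(3) by simp
  then obtain q s where q: "q \<in> closure Q" "strict_mono s" "(p \<circ> s) \<longlonglongrightarrow> q"
    using p(1) unfolding compact_def by (meson closure_subset subsetD)
  have "(\<lambda>n. W (p n)) \<longlonglongrightarrow> I"
    by (rule tendsto_sandwich[OF _ _ tendsto_const LIMSEQ_inverse_real_of_nat_add[of I]])
       (use p I in \<open>auto simp: less_imp_le\<close>)
  then have WI: "(\<lambda>n. W ((p \<circ> s) n)) \<longlonglongrightarrow> I" using LIMSEQ_subseq_LIMSEQ[OF _ q(2)] by (simp add: o_def)
  have qQ: "q \<in> Q"
  proof (rule ccontr)
    assume nq: "q \<notin> Q"
    have "\<forall>\<^sub>F r in at q within Q. W r > - (- I / 2)"
      using bdry[of "fst q" "snd q" "- I / 2"] q(1) nq \<open>I < 0\<close> by (simp add: W_def)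
    moreover have "filterlim (p \<circ> s) (at q within Q) sequentially"
      using q(3) p(1) nq by (auto simp: filterlim_at intro!: always_eventually)
    ultimately have "\<forall>\<^sub>F n in sequentially. W ((p \<circ> s) n) > I / 2"
      using eventually_compose_filterlim by fastforce
    then have "I \<ge> I / 2" using WI by (intro tendsto_lowerbound[OF WI]) (auto elim: eventually_mono)
    then show False using \<open>I < 0\<close> by simp
  qed
  have "continuous_on Q W" using cont by (simp add: W_def split_beta)
  then have "(\<lambda>n. W ((p \<circ> s) n)) \<longlonglongrightarrow> W q"
    using q(3) p(1) qQ by (auto simp: continuous_on_sequentially o_def)
  then have Wq: "W q = I" using WI LIMSEQ_unique by blast
  obtain y \<tau> where y: "q = (y, \<tau>)" by (cases q)
  obtain L d where Ld: "has_lap (\<lambda>x. w x \<tau>) L y" "((\<lambda>s. w y s) has_real_derivative d) (at \<tau> within {..\<tau>})" "L < d"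
    using super qQ y by blast
  have \<tau>: "0 < \<tau>" "\<tau> \<le> T" "(y, \<tau>) \<in> O'" using qQ y Q(2) by auto
  have "((\<lambda>x. (x, \<tau>)) \<longlongrightarrow> (y, \<tau>)) (nhds y)" by (intro tendsto_intros filterlim_ident)
  then have "\<forall>\<^sub>F x in nhds y. (x, \<tau>) \<in> O'" using topological_tendstoD[OF _ Q(1) \<tau>(3)] by blast
  then have "\<forall>\<^sub>F x in nhds y. w y \<tau> \<le> w x \<tau>"
  proof eventually_elim
    case (elim x)
    then have "(x, \<tau>) \<in> Q" using \<tau> Q(2) by simp
    from I[OF this] show ?case using Wq y by (simp add: W_def)
  qed
  then have "L \<ge> 0" using has_lap_local_min[OF Ld(1)] by blast
  have "((\<lambda>s. (y, s)) \<longlongrightarrow> (y, \<tau>)) (at_left \<tau>)" by (intro tendsto_intros)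
  then have "\<forall>\<^sub>F s in at_left \<tau>. (y, s) \<in> O'" using topological_tendstoD[OF _ Q(1) \<tau>(3)] by blast
  moreover have "\<forall>\<^sub>F s in at_left \<tau>. 0 < s \<and> s < \<tau>"
    using \<tau>(1) eventually_at_left_real by (auto elim: eventually_mono)
  ultimately have "\<forall>\<^sub>F s in at_left \<tau>. w y s \<ge> w y \<tau>"
  proof eventually_elim
    case (elim s)
    then have "(y, s) \<in> Q" using \<tau> Q(2) by simp
    from I[OF this] show ?case using Wq y by (simp add: W_def)
  qed
  then have "d \<le> 0" by (rule DERIV_left_min[OF Ld(2)])
  with \<open>L \<ge> 0\<close> Ld(3) show False by simp
qed

text \<open>The exceptional set \<open>Z \<times> {0}\<close> accounts for the incompatibility of initial and boundary
  values: no boundary condition is imposed there.\<close>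

lemma heat_min_principle:
  fixes w :: "'a::euclidean_space \<Rightarrow> real \<Rightarrow> real"
  assumes Q: "open O'" "Q = O' \<inter> {p. 0 < snd p \<and> snd p \<le> T}" "bounded Q"
    and super: "heat_supersolution Q w"
    and cont: "continuous_on Q (\<lambda>(x, t). w x t)"
    and bdd: "\<And>x t. (x, t) \<in> Q \<Longrightarrow> - M \<le> w x t"
    and Z: "compact Z" "negligible Z"
    and bdry: "\<And>x t e. (x, t) \<in> closure Q \<Longrightarrow> (x, t) \<notin> Q \<Longrightarrow> \<not> (t = 0 \<and> x \<in> Z) \<Longrightarrow> e > 0 \<Longrightarrow>
      \<forall>\<^sub>F p in at (x, t) within Q. w (fst p) (snd p) > - e"
    and xt: "(x, t) \<in> Q"
  shows "w x t \<ge> 0"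
proof (rule ccontr)
  assume neg: "\<not> w x t \<ge> 0"
  have t: "t > 0" using xt Q(2) by simp
  \<comment> \<open>\<open>m > M\<close> makes \<open>w + m * B\<close> positive near the
    exceptional set, where \<open>B > 1\<close>.\<close>
  define m where "m = max M 0 + 1"
  have m: "m > 0" "m > M" by (auto simp: m_def)
  define a where "a = - w x t"
  have a: "a > 0" using neg by (simp add: a_def)
  obtain B where B: "\<And>x t. t \<ge> 0 \<Longrightarrow> B x t \<ge> 0" "B x t < a / (3 * m)"
    "\<And>x t. t > 0 \<Longrightarrow> \<exists>d. has_lap (\<lambda>y. B y t) d x \<and> ((\<lambda>s. B x s) has_real_derivative d) (at t)"
    "continuous_on (UNIV \<times> {0..}) (\<lambda>(x, t). B x t)"
    "\<And>z. z \<in> Z \<Longrightarrow> B z 0 > 1"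
    using heat_barrier_negligible[OF Z t, of "a / (3 * m)" x] a m by auto
  \<comment> \<open>The perturbations \<open>\<epsilon> * t\<close> and \<open>m * B x t\<close>
    each use at most a third of \<open>a\<close>, so \<open>W x t\<close> stays negative; the first
    one also makes the supersolution strict.\<close>
  define \<epsilon> where "\<epsilon> = a / (3 * t)"
  have \<epsilon>: "\<epsilon> > 0" using a t by (simp add: \<epsilon>_def)
  have Qpos: "snd p > 0" if "p \<in> Q" for p using that Q(2) by simp
  define W where "W = (\<lambda>x t. w x t + \<epsilon> * t + m * B x t)"
  have contB: "continuous_on Q (\<lambda>(x, t). B x t)"
    by (rule continuous_on_subset[OF B(4)]) (use Qpos in \<open>auto simp: less_imp_le\<close>)
  have ge: "W x t \<ge> w x t" if "t > 0" for x t
    using that B(1)[of t x] m \<epsilon> by (simp add: W_def less_imp_le)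
  have "W x t \<ge> 0"
  proof (rule strict_heat_min_principle[OF Q _ _ _ _ xt])
    fix x t assume "(x, t) \<in> Q"
    obtain L d where Ld: "has_lap (\<lambda>y. w y t) L x" "((\<lambda>s. w x s) has_real_derivative d) (at t within {..t})" "L \<le> d"
      using super \<open>(x, t) \<in> Q\<close> unfolding heat_supersolution_def by blast
    obtain k where k: "has_lap (\<lambda>y. B y t) k x" "((\<lambda>s. B x s) has_real_derivative k) (at t)"
      using B(3)[of t x] Qpos[OF \<open>(x, t) \<in> Q\<close>] by auto
    have "has_lap (\<lambda>y. W y t) (L + 0 + m * k) x" unfolding W_def
      by (intro has_lap_add has_lap_cmult has_lap_const Ld k)
    moreover have "((\<lambda>s. W x s) has_real_derivative (d + \<epsilon> * 1 + m * k)) (at t within {..t})"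
      unfolding W_def
      by (intro DERIV_add DERIV_cmult Ld DERIV_ident DERIV_subset[OF k(2)]) auto
    ultimately show "\<exists>L d. has_lap (\<lambda>y. W y t) L x \<and>
         ((\<lambda>s. W x s) has_real_derivative d) (at t within {..t}) \<and> L < d"
      using Ld(3) \<epsilon> by (intro exI[of _ "L + 0 + m * k"] exI[of _ "d + \<epsilon> * 1 + m * k"]) auto
  next
    have "continuous_on Q (\<lambda>p. (\<lambda>(x, t). w x t) p + \<epsilon> * snd p + m * (\<lambda>(x, t). B x t) p)"
      by (intro continuous_intros cont contB)
    then show "continuous_on Q (\<lambda>(x, t). W x t)" by (simp add: W_def split_beta)
  next
    show "- M \<le> W x t" if "(x, t) \<in> Q" for x t using ge[of t x] bdd[OF that] Qpos[OF that] by simp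
  next
    fix x t and e :: real assume xt: "(x, t) \<in> closure Q" "(x, t) \<notin> Q" "e > 0"
    have inQ: "\<forall>\<^sub>F p in at (x, t) within Q. p \<in> Q" by (simp add: eventually_at_filter)
    show "\<forall>\<^sub>F p in at (x, t) within Q. W (fst p) (snd p) > - e"
    proof (cases "t = 0 \<and> x \<in> Z")
      case False
      then have "\<forall>\<^sub>F p in at (x, t) within Q. w (fst p) (snd p) > - e" using bdry xt by blast
      with inQ show ?thesis
        by eventually_elim (use ge Qpos in \<open>force intro: less_le_trans\<close>)
    next
      case True
      have "((\<lambda>(x, t). B x t) \<longlongrightarrow> B x t) (at (x, t) within UNIV \<times> {0..})"
        using B(4) True by (auto simp: continuous_on_def)
      then have "((\<lambda>(x, t). B x t) \<longlongrightarrow> B x t) (at (x, t) within Q)"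
        by (rule tendsto_within_subset) (use Qpos in \<open>auto simp: less_imp_le\<close>)
      then have "\<forall>\<^sub>F p in at (x, t) within Q. (\<lambda>(x, t). B x t) p > 1"
        by (rule order_tendstoD(1)) (use B(5) True in auto)
      with inQ show ?thesis
      proof eventually_elim
        case (elim p)
        have "w (fst p) (snd p) \<ge> - M" using bdd[of "fst p" "snd p"] elim by simp
        moreover have "m * B (fst p) (snd p) > m * 1" using elim m by (intro mult_strict_left_mono) (auto simp: split_beta)
        moreover have "\<epsilon> * snd p > 0" using \<epsilon> Qpos elim by simp
        ultimately show ?case using m xt(3) unfolding W_def by linarith
      qed
    qed
  qed
  moreover have "W x t < 0"
  proof -
    have "m * B x t < a / 3" using B(2) m by (simp add: field_simps)
    moreover have "\<epsilon> * t = a / 3" using t by (simp add: \<epsilon>_def)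
    ultimately show ?thesis unfolding W_def using a by (simp add: a_def)
  qed
  ultimately show False by simp
qed

lemma eventually_within_continuous_ge:
  fixes w :: "'a::euclidean_space \<Rightarrow> real \<Rightarrow> real"
  assumes "continuous_on S (\<lambda>(x, t). w x t)" "(x, t) \<in> S" "Q \<subseteq> S" "w x t \<ge> 0" "e > 0"
  shows "\<forall>\<^sub>F p in at (x, t) within Q. w (fst p) (snd p) > - e"
proof -
  have "((\<lambda>(x, t). w x t) \<longlongrightarrow> w x t) (at (x, t) within S)"
    using assms(1,2) by (auto simp: continuous_on_def)
  then have "((\<lambda>(x, t). w x t) \<longlongrightarrow> w x t) (at (x, t) within Q)"
    by (rule tendsto_within_subset[OF _ assms(3)])
  then have "\<forall>\<^sub>F p in at (x, t) within Q. (\<lambda>(x, t). w x t) p > - e"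
    by (rule order_tendstoD(1)) (use assms(4,5) in linarith)
  then show ?thesis by (simp add: split_beta)
qed

lemma heat_min_principle_cylinder:
  fixes w :: "'a::euclidean_space \<Rightarrow> real \<Rightarrow> real"
  assumes D: "open D" "bounded D"
    and super: "heat_supersolution (D \<times> {0<..T}) w"
    and cont: "continuous_on (D \<times> {0<..T}) (\<lambda>(x, t). w x t)"
    and bdd: "\<And>x t. x \<in> D \<Longrightarrow> 0 < t \<Longrightarrow> t \<le> T \<Longrightarrow> - M \<le> w x t"
    and Z: "compact Z" "negligible Z"
    and bdry: "\<And>x t e. x \<in> closure D \<Longrightarrow> 0 \<le> t \<Longrightarrow> t \<le> T \<Longrightarrow> x \<notin> D \<or> t = 0 \<Longrightarrow>
      \<not> (t = 0 \<and> x \<in> Z) \<Longrightarrow> e > 0 \<Longrightarrow>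
      \<forall>\<^sub>F p in at (x, t) within D \<times> {0<..T}. w (fst p) (snd p) > - e"
    and xt: "x \<in> D" "0 < t" "t \<le> T"
  shows "w x t \<ge> 0"
proof (rule heat_min_principle[where Q = "D \<times> {0<..T}" and O' = "D \<times> UNIV", OF _ _ _ super cont _ Z])
  show "open (D \<times> (UNIV :: real set))" by (intro open_Times D open_UNIV)
  show "D \<times> {0<..T} = D \<times> UNIV \<inter> {p. 0 < snd p \<and> snd p \<le> T}" by auto
  have "bounded {0<..T}" by (rule bounded_subset[OF bounded_closed_interval[of 0 T]]) auto
  with D show "bounded (D \<times> {0<..T})" by (intro bounded_Times)
  show "- M \<le> w x t" if "(x, t) \<in> D \<times> {0<..T}" for x t using that bdd by auto
  show "(x, t) \<in> D \<times> {0<..T}" using xt by auto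
  fix x t and e :: real
  assume *: "(x, t) \<in> closure (D \<times> {0<..T})" "(x, t) \<notin> D \<times> {0<..T}" "\<not> (t = 0 \<and> x \<in> Z)" "e > 0"
  have "closure {0<..T} \<subseteq> {0..T}" by (rule closure_minimal) auto
  then have "x \<in> closure D" "0 \<le> t" "t \<le> T" using *(1) by (auto simp: closure_Times)
  then show "\<forall>\<^sub>F p in at (x, t) within D \<times> {0<..T}. w (fst p) (snd p) > - e"
    using *(2-4) by (intro bdry) auto
qed

section \<open>Comparison principles for the solution with initial value 1\<close>

locale heat_from_one =
  fixes \<Omega> :: "'a::euclidean_space set" and u :: "'a \<Rightarrow> real \<Rightarrow> real"
  assumes op: "open \<Omega>" and bounded_dom: "bounded \<Omega>"
    and neg: "negligible (frontier \<Omega>)"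
    and sol: "heat_solution_one \<Omega> u"
begin

lemma u_C2: "t > 0 \<Longrightarrow> Ck_on 2 \<Omega> (\<lambda>x. u x t)"
  using sol unfolding heat_solution_one_def by blast

lemma u_deriv: "x \<in> \<Omega> \<Longrightarrow> t > 0 \<Longrightarrow> ((\<lambda>s. u x s) has_real_derivative laplacian (\<lambda>y. u y t) x) (at t)"
  using sol unfolding heat_solution_one_def by blast

lemma u_lap: "x \<in> \<Omega> \<Longrightarrow> t > 0 \<Longrightarrow> has_lap (\<lambda>y. u y t) (laplacian (\<lambda>y. u y t) x) x"
  using C2_has_lap[OF op u_C2] .

lemma u_cont: "continuous_on ((closure \<Omega> \<times> {0<..}) \<union> (\<Omega> \<times> {0..})) (\<lambda>(x,t). u x t)"
  using sol unfolding heat_solution_one_def by blast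

lemma u_init: "x \<in> \<Omega> \<Longrightarrow> u x 0 = 1"
  using sol unfolding heat_solution_one_def by blast

lemma u_bdry: "x \<in> frontier \<Omega> \<Longrightarrow> t > 0 \<Longrightarrow> u x t = 0"
  using sol unfolding heat_solution_one_def by blast

lemma u_bounded: obtains M where "M > 0" "\<And>x t. x \<in> closure \<Omega> \<Longrightarrow> t > 0 \<Longrightarrow> \<bar>u x t\<bar> \<le> M"
proof -
  have "bounded ((\<lambda>(x,t). u x t) ` ((closure \<Omega> \<times> {0<..}) \<union> (\<Omega> \<times> {0..})))"
    using sol unfolding heat_solution_one_def by blast
  then obtain M where M: "M > 0" "\<And>y. y \<in> ((\<lambda>(x,t). u x t) ` ((closure \<Omega> \<times> {0<..}) \<union> (\<Omega> \<times> {0..}))) \<Longrightarrow> norm y \<le> M"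
    unfolding bounded_pos by blast
  have "\<bar>u x t\<bar> \<le> M" if "x \<in> closure \<Omega>" "t > 0" for x t
  proof -
    have "(x, t) \<in> (closure \<Omega> \<times> {0<..}) \<union> (\<Omega> \<times> {0..})" using that by simp
    then have "(\<lambda>(x,t). u x t) (x, t) \<in> ((\<lambda>(x,t). u x t) ` ((closure \<Omega> \<times> {0<..}) \<union> (\<Omega> \<times> {0..})))"
      by (rule imageI)
    from M(2)[OF this] show ?thesis by simp
  qed
  with M(1) show ?thesis using that by blast
qed

lemma compact_frontier_dom: "compact (frontier \<Omega>)"
  using bounded_dom by (rule compact_frontier_bounded)

text \<open>The comparison principle for differences with \<open>u\<close>; \<open>\<sigma> = 1\<close> compares from above and
  \<open>\<sigma> = -1\<close> from below.\<close>

lemma u_compare: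
  fixes v :: "'a \<Rightarrow> real \<Rightarrow> real" and \<sigma> :: real
  assumes D: "open D" "D \<subseteq> \<Omega>"
    and v: "\<And>x t. x \<in> D \<Longrightarrow> 0 < t \<Longrightarrow> t \<le> T \<Longrightarrow> \<exists>L d. has_lap (\<lambda>y. v y t) L x \<and>
        ((\<lambda>s. v x s) has_real_derivative d) (at t) \<and> \<sigma> * L \<le> \<sigma> * d"
    and vc: "continuous_on (closure D \<times> {0<..T}) (\<lambda>(x, t). v x t)"
    and vb: "\<And>x t. x \<in> D \<Longrightarrow> 0 < t \<Longrightarrow> t \<le> T \<Longrightarrow> - M \<le> \<sigma> * v x t"
    and lat: "\<And>x t. x \<in> closure D \<Longrightarrow> x \<notin> D \<Longrightarrow> 0 < t \<Longrightarrow> t \<le> T \<Longrightarrow> \<sigma> * u x t \<le> \<sigma> * v x t"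
    and ini: "\<And>x e. x \<in> closure D \<inter> \<Omega> \<Longrightarrow> e > 0 \<Longrightarrow>
        \<forall>\<^sub>F p in at (x, 0) within D \<times> {0<..T}. \<sigma> * v (fst p) (snd p) \<ge> \<sigma> - e"
    and xt: "x \<in> D" "0 < t" "t \<le> T"
  shows "\<sigma> * u x t \<le> \<sigma> * v x t"
proof -
  obtain B where B: "B > 0" "\<And>x t. x \<in> closure \<Omega> \<Longrightarrow> t > 0 \<Longrightarrow> \<bar>u x t\<bar> \<le> B" using u_bounded by blast
  define w where "w = (\<lambda>x t. \<sigma> * v x t - \<sigma> * u x t)"
  have cl: "closure D \<subseteq> closure \<Omega>" using D(2) by (rule closure_mono)
  have uc: "continuous_on (closure D \<times> {0<..T}) (\<lambda>(x, t). u x t)"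
    by (rule continuous_on_subset[OF u_cont]) (use cl in auto)
  have wc: "continuous_on (closure D \<times> {0<..T}) (\<lambda>(x, t). w x t)"
    using continuous_on_diff[OF continuous_on_mult_left[OF vc, of \<sigma>] continuous_on_mult_left[OF uc, of \<sigma>]]
    by (simp add: w_def split_beta)
  have "w x t \<ge> 0"
  proof (rule heat_min_principle_cylinder[OF D(1) _ _ _ _ compact_frontier_dom neg _ xt])
    show "bounded D" using bounded_subset[OF bounded_dom D(2)] .
    show "heat_supersolution (D \<times> {0<..T}) w"
      unfolding heat_supersolution_def
    proof (intro allI impI)
      fix x t assume "(x, t) \<in> D \<times> {0<..T}"
      then have x: "x \<in> D" "0 < t" "t \<le> T" "x \<in> \<Omega>" using D(2) by auto
      obtain L d where Ld: "has_lap (\<lambda>y. v y t) L x" "((\<lambda>s. v x s) has_real_derivative d) (at t)" "\<sigma> * L \<le> \<sigma> * d"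
        using v x by blast
      define l where "l = laplacian (\<lambda>y. u y t) x"
      have "has_lap (\<lambda>y. w y t) (\<sigma> * L - \<sigma> * l) x" unfolding w_def l_def
        by (intro has_lap_diff has_lap_cmult Ld u_lap x)
      moreover have "((\<lambda>s. w x s) has_real_derivative (\<sigma> * d - \<sigma> * l)) (at t within {..t})"
        unfolding w_def l_def
        by (rule DERIV_subset[of _ _ t UNIV]) (auto intro!: DERIV_diff DERIV_cmult Ld u_deriv x)
      ultimately show "\<exists>L d. has_lap (\<lambda>y. w y t) L x \<and>
          ((\<lambda>s. w x s) has_real_derivative d) (at t within {..t}) \<and> L \<le> d"
        using Ld(3) by (intro exI[of _ "\<sigma> * L - \<sigma> * l"] exI[of _ "\<sigma> * d - \<sigma> * l"]) simp
    qed
    show "continuous_on (D \<times> {0<..T}) (\<lambda>(x, t). w x t)"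
      by (rule continuous_on_subset[OF wc]) (use closure_subset in auto)
    show "- (M + \<bar>\<sigma>\<bar> * B) \<le> w x t" if "x \<in> D" "0 < t" "t \<le> T" for x t
    proof -
      have "\<bar>\<sigma> * u x t\<bar> \<le> \<bar>\<sigma>\<bar> * B"
        unfolding abs_mult using that cl closure_subset[of D] by (intro mult_left_mono B) auto
      then show ?thesis using vb[OF that] by (simp add: w_def)
    qed
    fix x t and e :: real
    assume *: "x \<in> closure D" "0 \<le> t" "t \<le> T" "x \<notin> D \<or> t = 0" "\<not> (t = 0 \<and> x \<in> frontier \<Omega>)" "e > 0"
    show "\<forall>\<^sub>F p in at (x, t) within D \<times> {0<..T}. w (fst p) (snd p) > - e"
    proof (cases "t = 0")
      case False
      then show ?thesis
        by (intro eventually_within_continuous_ge[OF wc]) (use * lat closure_subset[of D] in \<open>auto simp: w_def\<close>)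
    next
      case True
      then have x: "x \<in> \<Omega>" using * cl frontier_def interior_open[OF op] by auto
      have "continuous_on ((closure \<Omega> \<times> {0<..}) \<union> (\<Omega> \<times> {0..})) (\<lambda>(x, t). \<sigma> * (1 - u x t))"
        using continuous_on_mult_left[OF continuous_on_diff[OF continuous_on_const[of _ 1] u_cont], of \<sigma>]
        by (simp add: split_beta)
      then have "\<forall>\<^sub>F p in at (x, 0) within D \<times> {0<..T}. \<sigma> * (1 - u (fst p) (snd p)) > - (e / 2)"
        by (rule eventually_within_continuous_ge) (use x * u_init D(2) in auto)
      moreover have "\<forall>\<^sub>F p in at (x, 0) within D \<times> {0<..T}. \<sigma> * v (fst p) (snd p) \<ge> \<sigma> - e / 2"
        using ini[of x "e / 2"] x * by simp
      ultimately show ?thesis unfolding True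
        by eventually_elim (simp add: w_def algebra_simps)
    qed
  qed
  then show ?thesis by (simp add: w_def)
qed

lemma u_nonneg: assumes "x \<in> closure \<Omega>" "t > 0" shows "u x t \<ge> 0"
proof (cases "x \<in> \<Omega>")
  case True
  have "- 1 * u x t \<le> - 1 * 0"
  proof (rule u_compare[where D = \<Omega> and T = t and M = 0, OF op])
    show "\<exists>L d. has_lap (\<lambda>y. 0) L x \<and> ((\<lambda>s. 0) has_real_derivative d) (at t) \<and> - 1 * L \<le> - 1 * d" for x t
      using has_lap_const DERIV_const by force
    show "\<forall>\<^sub>F p in at (x, 0) within \<Omega> \<times> {0<..t}. - 1 * (0::real) \<ge> - 1 - e" if "e > 0" for x e
      using that by (intro always_eventually) auto
    show "- 1 * u x t \<le> - 1 * 0" if "x \<in> closure \<Omega>" "x \<notin> \<Omega>" "0 < t" for x t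
      using that u_bdry[of x t] by (simp add: frontier_def interior_open[OF op])
  qed (use True assms in auto)
  then show ?thesis by simp
qed (use assms u_bdry in \<open>auto simp: frontier_def interior_open[OF op]\<close>)

lemma u_le_one: assumes "x \<in> closure \<Omega>" "t > 0" shows "u x t \<le> 1"
proof (cases "x \<in> \<Omega>")
  case True
  have "1 * u x t \<le> 1 * 1"
  proof (rule u_compare[where D = \<Omega> and T = t and M = 0, OF op])
    show "\<exists>L d. has_lap (\<lambda>y. 1) L x \<and> ((\<lambda>s. 1) has_real_derivative d) (at t) \<and> 1 * L \<le> 1 * d" for x t
      using has_lap_const DERIV_const by force
    show "\<forall>\<^sub>F p in at (x, 0) within \<Omega> \<times> {0<..t}. 1 * (1::real) \<ge> 1 - e" if "e > 0" for x e
      using that by (intro always_eventually) auto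
    show "1 * u x t \<le> 1 * 1" if "x \<in> closure \<Omega>" "x \<notin> \<Omega>" "0 < t" for x t
      using that u_bdry[of x t] by (simp add: frontier_def interior_open[OF op])
  qed (use True assms in auto)
  then show ?thesis by simp
qed (use assms u_bdry in \<open>auto simp: frontier_def interior_open[OF op]\<close>)

text \<open>The comparison function 1 - (|x - y|^2 + 2 n t) / a^2, with n the dimension, solves the
  heat equation exactly, is at most 1, and is nonpositive on the sphere of radius \<open>a\<close>,
  where \<open>u\<close> is nonnegative.\<close>

lemma u_interior_lower:
  fixes t :: real
  assumes a: "a > 0" "cball y a \<subseteq> \<Omega>" and t: "t > 0"
  shows "u y t \<ge> 1 - 2 * DIM('a) * t / a\<^sup>2"
proof -
  define v where "v = (\<lambda>x (t :: real). 1 - ((norm (x - y))\<^sup>2 + 2 * DIM('a) * t) / a\<^sup>2)"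
  have aO: "ball y a \<subseteq> \<Omega>" "y \<in> ball y a" "closure (ball y a) = cball y a" using a ball_subset_cball by auto
  have "- 1 * u y t \<le> - 1 * v y t"
  proof (rule u_compare[where D = "ball y a" and T = t and M = 1, OF open_ball aO(1) _ _ _ _ _ aO(2) t order_refl])
    show "\<exists>L d. has_lap (\<lambda>y. v y t) L x \<and> ((\<lambda>s. v x s) has_real_derivative d) (at t) \<and> - 1 * L \<le> - 1 * d" for x t
    proof -
      have "has_lap (\<lambda>x. (1 - 2 * DIM('a) * t / a\<^sup>2) - (1 / a\<^sup>2) * (norm (x - y))\<^sup>2)
          (0 - (1 / a\<^sup>2) * (\<Sum>i\<in>(Basis::'a set). 2 * (i \<bullet> i))) x"
        by (intro has_lap_diff has_lap_const has_lap_cmult jet2_has_lap[OF jet2_norm_sq])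
      moreover have "(\<lambda>x. (1 - 2 * DIM('a) * t / a\<^sup>2) - (1 / a\<^sup>2) * (norm (x - y))\<^sup>2) = (\<lambda>x. v x t)"
        by (simp add: v_def add_divide_distrib algebra_simps)
      ultimately have "has_lap (\<lambda>x. v x t) (- (2 * DIM('a) / a\<^sup>2)) x" by (simp add: mult.commute)
      moreover have "((\<lambda>s. v x s) has_real_derivative (- (2 * DIM('a) / a\<^sup>2))) (at t)"
        unfolding v_def using a by (auto intro!: derivative_eq_intros simp: field_simps eval_nat_numeral)
      ultimately show ?thesis by blast
    qed
    have "continuous_on S (\<lambda>p. 1 - ((norm (fst p - y))\<^sup>2 + 2 * DIM('a) * snd p) / a\<^sup>2)" for S :: "('a \<times> real) set"
      using a by (intro continuous_intros) auto
    then have vc: "continuous_on S (\<lambda>(x, t). v x t)" for S :: "('a \<times> real) set"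
      by (simp add: v_def split_beta)
    then show "continuous_on (closure (ball y a) \<times> {0<..t}) (\<lambda>(x, t). v x t)" .
    have v1: "v x t \<le> 1" if "0 \<le> t" for x t using that by (simp add: v_def)
    show "- 1 \<le> - 1 * v x t" if "0 < t" for x t using v1[of t x] that by simp
    show "- 1 * u x t \<le> - 1 * v x t" if "x \<in> closure (ball y a)" "x \<notin> ball y a" "0 < t" for x t
    proof -
      have "norm (x - y) = a" using that aO(3) by (simp add: dist_norm norm_minus_commute)
      then have "v x t \<le> 0" using that a by (simp add: v_def field_simps)
      moreover have "x \<in> closure \<Omega>" using that aO(3) a(2) closure_subset[of \<Omega>] by blast
      then have "u x t \<ge> 0" using u_nonneg that by simp
      ultimately show ?thesis by simp
    qed
    show "\<forall>\<^sub>F p in at (x, 0) within ball y a \<times> {0<..t}. - 1 * v (fst p) (snd p) \<ge> - 1 - e" if "e > 0" for x e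
    proof -
      have "\<forall>\<^sub>F p in at (x, 0) within ball y a \<times> {0<..t}. p \<in> ball y a \<times> {0<..t}" by (simp add: eventually_at_filter)
      then show ?thesis
      proof eventually_elim
        case (elim p)
        then have "v (fst p) (snd p) \<le> 1" by (intro v1) auto
        then show ?case using that by simp
      qed
    qed
  qed
  then show ?thesis by (simp add: v_def)
qed

end

section \<open>The one-dimensional boundary layer\<close>

definition gauss_int :: "real \<Rightarrow> real" where
  "gauss_int z = (LBINT y=ereal 0..ereal z. exp (- y\<^sup>2))"

lemma gauss_int_deriv: "(gauss_int has_real_derivative exp (- z\<^sup>2)) (at z)"
proof -
  define a b where "a = - \<bar>z\<bar> - 1" and "b = \<bar>z\<bar> + 1"
  have "((\<lambda>u. LBINT y=ereal 0..ereal u. exp (- y\<^sup>2)) has_vector_derivative exp (- z\<^sup>2)) (at z within {a..b})"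
    by (rule interval_integral_FTC2) (auto simp: a_def b_def intro!: continuous_intros)
  then have "(gauss_int has_real_derivative exp (- z\<^sup>2)) (at z within {a..b})"
    by (simp add: has_real_derivative_iff_has_vector_derivative gauss_int_def[abs_def])
  moreover have "z \<in> interior {a..b}" by (auto simp: a_def b_def)
  ultimately show ?thesis using at_within_interior by metis
qed

lemma gauss_int_0 [simp]: "gauss_int 0 = 0"
  by (simp add: gauss_int_def)

lemma DERIV_le_mono:
  fixes f g :: "real \<Rightarrow> real"
  assumes "a \<le> b" "\<And>x. a \<le> x \<Longrightarrow> x \<le> b \<Longrightarrow> (f has_real_derivative f' x) (at x)"
    "\<And>x. a \<le> x \<Longrightarrow> x \<le> b \<Longrightarrow> (g has_real_derivative g' x) (at x)"
    "\<And>x. a \<le> x \<Longrightarrow> x \<le> b \<Longrightarrow> f' x \<le> g' x"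
  shows "f b - f a \<le> g b - g a"
proof -
  have "(\<lambda>x. g x - f x) a \<le> (\<lambda>x. g x - f x) b"
  proof (rule DERIV_nonneg_imp_nondecreasing[OF assms(1)])
    fix x assume "a \<le> x" "x \<le> b"
    then show "\<exists>y. ((\<lambda>x. g x - f x) has_real_derivative y) (at x) \<and> 0 \<le> y"
      using DERIV_diff[OF assms(3) assms(2), of x] assms(4)[of x]
      by (intro exI[of _ "g' x - f' x"]) auto
  qed
  then show ?thesis by simp
qed

lemma gauss_int_mono: "x \<le> y \<Longrightarrow> gauss_int x \<le> gauss_int y"
  using DERIV_le_mono[of x y "\<lambda>_. 0" "\<lambda>_. 0" gauss_int "\<lambda>z. exp (- z\<^sup>2)"] gauss_int_deriv by simp

text \<open>Since exp (x^2) \<ge> 1 + x^2, the integrand is dominated by the derivative of arctan;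
  this makes the supremum \<open>gauss_total\<close> finite.\<close>

lemma gauss_int_bdd: "gauss_int z \<le> pi / 2"
proof (cases "z \<ge> 0")
  case True
  have "gauss_int z - gauss_int 0 \<le> arctan z - arctan 0"
  proof (rule DERIV_le_mono[OF True gauss_int_deriv])
    show "(arctan has_real_derivative inverse (1 + x\<^sup>2)) (at x)" for x by (rule DERIV_arctan)
    fix x :: real
    have "1 + x\<^sup>2 \<le> exp (x\<^sup>2)" by (rule exp_ge_add_one_self)
    then have "inverse (exp (x\<^sup>2)) \<le> inverse (1 + x\<^sup>2)"
      by (intro le_imp_inverse_le) (auto simp: add_pos_nonneg)
    then show "exp (- x\<^sup>2) \<le> inverse (1 + x\<^sup>2)" by (simp add: exp_minus)
  qed
  then show ?thesis using arctan_ubound[of z] by simp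
next
  case False
  then have "gauss_int z \<le> 0" using gauss_int_mono[of z 0] by simp
  then show ?thesis using pi_gt_zero by linarith
qed

text \<open>This is sqrt \<pi> / 2, so \<open>erf0\<close> is the error function and
  \<open>erf_slope\<close> is 2 / sqrt \<pi>. The same constant leads both bounds for the normal
  derivative and cancels between them.\<close>

definition gauss_total :: real where "gauss_total = (SUP z. gauss_int z)"

lemma gauss_int_le_total: "gauss_int z \<le> gauss_total"
  unfolding gauss_total_def by (rule cSUP_upper) (auto intro: bdd_aboveI2 gauss_int_bdd)

lemma gauss_total_pos: "gauss_total > 0"
proof -
  have "\<exists>l>0. ((gauss_int has_real_derivative l) (at (0::real)))"
    using gauss_int_deriv[of 0] by (intro exI[of _ 1]) simp
  then obtain d where "d > 0" "\<And>h. 0 < h \<Longrightarrow> h < d \<Longrightarrow> gauss_int 0 < gauss_int (0 + h)"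
    using DERIV_pos_inc_right by metis
  from this(2)[of "d / 2"] this(1) gauss_int_le_total[of "d / 2"] show ?thesis by simp
qed

definition erf0 :: "real \<Rightarrow> real" where "erf0 z = gauss_int z / gauss_total"

abbreviation erf_slope :: real where "erf_slope \<equiv> inverse gauss_total"

lemma erf_slope_pos: "erf_slope > 0" using gauss_total_pos by simp

lemma erf0_deriv: "(erf0 has_real_derivative erf_slope * exp (- z\<^sup>2)) (at z)"
  using DERIV_cdivide[OF gauss_int_deriv[of z], of gauss_total]
  by (simp add: erf0_def[abs_def] divide_inverse mult.commute)

lemma erf0_0 [simp]: "erf0 0 = 0" by (simp add: erf0_def)

lemma erf0_le_one: "erf0 z \<le> 1"
  using gauss_int_le_total gauss_total_pos by (simp add: erf0_def)

text \<open>For x \<ge> z \<ge> 0 one has z^2 + (x - z)^2 \<le> x^2, so the Gaussian integral beyond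
  \<open>z\<close> is at most exp (-z^2) times the full half-line integral.\<close>

lemma erf0_tail:
  assumes z: "z \<ge> 0" shows "1 - erf0 z \<le> exp (- z\<^sup>2)"
proof -
  have "gauss_int b \<le> gauss_int z + exp (- z\<^sup>2) * gauss_total" for b
  proof (cases "b \<ge> z")
    case True
    have "gauss_int b - gauss_int z \<le> exp (- z\<^sup>2) * gauss_int (b - z) - exp (- z\<^sup>2) * gauss_int (z - z)"
    proof (rule DERIV_le_mono[OF True gauss_int_deriv])
      show "((\<lambda>b. exp (- z\<^sup>2) * gauss_int (b - z)) has_real_derivative exp (- z\<^sup>2) * exp (- (x - z)\<^sup>2)) (at x)" for x
        using DERIV_cmult[OF DERIV_chain2[OF gauss_int_deriv DERIV_diff[OF DERIV_ident DERIV_const[of z]]], of "exp (- z\<^sup>2)" x]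
        by simp
      fix x assume "z \<le> x"
      then have "z\<^sup>2 + (x - z)\<^sup>2 \<le> x\<^sup>2" using z mult_nonneg_nonneg[of z "x - z"]
        by (simp add: power2_eq_square algebra_simps)
      then show "exp (- x\<^sup>2) \<le> exp (- z\<^sup>2) * exp (- (x - z)\<^sup>2)" by (simp add: exp_add[symmetric])
    qed
    moreover have "exp (- z\<^sup>2) * gauss_int (b - z) \<le> exp (- z\<^sup>2) * gauss_total"
      by (intro mult_left_mono gauss_int_le_total) auto
    ultimately show ?thesis by (simp only: diff_self gauss_int_0 mult_zero_right)
  next
    case False
    then have "gauss_int b \<le> gauss_int z" using gauss_int_mono by simp
    moreover have "exp (- z\<^sup>2) * gauss_total \<ge> 0" using gauss_total_pos by simp
    ultimately show ?thesis by linarith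
  qed
  then have "gauss_total \<le> gauss_int z + exp (- z\<^sup>2) * gauss_total"
    unfolding gauss_total_def by (intro cSUP_least) auto
  then show ?thesis using gauss_total_pos by (simp add: erf0_def field_simps)
qed

text \<open>The integrand decreases on the interval from 0 to \<open>z\<close>. The bound has the
  same shape as the error term that it has to beat in \<open>layer_nonneg\<close>.\<close>

lemma erf0_lower:
  assumes "z \<ge> 0" shows "erf_slope * z * exp (- z\<^sup>2) \<le> erf0 z"
proof -
  have "erf_slope * exp (- z\<^sup>2) * z - erf_slope * exp (- z\<^sup>2) * 0 \<le> erf0 z - erf0 0"
  proof (rule DERIV_le_mono[OF assms _ erf0_deriv])
    show "((\<lambda>x. erf_slope * exp (- z\<^sup>2) * x) has_real_derivative erf_slope * exp (- z\<^sup>2)) (at x)" for x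
      by (auto intro!: derivative_eq_intros)
    fix x :: real assume "0 \<le> x" "x \<le> z"
    then have "x\<^sup>2 \<le> z\<^sup>2" by (intro power_mono) auto
    then show "erf_slope * exp (- z\<^sup>2) \<le> erf_slope * exp (- x\<^sup>2)"
      using erf_slope_pos by (intro mult_left_mono) auto
  qed
  then show ?thesis by (simp add: algebra_simps)
qed

text \<open>An approximate solution of \<open>v\<^sub>t = v\<^sub>s\<^sub>s + \<kappa> v\<^sub>s\<close> on the half line with initial value \<open>1\<close>
  and boundary value \<open>0\<close>: the first two terms of its expansion in powers of \<open>\<kappa>\<close>.\<close>

definition layer :: "real \<Rightarrow> real \<Rightarrow> real \<Rightarrow> real" where
  "layer \<kappa> s t = erf0 (s / (2 * sqrt t)) + \<kappa> / 2 * s * (1 - erf0 (s / (2 * sqrt t)))"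

text \<open>The derivative of \<open>erf0 (s / (2 * sqrt t))\<close> in \<open>s\<close>, a multiple
  of the heat kernel. All errors of the layer are measured relative to it.\<close>

definition layer_kernel :: "real \<Rightarrow> real \<Rightarrow> real" where
  "layer_kernel s t = erf_slope * exp (- (s\<^sup>2 / (4 * t))) / (2 * sqrt t)"

definition layer_s :: "real \<Rightarrow> real \<Rightarrow> real \<Rightarrow> real" where
  "layer_s \<kappa> s t = layer_kernel s t + \<kappa> / 2 * (1 - erf0 (s / (2 * sqrt t)) - s * layer_kernel s t)"

lemma layer_kernel_pos: "t > 0 \<Longrightarrow> layer_kernel s t > 0"
  using erf_slope_pos by (simp add: layer_kernel_def)

lemma scaled_sq: "t > 0 \<Longrightarrow> (s / (2 * sqrt t))\<^sup>2 = s\<^sup>2 / (4 * t)"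
  by (simp add: power_divide power_mult_distrib)

lemma erf0_scaled_deriv:
  assumes t: "t > 0"
  shows "((\<lambda>s. erf0 (s / (2 * sqrt t))) has_real_derivative layer_kernel s t) (at s)"
  using DERIV_chain2[OF erf0_deriv DERIV_cdivide[OF DERIV_ident, of "2 * sqrt t" s UNIV]]
  by (simp add: layer_kernel_def scaled_sq[OF t])

lemma layer_kernel_deriv:
  assumes t: "t > 0"
  shows "((\<lambda>s. layer_kernel s t) has_real_derivative - (s / (2 * t)) * layer_kernel s t) (at s)"
  unfolding layer_kernel_def using t gauss_total_pos
  by (auto intro!: derivative_eq_intros simp: field_simps)

lemma layer_deriv_s:
  assumes t: "t > 0" shows "((\<lambda>s. layer \<kappa> s t) has_real_derivative layer_s \<kappa> s t) (at s)"
  unfolding layer_def layer_s_def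
  by (rule DERIV_cong[OF DERIV_add[OF erf0_scaled_deriv[OF t]
        DERIV_mult[OF DERIV_cmult[OF DERIV_ident] DERIV_diff[OF DERIV_const erf0_scaled_deriv[OF t]]]]])
     (simp add: algebra_simps)

lemma layer_deriv_ss:
  assumes t: "t > 0"
  shows "((\<lambda>s. layer_s \<kappa> s t) has_real_derivative
     layer_kernel s t * (- (s / (2 * t)) - \<kappa> + \<kappa> * s\<^sup>2 / (4 * t))) (at s)"
  unfolding layer_s_def
  by (rule DERIV_cong[OF DERIV_add[OF layer_kernel_deriv[OF t] DERIV_cmult[OF
        DERIV_diff[OF DERIV_diff[OF DERIV_const erf0_scaled_deriv[OF t]]
          DERIV_mult[OF DERIV_ident layer_kernel_deriv[OF t]]]]]])
     (use t gauss_total_pos in \<open>simp add: field_simps power2_eq_square\<close>)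

lemma layer_deriv_t:
  assumes t: "t > 0"
  shows "((\<lambda>t. layer \<kappa> s t) has_real_derivative
     layer_kernel s t * (- (s / (2 * t)) + \<kappa> * s\<^sup>2 / (4 * t))) (at t)"
proof -
  have "((\<lambda>t. s / (2 * sqrt t)) has_real_derivative - (s / (4 * t * sqrt t))) (at t)"
    using t by (auto intro!: derivative_eq_intros simp: field_simps)
  from DERIV_chain2[OF erf0_deriv this]
  have E: "((\<lambda>t. erf0 (s / (2 * sqrt t))) has_real_derivative - (s / (2 * t)) * layer_kernel s t) (at t)"
    by (rule DERIV_cong) (use t gauss_total_pos in \<open>simp add: layer_kernel_def scaled_sq field_simps\<close>)
  show ?thesis unfolding layer_def
    by (rule DERIV_cong[OF DERIV_add[OF E DERIV_cmult[OF DERIV_diff[OF DERIV_const E]]]])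
       (use t in \<open>simp add: field_simps power2_eq_square\<close>)
qed

lemma layer_compose_heat:
  assumes g: "jet2 g x p A" and t: "t > 0"
  shows "has_lap (\<lambda>y. layer \<kappa> (g y) t)
     (layer_kernel (g x) t * (- (g x / (2 * t)) - \<kappa> + \<kappa> * (g x)\<^sup>2 / (4 * t)) * (norm p)\<^sup>2
       + layer_s \<kappa> (g x) t * (\<Sum>i\<in>Basis. A i i)) x"
  by (rule jet2_compose[OF g _ layer_deriv_ss[OF t]]) (simp add: layer_deriv_s[OF t])

text \<open>The tail bound turns 1 - erf0 into 2 sqrt t times a constant times the kernel. So the
  curvature correction of the slope is of relative size sqrt t + s, and the kernel can be factored
  out of the supersolution inequality.\<close>

lemma layer_s_approx:
  assumes t: "t > 0" and s: "s \<ge> 0"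
  shows "\<bar>layer_s \<kappa> s t - layer_kernel s t\<bar> \<le> \<bar>\<kappa>\<bar> / 2 * (2 * sqrt t * gauss_total + s) * layer_kernel s t"
proof -
  have "1 - erf0 (s / (2 * sqrt t)) \<le> exp (- (s\<^sup>2 / (4 * t)))"
    using erf0_tail[of "s / (2 * sqrt t)"] s t by (simp add: scaled_sq)
  also have "\<dots> = 2 * sqrt t * gauss_total * layer_kernel s t"
    using t gauss_total_pos by (simp add: layer_kernel_def field_simps)
  finally have 1: "\<bar>1 - erf0 (s / (2 * sqrt t))\<bar> \<le> 2 * sqrt t * gauss_total * layer_kernel s t"
    using erf0_le_one[of "s / (2 * sqrt t)"] by simp
  have 2: "\<bar>s * layer_kernel s t\<bar> = s * layer_kernel s t" using s layer_kernel_pos[OF t, of s] by simp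
  have "\<bar>layer_s \<kappa> s t - layer_kernel s t\<bar> =
      \<bar>\<kappa>\<bar> / 2 * \<bar>1 - erf0 (s / (2 * sqrt t)) - s * layer_kernel s t\<bar>"
    by (simp add: layer_s_def abs_mult)
  also have "\<dots> \<le> \<bar>\<kappa>\<bar> / 2 * (2 * sqrt t * gauss_total * layer_kernel s t + s * layer_kernel s t)"
    using 1 2 by (intro mult_left_mono) linarith+
  finally show ?thesis by (simp add: algebra_simps)
qed

text \<open>\<open>G\<close> and \<open>L\<close> stand for \<open>|\<nabla>g|\<^sup>2\<close> and \<open>\<Delta>g\<close>.\<close>

lemma layer_super:
  fixes \<kappa> s t G L \<delta> \<eta> \<Lambda> :: real
  assumes t: "t > 0" and s: "s \<ge> 0" "\<bar>\<kappa>\<bar> * s \<le> 2"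
    and G: "0 \<le> \<sigma> * (G - 1)" "\<sigma> * (G - 1) \<le> \<delta>" and \<sigma>: "\<bar>\<sigma>\<bar> = 1"
    and L: "\<sigma> * L \<le> \<sigma> * \<kappa> - \<eta>" "\<bar>L\<bar> \<le> \<Lambda>"
    and small: "\<bar>\<kappa>\<bar> * \<delta> + \<bar>\<kappa>\<bar> / 2 * (2 * sqrt t * gauss_total + s) * \<Lambda> \<le> \<eta>"
  shows "\<sigma> * (layer_kernel s t * (- (s / (2 * t)) - \<kappa> + \<kappa> * s\<^sup>2 / (4 * t)) * G + layer_s \<kappa> s t * L)
      \<le> \<sigma> * (layer_kernel s t * (- (s / (2 * t)) + \<kappa> * s\<^sup>2 / (4 * t)))"
proof -
  define k where "k = layer_kernel s t"
  define \<omega> where "\<omega> = \<bar>\<kappa>\<bar> / 2 * (2 * sqrt t * gauss_total + s)"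
  define a where "a = - (s / (2 * t)) + \<kappa> * s\<^sup>2 / (4 * t)"
  have k: "k > 0" unfolding k_def by (rule layer_kernel_pos[OF t])
  \<comment> \<open>Hence \<open>a \<le> 0\<close>, where \<open>k * a\<close> is the time
    derivative of the layer. A deviation of \<open>G\<close> from 1 with the sign of \<sigma> then
    acts in favour of the inequality.\<close>
  have "\<kappa> * s\<^sup>2 / (4 * t) \<le> s / (2 * t)"
  proof -
    have "\<kappa> * s\<^sup>2 \<le> \<bar>\<kappa>\<bar> * s\<^sup>2" by (rule mult_right_mono) auto
    then have "\<kappa> * s\<^sup>2 \<le> (\<bar>\<kappa>\<bar> * s) * s" by (simp add: power2_eq_square)
    also have "\<dots> \<le> 2 * s" by (rule mult_right_mono[OF s(2) s(1)])
    finally show ?thesis using t by (simp add: field_simps)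
  qed
  then have a: "a \<le> 0" by (simp add: a_def)
  have w: "\<bar>layer_s \<kappa> s t - k\<bar> \<le> \<omega> * k" unfolding \<omega>_def k_def by (rule layer_s_approx[OF t s(1)])
  have \<omega>0: "\<omega> \<ge> 0" unfolding \<omega>_def using s t gauss_total_pos by (intro mult_nonneg_nonneg add_nonneg_nonneg) auto
  have "\<sigma> * (k * (a - \<kappa>) * G + layer_s \<kappa> s t * L) - \<sigma> * (k * a)
      = k * (\<sigma> * (G - 1) * a) - k * \<kappa> * (\<sigma> * (G - 1)) - k * (\<sigma> * \<kappa>) + k * (\<sigma> * L) + \<sigma> * (layer_s \<kappa> s t - k) * L"
    by (simp add: algebra_simps)
  also have "\<dots> \<le> 0 + k * (\<bar>\<kappa>\<bar> * \<delta>) - k * (\<sigma> * \<kappa>) + k * (\<sigma> * \<kappa> - \<eta>) + k * (\<omega> * \<Lambda>)"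
  proof (intro add_mono diff_mono order_refl)
    have "\<sigma> * (G - 1) * a \<le> 0" using mult_nonneg_nonpos[OF G(1) a] .
    moreover have "- \<kappa> * (\<sigma> * (G - 1)) \<le> \<bar>\<kappa>\<bar> * \<delta>"
      by (rule order_trans[OF mult_right_mono[of "- \<kappa>" "\<bar>\<kappa>\<bar>"] mult_left_mono]) (use G in auto)
    ultimately have "k * (\<sigma> * (G - 1) * a + - \<kappa> * (\<sigma> * (G - 1))) \<le> k * (\<bar>\<kappa>\<bar> * \<delta>)"
      using k by (intro mult_left_mono) auto
    then show "k * (\<sigma> * (G - 1) * a) - k * \<kappa> * (\<sigma> * (G - 1)) \<le> 0 + k * (\<bar>\<kappa>\<bar> * \<delta>)"
      by (simp add: algebra_simps)
    show "k * (\<sigma> * L) \<le> k * (\<sigma> * \<kappa> - \<eta>)" using L k by (intro mult_left_mono) auto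
    have "\<sigma> * (layer_s \<kappa> s t - k) * L \<le> \<bar>\<sigma> * (layer_s \<kappa> s t - k) * L\<bar>" by (rule abs_ge_self)
    also have "\<dots> = \<bar>layer_s \<kappa> s t - k\<bar> * \<bar>L\<bar>" by (simp add: abs_mult \<sigma>)
    also have "\<dots> \<le> (\<omega> * k) * \<Lambda>" by (intro mult_mono w L) (use \<omega>0 k in auto)
    finally show "\<sigma> * (layer_s \<kappa> s t - k) * L \<le> k * (\<omega> * \<Lambda>)" by (simp add: algebra_simps)
  qed
  also have "\<dots> = k * (\<bar>\<kappa>\<bar> * \<delta> + \<omega> * \<Lambda> - \<eta>)" by (simp add: algebra_simps)
  also have "\<dots> \<le> 0" using small k by (intro mult_nonneg_nonpos) (auto simp: \<omega>_def)
  finally show ?thesis by (simp add: k_def a_def algebra_simps)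
qed

lemma layer_0 [simp]: "layer \<kappa> 0 t = 0" by (simp add: layer_def)

lemma layer_alt: "layer \<kappa> s t = 1 - (1 - erf0 (s / (2 * sqrt t))) * (1 - \<kappa> * s / 2)"
  by (simp add: layer_def algebra_simps)

lemma layer_le_one: "\<bar>\<kappa>\<bar> * s \<le> 2 \<Longrightarrow> s \<ge> 0 \<Longrightarrow> layer \<kappa> s t \<le> 1"
proof -
  assume s: "\<bar>\<kappa>\<bar> * s \<le> 2" "s \<ge> 0"
  have "\<kappa> * s \<le> \<bar>\<kappa>\<bar> * s" using s by (intro mult_right_mono) auto
  then have "1 - \<kappa> * s / 2 \<ge> 0" using s by linarith
  then show ?thesis unfolding layer_alt using erf0_le_one[of "s / (2 * sqrt t)"] by simp
qed

text \<open>The 8 is a product of 4 and 2: with z = s / (2 sqrt t) the tail is at most exp (-z^2)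
  \<le> 1 / z^2 = 4 t / s^2, and the factor 1 - \<kappa> s / 2 is at most 2.\<close>

lemma layer_lower:
  assumes t: "t > 0" and s: "s > 0" "\<bar>\<kappa>\<bar> * s \<le> 2"
  shows "layer \<kappa> s t \<ge> 1 - 8 * t / s\<^sup>2"
proof -
  define z where "z = s / (2 * sqrt t)"
  have z: "z > 0" "z\<^sup>2 = s\<^sup>2 / (4 * t)" using t s by (auto simp: scaled_sq z_def)
  have "1 - erf0 z \<le> exp (- z\<^sup>2)" using z by (intro erf0_tail) simp
  also have "exp (- z\<^sup>2) \<le> 1 / z\<^sup>2"
  proof -
    have "z\<^sup>2 \<le> exp (z\<^sup>2)" using exp_ge_add_one_self[of "z\<^sup>2"] by linarith
    then have "inverse (exp (z\<^sup>2)) \<le> inverse (z\<^sup>2)" using z(1) by (intro le_imp_inverse_le) auto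
    then show ?thesis by (simp add: exp_minus divide_inverse)
  qed
  also have "1 / z\<^sup>2 = 4 * t / s\<^sup>2" unfolding z(2) by simp
  finally have 1: "1 - erf0 z \<le> 4 * t / s\<^sup>2" .
  have "\<bar>\<kappa> * s\<bar> \<le> 2" using s by (simp add: abs_mult)
  then have 2: "1 - \<kappa> * s / 2 \<le> 2" by linarith
  have "(1 - erf0 z) * (1 - \<kappa> * s / 2) \<le> (1 - erf0 z) * 2"
    using erf0_le_one[of z] by (intro mult_left_mono[OF 2]) linarith
  also have "\<dots> \<le> 4 * t / s\<^sup>2 * 2" by (rule mult_right_mono[OF 1]) simp
  also have "\<dots> = 8 * t / s\<^sup>2" by simp
  finally show ?thesis unfolding layer_alt z_def[symmetric] by linarith
qed

text \<open>By \<open>erf0_tail\<close> the correction is at most |\<kappa>| sqrt t times z exp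
  (-z^2), and \<open>erf0_lower\<close> offers \<open>erf_slope\<close> times the same
  function.\<close>

lemma layer_nonneg:
  assumes t: "t > 0" and s: "s \<ge> 0" and k: "\<bar>\<kappa>\<bar> * sqrt t \<le> erf_slope"
  shows "layer \<kappa> s t \<ge> 0"
proof -
  define z where "z = s / (2 * sqrt t)"
  have z: "z \<ge> 0" "s = 2 * sqrt t * z" using t s by (auto simp: z_def)
  have e: "1 - erf0 z \<ge> 0" using erf0_le_one[of z] by linarith
  have "\<bar>\<kappa> / 2 * s * (1 - erf0 z)\<bar> = \<bar>\<kappa>\<bar> / 2 * s * (1 - erf0 z)" using s e by (simp add: abs_mult)
  also have "\<dots> \<le> \<bar>\<kappa>\<bar> / 2 * s * exp (- z\<^sup>2)"
    using s by (intro mult_left_mono erf0_tail z) auto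
  also have "\<dots> = (\<bar>\<kappa>\<bar> * sqrt t) * (z * exp (- z\<^sup>2))" unfolding z(2) by simp
  also have "\<dots> \<le> erf_slope * (z * exp (- z\<^sup>2))" using z by (intro mult_right_mono[OF k]) auto
  also have "\<dots> \<le> erf0 z" using erf0_lower[OF z(1)] by (simp only: mult.assoc)
  finally show ?thesis unfolding layer_def z_def[symmetric] by linarith
qed

lemma layer_s_0: "layer_s \<kappa> 0 t = erf_slope / (2 * sqrt t) + \<kappa> / 2"
  by (simp add: layer_s_def layer_kernel_def)

lemma continuous_on_erf0: "continuous_on S erf0"
  using erf0_deriv by (meson DERIV_isCont continuous_at_imp_continuous_on)

lemma layer_continuous:
  fixes g :: "'a::euclidean_space \<Rightarrow> real"
  assumes "continuous_on S g"
  shows "continuous_on (S \<times> {0<..T}) (\<lambda>(x, t). layer \<kappa> (g x) t)"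
proof -
  have g: "continuous_on (S \<times> {0<..T}) (\<lambda>p. g (fst p))"
    by (rule continuous_on_compose2[OF assms continuous_on_fst[OF continuous_on_id]]) auto
  have z: "continuous_on (S \<times> {0<..T}) (\<lambda>p. g (fst p) / (2 * sqrt (snd p)))"
    by (intro continuous_intros g) auto
  have e: "continuous_on (S \<times> {0<..T}) (\<lambda>p. erf0 (g (fst p) / (2 * sqrt (snd p))))"
    by (rule continuous_on_compose2[OF continuous_on_erf0 z]) auto
  show ?thesis unfolding layer_def split_beta by (intro continuous_intros g e)
qed

section \<open>Jets of polynomials and products, and the second-order Taylor formula\<close>

lemma jet2_linear: "jet2 (\<lambda>x. a \<bullet> (x - c)) x a (\<lambda>v w. 0)"
  unfolding jet2_def
proof (intro allI)
  fix v m
  show "has_d2 (\<lambda>s. a \<bullet> (x + s *\<^sub>R v + s\<^sup>2 *\<^sub>R m - c)) (a \<bullet> v) (0 + 2 * (a \<bullet> m))"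
  proof (rule has_d2I[where g = "\<lambda>s. a \<bullet> v + 2 * s * (a \<bullet> m)"])
    have "(\<lambda>s. a \<bullet> (x + s *\<^sub>R v + s\<^sup>2 *\<^sub>R m - c)) = (\<lambda>s. a \<bullet> (x - c) + s * (a \<bullet> v) + s\<^sup>2 * (a \<bullet> m))"
      by (simp add: inner_add_right inner_diff_right algebra_simps)
    then show "((\<lambda>s. a \<bullet> (x + s *\<^sub>R v + s\<^sup>2 *\<^sub>R m - c)) has_real_derivative a \<bullet> v + 2 * s * (a \<bullet> m)) (at s)" for s
      by (auto intro!: derivative_eq_intros)
  qed (auto intro!: derivative_eq_intros)
qed

lemma jet2_quadratic:
  fixes B :: "'a::euclidean_space \<Rightarrow> 'a \<Rightarrow> real"
  assumes B: "bilinear B"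
  shows "jet2 (\<lambda>x. B (x - c) (x - c)) x (\<Sum>i\<in>Basis. (B (x - c) i + B i (x - c)) *\<^sub>R i) (\<lambda>v w. B v w + B w v)"
  unfolding jet2_def
proof (intro allI)
  fix v m
  let ?y = "x - c"
  have l: "linear (B x)" "linear (\<lambda>x. B x y)" for x y using B by (auto simp: bilinear_def)
  have inner: "(\<Sum>i\<in>Basis. (B ?y i + B i ?y) *\<^sub>R i) \<bullet> v = B ?y v + B v ?y" for v
  proof -
    have "B ?y v + B v ?y = B ?y (\<Sum>i\<in>Basis. (v \<bullet> i) *\<^sub>R i) + B (\<Sum>i\<in>Basis. (v \<bullet> i) *\<^sub>R i) ?y"
      by (simp add: euclidean_representation)
    also have "\<dots> = (\<Sum>i\<in>Basis. (v \<bullet> i) * (B ?y i + B i ?y))"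
      by (simp add: linear_sum[OF l(1)] linear_sum[OF l(2)] bilinear_lmul[OF B] bilinear_rmul[OF B]
          sum.distrib algebra_simps)
    finally show ?thesis by (simp add: inner_sum_left inner_commute[of v] mult.commute)
  qed
  let ?g = "\<lambda>s. (B ?y v + B v ?y) + 2 * s * (B v v + B ?y m + B m ?y) + 3 * s\<^sup>2 * (B v m + B m v) + 4 * s^3 * B m m"
  have "(\<lambda>s. B (x + s *\<^sub>R v + s\<^sup>2 *\<^sub>R m - c) (x + s *\<^sub>R v + s\<^sup>2 *\<^sub>R m - c)) =
     (\<lambda>s. B ?y ?y + s * (B ?y v + B v ?y) + s\<^sup>2 * (B v v + B ?y m + B m ?y) + s^3 * (B v m + B m v) + s^4 * B m m)"
  proof
    fix s
    have "x + s *\<^sub>R v + s\<^sup>2 *\<^sub>R m - c = ?y + s *\<^sub>R v + s\<^sup>2 *\<^sub>R m" by simp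
    then show "B (x + s *\<^sub>R v + s\<^sup>2 *\<^sub>R m - c) (x + s *\<^sub>R v + s\<^sup>2 *\<^sub>R m - c) =
       B ?y ?y + s * (B ?y v + B v ?y) + s\<^sup>2 * (B v v + B ?y m + B m ?y) + s^3 * (B v m + B m v) + s^4 * B m m"
      by (simp only: bilinear_ladd[OF B] bilinear_radd[OF B] bilinear_lmul[OF B] bilinear_rmul[OF B])
         (simp add: algebra_simps power2_eq_square power3_eq_cube power4_eq_xxxx)
  qed
  note eq = this
  show "has_d2 (\<lambda>s. B (x + s *\<^sub>R v + s\<^sup>2 *\<^sub>R m - c) (x + s *\<^sub>R v + s\<^sup>2 *\<^sub>R m - c))
     ((\<Sum>i\<in>Basis. (B ?y i + B i ?y) *\<^sub>R i) \<bullet> v)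
     (B v v + B v v + 2 * ((\<Sum>i\<in>Basis. (B ?y i + B i ?y) *\<^sub>R i) \<bullet> m))"
    unfolding eq inner
  proof (rule has_d2I[where g = ?g])
    show "((\<lambda>s. B ?y ?y + s * (B ?y v + B v ?y) + s\<^sup>2 * (B v v + B ?y m + B m ?y) + s^3 * (B v m + B m v) + s^4 * B m m)
      has_real_derivative ?g s) (at s)" for s
      by (auto intro!: derivative_eq_intros simp: algebra_simps)
    show "(?g has_real_derivative B v v + B v v + 2 * (B ?y m + B m ?y)) (at 0)"
      by (auto intro!: derivative_eq_intros simp: algebra_simps)
  qed simp
qed

lemma jet2_mult:
  assumes "jet2 f x p A" "jet2 g x q B"
  shows "jet2 (\<lambda>x. f x * g x) x (g x *\<^sub>R p + f x *\<^sub>R q)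
    (\<lambda>v w. g x * A v w + 2 * (p \<bullet> v) * (q \<bullet> w) + f x * B v w)"
  unfolding jet2_def
proof (intro allI)
  fix v m
  show "has_d2 (\<lambda>s. f (x + s *\<^sub>R v + s\<^sup>2 *\<^sub>R m) * g (x + s *\<^sub>R v + s\<^sup>2 *\<^sub>R m)) ((g x *\<^sub>R p + f x *\<^sub>R q) \<bullet> v)
      (g x * A v v + 2 * (p \<bullet> v) * (q \<bullet> v) + f x * B v v + 2 * ((g x *\<^sub>R p + f x *\<^sub>R q) \<bullet> m))"
    using has_d2_mult[OF assms(1)[unfolded jet2_def, rule_format, of v m]
        assms(2)[unfolded jet2_def, rule_format, of v m]]
    by (simp add: inner_add_left algebra_simps)
qed

lemma bilinear_bounded:
  fixes B :: "'a::euclidean_space \<Rightarrow> 'a \<Rightarrow> real"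
  assumes "bilinear B" obtains K where "K > 0" "\<And>v w. \<bar>B v w\<bar> \<le> K * norm v * norm w"
proof -
  have "bounded_bilinear B" using assms by (simp add: bilinear_conv_bounded_bilinear)
  from bounded_bilinear.pos_bounded[OF this] obtain K where "K > 0" "\<And>a b. norm (B a b) \<le> norm a * norm b * K" by blast
  then show ?thesis using that[of K] by (simp add: algebra_simps)
qed

text \<open>On the segment the mean value theorem reduces the remainder to the error of the
  differential of \<open>grad f\<close> at \<open>x\<close>. This is why the remainder is
  o(|\<xi>|^2), with a radius depending on \<epsilon>.\<close>

lemma C2_taylor:
  fixes f :: "'a::euclidean_space \<Rightarrow> real"
  assumes U: "open U" "Ck_on 2 U f" "x \<in> U" and \<epsilon>: "\<epsilon> > 0"
  obtains r where "r > 0" "cball x r \<subseteq> U"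
    "\<And>\<xi>. norm \<xi> \<le> r \<Longrightarrow> \<bar>f (x + \<xi>) - f x - grad f x \<bullet> \<xi> - hess f x \<xi> \<xi> / 2\<bar> \<le> \<epsilon> * (norm \<xi>)\<^sup>2"
proof -
  define H where "H = (\<lambda>h. \<Sum>i\<in>Basis. hess f x i h *\<^sub>R i)"
  have bl: "bilinear (hess f x)" by (rule hess_bilinear[OF U])
  have H: "H h \<bullet> \<xi> = hess f x \<xi> h" for h \<xi>
  proof -
    have l: "linear (\<lambda>v. hess f x v h)" using bl by (simp add: bilinear_def)
    have "hess f x \<xi> h = hess f x (\<Sum>i\<in>Basis. (\<xi> \<bullet> i) *\<^sub>R i) h" by (simp add: euclidean_representation)
    also have "\<dots> = (\<Sum>i\<in>Basis. (\<xi> \<bullet> i) * hess f x i h)"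
      by (simp add: linear_sum[OF l] bilinear_lmul[OF bl])
    finally show ?thesis by (simp add: H_def inner_sum_left inner_commute[of \<xi>] mult.commute)
  qed
  have "((\<lambda>y. \<Sum>i\<in>Basis. (grad f y \<bullet> i) *\<^sub>R i) has_derivative H) (at x)"
    unfolding H_def by (intro has_derivative_sum has_derivative_scaleR_left C2_hess[OF U])
  then have dg: "(grad f has_derivative H) (at x)" by (simp add: euclidean_representation)
  obtain d where d: "d > 0" "\<And>y. norm (y - x) < d \<Longrightarrow> norm (grad f y - grad f x - H (y - x)) \<le> \<epsilon> * norm (y - x)"
    using dg \<epsilon> unfolding has_derivative_at_alt by blast
  obtain r1 where r1: "r1 > 0" "cball x r1 \<subseteq> U" using U(1,3) open_contains_cball by blast
  define r where "r = min r1 (d / 2)"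
  have r: "r > 0" "r < d" "cball x r \<subseteq> U" using r1 d by (auto simp: r_def)
  have "\<bar>f (x + \<xi>) - f x - grad f x \<bullet> \<xi> - hess f x \<xi> \<xi> / 2\<bar> \<le> \<epsilon> * (norm \<xi>)\<^sup>2" if \<xi>: "norm \<xi> \<le> r" for \<xi>
  proof -
    define \<phi> where "\<phi> = (\<lambda>s. f (x + s *\<^sub>R \<xi>) - s * (grad f x \<bullet> \<xi>) - s\<^sup>2 * (hess f x \<xi> \<xi> / 2))"
    define \<phi>' where "\<phi>' = (\<lambda>s. (grad f (x + s *\<^sub>R \<xi>) - grad f x - H (s *\<^sub>R \<xi>)) \<bullet> \<xi>)"
    have le: "norm (s *\<^sub>R \<xi>) \<le> r" "norm (s *\<^sub>R \<xi>) \<le> norm \<xi>" if "0 \<le> s" "s \<le> 1" for s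
    proof -
      show "norm (s *\<^sub>R \<xi>) \<le> norm \<xi>" using that mult_right_mono[of s 1 "norm \<xi>"] by simp
      then show "norm (s *\<^sub>R \<xi>) \<le> r" using \<xi> by simp
    qed
    have der: "(\<phi> has_real_derivative \<phi>' s) (at s)" if "0 \<le> s" "s \<le> 1" for s
    proof -
      have inU: "x + s *\<^sub>R \<xi> \<in> U" using le[OF that] r(3) by (auto simp: dist_norm)
      have "((\<lambda>s. x + s *\<^sub>R \<xi>) has_derivative (\<lambda>h. h *\<^sub>R \<xi>)) (at s)" by (auto intro!: derivative_eq_intros)
      from has_derivative_compose[OF this C2_grad[OF U(1,2) inU]]
      have "((\<lambda>s. f (x + s *\<^sub>R \<xi>)) has_real_derivative grad f (x + s *\<^sub>R \<xi>) \<bullet> \<xi>) (at s)"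
        by (simp add: has_field_derivative_def mult_commute_abs)
      then have "(\<phi> has_real_derivative grad f (x + s *\<^sub>R \<xi>) \<bullet> \<xi> - grad f x \<bullet> \<xi> - s * hess f x \<xi> \<xi>) (at s)"
        unfolding \<phi>_def by (auto intro!: derivative_eq_intros)
      then show ?thesis by (simp add: \<phi>'_def inner_diff_left H bilinear_rmul[OF bl])
    qed
    have "\<exists>z. 0 < z \<and> z < 1 \<and> \<phi> 1 - \<phi> 0 = (1 - 0) * \<phi>' z"
      by (rule MVT2) (use der in auto)
    then obtain z where z: "0 < z" "z < 1" "\<phi> 1 - \<phi> 0 = \<phi>' z" by auto
    have "\<bar>\<phi>' z\<bar> \<le> norm (grad f (x + z *\<^sub>R \<xi>) - grad f x - H (z *\<^sub>R \<xi>)) * norm \<xi>"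
      unfolding \<phi>'_def by (rule Cauchy_Schwarz_ineq2)
    also have "\<dots> \<le> (\<epsilon> * norm (z *\<^sub>R \<xi>)) * norm \<xi>"
      using d(2)[of "x + z *\<^sub>R \<xi>"] le[of z] z r(2) by (intro mult_right_mono) auto
    also have "\<dots> \<le> (\<epsilon> * norm \<xi>) * norm \<xi>"
      using le(2)[of z] z \<epsilon> by (intro mult_right_mono mult_left_mono) auto
    finally show ?thesis using z(3) by (simp add: \<phi>_def power2_eq_square mult.assoc)
  qed
  then show ?thesis using that[of r] r by blast
qed

section \<open>Local defining functions of a smooth boundary\<close>

definition local_defining :: "'a::euclidean_space set \<Rightarrow> 'a set \<Rightarrow> ('a \<Rightarrow> real) \<Rightarrow> bool" where
  "local_defining \<Omega> U \<rho> \<longleftrightarrow> open U \<and> smooth_on U \<rho> \<and> \<Omega> \<inter> U = {y\<in>U. \<rho> y < 0} \<and> (\<forall>y\<in>U. grad \<rho> y \<noteq> 0)"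

lemma local_definingD:
  assumes "local_defining \<Omega> U \<rho>"
  shows "open U" "Ck_on k U \<rho>" "y \<in> U \<Longrightarrow> y \<in> \<Omega> \<longleftrightarrow> \<rho> y < 0" "y \<in> U \<Longrightarrow> grad \<rho> y \<noteq> 0"
  using assms unfolding local_defining_def smooth_on_def by auto

lemma C2_line_deriv:
  assumes "open U" "Ck_on 2 U f" "x \<in> U"
  shows "((\<lambda>s. f (x + s *\<^sub>R v)) has_real_derivative grad f x \<bullet> v) (at 0)"
  using has_d2_deriv[OF jet2_line[OF C2_jet2[OF assms]]] .

text \<open>A zero of \<rho> is a limit of points of \<Omega> because \<rho> strictly decreases
  along its negative gradient; a positive value persists nearby and keeps \<Omega> away.\<close>

lemma local_defining_closure:
  assumes ld: "local_defining \<Omega> U \<rho>" and y: "y \<in> U"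
  shows "y \<in> closure \<Omega> \<longleftrightarrow> \<rho> y \<le> 0"
proof
  note D = local_definingD[OF ld]
  have c: "continuous_on U \<rho>" using Ck_on_cont[OF D(2)[of 0]] .
  {
    assume "y \<in> closure \<Omega>"
    show "\<rho> y \<le> 0"
    proof (rule ccontr)
      assume "\<not> \<rho> y \<le> 0"
      have "open (U \<inter> \<rho> -` {0<..})" using c D(1) by (simp add: continuous_on_open_vimage Int_commute)
      moreover have "y \<in> U \<inter> \<rho> -` {0<..}" using y \<open>\<not> \<rho> y \<le> 0\<close> by auto
      ultimately obtain z where "z \<in> \<Omega>" "z \<in> U \<inter> \<rho> -` {0<..}"
        using \<open>y \<in> closure \<Omega>\<close> by (meson closure_iff_nhds_not_empty disjoint_iff order_refl)
      then show False using D(3)[of z] by auto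
    qed
  next
    assume le: "\<rho> y \<le> 0"
    show "y \<in> closure \<Omega>"
    proof (cases "\<rho> y < 0")
      case True then show ?thesis using D(3)[OF y] closure_subset by blast
    next
      case False
      then have 0: "\<rho> y = 0" using le by simp
      define \<gamma> where "\<gamma> = (\<lambda>s::real. y + s *\<^sub>R (- grad \<rho> y))"
      have "((\<lambda>s. \<rho> (\<gamma> s)) has_real_derivative grad \<rho> y \<bullet> (- grad \<rho> y)) (at 0)"
        unfolding \<gamma>_def by (rule C2_line_deriv[OF D(1,2) y])
      moreover have "grad \<rho> y \<bullet> (- grad \<rho> y) < 0" using D(4)[OF y] by simp
      ultimately obtain d where d: "d > 0" "\<And>h. 0 < h \<Longrightarrow> h < d \<Longrightarrow> \<rho> (\<gamma> (0 + h)) < \<rho> (\<gamma> 0)"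
        using DERIV_neg_dec_right by blast
      have "(\<gamma> \<longlongrightarrow> y + 0 *\<^sub>R (- grad \<rho> y)) (at_right 0)" unfolding \<gamma>_def by (intro tendsto_intros)
      then have lim: "(\<gamma> \<longlongrightarrow> y) (at_right 0)" by simp
      have "\<forall>\<^sub>F h in at_right 0. \<gamma> h \<in> U" using topological_tendstoD[OF lim D(1) y] .
      moreover have "\<forall>\<^sub>F h in at_right 0. 0 < h \<and> h < d"
        using d(1) eventually_at_right_real by (auto elim: eventually_mono)
      ultimately have "\<forall>\<^sub>F h in at_right 0. \<gamma> h \<in> closure \<Omega>"
      proof eventually_elim
        case (elim h)
        then have "\<rho> (\<gamma> h) < 0" using d(2)[of h] 0 by (simp add: \<gamma>_def)
        then have "\<gamma> h \<in> \<Omega>" using D(3) elim by blast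
        then show ?case using closure_subset by blast
      qed
      then show ?thesis by (rule Lim_in_closed_set[OF closed_closure _ _ lim]) simp
    qed
  }
qed

lemma local_defining_frontier:
  assumes "open \<Omega>" "local_defining \<Omega> U \<rho>" "y \<in> U"
  shows "y \<in> frontier \<Omega> \<longleftrightarrow> \<rho> y = 0"
  using local_defining_closure[OF assms(2,3)] local_definingD(3)[OF assms(2,3)]
  by (auto simp: frontier_def interior_open[OF assms(1)])

lemma smooth_bounded_domain_local:
  assumes "smooth_bounded_domain \<Omega>" "x \<in> frontier \<Omega>"
  obtains U \<rho> where "local_defining \<Omega> U \<rho>" "x \<in> U"
proof -
  obtain U \<rho> where U: "open U" "x \<in> U" "smooth_on U \<rho>" "\<Omega> \<inter> U = {y\<in>U. \<rho> y < 0}"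
      "\<And>y. y\<in>U \<Longrightarrow> frechet_derivative \<rho> (at y) \<noteq> (\<lambda>h. 0)"
    using assms unfolding smooth_bounded_domain_def by blast
  have "grad \<rho> y \<noteq> 0" if "y \<in> U" for y
  proof
    assume "grad \<rho> y = 0"
    moreover have "\<rho> differentiable (at y)" using C2_differentiable[OF U(1) smooth_on_Ck[OF U(3)] that] .
    ultimately have "frechet_derivative \<rho> (at y) = (\<lambda>h. 0)" by (intro ext) (simp add: frechet_derivative_grad)
    with U(5)[OF that] show False by simp
  qed
  then show ?thesis using that U unfolding local_defining_def by blast
qed

lemma smooth_bounded_domainD:
  assumes "smooth_bounded_domain \<Omega>" shows "open \<Omega>" "connected \<Omega>" "bounded \<Omega>" "\<Omega> \<noteq> {}"
  using assms unfolding smooth_bounded_domain_def by auto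

text \<open>At a frontier point the gradient of \<rho> leads out of the closure, so no frontier
  point is interior to it. Later this upgrades an open reflected cap known to lie in the closure to
  a subset of \<Omega>.\<close>

lemma interior_closure_smooth_domain:
  assumes sm: "smooth_bounded_domain \<Omega>" shows "interior (closure \<Omega>) = \<Omega>"
proof
  note S = smooth_bounded_domainD[OF sm]
  show "\<Omega> \<subseteq> interior (closure \<Omega>)" using S(1) closure_subset by (rule interior_maximal[rotated])
  show "interior (closure \<Omega>) \<subseteq> \<Omega>"
  proof (rule subsetI, rule ccontr)
    fix x assume x: "x \<in> interior (closure \<Omega>)" "x \<notin> \<Omega>"
    then have fr: "x \<in> frontier \<Omega>" using interior_subset by (auto simp: frontier_def interior_open[OF S(1)])
    then obtain U \<rho> where U: "local_defining \<Omega> U \<rho>" "x \<in> U" using smooth_bounded_domain_local[OF sm] by blast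
    note D = local_definingD[OF U(1)]
    have 0: "\<rho> x = 0" using local_defining_frontier[OF S(1) U] fr by simp
    define \<gamma> where "\<gamma> = (\<lambda>s::real. x + s *\<^sub>R grad \<rho> x)"
    have "((\<lambda>s. \<rho> (\<gamma> s)) has_real_derivative grad \<rho> x \<bullet> grad \<rho> x) (at 0)"
      unfolding \<gamma>_def by (rule C2_line_deriv[OF D(1,2) U(2)])
    moreover have "grad \<rho> x \<bullet> grad \<rho> x > 0" using D(4)[OF U(2)] by simp
    ultimately obtain d where d: "d > 0" "\<And>h. 0 < h \<Longrightarrow> h < d \<Longrightarrow> \<rho> (\<gamma> 0) < \<rho> (\<gamma> (0 + h))"
      using DERIV_pos_inc_right by blast
    have "(\<gamma> \<longlongrightarrow> x + 0 *\<^sub>R grad \<rho> x) (at_right 0)" unfolding \<gamma>_def by (intro tendsto_intros)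
    then have lim: "(\<gamma> \<longlongrightarrow> x) (at_right 0)" by simp
    have "\<forall>\<^sub>F h in at_right 0. \<gamma> h \<in> U" using topological_tendstoD[OF lim D(1) U(2)] .
    moreover have "\<forall>\<^sub>F h in at_right 0. \<gamma> h \<in> interior (closure \<Omega>)"
      using topological_tendstoD[OF lim open_interior x(1)] .
    moreover have "\<forall>\<^sub>F h in at_right 0. 0 < h \<and> h < d"
      using d(1) eventually_at_right_real by (auto elim: eventually_mono)
    ultimately have "\<forall>\<^sub>F h in at_right (0::real). False"
    proof eventually_elim
      case (elim h)
      then have "\<rho> (\<gamma> h) > 0" using d(2)[of h] 0 by (simp add: \<gamma>_def)
      moreover have "\<gamma> h \<in> closure \<Omega>" using elim interior_subset by blast
      ultimately show ?case using local_defining_closure[OF U(1), of "\<gamma> h"] elim by simp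
    qed
    then show False by simp
  qed
qed

section \<open>Short-time asymptotics of the normal derivative\<close>

text \<open>\<open>\<nu>\<close> will be the outer normal at the boundary point \<open>P\<close>,
  and \<open>B\<close> the normalised Hessian of a defining function, shifted by a multiple of the
  inner product so that the paraboloid built from it lies on one side of the boundary.\<close>

locale boundary_frame =
  fixes P \<nu> :: "'a::euclidean_space" and B :: "'a \<Rightarrow> 'a \<Rightarrow> real" and c \<beta> :: real
  assumes \<nu>: "norm \<nu> = 1" and B: "bilinear B" and c: "c \<ge> 0"
    and \<beta>: "\<beta> > 0" "\<And>v w. \<bar>B v w\<bar> \<le> \<beta> * norm v * norm w"
begin

text \<open>The factor \<open>1 *\<close> gives the projection the shape of
  \<open>bilinear_trace_reflect\<close> with k = 1.\<close>

definition tang :: "'a \<Rightarrow> 'a" where "tang \<xi> = \<xi> - (1 * (\<xi> \<bullet> \<nu>)) *\<^sub>R \<nu>"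

definition height :: "'a \<Rightarrow> real" where "height x = (- \<nu>) \<bullet> (x - P)"

definition tang_sq :: "'a \<Rightarrow> real" where "tang_sq x = tang (x - P) \<bullet> tang (x - P)"

text \<open>Without the cubic term the gradient of the barrier has norm at least \<open>1\<close>; with large
  \<open>c\<close> it has norm at most \<open>1\<close> near \<open>P\<close>.\<close>

definition barrier :: "'a \<Rightarrow> real" where
  "barrier x = (height x - 1 / 2 * B (tang (x - P)) (tang (x - P))) - c * (height x * tang_sq x)"

lemma nn: "\<nu> \<bullet> \<nu> = 1" using \<nu> by (simp add: norm_eq_1)

lemma tang_linear: "linear tang"
  by (rule linearI) (simp_all add: tang_def inner_add_left algebra_simps)

lemma tang_nu [simp]: "tang \<nu> = 0" by (simp add: tang_def nn)

lemma norm_split: "(norm \<xi>)\<^sup>2 = tang \<xi> \<bullet> tang \<xi> + (\<xi> \<bullet> \<nu>)\<^sup>2"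
proof -
  have "tang \<xi> \<bullet> tang \<xi> = \<xi> \<bullet> \<xi> - (\<xi> \<bullet> \<nu>) * (\<xi> \<bullet> \<nu>)"
    by (simp add: tang_def inner_diff_left inner_diff_right nn inner_commute[of \<nu> \<xi>])
  then show ?thesis unfolding power2_norm_eq_inner power2_eq_square[of "\<xi> \<bullet> \<nu>"] by linarith
qed

lemma norm_tang_le: "norm (tang \<xi>) \<le> norm \<xi>"
proof -
  have "(norm (tang \<xi>))\<^sup>2 \<le> (norm \<xi>)\<^sup>2"
    unfolding norm_split[of \<xi>] power2_norm_eq_inner[of "tang \<xi>"] by simp
  then show ?thesis by (rule power2_le_imp_le) simp
qed

lemma tang_sq_nonneg: "tang_sq x \<ge> 0" by (simp add: tang_sq_def)

lemma height_sq: "(norm (x - P))\<^sup>2 = tang_sq x + (height x)\<^sup>2"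
  using norm_split[of "x - P"] by (simp add: tang_sq_def height_def inner_commute)

lemma abs_height_le: "\<bar>height x\<bar> \<le> norm (x - P)"
  using Cauchy_Schwarz_ineq2[of "- \<nu>" "x - P"] \<nu> by (simp add: height_def)

lemma bilinear_tang: assumes "bilinear C" shows "bilinear (\<lambda>v w. C (tang v) (tang w))"
proof -
  have C: "linear (C x)" "linear (\<lambda>x. C x y)" for x y using assms by (auto simp: bilinear_def)
  show ?thesis unfolding bilinear_def
    using linear_compose[OF tang_linear C(1)] linear_compose[OF tang_linear C(2)] by (simp add: o_def)
qed

lemma bilinear_inner: "bilinear ((\<bullet>) :: 'a \<Rightarrow> 'a \<Rightarrow> real)"
  by (simp add: bilinear_conv_bounded_bilinear bounded_bilinear_inner)

text \<open>\<open>g \<xi>\<close> is the gradient of the quadratic form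
  \<open>C (tang \<xi>) (tang \<xi>)\<close>. Its inner product with itself gives the norm bound,
  and it is tangential because the form does not see \<nu>.\<close>

lemma quadratic_gradient_bound:
  assumes C: "bilinear C" and K: "\<And>v w. \<bar>C v w\<bar> \<le> K * norm v * norm w" "K \<ge> 0"
  defines "g \<equiv> \<lambda>\<xi>. (\<Sum>i\<in>Basis. (C (tang \<xi>) (tang i) + C (tang i) (tang \<xi>)) *\<^sub>R i)"
  shows "norm (g \<xi>) \<le> 2 * K * norm (tang \<xi>)" "g \<xi> \<bullet> \<nu> = 0"
proof -
  have bt: "bilinear (\<lambda>v w. C (tang v) (tang w))" by (rule bilinear_tang[OF C])
  have l: "linear (\<lambda>v. C (tang \<xi>) (tang v) + C (tang v) (tang \<xi>))"
    using bt by (intro linear_compose_add) (auto simp: bilinear_def)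
  have inner: "g \<xi> \<bullet> v = C (tang \<xi>) (tang v) + C (tang v) (tang \<xi>)" for v
  proof -
    have "C (tang \<xi>) (tang v) + C (tang v) (tang \<xi>) =
      (\<lambda>v. C (tang \<xi>) (tang v) + C (tang v) (tang \<xi>)) (\<Sum>i\<in>Basis. (v \<bullet> i) *\<^sub>R i)"
      by (simp add: euclidean_representation)
    also have "\<dots> = (\<Sum>i\<in>Basis. (v \<bullet> i) * (C (tang \<xi>) (tang i) + C (tang i) (tang \<xi>)))"
      by (subst linear_sum[OF l]) (simp add: linear_cmul[OF l])
    finally show ?thesis by (simp add: g_def inner_sum_left inner_commute[of v] mult.commute)
  qed
  show "g \<xi> \<bullet> \<nu> = 0" using bilinear_lzero[OF C] bilinear_rzero[OF C] by (simp add: inner)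
  have "norm (g \<xi>) * norm (g \<xi>) = g \<xi> \<bullet> g \<xi>" by (simp add: power2_norm_eq_inner[symmetric] power2_eq_square)
  also have "\<dots> \<le> \<bar>C (tang \<xi>) (tang (g \<xi>))\<bar> + \<bar>C (tang (g \<xi>)) (tang \<xi>)\<bar>" unfolding inner by linarith
  also have "\<dots> \<le> K * norm (tang \<xi>) * norm (tang (g \<xi>)) + K * norm (tang (g \<xi>)) * norm (tang \<xi>)"
    by (intro add_mono K)
  also have "\<dots> = (2 * K * norm (tang \<xi>)) * norm (tang (g \<xi>))" by simp
  also have "\<dots> \<le> (2 * K * norm (tang \<xi>)) * norm (g \<xi>)"
    by (intro mult_left_mono norm_tang_le) (use K in auto)
  finally have *: "norm (g \<xi>) * norm (g \<xi>) \<le> (2 * K * norm (tang \<xi>)) * norm (g \<xi>)" .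
  show "norm (g \<xi>) \<le> 2 * K * norm (tang \<xi>)"
  proof (cases "norm (g \<xi>) = 0")
    case True then show ?thesis using K(2) by simp
  next
    case False then show ?thesis using mult_right_le_imp_le[OF *] by simp
  qed
qed

text \<open>The gradient is minus (1 - c X) \<nu> + e with X = \<open>tang_sq x\<close> and a
  tangential vector e of norm \<open>E\<close>, so its squared norm splits. In the trace, the
  product of the gradients of \<open>height\<close> and \<open>tang_sq\<close> vanishes for the same
  orthogonality.\<close>

lemma barrier_jet:
  obtains p A E where "jet2 barrier x p A" "(norm p)\<^sup>2 = (1 - c * tang_sq x)\<^sup>2 + E\<^sup>2"
    "0 \<le> E" "E \<le> (\<beta> + 2 * c * \<bar>height x\<bar>) * sqrt (tang_sq x)"
    "(\<Sum>i\<in>Basis. A i i) = - ((\<Sum>i\<in>Basis. B i i) - B \<nu> \<nu>) - 2 * c * height x * (\<Sum>i\<in>Basis. tang i \<bullet> tang i)"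
proof -
  let ?\<xi> = "x - P"
  define b where "b = (\<Sum>i\<in>Basis. (B (tang ?\<xi>) (tang i) + B (tang i) (tang ?\<xi>)) *\<^sub>R i)"
  define \<tau> where "\<tau> = (\<Sum>i\<in>Basis. (tang ?\<xi> \<bullet> tang i + tang i \<bullet> tang ?\<xi>) *\<^sub>R i)"
  have jh: "jet2 height x (- \<nu>) (\<lambda>v w. 0)" unfolding height_def[abs_def] by (rule jet2_linear)
  have jB: "jet2 (\<lambda>x. B (tang (x - P)) (tang (x - P))) x b (\<lambda>v w. B (tang v) (tang w) + B (tang w) (tang v))"
    unfolding b_def by (rule jet2_quadratic[OF bilinear_tang[OF B]])
  have jT: "jet2 tang_sq x \<tau> (\<lambda>v w. tang v \<bullet> tang w + tang w \<bullet> tang v)"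
    unfolding \<tau>_def tang_sq_def[abs_def] by (rule jet2_quadratic[OF bilinear_tang[OF bilinear_inner]])
  define p where "p = (- \<nu> - (1 / 2) *\<^sub>R b) - c *\<^sub>R (tang_sq x *\<^sub>R (- \<nu>) + height x *\<^sub>R \<tau>)"
  define A where "A = (\<lambda>v w. (0 - 1 / 2 * (B (tang v) (tang w) + B (tang w) (tang v)))
     - c * (tang_sq x * 0 + 2 * ((- \<nu>) \<bullet> v) * (\<tau> \<bullet> w) + height x * (tang v \<bullet> tang w + tang w \<bullet> tang v)))"
  have j: "jet2 barrier x p A" unfolding barrier_def[abs_def] p_def A_def
    by (intro jet2_diff jet2_cmult jet2_mult jh jB jT)
  define e where "e = (1 / 2) *\<^sub>R b + (c * height x) *\<^sub>R \<tau>"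
  have p: "p = - ((1 - c * tang_sq x) *\<^sub>R \<nu> + e)"
    unfolding p_def e_def by (simp add: algebra_simps)
  have b: "norm b \<le> 2 * \<beta> * norm (tang ?\<xi>)" "b \<bullet> \<nu> = 0"
    unfolding b_def using quadratic_gradient_bound[OF B \<beta>(2)] \<beta>(1) by auto
  have \<tau>: "norm \<tau> \<le> 2 * 1 * norm (tang ?\<xi>)" "\<tau> \<bullet> \<nu> = 0"
    unfolding \<tau>_def using quadratic_gradient_bound[OF bilinear_inner, of 1] Cauchy_Schwarz_ineq2 by auto
  have e\<nu>: "e \<bullet> \<nu> = 0" "\<nu> \<bullet> e = 0" using b \<tau> by (simp_all add: e_def inner_add_left inner_add_right inner_commute)
  have np: "(norm p)\<^sup>2 = (1 - c * tang_sq x)\<^sup>2 + (norm e)\<^sup>2"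
    unfolding p norm_minus_cancel power2_norm_eq_inner
    by (simp add: inner_add_left inner_add_right e\<nu> nn power2_eq_square)
  have "norm e \<le> norm b / 2 + c * \<bar>height x\<bar> * norm \<tau>"
    unfolding e_def using norm_triangle_ineq[of "(1 / 2) *\<^sub>R b" "(c * height x) *\<^sub>R \<tau>"] c by (simp add: abs_mult)
  also have "\<dots> \<le> (2 * \<beta> * norm (tang ?\<xi>)) / 2 + c * \<bar>height x\<bar> * (2 * 1 * norm (tang ?\<xi>))"
    using b \<tau> c by (intro add_mono mult_left_mono divide_right_mono) auto
  also have "\<dots> = (\<beta> + 2 * c * \<bar>height x\<bar>) * sqrt (tang_sq x)"
    by (simp add: tang_sq_def norm_eq_sqrt_inner algebra_simps)
  finally have ne: "norm e \<le> (\<beta> + 2 * c * \<bar>height x\<bar>) * sqrt (tang_sq x)" .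
  have s0: "(\<Sum>i\<in>Basis. ((- \<nu>) \<bullet> i) * (\<tau> \<bullet> i)) = 0"
    using euclidean_inner[of "- \<nu>" \<tau>] \<tau>(2) by (simp add: inner_commute)
  have "(\<Sum>i\<in>Basis. B (tang i) (tang i)) = (\<Sum>i\<in>Basis. B i i) - B \<nu> \<nu>"
    unfolding tang_def bilinear_trace_reflect[OF B, of 1 \<nu>] by (simp add: nn)
  moreover have "(\<Sum>i\<in>Basis. A i i) = - (\<Sum>i\<in>Basis. B (tang i) (tang i))
     - 2 * c * (\<Sum>i\<in>Basis. ((- \<nu>) \<bullet> i) * (\<tau> \<bullet> i)) - 2 * c * height x * (\<Sum>i\<in>Basis. tang i \<bullet> tang i)"
    unfolding A_def by (simp add: sum_subtractf sum.distrib sum_distrib_left sum_negf algebra_simps)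
  ultimately have "(\<Sum>i\<in>Basis. A i i) = - ((\<Sum>i\<in>Basis. B i i) - B \<nu> \<nu>) - 2 * c * height x * (\<Sum>i\<in>Basis. tang i \<bullet> tang i)"
    using s0 by simp
  with that[OF j np _ ne] show ?thesis by simp
qed

lemma continuous_tang: "continuous_on S (\<lambda>x. tang (x - P))"
  unfolding tang_def by (intro continuous_intros)

lemma continuous_height: "continuous_on S height"
  unfolding height_def[abs_def] by (intro continuous_intros)

lemma continuous_tang_sq: "continuous_on S tang_sq"
  unfolding tang_sq_def[abs_def] by (intro continuous_intros continuous_tang)

lemma continuous_barrier: "continuous_on S barrier"
proof -
  have "bounded_bilinear B" using B by (simp add: bilinear_conv_bounded_bilinear)
  then have "continuous_on S (\<lambda>x. B (tang (x - P)) (tang (x - P)))"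
    by (rule bounded_bilinear.continuous_on) (rule continuous_tang)+
  then show ?thesis unfolding barrier_def[abs_def]
    by (intro continuous_intros continuous_height continuous_tang_sq)
qed

lemma at_P [simp]: "height P = 0" "tang_sq P = 0" "barrier P = 0"
  using bilinear_lzero[OF B] by (simp_all add: height_def tang_sq_def tang_def barrier_def)

lemma eventually_small:
  fixes F :: "'a \<Rightarrow> real"
  assumes "continuous_on UNIV F" "F P = 0" "e > 0"
  shows "\<forall>\<^sub>F x in nhds P. F x < e"
proof -
  have "isCont F P" using assms(1) by (simp add: continuous_on_eq_continuous_at)
  then have "(F \<longlongrightarrow> F P) (nhds P)" by (simp add: isCont_def tendsto_nhds_iff)
  then show ?thesis using assms(2,3) by (intro order_tendstoD(2)) auto
qed

text \<open>\<open>layer_super\<close> wants |grad g|^2 - 1 to have the sign of \<sigma>. For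
  \<sigma> = 1 and c = 0 this is automatic. For \<sigma> = -1 the choice of \<open>c\<close> makes
  E^2 \<le> c X near \<open>P\<close>, and c^2 X^2 \<le> c X once c X < 1, so -2 c X outweighs
  both.\<close>

lemma layer_barrier_supersolution:
  fixes \<sigma> \<kappa> \<eta> :: real
  assumes \<sigma>: "\<sigma> = 1 \<and> c = 0 \<or> \<sigma> = - 1 \<and> c = (\<beta> + 1)\<^sup>2"
    and \<eta>: "\<eta> > 0" and k: "\<sigma> * - ((\<Sum>i\<in>Basis. B i i) - B \<nu> \<nu>) \<le> \<sigma> * \<kappa> - 2 * \<eta>"
  obtains T0 where "T0 > 0"
    "\<forall>\<^sub>F x in nhds P. \<bar>\<kappa>\<bar> * \<bar>barrier x\<bar> \<le> 2 \<and> (barrier x \<ge> 0 \<longrightarrow> (\<forall>t. 0 < t \<and> t \<le> T0 \<longrightarrow>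
       (\<exists>L d. has_lap (\<lambda>y. layer \<kappa> (barrier y) t) L x \<and>
          ((\<lambda>s. layer \<kappa> (barrier x) s) has_real_derivative d) (at t) \<and> \<sigma> * L \<le> \<sigma> * d)))"
proof -
  define L0 where "L0 = - ((\<Sum>i\<in>Basis. B i i) - B \<nu> \<nu>)"
  define n where "n = (\<Sum>i\<in>Basis. tang i \<bullet> tang i)"
  have n: "n \<ge> 0" unfolding n_def by (intro sum_nonneg) simp
  define \<Lambda> where "\<Lambda> = \<bar>L0\<bar> + 1"
  \<comment> \<open>Of the 2 \<eta> in the hypothesis, one absorbs the Laplacian of the cubic term.
    The other is spent in thirds: on the sqrt t term (through \<open>T0\<close>), on the deviation
    of the gradient norm from 1, and on the height of the barrier.\<close>
  define T0 where "T0 = (\<eta> / (3 * ((\<bar>\<kappa>\<bar> + 1) * gauss_total * \<Lambda>)))\<^sup>2"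
  have \<Lambda>: "\<Lambda> > 0" by (simp add: \<Lambda>_def)
  have den: "(\<bar>\<kappa>\<bar> + 1) * gauss_total * \<Lambda> > 0" using \<Lambda> gauss_total_pos by (intro mult_pos_pos) auto
  have T0: "T0 > 0" unfolding T0_def using \<eta> den by (intro zero_less_power divide_pos_pos) auto
  have T0b: "\<bar>\<kappa>\<bar> * sqrt t * gauss_total * \<Lambda> \<le> \<eta> / 3" if "0 < t" "t \<le> T0" for t
  proof -
    have "sqrt t \<le> sqrt T0" using that by simp
    also have "sqrt T0 = \<eta> / (3 * ((\<bar>\<kappa>\<bar> + 1) * gauss_total * \<Lambda>))"
      unfolding T0_def using \<eta> den by (intro real_sqrt_unique) auto
    finally have "sqrt t * ((\<bar>\<kappa>\<bar> + 1) * gauss_total * \<Lambda>) \<le> \<eta> / 3" using den by (simp add: field_simps)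
    moreover have "sqrt t * (\<bar>\<kappa>\<bar> * gauss_total * \<Lambda>) \<le> sqrt t * ((\<bar>\<kappa>\<bar> + 1) * gauss_total * \<Lambda>)"
      using that \<Lambda> gauss_total_pos by (intro mult_left_mono mult_right_mono) auto
    ultimately show ?thesis by (simp add: algebra_simps)
  qed
  note cs = continuous_intros continuous_height continuous_tang_sq continuous_barrier
  have "\<forall>\<^sub>F x in nhds P. \<bar>\<kappa>\<bar> * \<bar>barrier x\<bar> < 2" by (rule eventually_small) (auto intro!: cs)
  moreover have "\<forall>\<^sub>F x in nhds P. 2 * c * \<bar>height x\<bar> * n < min \<eta> 1"
    by (rule eventually_small) (use \<eta> in \<open>auto intro!: cs\<close>)
  moreover have "\<forall>\<^sub>F x in nhds P. 2 * c * \<bar>height x\<bar> < 1" by (rule eventually_small) (auto intro!: cs)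
  moreover have "\<forall>\<^sub>F x in nhds P. c * tang_sq x < 1" by (rule eventually_small) (auto intro!: cs)
  moreover have "\<forall>\<^sub>F x in nhds P. \<bar>\<kappa>\<bar> * ((\<beta>\<^sup>2 + 2 * c) * tang_sq x) < \<eta> / 3"
    by (rule eventually_small) (use \<eta> in \<open>auto intro!: cs\<close>)
  moreover have "\<forall>\<^sub>F x in nhds P. \<bar>\<kappa>\<bar> / 2 * \<bar>barrier x\<bar> * \<Lambda> < \<eta> / 3"
    by (rule eventually_small) (use \<eta> in \<open>auto intro!: cs\<close>)
  ultimately have "\<forall>\<^sub>F x in nhds P. \<bar>\<kappa>\<bar> * \<bar>barrier x\<bar> \<le> 2 \<and> (barrier x \<ge> 0 \<longrightarrow> (\<forall>t. 0 < t \<and> t \<le> T0 \<longrightarrow>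
       (\<exists>L d. has_lap (\<lambda>y. layer \<kappa> (barrier y) t) L x \<and>
          ((\<lambda>s. layer \<kappa> (barrier x) s) has_real_derivative d) (at t) \<and> \<sigma> * L \<le> \<sigma> * d)))"
  proof eventually_elim
    case (elim x)
    define X where "X = tang_sq x"
    have X: "X \<ge> 0" by (simp add: X_def tang_sq_nonneg)
    obtain p A E where j: "jet2 barrier x p A" and np: "(norm p)\<^sup>2 = (1 - c * X)\<^sup>2 + E\<^sup>2"
      and E: "0 \<le> E" "E \<le> (\<beta> + 2 * c * \<bar>height x\<bar>) * sqrt X"
      and tr: "(\<Sum>i\<in>Basis. A i i) = L0 - 2 * c * height x * n"
      unfolding X_def L0_def n_def by (rule barrier_jet[of x])
    have E2: "E\<^sup>2 \<le> (\<beta> + 2 * c * \<bar>height x\<bar>)\<^sup>2 * X"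
      using power_mono[OF E(2,1), of 2] X by (simp add: power_mult_distrib)
    have h: "\<bar>2 * c * height x * n\<bar> \<le> min \<eta> 1"
      using elim(2) c n by (simp add: abs_mult)
    have G: "0 \<le> \<sigma> * ((norm p)\<^sup>2 - 1)" "\<sigma> * ((norm p)\<^sup>2 - 1) \<le> (\<beta>\<^sup>2 + 2 * c) * X"
    proof -
      have "0 \<le> \<sigma> * ((norm p)\<^sup>2 - 1) \<and> \<sigma> * ((norm p)\<^sup>2 - 1) \<le> (\<beta>\<^sup>2 + 2 * c) * X"
        using \<sigma>
      proof
        assume "\<sigma> = 1 \<and> c = 0" then show ?thesis using np E2 by simp
      next
        assume s: "\<sigma> = - 1 \<and> c = (\<beta> + 1)\<^sup>2"
        have "(\<beta> + 2 * c * \<bar>height x\<bar>)\<^sup>2 \<le> (\<beta> + 1)\<^sup>2" using elim(3) c \<beta>(1) by (intro power_mono) auto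
        then have "(\<beta> + 2 * c * \<bar>height x\<bar>)\<^sup>2 * X \<le> c * X" using s X by (intro mult_right_mono) auto
        then have E2c: "E\<^sup>2 \<le> c * X" using E2 by simp
        have "c\<^sup>2 * X\<^sup>2 = (c * X) * (c * X)" by (simp add: power2_eq_square)
        also have "\<dots> \<le> 1 * (c * X)" using elim(4) c X by (intro mult_right_mono) (auto simp: X_def)
        finally have 1: "c\<^sup>2 * X\<^sup>2 \<le> c * X" by simp
        have 2: "(1 - c * X)\<^sup>2 = 1 - 2 * (c * X) + c\<^sup>2 * X\<^sup>2" by (simp add: power2_eq_square algebra_simps)
        have "c * X \<ge> 0" "\<beta>\<^sup>2 * X \<ge> 0" "c\<^sup>2 * X\<^sup>2 \<ge> 0" "E\<^sup>2 \<ge> 0" using c X by auto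
        then show ?thesis using 1 2 E2c np s by (simp add: algebra_simps)
      qed
      then show "0 \<le> \<sigma> * ((norm p)\<^sup>2 - 1)" "\<sigma> * ((norm p)\<^sup>2 - 1) \<le> (\<beta>\<^sup>2 + 2 * c) * X" by auto
    qed
    have s1: "\<bar>\<sigma>\<bar> = 1" using \<sigma> by auto
    have L: "\<sigma> * (L0 - 2 * c * height x * n) \<le> \<sigma> * \<kappa> - \<eta>"
    proof -
      have "\<bar>\<sigma> * (2 * c * height x * n)\<bar> \<le> \<eta>" using h s1 by (simp add: abs_mult)
      moreover have "\<sigma> * L0 \<le> \<sigma> * \<kappa> - 2 * \<eta>" using k by (simp add: L0_def)
      ultimately show ?thesis unfolding right_diff_distrib by linarith
    qed
    have L2: "\<bar>L0 - 2 * c * height x * n\<bar> \<le> \<Lambda>" using h unfolding \<Lambda>_def by linarith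
    show ?case
    proof (intro conjI impI allI)
      show "\<bar>\<kappa>\<bar> * \<bar>barrier x\<bar> \<le> 2" using elim(1) by simp
      fix t assume b: "barrier x \<ge> 0" and t: "0 < t \<and> t \<le> T0"
      then have t0: "t > 0" by simp
      have kb: "\<bar>\<kappa>\<bar> * barrier x \<le> 2" using elim(1) b by simp
      have small: "\<bar>\<kappa>\<bar> * ((\<beta>\<^sup>2 + 2 * c) * X) + \<bar>\<kappa>\<bar> / 2 * (2 * sqrt t * gauss_total + barrier x) * \<Lambda> \<le> \<eta>"
      proof -
        have "\<bar>\<kappa>\<bar> / 2 * (2 * sqrt t * gauss_total + barrier x) * \<Lambda> =
           \<bar>\<kappa>\<bar> * sqrt t * gauss_total * \<Lambda> + \<bar>\<kappa>\<bar> / 2 * \<bar>barrier x\<bar> * \<Lambda>" using b by (simp add: algebra_simps)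
        then show ?thesis using T0b[of t] t elim(5,6) unfolding X_def by linarith
      qed
      have "\<sigma> * (layer_kernel (barrier x) t * (- (barrier x / (2 * t)) - \<kappa> + \<kappa> * (barrier x)\<^sup>2 / (4 * t)) * (norm p)\<^sup>2
          + layer_s \<kappa> (barrier x) t * (L0 - 2 * c * height x * n))
        \<le> \<sigma> * (layer_kernel (barrier x) t * (- (barrier x / (2 * t)) + \<kappa> * (barrier x)\<^sup>2 / (4 * t)))"
        by (rule layer_super[OF t0 b kb G s1 L L2 small])
      then show "\<exists>L d. has_lap (\<lambda>y. layer \<kappa> (barrier y) t) L x \<and>
          ((\<lambda>s. layer \<kappa> (barrier x) s) has_real_derivative d) (at t) \<and> \<sigma> * L \<le> \<sigma> * d"
        using layer_compose_heat[OF j t0, of \<kappa>, unfolded tr] layer_deriv_t[OF t0, of \<kappa> "barrier x"] by blast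
    qed
  qed
  with that[OF T0] show ?thesis by blast
qed

text \<open>On the inner normal the barrier is the distance to \<open>P\<close>, so the normal
  derivative of the composed layer at \<open>P\<close> is read off from
  \<open>layer_s \<kappa> 0 t\<close>.\<close>

lemma barrier_ray: "barrier (P - h *\<^sub>R \<nu>) = h"
proof -
  have "tang (P - h *\<^sub>R \<nu> - P) = 0" using linear_cmul[OF tang_linear, of "- h" \<nu>] by simp
  then show ?thesis using bilinear_lzero[OF B] by (simp add: barrier_def height_def tang_sq_def nn)
qed

end

text \<open>To second order N g + \<rho> equals \<eta> N / 2 times \<open>X\<close>: the shift by
  \<eta> separates the zero sets of the barrier and of \<rho> quadratically, on a side given by the
  sign of \<eta>. The errors eat up at most half of this separation and half of N |g|. The last
  inequality serves to recover |x - P| from \<open>g\<close> and \<open>X\<close>.\<close>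

lemma barrier_compare:
  fixes \<rho> :: "'a::euclidean_space \<Rightarrow> real"
  assumes U: "open U" "Ck_on 2 U \<rho>" "P \<in> U" "\<rho> P = 0" and N: "grad \<rho> P = N *\<^sub>R \<nu>" "N > 0"
    and fr: "boundary_frame \<nu> (\<lambda>v w. hess \<rho> P v w / N - \<eta> * (v \<bullet> w)) c \<beta>" and \<eta>: "\<eta> \<noteq> 0"
  defines "g \<equiv> boundary_frame.barrier P \<nu> (\<lambda>v w. hess \<rho> P v w / N - \<eta> * (v \<bullet> w)) c"
    and "X \<equiv> boundary_frame.tang_sq P \<nu>"
  shows "\<forall>\<^sub>F x in nhds P. x \<in> U \<and> \<bar>N * g x + \<rho> x - \<eta> * N / 2 * X x\<bar> \<le> \<bar>\<eta>\<bar> * N / 4 * X x + N / 2 * \<bar>g x\<bar>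
     \<and> (norm (x - P))\<^sup>2 \<le> 2 * \<bar>g x\<bar> + (1 + \<beta>) * X x"
proof -
  interpret F: boundary_frame P \<nu> "\<lambda>v w. hess \<rho> P v w / N - \<eta> * (v \<bullet> w)" c \<beta> by (rule fr)
  define H where "H = hess \<rho> P"
  have bl: "bilinear H" unfolding H_def by (rule hess_bilinear[OF U(1-3)])
  obtain K where K: "K > 0" "\<And>v w. \<bar>H v w\<bar> \<le> K * norm v * norm w" using bilinear_bounded[OF bl] by blast
  \<comment> \<open>Half of the allowed |\<eta>| N / 4 pays for the Taylor remainder in
    \<open>X\<close>, the other half for \<open>\<omega> x * \<beta> * X x\<close>.\<close>
  define \<epsilon> where "\<epsilon> = \<bar>\<eta>\<bar> * N / 8"
  have \<epsilon>: "\<epsilon> > 0" using \<eta> N by (simp add: \<epsilon>_def)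
  obtain r where r: "r > 0" "cball P r \<subseteq> U"
    "\<And>\<xi>. norm \<xi> \<le> r \<Longrightarrow> \<bar>\<rho> (P + \<xi>) - \<rho> P - grad \<rho> P \<bullet> \<xi> - H \<xi> \<xi> / 2\<bar> \<le> \<epsilon> * (norm \<xi>)\<^sup>2"
    using C2_taylor[OF U(1-3) \<epsilon>] unfolding H_def by blast
  \<comment> \<open>Everything that multiplies |height x| in the error: the mixed and normal Hessian
    entries, the Taylor remainder and the cubic term. It vanishes at \<open>P\<close>.\<close>
  define \<omega> where "\<omega> = (\<lambda>x. 3 / 2 * K * norm (x - P) + \<epsilon> * \<bar>F.height x\<bar> + N * c * X x)"
  note cs = continuous_intros F.continuous_height F.continuous_tang_sq F.continuous_barrier
  have Xc: "continuous_on UNIV X" "X P = 0" unfolding X_def by (auto intro: cs)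
  have \<omega>c: "continuous_on UNIV \<omega>" "\<omega> P = 0" unfolding \<omega>_def by (auto intro!: cs Xc simp: Xc)
  have "\<forall>\<^sub>F x in nhds P. \<omega> x * \<beta> < \<epsilon>" by (rule F.eventually_small) (use \<epsilon> in \<open>auto intro!: cs \<omega>c simp: \<omega>c\<close>)
  moreover have "\<forall>\<^sub>F x in nhds P. \<omega> x < N / 4" by (rule F.eventually_small) (use N in \<open>auto intro!: cs \<omega>c simp: \<omega>c\<close>)
  moreover have "\<forall>\<^sub>F x in nhds P. c * X x < 1 / 2" by (rule F.eventually_small) (auto intro!: cs Xc simp: Xc)
  moreover have "\<forall>\<^sub>F x in nhds P. \<bar>F.height x\<bar> < 1" by (rule F.eventually_small) (auto intro!: cs)
  moreover have "\<forall>\<^sub>F x in nhds P. norm (x - P) < r" by (rule F.eventually_small) (use r in \<open>auto intro!: cs\<close>)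
  ultimately show ?thesis
  proof eventually_elim
    case (elim x)
    define \<xi> where "\<xi> = x - P"
    define s where "s = F.height x"
    define \<theta> where "\<theta> = F.tang \<xi>"
    have X0: "X x \<ge> 0" unfolding X_def by (rule F.tang_sq_nonneg)
    have X\<theta>: "X x = \<theta> \<bullet> \<theta>" by (simp add: X_def F.tang_sq_def \<theta>_def \<xi>_def)
    have s\<nu>: "\<xi> \<bullet> \<nu> = - s" by (simp add: s_def F.height_def \<xi>_def inner_commute)
    have n\<xi>: "(norm \<xi>)\<^sup>2 = X x + s\<^sup>2" unfolding \<xi>_def s_def X_def by (rule F.height_sq)
    have s\<xi>: "\<bar>s\<bar> \<le> norm \<xi>" unfolding s_def \<xi>_def by (rule F.abs_height_le)
    have \<theta>\<xi>: "norm \<theta> \<le> norm \<xi>" unfolding \<theta>_def by (rule F.norm_tang_le)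
    have dec: "\<xi> = \<theta> + (- s) *\<^sub>R \<nu>" by (simp add: \<theta>_def F.tang_def s\<nu>)
    have g: "g x = s - 1 / 2 * (H \<theta> \<theta> / N - \<eta> * X x) - c * (s * X x)"
      by (simp add: g_def F.barrier_def s_def X\<theta> \<theta>_def H_def \<xi>_def[symmetric] F.tang_sq_def)
    have Hd: "\<bar>H \<xi> \<xi> - H \<theta> \<theta>\<bar> \<le> 3 * K * norm \<xi> * \<bar>s\<bar>"
    proof -
      have "H \<xi> \<xi> = H \<theta> \<theta> - s * H \<theta> \<nu> - s * H \<nu> \<theta> + s * s * H \<nu> \<nu>"
        by (subst (1 2) dec) (simp only: bilinear_ladd[OF bl] bilinear_radd[OF bl] bilinear_lmul[OF bl]
            bilinear_rmul[OF bl], simp add: algebra_simps)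
      then have "H \<xi> \<xi> - H \<theta> \<theta> = s * (s * H \<nu> \<nu> - H \<theta> \<nu> - H \<nu> \<theta>)" by (simp add: algebra_simps)
      then have "\<bar>H \<xi> \<xi> - H \<theta> \<theta>\<bar> = \<bar>s\<bar> * \<bar>s * H \<nu> \<nu> - H \<theta> \<nu> - H \<nu> \<theta>\<bar>" by (simp add: abs_mult)
      also have "\<dots> \<le> \<bar>s\<bar> * (3 * K * norm \<xi>)"
      proof (rule mult_left_mono)
        have "\<bar>H \<nu> \<nu>\<bar> \<le> K" "\<bar>H \<theta> \<nu>\<bar> \<le> K * norm \<theta>" "\<bar>H \<nu> \<theta>\<bar> \<le> K * norm \<theta>"
          using K(2)[of \<nu> \<nu>] K(2)[of \<theta> \<nu>] K(2)[of \<nu> \<theta>] F.\<nu> by auto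
        moreover have "K * norm \<theta> \<le> K * norm \<xi>" using \<theta>\<xi> K by simp
        moreover have "\<bar>s * H \<nu> \<nu>\<bar> \<le> norm \<xi> * K"
          unfolding abs_mult using s\<xi> calculation(1) by (intro mult_mono) auto
        ultimately show "\<bar>s * H \<nu> \<nu> - H \<theta> \<nu> - H \<nu> \<theta>\<bar> \<le> 3 * K * norm \<xi>" by (simp add: algebra_simps)
      qed simp
      finally show ?thesis by (simp add: algebra_simps)
    qed
    define E where "E = \<rho> x + N * s - H \<xi> \<xi> / 2"
    have E: "\<bar>E\<bar> \<le> \<epsilon> * (X x + s\<^sup>2)"
    proof -
      have "grad \<rho> P \<bullet> \<xi> = - (N * s)" using s\<nu> by (simp add: N inner_commute)
      then show ?thesis using r(3)[of \<xi>] elim(5) n\<xi> U(4) by (simp add: E_def \<xi>_def algebra_simps)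
    qed
    have sb: "\<bar>s\<bar> \<le> 2 * \<bar>g x\<bar> + \<beta> * X x"
    proof -
      define q w where "q = H \<theta> \<theta> / N - \<eta> * X x" and "w = c * (s * X x)"
      have "\<bar>q\<bar> \<le> \<beta> * X x" unfolding q_def
        using F.\<beta>(2)[of \<theta> \<theta>] by (simp add: H_def X\<theta> power2_norm_eq_inner[symmetric] power2_eq_square mult.assoc)
      moreover have "\<bar>w\<bar> \<le> \<bar>s\<bar> / 2"
        using mult_right_mono[of "c * X x" "1 / 2" "\<bar>s\<bar>"] elim(3) F.c X0 by (simp add: w_def abs_mult algebra_simps)
      moreover have "g x = s - 1 / 2 * q - w" unfolding g q_def w_def by simp
      ultimately show ?thesis by linarith
    qed
    have "N * g x = N * s - H \<theta> \<theta> / 2 + \<eta> * N / 2 * X x - N * c * (s * X x)"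
      using N unfolding g by (simp add: field_simps)
    then have id: "N * g x + \<rho> x - \<eta> * N / 2 * X x = (H \<xi> \<xi> - H \<theta> \<theta>) / 2 + E - N * c * (s * X x)"
      by (simp add: E_def diff_divide_distrib)
    define S w D where "S = \<bar>s\<bar>" and "w = N * c * (s * X x)" and "D = H \<xi> \<xi> - H \<theta> \<theta>"
    have "\<bar>w\<bar> = N * c * X x * S" using N F.c X0 by (simp add: abs_mult w_def S_def)
    moreover have "\<bar>D\<bar> \<le> 3 * K * norm \<xi> * S" using Hd by (simp add: D_def S_def)
    ultimately have "\<bar>D / 2 + E - w\<bar> \<le> 3 * K * norm \<xi> * S / 2 + \<epsilon> * (X x + s\<^sup>2) + N * c * X x * S"
      using E by linarith
    then have "\<bar>N * g x + \<rho> x - \<eta> * N / 2 * X x\<bar> \<le> 3 * K * norm \<xi> * \<bar>s\<bar> / 2 + \<epsilon> * (X x + s\<^sup>2) + N * c * X x * \<bar>s\<bar>"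
      unfolding id D_def w_def S_def .
    also have "\<dots> = \<epsilon> * X x + \<omega> x * \<bar>s\<bar>"
      by (simp add: \<omega>_def \<xi>_def s_def power2_eq_square algebra_simps)
    also have "\<dots> \<le> \<epsilon> * X x + \<omega> x * (2 * \<bar>g x\<bar> + \<beta> * X x)"
    proof -
      have "\<omega> x \<ge> 0" unfolding \<omega>_def using K \<epsilon> N F.c X0 by (intro add_nonneg_nonneg mult_nonneg_nonneg) auto
      then show ?thesis using sb by (simp add: mult_left_mono)
    qed
    also have "\<dots> \<le> \<bar>\<eta>\<bar> * N / 4 * X x + N / 2 * \<bar>g x\<bar>"
    proof -
      have "\<omega> x * \<beta> * X x \<le> \<epsilon> * X x" using elim(1) X0 by (intro mult_right_mono) auto
      moreover have "\<omega> x * (2 * \<bar>g x\<bar>) \<le> N / 4 * (2 * \<bar>g x\<bar>)" using elim(2) by (intro mult_right_mono) auto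
      ultimately show ?thesis by (simp add: \<epsilon>_def algebra_simps)
    qed
    finally have 1: "\<bar>N * g x + \<rho> x - \<eta> * N / 2 * X x\<bar> \<le> \<bar>\<eta>\<bar> * N / 4 * X x + N / 2 * \<bar>g x\<bar>" .
    have "s\<^sup>2 \<le> \<bar>s\<bar>"
      using elim(4) mult_right_mono[of "\<bar>s\<bar>" 1 "\<bar>s\<bar>"] by (simp add: s_def power2_eq_square)
    with sb have 2: "(norm (x - P))\<^sup>2 \<le> 2 * \<bar>g x\<bar> + (1 + \<beta>) * X x"
      using n\<xi> by (simp add: \<xi>_def algebra_simps)
    have "x \<in> U" using elim(5) r(2) by (auto simp: dist_norm norm_minus_commute)
    with 1 2 show ?case by blast
  qed
qed

lemma local_defining_outer_normal:
  assumes "local_defining \<Omega> U \<rho>" "P \<in> U" "\<rho> P = 0"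
  shows "outer_unit_normal \<Omega> P (grad \<rho> P /\<^sub>R norm (grad \<rho> P))"
proof -
  note D = local_definingD[OF assms(1)]
  have "\<Omega> \<inter> U = {y\<in>U. \<rho> y < 0}" using assms(1) unfolding local_defining_def by blast
  then show ?thesis unfolding outer_unit_normal_def
    using D(1) assms D(4)[OF assms(2)] C2_grad[OF D(1,2) assms(2)] by blast
qed

text \<open>Both functions vanish at the boundary point, so their order along the inner normal
  passes to the difference quotients; \<open>- b\<close> is the slope of \<open>f\<close> in the
  inward direction, and \<sigma> is the direction of the comparison.\<close>

lemma normal_deriv_compare:
  assumes nd: "normal_deriv_eq \<Omega> f P b" and \<nu>: "outer_unit_normal \<Omega> P \<nu>" and f: "f P = 0"
    and \<phi>: "(\<phi> has_real_derivative d) (at 0)" "\<phi> 0 = 0"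
    and le: "\<forall>\<^sub>F h in at_right 0. \<sigma> * f (P - h *\<^sub>R \<nu>) \<le> \<sigma> * \<phi> h"
  shows "\<sigma> * - b \<le> \<sigma> * d"
proof -
  have "((\<lambda>h. f (P + h *\<^sub>R \<nu>)) has_real_derivative b) (at_left 0)"
    using nd \<nu> unfolding normal_deriv_eq_def by blast
  then have "((\<lambda>h. f (P + h *\<^sub>R \<nu>) / h) \<longlongrightarrow> b) (at_left 0)"
    by (simp add: has_field_derivative_iff f)
  then have "((\<lambda>h. f (P - h *\<^sub>R \<nu>) / (- h)) \<longlongrightarrow> b) (at_right 0)"
    by (simp add: at_left_minus[of 0] filterlim_filtermap)
  then have "((\<lambda>h. \<sigma> * - (f (P - h *\<^sub>R \<nu>) / (- h))) \<longlongrightarrow> \<sigma> * - b) (at_right 0)"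
    by (intro tendsto_intros)
  then have 1: "((\<lambda>h. \<sigma> * f (P - h *\<^sub>R \<nu>) / h) \<longlongrightarrow> \<sigma> * - b) (at_right 0)" by simp
  have "((\<lambda>h. \<phi> h / h) \<longlongrightarrow> d) (at 0)" using \<phi> by (simp add: has_field_derivative_iff)
  then have "((\<lambda>h. \<phi> h / h) \<longlongrightarrow> d) (at_right 0)" by (rule filterlim_mono[OF _ order_refl at_le]) simp
  then have 2: "((\<lambda>h. \<sigma> * (\<phi> h / h)) \<longlongrightarrow> \<sigma> * d) (at_right 0)" by (intro tendsto_intros)
  have "\<forall>\<^sub>F h in at_right (0::real). h > 0" by (simp add: eventually_at_filter)
  with le have "\<forall>\<^sub>F h in at_right 0. \<sigma> * f (P - h *\<^sub>R \<nu>) / h \<le> \<sigma> * (\<phi> h / h)"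
    by eventually_elim (simp add: divide_right_mono)
  then show ?thesis by (rule tendsto_le[OF _ 2 1, rotated]) simp
qed

text \<open>The tangential trace of the Hessian divided by the length of the gradient: the sum of
  the principal curvatures, positive for a ball.\<close>

definition mean_curv :: "('a::euclidean_space \<Rightarrow> real) \<Rightarrow> 'a \<Rightarrow> real" where
  "mean_curv \<rho> x = ((\<Sum>i\<in>Basis. hess \<rho> x i i) -
      hess \<rho> x (grad \<rho> x /\<^sub>R norm (grad \<rho> x)) (grad \<rho> x /\<^sub>R norm (grad \<rho> x))) / norm (grad \<rho> x)"

text \<open>The shift by \<eta> changes the tangential trace by \<eta> times the dimension of the
  tangent space, and this is the amount by which the curvature of the barrier misses that of the
  boundary.\<close>

lemma boundary_frameI:
  fixes \<rho> :: "'a::euclidean_space \<Rightarrow> real" and \<eta> :: real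
  assumes U: "open U" "Ck_on 2 U \<rho>" "P \<in> U" and g: "grad \<rho> P \<noteq> 0"
  defines "N \<equiv> norm (grad \<rho> P)" and "\<nu> \<equiv> grad \<rho> P /\<^sub>R norm (grad \<rho> P)"
  defines "B \<equiv> \<lambda>v w. hess \<rho> P v w / N - \<eta> * (v \<bullet> w)"
  obtains \<beta> where "\<And>c. c \<ge> 0 \<Longrightarrow> boundary_frame \<nu> B c \<beta>"
    "(\<Sum>i\<in>Basis. B i i) - B \<nu> \<nu> = mean_curv \<rho> P - \<eta> * (DIM('a) - 1)"
    "grad \<rho> P = N *\<^sub>R \<nu>" "N > 0"
proof -
  have N: "N > 0" using g by (simp add: N_def)
  have \<nu>: "norm \<nu> = 1" using g by (simp add: \<nu>_def)
  have bl: "bilinear (hess \<rho> P)" by (rule hess_bilinear[OF U])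
  have B: "bilinear B"
  proof -
    have "linear (\<lambda>w. hess \<rho> P v w / N - \<eta> * (v \<bullet> w))" for v
      using bilinear_radd[OF bl] bilinear_rmul[OF bl]
      by (intro linearI) (simp_all add: inner_add_right add_divide_distrib algebra_simps)
    moreover have "linear (\<lambda>v. hess \<rho> P v w / N - \<eta> * (v \<bullet> w))" for w
      using bilinear_ladd[OF bl] bilinear_lmul[OF bl]
      by (intro linearI) (simp_all add: inner_add_left add_divide_distrib algebra_simps)
    ultimately show ?thesis by (simp add: bilinear_def B_def)
  qed
  obtain \<beta> where "\<beta> > 0" "\<And>v w. \<bar>B v w\<bar> \<le> \<beta> * norm v * norm w" using bilinear_bounded[OF B] by blast
  then have "boundary_frame \<nu> B c \<beta>" if "c \<ge> 0" for c
    using \<nu> B that by (simp add: boundary_frame_def)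
  moreover have "(\<Sum>i\<in>Basis. B i i) - B \<nu> \<nu> = mean_curv \<rho> P - \<eta> * (DIM('a) - 1)"
  proof -
    have "\<nu> \<bullet> \<nu> = 1" using \<nu> by (simp add: norm_eq_1)
    moreover have "(\<Sum>i\<in>Basis. B i i) = (\<Sum>i\<in>Basis. hess \<rho> P i i) / N - \<eta> * DIM('a)"
      by (simp add: B_def sum_subtractf sum_divide_distrib)
    ultimately show ?thesis
      by (simp add: mean_curv_def B_def N_def \<nu>_def diff_divide_distrib of_nat_diff algebra_simps)
  qed
  moreover have "grad \<rho> P = N *\<^sub>R \<nu>" using g by (simp add: N_def \<nu>_def)
  ultimately show ?thesis using that N by blast
qed

lemma eventually_nhds_cball:
  assumes "\<forall>\<^sub>F x in nhds P. Q x" obtains r where "r > 0" "\<And>x. x \<in> cball P r \<Longrightarrow> Q x"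
proof -
  obtain d where d: "d > 0" "\<And>x. dist x P < d \<Longrightarrow> Q x" using assms unfolding eventually_nhds_metric by blast
  show ?thesis by (rule that[of "d / 2"]) (use d in \<open>auto simp: dist_commute\<close>)
qed

section \<open>Upper and lower bounds for the normal derivative at small times\<close>

context heat_from_one
begin

lemma inner_ray_eventually:
  assumes ld: "local_defining \<Omega> U \<rho>" and P: "P \<in> U" "\<rho> P = 0" and V: "open V" "P \<in> V"
    and \<nu>: "\<nu> = grad \<rho> P /\<^sub>R norm (grad \<rho> P)"
  shows "\<forall>\<^sub>F h in at_right 0. P - h *\<^sub>R \<nu> \<in> \<Omega> \<inter> V"
proof -
  note D = local_definingD[OF ld]
  have "((\<lambda>s. \<rho> (P + s *\<^sub>R (- \<nu>))) has_real_derivative grad \<rho> P \<bullet> (- \<nu>)) (at 0)"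
    by (rule C2_line_deriv[OF D(1,2) P(1)])
  moreover have "grad \<rho> P \<bullet> (- \<nu>) < 0" using D(4)[OF P(1)] by (simp add: \<nu>)
  ultimately obtain d where d: "d > 0" "\<And>h. 0 < h \<Longrightarrow> h < d \<Longrightarrow> \<rho> (P + (0 + h) *\<^sub>R (- \<nu>)) < \<rho> (P + 0 *\<^sub>R (- \<nu>))"
    using DERIV_neg_dec_right by blast
  have "((\<lambda>h. P - h *\<^sub>R \<nu>) \<longlongrightarrow> P - 0 *\<^sub>R \<nu>) (at_right 0)" by (intro tendsto_intros)
  then have lim: "((\<lambda>h. P - h *\<^sub>R \<nu>) \<longlongrightarrow> P) (at_right 0)" by simp
  have "\<forall>\<^sub>F h in at_right 0. P - h *\<^sub>R \<nu> \<in> U" using topological_tendstoD[OF lim D(1) P(1)] .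
  moreover have "\<forall>\<^sub>F h in at_right 0. P - h *\<^sub>R \<nu> \<in> V" using topological_tendstoD[OF lim V] .
  moreover have "\<forall>\<^sub>F h in at_right 0. 0 < h \<and> h < d"
    using d(1) eventually_at_right_real by (auto elim: eventually_mono)
  ultimately show ?thesis
  proof eventually_elim
    case (elim h)
    then have "\<rho> (P - h *\<^sub>R \<nu>) < 0" using d(2)[of h] P(2) by simp
    then show ?case using D(3)[of "P - h *\<^sub>R \<nu>"] elim by simp
  qed
qed

text \<open>With \<eta> > 0 the barrier is positive on the closure of \<Omega> near \<open>P\<close>
  except at \<open>P\<close>, so the layer composed with it lies above the boundary values 0. It
  falls short of 1 on the spherical part of the lateral boundary; dividing by 1 - C T repairs this
  at a relative cost of order \<open>T\<close>.\<close>

lemma normal_derivative_upper: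
  assumes ld: "local_defining \<Omega> U \<rho>" and P: "P \<in> U" "\<rho> P = 0" and k: "- mean_curv \<rho> P < \<kappa>"
  obtains C T0 where "C > 0" "T0 > 0" "C * T0 < 1"
    "\<And>T b. 0 < T \<Longrightarrow> T < T0 \<Longrightarrow> normal_deriv_eq \<Omega> (\<lambda>y. u y T) P b \<Longrightarrow>
       - b \<le> (erf_slope / (2 * sqrt T) + \<kappa> / 2) / (1 - C * T)"
proof -
  note D = local_definingD[OF ld]
  have fr: "P \<in> frontier \<Omega>" using local_defining_frontier[OF op ld P(1)] P(2) by simp
  define \<delta> where "\<delta> = \<kappa> + mean_curv \<rho> P"
  have \<delta>: "\<delta> > 0" using k by (simp add: \<delta>_def)
  \<comment> \<open>The shift costs at most half of the gap \<open>\<delta>\<close>; the other half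
    is the 2 (\<delta> / 4) demanded by the supersolution property.\<close>
  define \<eta> where "\<eta> = \<delta> / (2 * DIM('a))"
  have \<eta>: "\<eta> > 0" using \<delta> by (simp add: \<eta>_def)
  define N where "N = norm (grad \<rho> P)"
  define \<nu> where "\<nu> = grad \<rho> P /\<^sub>R norm (grad \<rho> P)"
  define B where "B = (\<lambda>v w. hess \<rho> P v w / N - \<eta> * (v \<bullet> w))"
  obtain \<beta> where \<beta>: "\<And>c. c \<ge> 0 \<Longrightarrow> boundary_frame \<nu> B c \<beta>"
    and tr: "(\<Sum>i\<in>Basis. B i i) - B \<nu> \<nu> = mean_curv \<rho> P - \<eta> * (DIM('a) - 1)"
    and N: "grad \<rho> P = N *\<^sub>R \<nu>" "N > 0"
    using boundary_frameI[OF D(1,2) P(1) D(4)[OF P(1)], of \<eta>] unfolding N_def \<nu>_def B_def by blast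
  interpret F: boundary_frame P \<nu> B 0 \<beta> by (rule \<beta>) simp
  have k2: "1 * - ((\<Sum>i\<in>Basis. B i i) - B \<nu> \<nu>) \<le> 1 * \<kappa> - 2 * (\<delta> / 4)"
  proof -
    define q where "q = \<eta> * (DIM('a) - 1)"
    have "q \<le> \<eta> * DIM('a)" unfolding q_def using \<eta> by (intro mult_left_mono) auto
    also have "\<dots> = \<delta> / 2" by (simp add: \<eta>_def)
    finally have "- (mean_curv \<rho> P - q) \<le> \<kappa> - \<delta> / 2" using \<delta>_def by linarith
    then show ?thesis unfolding tr q_def[symmetric] by simp
  qed
  obtain T1 where T1: "T1 > 0" "\<forall>\<^sub>F x in nhds P. \<bar>\<kappa>\<bar> * \<bar>F.barrier x\<bar> \<le> 2 \<and> (F.barrier x \<ge> 0 \<longrightarrow> (\<forall>t. 0 < t \<and> t \<le> T1 \<longrightarrow>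
       (\<exists>L d. has_lap (\<lambda>y. layer \<kappa> (F.barrier y) t) L x \<and>
          ((\<lambda>s. layer \<kappa> (F.barrier x) s) has_real_derivative d) (at t) \<and> 1 * L \<le> 1 * d)))"
    using F.layer_barrier_supersolution[of 1 "\<delta> / 4" \<kappa>] k2 \<delta> by auto
  \<comment> \<open>For \<rho> \<le> 0 the comparison gives X \<le> 6 g / \<eta>; inserted into |x -
    P|^2 \<le> 2 g + (1 + \<beta>) X this bounds |x - P|^2 by g / k.\<close>
  define k where "k = 1 / (2 + (1 + \<beta>) * 6 / \<eta>)"
  have kpos: "k > 0" unfolding k_def using F.\<beta>(1) \<eta> by (intro divide_pos_pos add_pos_pos mult_pos_pos) auto
  have cmp: "\<forall>\<^sub>F x in nhds P. x \<in> U \<and> (\<rho> x \<le> 0 \<longrightarrow> F.barrier x \<ge> k * (norm (x - P))\<^sup>2)"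
    using barrier_compare[OF D(1,2) P N \<beta>[unfolded B_def, OF order_refl] less_imp_neq[OF \<eta>, symmetric]]
    unfolding B_def[symmetric]
  proof eventually_elim
    case (elim x)
    define g X where "g = F.barrier x" and "X = F.tang_sq x"
    have 1: "\<bar>N * g + \<rho> x - \<eta> * N / 2 * X\<bar> \<le> \<bar>\<eta>\<bar> * N / 4 * X + N / 2 * \<bar>g\<bar>"
      and 2: "(norm (x - P))\<^sup>2 \<le> 2 * \<bar>g\<bar> + (1 + \<beta>) * X" and xU: "x \<in> U"
      using elim by (auto simp: g_def X_def)
    have "F.barrier x \<ge> k * (norm (x - P))\<^sup>2" if \<rho>: "\<rho> x \<le> 0"
    proof -
    have X: "X \<ge> 0" unfolding X_def by (rule F.tang_sq_nonneg)
    have "\<eta> * N / 2 * X \<le> N * g + \<eta> * N / 4 * X + N / 2 * \<bar>g\<bar>"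
      using abs_le_D2[OF 1] \<rho> unfolding abs_of_pos[OF \<eta>] by linarith
    then have "N * (\<eta> * X) \<le> N * (4 * g + 2 * \<bar>g\<bar>)" by (simp add: algebra_simps)
    then have 3: "\<eta> * X \<le> 4 * g + 2 * \<bar>g\<bar>" using N(2) by simp
    then have g0: "g \<ge> 0" using mult_nonneg_nonneg[of \<eta> X] \<eta> X by linarith
    then have "X \<le> 6 * g / \<eta>" using 3 \<eta> by (simp add: field_simps)
    then have "(1 + \<beta>) * X \<le> (1 + \<beta>) * (6 * g / \<eta>)" using F.\<beta>(1) by (intro mult_left_mono) auto
    then have "(norm (x - P))\<^sup>2 \<le> (2 + (1 + \<beta>) * 6 / \<eta>) * g" using 2 g0 by (simp add: algebra_simps)
    moreover have "2 + (1 + \<beta>) * 6 / \<eta> > 0" using F.\<beta>(1) \<eta> by (intro add_pos_pos divide_pos_pos mult_pos_pos) auto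
    ultimately show ?thesis by (simp add: k_def g_def field_simps)
    qed
    with xU show ?case by blast
  qed
  obtain r where r: "r > 0" and rQ: "\<And>x. x \<in> cball P r \<Longrightarrow> x \<in> U"
    "\<And>x. x \<in> cball P r \<Longrightarrow> \<rho> x \<le> 0 \<Longrightarrow> F.barrier x \<ge> k * (norm (x - P))\<^sup>2"
    "\<And>x. x \<in> cball P r \<Longrightarrow> \<bar>\<kappa>\<bar> * \<bar>F.barrier x\<bar> \<le> 2"
    "\<And>x t. x \<in> cball P r \<Longrightarrow> F.barrier x \<ge> 0 \<Longrightarrow> 0 < t \<Longrightarrow> t \<le> T1 \<Longrightarrow> (\<exists>L d. has_lap (\<lambda>y. layer \<kappa> (F.barrier y) t) L x \<and>
          ((\<lambda>s. layer \<kappa> (F.barrier x) s) has_real_derivative d) (at t) \<and> 1 * L \<le> 1 * d)"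
    by (rule eventually_nhds_cball[OF eventually_conj[OF cmp T1(2)]]) blast
  define s0 where "s0 = k * r\<^sup>2"
  have s0: "s0 > 0" using kpos r by (simp add: s0_def)
  define C where "C = 8 / s0\<^sup>2"
  have C: "C > 0" using s0 by (simp add: C_def)
  \<comment> \<open>The time range in which \<open>layer_nonneg\<close> applies; the added 1 keeps
    the quotient defined for \<kappa> = 0.\<close>
  define T2 where "T2 = (erf_slope / (\<bar>\<kappa>\<bar> + 1))\<^sup>2"
  have T2: "T2 > 0" unfolding T2_def using erf_slope_pos by (intro zero_less_power divide_pos_pos) auto
  have T2b: "\<bar>\<kappa>\<bar> * sqrt t \<le> erf_slope" if "0 < t" "t \<le> T2" for t
  proof -
    have "sqrt t \<le> sqrt T2" using that by simp
    also have "sqrt T2 = erf_slope / (\<bar>\<kappa>\<bar> + 1)"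
      unfolding T2_def using erf_slope_pos by (intro real_sqrt_unique) auto
    finally have "sqrt t * (\<bar>\<kappa>\<bar> + 1) \<le> erf_slope" by (subst (asm) pos_le_divide_eq) auto
    then have "sqrt t + \<bar>\<kappa>\<bar> * sqrt t \<le> erf_slope" by (simp add: algebra_simps)
    moreover have "sqrt t \<ge> 0" using that by simp
    ultimately show ?thesis by linarith
  qed
  define T0 where "T0 = min (min T1 T2) (1 / (2 * C))"
  have T0: "T0 > 0" "T0 \<le> T1" "T0 \<le> T2" using T1(1) T2 C by (auto simp: T0_def)
  have CT0: "C * T0 < 1"
  proof -
    have "C * T0 \<le> C * (1 / (2 * C))" using C by (intro mult_left_mono) (auto simp: T0_def)
    also have "\<dots> < 1" using C by simp
    finally show ?thesis .
  qed
  have main: "- b \<le> (erf_slope / (2 * sqrt T) + \<kappa> / 2) / (1 - C * T)"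
    if T: "0 < T" "T < T0" and nd: "normal_deriv_eq \<Omega> (\<lambda>y. u y T) P b" for T b
  proof -
    \<comment> \<open>On the spherical part inside \<Omega> the barrier is at least
      \<open>s0\<close>, so the layer is at least 1 - 8 T / s0^2 = m, and after division by
      \<open>m\<close> it dominates u \<le> 1.\<close>
    define m where "m = 1 - C * T"
    have "C * T < C * T0" using T C by simp
    then have m: "m > 0" "m \<le> 1" using CT0 T C unfolding m_def by (linarith, simp)
    define E where "E = \<Omega> \<inter> ball P r"
    have E: "open E" "E \<subseteq> \<Omega>" using op by (auto simp: E_def)
    have clE: "closure E \<subseteq> closure \<Omega> \<inter> cball P r"
      using closure_mono[of E \<Omega>] closure_mono[of E "ball P r"] r by (auto simp: E_def)
    have g0: "F.barrier x \<ge> k * (norm (x - P))\<^sup>2" if "x \<in> closure E" for x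
    proof -
      have x: "x \<in> closure \<Omega>" "x \<in> cball P r" using clE that by auto
      then have "\<rho> x \<le> 0" using local_defining_closure[OF ld rQ(1)[OF x(2)]] by simp
      then show ?thesis by (rule rQ(2)[OF x(2)])
    qed
    have g0': "F.barrier x \<ge> 0" if "x \<in> closure E" for x
      by (rule order_trans[OF _ g0[OF that]]) (use kpos in simp)
    have l0: "layer \<kappa> (F.barrier x) t \<ge> 0" if "x \<in> closure E" "0 < t" "t \<le> T" for x t
      using that T T0 g0'[OF that(1)] by (intro layer_nonneg T2b) auto
    have ge: "layer \<kappa> (F.barrier x) t / m \<ge> layer \<kappa> (F.barrier x) t" if "x \<in> closure E" "0 < t" "t \<le> T" for x t
      using mult_right_mono[OF m(2) l0[OF that]] m(1) by (simp add: field_simps)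
    have comp: "u x T \<le> layer \<kappa> (F.barrier x) T / m" if "x \<in> E" for x
    proof -
      have "1 * u x T \<le> 1 * (layer \<kappa> (F.barrier x) T / m)"
      proof (rule u_compare[where M = 0 and T = T, OF E _ _ _ _ _ that T(1) order_refl])
        fix x t assume x: "x \<in> E" and t: "0 < t" "t \<le> T"
        have "x \<in> cball P r" "F.barrier x \<ge> 0" using x g0'[of x] closure_subset[of E] by (auto simp: E_def)
        then obtain L d where Ld: "has_lap (\<lambda>y. layer \<kappa> (F.barrier y) t) L x"
          "((\<lambda>s. layer \<kappa> (F.barrier x) s) has_real_derivative d) (at t)" "L \<le> d"
          using rQ(4)[of x t] t T T0 by auto
        have "has_lap (\<lambda>y. layer \<kappa> (F.barrier y) t / m) (L / m) x"
          using has_lap_cmult[OF Ld(1), of "1 / m"] by simp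
        moreover have "((\<lambda>s. layer \<kappa> (F.barrier x) s / m) has_real_derivative (d / m)) (at t)"
          by (rule DERIV_cdivide[OF Ld(2)])
        ultimately show "\<exists>L d. has_lap (\<lambda>y. layer \<kappa> (F.barrier y) t / m) L x \<and>
             ((\<lambda>s. layer \<kappa> (F.barrier x) s / m) has_real_derivative d) (at t) \<and> 1 * L \<le> 1 * d"
          using Ld(3) m by (intro exI[of _ "L / m"] exI[of _ "d / m"]) (simp add: divide_right_mono)
        show "- 0 \<le> 1 * (layer \<kappa> (F.barrier x) t / m)"
          using l0[of x t] x t m closure_subset[of E] by auto
      next
        show "continuous_on (closure E \<times> {0<..T}) (\<lambda>(x, t). layer \<kappa> (F.barrier x) t / m)"
          using continuous_on_divide[OF layer_continuous[OF F.continuous_barrier[of "closure E"], of T \<kappa>] continuous_on_const[of _ m]] m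
          by (simp add: split_beta)
      next
        fix x t assume x: "x \<in> closure E" "x \<notin> E" and t: "0 < t" "t \<le> T"
        have xc: "x \<in> closure \<Omega>" "x \<in> cball P r" using x clE by auto
        show "1 * u x t \<le> 1 * (layer \<kappa> (F.barrier x) t / m)"
        proof (cases "x \<in> \<Omega>")
          case False
          then have "u x t = 0" using u_bdry[of x t] xc t by (simp add: frontier_def interior_open[OF op])
          then show ?thesis using l0[OF x(1) t] m by simp
        next
          case True
          then have "norm (x - P) = r" using x xc by (auto simp: E_def dist_norm norm_minus_commute)
          then have gs: "F.barrier x \<ge> s0" using g0[OF x(1)] by (simp add: s0_def)
          have "8 * t / (F.barrier x)\<^sup>2 \<le> 8 * T / s0\<^sup>2"
            using t gs s0 T by (intro frac_le power_mono) auto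
          moreover have "layer \<kappa> (F.barrier x) t \<ge> 1 - 8 * t / (F.barrier x)\<^sup>2"
            using rQ(3)[OF xc(2)] gs s0 t by (intro layer_lower) auto
          ultimately have "layer \<kappa> (F.barrier x) t \<ge> m" by (simp add: m_def C_def)
          then have "layer \<kappa> (F.barrier x) t / m \<ge> 1" using m by (simp add: field_simps)
          then show ?thesis using u_le_one[OF xc(1) t(1)] by simp
        qed
      next
        fix x :: 'a and e :: real assume x: "x \<in> closure E \<inter> \<Omega>" and e: "e > 0"
        \<comment> \<open>Within the closure of \<open>E\<close> the barrier vanishes only at
          \<open>P\<close>, which is not in \<Omega>. So it is positive at \<open>x\<close>, and
          \<open>layer_lower\<close> pushes the layer to 1 as the time tends to 0.\<close>
        have "P \<notin> \<Omega>" using fr by (simp add: frontier_def interior_open[OF op])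
        then have "norm (x - P) > 0" using x by auto
        then have gp: "F.barrier x > 0" using g0[of x] x kpos
          by (intro less_le_trans[OF _ g0]) auto
        have g_lim: "((\<lambda>p. F.barrier (fst p)) \<longlongrightarrow> F.barrier x) (at (x, 0) within E \<times> {0<..T})"
          by (rule isCont_tendsto_compose[of _ F.barrier])
             (use F.continuous_barrier[of UNIV] in \<open>auto simp: continuous_on_eq_continuous_at intro!: tendsto_eq_intros\<close>)
        have t_lim: "((\<lambda>p. snd p) \<longlongrightarrow> 0) (at (x, 0) within E \<times> {0<..T})"
          by (auto intro!: tendsto_eq_intros)
        have "((\<lambda>p. 1 - 8 * snd p / (F.barrier (fst p))\<^sup>2) \<longlongrightarrow> 1 - 8 * 0 / (F.barrier x)\<^sup>2) (at (x, 0) within E \<times> {0<..T})"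
          by (intro tendsto_intros g_lim t_lim) (use gp in auto)
        then have "\<forall>\<^sub>F p in at (x, 0) within E \<times> {0<..T}. 1 - 8 * snd p / (F.barrier (fst p))\<^sup>2 > 1 - e"
          by (rule order_tendstoD(1)) (use e in auto)
        moreover have "\<forall>\<^sub>F p in at (x, 0) within E \<times> {0<..T}. F.barrier (fst p) > 0"
          using order_tendstoD(1)[OF g_lim gp] .
        moreover have "\<forall>\<^sub>F p in at (x, 0) within E \<times> {0<..T}. p \<in> E \<times> {0<..T}" by (simp add: eventually_at_filter)
        ultimately show "\<forall>\<^sub>F p in at (x, 0) within E \<times> {0<..T}. 1 * (layer \<kappa> (F.barrier (fst p)) (snd p) / m) \<ge> 1 - e"
        proof eventually_elim
          case (elim p)
          then have p: "fst p \<in> E" "0 < snd p" "snd p \<le> T" by auto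
          then have pc: "fst p \<in> closure E" "fst p \<in> cball P r" using closure_subset[of E] by (auto simp: E_def)
          have "layer \<kappa> (F.barrier (fst p)) (snd p) \<ge> 1 - 8 * snd p / (F.barrier (fst p))\<^sup>2"
            using rQ(3)[OF pc(2)] elim p by (intro layer_lower) auto
          then show ?case using ge[OF pc(1) p(2,3)] elim(1) by simp
        qed
      qed
      then show ?thesis by simp
    qed
    have "\<forall>\<^sub>F h in at_right 0. P - h *\<^sub>R \<nu> \<in> \<Omega> \<inter> ball P r"
      by (rule inner_ray_eventually[OF ld P _ _ \<nu>_def]) (use r in auto)
    then have "\<forall>\<^sub>F h in at_right 0. 1 * u (P - h *\<^sub>R \<nu>) T \<le> 1 * (layer \<kappa> h T / m)"
    proof eventually_elim
      case (elim h)
      from comp[of "P - h *\<^sub>R \<nu>"] elim show ?case using F.barrier_ray[of h] by (simp add: E_def)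
    qed
    from normal_deriv_compare[OF nd local_defining_outer_normal[OF ld P, folded \<nu>_def] u_bdry[OF fr T(1)]
        DERIV_cdivide[OF layer_deriv_s[OF T(1)]] _ this]
    show ?thesis by (simp add: layer_s_0 m_def)
  qed
  show ?thesis by (rule that[OF C T0(1) CT0 main])
qed

text \<open>Now \<eta> < 0, so the region where the barrier is nonnegative touches the complement of
  \<Omega> only at \<open>P\<close>. The comparison takes place in that region: where the barrier is
  0 the layer is 0 and u \<ge> 0, and on the sphere \<open>u\<close> is close to 1 by the interior
  estimate, so the layer is multiplied by 1 - C T.\<close>

lemma normal_derivative_lower:
  assumes ld: "local_defining \<Omega> U \<rho>" and P: "P \<in> U" "\<rho> P = 0" and k: "\<kappa> < - mean_curv \<rho> P"
  obtains C T0 where "C > 0" "T0 > 0" "C * T0 < 1"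
    "\<And>T b. 0 < T \<Longrightarrow> T < T0 \<Longrightarrow> normal_deriv_eq \<Omega> (\<lambda>y. u y T) P b \<Longrightarrow>
       (erf_slope / (2 * sqrt T) + \<kappa> / 2) * (1 - C * T) \<le> - b"
proof -
  note D = local_definingD[OF ld]
  have fr: "P \<in> frontier \<Omega>" using local_defining_frontier[OF op ld P(1)] P(2) by simp
  define \<delta> where "\<delta> = - mean_curv \<rho> P - \<kappa>"
  have \<delta>: "\<delta> > 0" using k by (simp add: \<delta>_def)
  define \<eta> where "\<eta> = - (\<delta> / (2 * DIM('a)))"
  have \<eta>: "\<eta> < 0" using \<delta> by (simp add: \<eta>_def)
  define N where "N = norm (grad \<rho> P)"
  define \<nu> where "\<nu> = grad \<rho> P /\<^sub>R norm (grad \<rho> P)"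
  define B where "B = (\<lambda>v w. hess \<rho> P v w / N - \<eta> * (v \<bullet> w))"
  obtain \<beta> where \<beta>: "\<And>c. c \<ge> 0 \<Longrightarrow> boundary_frame \<nu> B c \<beta>"
    and tr: "(\<Sum>i\<in>Basis. B i i) - B \<nu> \<nu> = mean_curv \<rho> P - \<eta> * (DIM('a) - 1)"
    and N: "grad \<rho> P = N *\<^sub>R \<nu>" "N > 0"
    using boundary_frameI[OF D(1,2) P(1) D(4)[OF P(1)], of \<eta>] unfolding N_def \<nu>_def B_def by blast
  interpret F: boundary_frame P \<nu> B "(\<beta> + 1)\<^sup>2" \<beta> by (rule \<beta>) simp
  have k2: "- 1 * - ((\<Sum>i\<in>Basis. B i i) - B \<nu> \<nu>) \<le> - 1 * \<kappa> - 2 * (\<delta> / 4)"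
  proof -
    define q where "q = \<eta> * (DIM('a) - 1)"
    have "- q \<le> (- \<eta>) * DIM('a)" unfolding q_def mult_minus_left[symmetric]
      using \<eta> by (intro mult_left_mono) auto
    also have "\<dots> = \<delta> / 2" by (simp add: \<eta>_def)
    finally have "mean_curv \<rho> P - q \<le> - \<kappa> - \<delta> / 2" using \<delta>_def by linarith
    then show ?thesis unfolding tr q_def[symmetric] by simp
  qed
  obtain T1 where T1: "T1 > 0" "\<forall>\<^sub>F x in nhds P. \<bar>\<kappa>\<bar> * \<bar>F.barrier x\<bar> \<le> 2 \<and> (F.barrier x \<ge> 0 \<longrightarrow> (\<forall>t. 0 < t \<and> t \<le> T1 \<longrightarrow>
       (\<exists>L d. has_lap (\<lambda>y. layer \<kappa> (F.barrier y) t) L x \<and>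
          ((\<lambda>s. layer \<kappa> (F.barrier x) s) has_real_derivative d) (at t) \<and> - 1 * L \<le> - 1 * d)))"
    using F.layer_barrier_supersolution[of "- 1" "\<delta> / 4" \<kappa>] k2 \<delta> by auto
  have cmp: "\<forall>\<^sub>F x in nhds P. x \<in> U \<and> (F.barrier x \<ge> 0 \<longrightarrow> x \<noteq> P \<longrightarrow> \<rho> x < 0)"
    using barrier_compare[OF D(1,2) P N \<beta>[unfolded B_def, OF zero_le_power2[of "\<beta> + 1"]] less_imp_neq[OF \<eta>]]
    unfolding B_def[symmetric]
  proof eventually_elim
    case (elim x)
    define g X where "g = F.barrier x" and "X = F.tang_sq x"
    have 1: "\<bar>N * g + \<rho> x - \<eta> * N / 2 * X\<bar> \<le> \<bar>\<eta>\<bar> * N / 4 * X + N / 2 * \<bar>g\<bar>"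
      and n: "(norm (x - P))\<^sup>2 \<le> 2 * \<bar>g\<bar> + (1 + \<beta>) * X" and xU: "x \<in> U"
      using elim by (auto simp: g_def X_def)
    have "\<rho> x < 0" if "F.barrier x \<ge> 0" "x \<noteq> P"
    proof -
    have g: "g \<ge> 0" and x: "(norm (x - P))\<^sup>2 > 0" using that by (auto simp: g_def)
    have 2: "0 < 2 * g + (1 + \<beta>) * X" using less_le_trans[OF x n] abs_of_nonneg[OF g] by (simp only:)
    have X: "X \<ge> 0" unfolding X_def by (rule F.tang_sq_nonneg)
    have "\<bar>\<eta>\<bar> = - \<eta>" "\<bar>g\<bar> = g" using \<eta> g by auto
    then have "N * g + \<rho> x - \<eta> * N / 2 * X \<le> - \<eta> * N / 4 * X + N / 2 * g" using 1 by (simp add: abs_le_iff)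
    then have \<rho>: "\<rho> x \<le> - (N * g / 2) - (- \<eta>) * N * X / 4" by (simp add: algebra_simps)
    show ?thesis
    proof (cases "g = 0")
      case True
      then have "X > 0" using 2 X F.\<beta>(1) by (auto simp: zero_less_mult_iff)
      then have "(- \<eta>) * N * X > 0" using \<eta> N by (intro mult_pos_pos) auto
      with \<rho> True show ?thesis by simp
    next
      case False
      then have "N * g > 0" using g N by simp
      moreover have "(- \<eta>) * N * X \<ge> 0" using \<eta> N X by (intro mult_nonneg_nonneg) auto
      ultimately show ?thesis using \<rho> by linarith
    qed
    qed
    with xU show ?case by blast
  qed
  obtain r where r: "r > 0" and rQ: "\<And>x. x \<in> cball P r \<Longrightarrow> x \<in> U"
    "\<And>x. x \<in> cball P r \<Longrightarrow> F.barrier x \<ge> 0 \<Longrightarrow> x \<noteq> P \<Longrightarrow> \<rho> x < 0"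
    "\<And>x. x \<in> cball P r \<Longrightarrow> \<bar>\<kappa>\<bar> * \<bar>F.barrier x\<bar> \<le> 2"
    "\<And>x t. x \<in> cball P r \<Longrightarrow> F.barrier x \<ge> 0 \<Longrightarrow> 0 < t \<Longrightarrow> t \<le> T1 \<Longrightarrow> (\<exists>L d. has_lap (\<lambda>y. layer \<kappa> (F.barrier y) t) L x \<and>
          ((\<lambda>s. layer \<kappa> (F.barrier x) s) has_real_derivative d) (at t) \<and> - 1 * L \<le> - 1 * d)"
    by (rule eventually_nhds_cball[OF eventually_conj[OF cmp T1(2)]]) blast
  \<comment> \<open>A compact subset of \<Omega>, hence at a positive distance from the complement;
    \<open>u_interior_lower\<close> on balls of one common radius \<open>a\<close> then gives u
    \<ge> 1 - C t on all of it.\<close>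
  define S where "S = {x \<in> sphere P r. F.barrier x \<ge> 0}"
  have "closed {x. F.barrier x \<ge> 0}" by (intro closed_Collect_le continuous_on_const F.continuous_barrier)
  then have "compact (sphere P r \<inter> {x. F.barrier x \<ge> 0})" by (intro compact_Int_closed compact_sphere)
  moreover have "sphere P r \<inter> {x. F.barrier x \<ge> 0} = S" by (auto simp: S_def)
  ultimately have S: "compact S" by simp
  have SO: "S \<subseteq> \<Omega>"
  proof
    fix x assume "x \<in> S"
    then have "x \<in> cball P r" "F.barrier x \<ge> 0" "x \<noteq> P" using r by (auto simp: S_def)
    then show "x \<in> \<Omega>" using rQ(1,2)[of x] D(3)[of x] by auto
  qed
  obtain a where a: "a > 0" "(\<Union>x\<in>S. cball x a) \<subseteq> \<Omega>"
    using compact_subset_open_imp_cball_epsilon_subset[OF S op SO] by blast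
  define C where "C = 2 * DIM('a) / a\<^sup>2"
  have C: "C > 0" using a by (simp add: C_def)
  define T0 where "T0 = min T1 (1 / (2 * C))"
  have T0: "T0 > 0" "T0 \<le> T1" using T1(1) C by (auto simp: T0_def)
  have CT0: "C * T0 < 1"
  proof -
    have "C * T0 \<le> C * (1 / (2 * C))" using C by (intro mult_left_mono) (auto simp: T0_def)
    also have "\<dots> < 1" using C by simp
    finally show ?thesis .
  qed
  have main: "(erf_slope / (2 * sqrt T) + \<kappa> / 2) * (1 - C * T) \<le> - b"
    if T: "0 < T" "T < T0" and nd: "normal_deriv_eq \<Omega> (\<lambda>y. u y T) P b" for T b
  proof -
    define m where "m = 1 - C * T"
    have "C * T < C * T0" using T C by simp
    then have m: "m > 0" "m \<le> 1" using CT0 T C unfolding m_def by (linarith, simp)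
    define E where "E = {x \<in> ball P r. F.barrier x > 0}"
    have "open {x. F.barrier x > 0}" by (intro open_Collect_less continuous_on_const F.continuous_barrier)
    then have "open (ball P r \<inter> {x. F.barrier x > 0})" by (intro open_Int open_ball)
    moreover have "ball P r \<inter> {x. F.barrier x > 0} = E" by (auto simp: E_def)
    ultimately have E1: "open E" by simp
    have E2: "E \<subseteq> \<Omega>"
    proof
      fix x assume "x \<in> E"
      then have x: "x \<in> cball P r" "F.barrier x > 0" by (auto simp: E_def)
      then have "x \<noteq> P" by auto
      then have "\<rho> x < 0" using rQ(2)[of x] x by simp
      then show "x \<in> \<Omega>" using rQ(1)[OF x(1)] D(3)[of x] by simp
    qed
    have clE: "closure E \<subseteq> cball P r \<inter> {x. F.barrier x \<ge> 0}"
      by (rule closure_minimal) (auto simp: E_def intro!: closed_Int closed_Collect_le continuous_on_const F.continuous_barrier)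
    have l1: "layer \<kappa> (F.barrier x) t \<le> 1" if "x \<in> closure E" for x t
    proof (rule layer_le_one)
      have "x \<in> cball P r" and g: "F.barrier x \<ge> 0" using clE that by auto
      from rQ(3)[OF this(1)] g show "\<bar>\<kappa>\<bar> * F.barrier x \<le> 2" "F.barrier x \<ge> 0" by simp_all
    qed
    have v1: "m * layer \<kappa> (F.barrier x) t \<le> m" if "x \<in> closure E" for x t
      using mult_left_mono[OF l1[OF that], of m] m by simp
    have comp: "m * layer \<kappa> (F.barrier x) T \<le> u x T" if "x \<in> E" for x
    proof -
      have "- 1 * u x T \<le> - 1 * (m * layer \<kappa> (F.barrier x) T)"
      proof (rule u_compare[where M = 1 and T = T, OF E1 E2 _ _ _ _ _ that T(1) order_refl])
        fix x t assume x: "x \<in> E" and t: "0 < t" "t \<le> T"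
        have "x \<in> cball P r" "F.barrier x \<ge> 0" using x by (auto simp: E_def)
        then obtain L d where Ld: "has_lap (\<lambda>y. layer \<kappa> (F.barrier y) t) L x"
          "((\<lambda>s. layer \<kappa> (F.barrier x) s) has_real_derivative d) (at t)" "L \<ge> d"
          using rQ(4)[of x t] t T T0 by auto
        show "\<exists>L d. has_lap (\<lambda>y. m * layer \<kappa> (F.barrier y) t) L x \<and>
             ((\<lambda>s. m * layer \<kappa> (F.barrier x) s) has_real_derivative d) (at t) \<and> - 1 * L \<le> - 1 * d"
          using has_lap_cmult[OF Ld(1), of m] DERIV_cmult[OF Ld(2), of m] Ld(3) m
          by (intro exI[of _ "m * L"] exI[of _ "m * d"]) auto
        show "- 1 \<le> - 1 * (m * layer \<kappa> (F.barrier x) t)"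
          using v1[OF subsetD[OF closure_subset x], of t] m by linarith
      next
        show "continuous_on (closure E \<times> {0<..T}) (\<lambda>(x, t). m * layer \<kappa> (F.barrier x) t)"
          using continuous_on_mult_left[OF layer_continuous[OF F.continuous_barrier[of "closure E"], of T \<kappa>], of m]
          by (simp add: split_beta)
      next
        fix x t assume x: "x \<in> closure E" "x \<notin> E" and t: "0 < t" "t \<le> T"
        have xc: "x \<in> closure \<Omega>" "x \<in> cball P r" "F.barrier x \<ge> 0" using x clE closure_mono[OF E2] by auto
        show "- 1 * u x t \<le> - 1 * (m * layer \<kappa> (F.barrier x) t)"
        proof (cases "F.barrier x = 0")
          case True
          then show ?thesis using u_nonneg[OF xc(1) t(1)] by simp
        next
          case False
          then have "x \<in> S" using x xc by (auto simp: E_def S_def)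
          then have "cball x a \<subseteq> \<Omega>" using a by blast
          from u_interior_lower[OF a(1) this t(1)] have "u x t \<ge> 1 - C * t" by (simp add: C_def)
          moreover have "C * t \<le> C * T" using C t by simp
          ultimately show ?thesis using v1[OF x(1), of t] by (simp add: m_def)
        qed
      next
        fix x :: 'a and e :: real assume "x \<in> closure E \<inter> \<Omega>" and e: "e > 0"
        have "\<forall>\<^sub>F p in at (x, 0) within E \<times> {0<..T}. p \<in> E \<times> {0<..T}" by (simp add: eventually_at_filter)
        then show "\<forall>\<^sub>F p in at (x, 0) within E \<times> {0<..T}. - 1 * (m * layer \<kappa> (F.barrier (fst p)) (snd p)) \<ge> - 1 - e"
        proof eventually_elim
          case (elim p)
          then have "fst p \<in> closure E" using closure_subset[of E] by auto
          from v1[OF this, of "snd p"] show ?case using m e by linarith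
        qed
      qed
      then show ?thesis by simp
    qed
    have "\<forall>\<^sub>F h in at_right 0. P - h *\<^sub>R \<nu> \<in> \<Omega> \<inter> ball P r"
      by (rule inner_ray_eventually[OF ld P _ _ \<nu>_def]) (use r in auto)
    moreover have "\<forall>\<^sub>F h in at_right (0::real). h > 0" by (simp add: eventually_at_filter)
    ultimately have "\<forall>\<^sub>F h in at_right 0. - 1 * u (P - h *\<^sub>R \<nu>) T \<le> - 1 * (m * layer \<kappa> h T)"
    proof eventually_elim
      case (elim h)
      then have "P - h *\<^sub>R \<nu> \<in> E" using F.barrier_ray[of h] by (simp add: E_def)
      from comp[OF this] show ?case using F.barrier_ray[of h] by simp
    qed
    from normal_deriv_compare[OF nd local_defining_outer_normal[OF ld P, folded \<nu>_def] u_bdry[OF fr T(1)]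
        DERIV_cmult[OF layer_deriv_s[OF T(1)]] _ this]
    show ?thesis by (simp add: layer_s_0 m_def mult.commute)
  qed
  show ?thesis by (rule that[OF C T0(1) CT0 main])
qed

text \<open>The leading terms \<open>1 / sqrt (\<pi> t)\<close> of the two asymptotic bounds agree, so the
  curvature terms can be compared as \<open>t \<rightarrow> 0\<close>.\<close>

lemma mean_curv_constant:
  assumes ld: "local_defining \<Omega> U \<rho>" "P \<in> U" "\<rho> P = 0"
    and ld': "local_defining \<Omega> U' \<rho>'" "P' \<in> U'" "\<rho>' P' = 0"
    and tb: "\<And>n::nat. t n > 0" "0 islimpt range t"
    and nd: "\<And>n. \<forall>x\<in>frontier \<Omega>. normal_deriv_eq \<Omega> (\<lambda>y. u y (t n)) x (b n)"
  shows "mean_curv \<rho> P \<le> mean_curv \<rho>' P'"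
proof (rule ccontr)
  assume "\<not> ?thesis"
  then obtain k2 k1 where k: "- mean_curv \<rho> P < k1" "k1 < k2" "k2 < - mean_curv \<rho>' P'"
    by (metis dense neg_less_iff_less not_le)
  obtain C1 T1 where 1: "C1 > 0" "T1 > 0" "C1 * T1 < 1"
    "\<And>T b. 0 < T \<Longrightarrow> T < T1 \<Longrightarrow> normal_deriv_eq \<Omega> (\<lambda>y. u y T) P b \<Longrightarrow>
       - b \<le> (erf_slope / (2 * sqrt T) + k1 / 2) / (1 - C1 * T)"
    by (rule normal_derivative_upper[OF ld k(1)]) blast
  obtain C2 T2 where 2: "C2 > 0" "T2 > 0" "C2 * T2 < 1"
    "\<And>T b. 0 < T \<Longrightarrow> T < T2 \<Longrightarrow> normal_deriv_eq \<Omega> (\<lambda>y. u y T) P' b \<Longrightarrow>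
       (erf_slope / (2 * sqrt T) + k2 / 2) * (1 - C2 * T) \<le> - b"
    by (rule normal_derivative_lower[OF ld' k(3)]) blast
  have fr: "P \<in> frontier \<Omega>" "P' \<in> frontier \<Omega>"
    using local_defining_frontier[OF op ld(1,2)] local_defining_frontier[OF op ld'(1,2)] ld(3) ld'(3) by auto
  define C where "C = C1 + C2"
  have C: "C > 0" using 1 2 by (simp add: C_def)
  \<comment> \<open>This is (A + k2 / 2) C T written in s = sqrt T. The leading term
    \<open>A\<close> has order 1 / s and the relative error has order s^2, so their product tends to
    0 while the gap between \<open>k1\<close> and \<open>k2\<close> stays.\<close>
  define f where "f = (\<lambda>s::real. (erf_slope / 2 * s * C + (k2 / 2) * (s\<^sup>2 * C)))"
  have "(f \<longlongrightarrow> erf_slope / 2 * 0 * C + (k2 / 2) * (0\<^sup>2 * C)) (at_right 0)"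
    unfolding f_def by (intro tendsto_intros)
  then have "\<forall>\<^sub>F s in at_right 0. f s < (k2 - k1) / 2"
    by (intro order_tendstoD(2)) (use k in auto)
  then obtain s0 where s0: "s0 > 0" "\<And>s. 0 < s \<Longrightarrow> s < s0 \<Longrightarrow> f s < (k2 - k1) / 2"
    unfolding eventually_at_right_field by auto
  define e where "e = min (min T1 T2) (s0\<^sup>2)"
  have "e > 0" using 1 2 s0 by (simp add: e_def)
  then obtain n where n: "\<bar>t n\<bar> < e"
    using tb(2) unfolding islimpt_approachable by (auto simp: dist_real_def)
  define T where "T = t n"
  have T: "0 < T" "T < T1" "T < T2" "T < s0\<^sup>2" using n tb(1)[of n] by (auto simp: T_def e_def)
  define s where "s = sqrt T"
  have s: "s > 0" "s\<^sup>2 = T" "s < s0" using T s0(1) real_less_lsqrt[of s0 T] by (auto simp: s_def)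
  have m1: "1 - C1 * T > 0" using mult_strict_left_mono[OF T(2) 1(1)] 1(3) by linarith
  have m2: "1 - C2 * T > 0" using mult_strict_left_mono[OF T(3) 2(1)] 2(3) by linarith
  define A where "A = erf_slope / (2 * s)"
  have "(A + k2 / 2) * (1 - C2 * T) \<le> (A + k1 / 2) / (1 - C1 * T)"
    using 1(4)[OF T(1,2), of "b n"] 2(4)[OF T(1,3), of "b n"] nd[of n] fr by (fastforce simp: T_def A_def s_def)
  then have le: "(A + k2 / 2) * (1 - C2 * T) * (1 - C1 * T) \<le> A + k1 / 2"
    by (rule iffD1[OF pos_le_divide_eq[OF m1]])
  define X q1 q2 where "X = (A + k2 / 2) * (1 - C2 * T) * (1 - C1 * T)" and "q1 = (A + k2 / 2) * (C * T)"
    and "q2 = (A + k2 / 2) * (C1 * C2 * T\<^sup>2)"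
  have "(A + k2 / 2) * (1 - C2 * T) * (1 - C1 * T) =
     (A + k2 / 2) - (A + k2 / 2) * (C * T) + (A + k2 / 2) * (C1 * C2 * T\<^sup>2)"
  proof -
    have "D * (1 - C2 * T) * (1 - C1 * T) = D - D * (C * T) + D * (C1 * C2 * T\<^sup>2)" for D
      unfolding C_def power2_eq_square by (simp add: algebra_simps)
    then show ?thesis .
  qed
  then have "X = A + k2 / 2 - q1 + q2" "X \<le> A + k1 / 2" using le unfolding X_def q1_def q2_def by auto
  then have "k2 / 2 - k1 / 2 + q2 \<le> q1" by linarith
  then have "(k2 - k1) / 2 + q2 \<le> q1" by (simp add: diff_divide_distrib)
  then have A1: "(k2 - k1) / 2 + (A + k2 / 2) * (C1 * C2 * T\<^sup>2) \<le> (A + k2 / 2) * (C * T)"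
    unfolding q1_def q2_def .
  have fs: "(A + k2 / 2) * (C * T) = f s"
    using s by (simp add: A_def f_def s(2)[symmetric] power2_eq_square field_simps)
  show False
  proof (cases "A + k2 / 2 \<ge> 0")
    case True
    then have "(A + k2 / 2) * (C1 * C2 * T\<^sup>2) \<ge> 0" using 1 2 by simp
    then show False using A1 fs s0(2)[OF s(1,3)] by linarith
  next
    case False
    \<comment> \<open>A negative number only grows under multiplication by a factor between 0 and 1,
      so here the correction factors cannot spoil the comparison of \<open>k1\<close> with
      \<open>k2\<close>.\<close>
    then have "(A + k2 / 2) * (1 - C2 * T) * (1 - C1 * T) \<ge> (A + k2 / 2)"
    proof -
      have "(1 - C2 * T) * (1 - C1 * T) \<le> 1 * 1" using m1 m2 1 2 T by (intro mult_mono) auto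
      then show ?thesis using mult_left_mono_neg[of "(1 - C2 * T) * (1 - C1 * T)" 1 "A + k2 / 2"] False
        by (simp add: mult.assoc)
    qed
    then show False using le k by linarith
  qed
qed

end

section \<open>Strong maximum principle, Hopf lemma and reflections\<close>

text \<open>With \<open>y\<close> interior this is the strong maximum principle; the linear lower bound at the sphere
  is the Hopf boundary point lemma. The barrier lives on a ball growing from time \<open>t0\<close> to \<open>t1\<close>.\<close>

lemma heat_positivity_spreads:
  fixes w :: "'a::euclidean_space \<Rightarrow> real \<Rightarrow> real"
  assumes R: "R > 0" and t: "t0 < t1"
    and heat: "\<And>x t. x \<in> ball y R \<Longrightarrow> t0 < t \<Longrightarrow> t \<le> t1 \<Longrightarrow>
      \<exists>L. has_lap (\<lambda>z. w z t) L x \<and> ((\<lambda>s. w x s) has_real_derivative L) (at t)"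
    and cont: "continuous_on (cball y R \<times> {t0..t1}) (\<lambda>(x, t). w x t)"
    and nonneg: "\<And>x t. x \<in> cball y R \<Longrightarrow> t0 \<le> t \<Longrightarrow> t \<le> t1 \<Longrightarrow> w x t \<ge> 0"
    and pos: "w y t0 > 0"
  obtains \<epsilon> where "\<epsilon> > 0" "\<And>x. x \<in> ball y R \<Longrightarrow> w x t1 \<ge> \<epsilon> * (R\<^sup>2 - (norm (x - y))\<^sup>2)"
proof -
  define m where "m = w y t0 / 2"
  have m: "m > 0" using pos by (simp add: m_def)
  have "continuous_on (cball y R) (\<lambda>x. w x t0)"
  proof -
    have "continuous_on (cball y R) (\<lambda>x. (x, t0))" by (intro continuous_intros)
    from continuous_on_compose2[OF cont this] t show ?thesis by (simp add: image_subset_iff)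
  qed
  then have "((\<lambda>x. w x t0) \<longlongrightarrow> w y t0) (at y within cball y R)" using R by (auto simp: continuous_on_def)
  then have "\<forall>\<^sub>F x in at y within cball y R. w x t0 > m" by (rule order_tendstoD(1)) (use pos in \<open>simp add: m_def\<close>)
  then obtain \<delta> where \<delta>: "\<delta> > 0" "\<And>x. x \<in> cball y R \<Longrightarrow> x \<noteq> y \<Longrightarrow> dist x y < \<delta> \<Longrightarrow> w x t0 > m"
    unfolding eventually_at by auto
  \<comment> \<open>The squared radius of a ball on which \<open>w\<close> is at least
    \<open>m\<close> at time \<open>t0\<close>. The comparison region is the ball of squared radius
    a + k s, which reaches R^2 at the final time.\<close>
  define a where "a = (min (\<delta> / 2) (R / 2))\<^sup>2"
  have a: "a > 0" "a < R\<^sup>2"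
  proof -
    show "a > 0" using \<delta>(1) R by (simp add: a_def)
    have "a \<le> (R / 2)\<^sup>2" unfolding a_def using \<delta>(1) R by (intro power_mono) auto
    also have "(R / 2)\<^sup>2 < R\<^sup>2" using R by (intro power_strict_mono) auto
    finally show "a < R\<^sup>2" .
  qed
  have init: "w x t0 \<ge> m" if "(norm (x - y))\<^sup>2 \<le> a" for x
  proof -
    have "norm (x - y) \<le> min (\<delta> / 2) (R / 2)"
      using that unfolding a_def by (rule power2_le_imp_le) (use \<delta>(1) R in simp)
    then have "norm (x - y) \<le> \<delta> / 2" "norm (x - y) \<le> R / 2" by simp_all
    then have "x \<in> cball y R" "dist x y < \<delta>"
      using \<delta>(1) R unfolding mem_cball dist_norm norm_minus_commute[of y x] by linarith+
    then show ?thesis using \<delta>(2)[of x] pos by (cases "x = y") (auto simp: m_def)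
  qed
  define T where "T = t1 - t0"
  have T: "T > 0" using t by (simp add: T_def)
  define k where "k = (R\<^sup>2 - a) / T"
  have k: "k > 0" using a T by (simp add: k_def)
  define n where "n = real DIM('a)"
  have n: "n > 0" by (simp add: n_def)
  \<comment> \<open>The barrier is a decaying multiple of q^2 + c q, where \<open>q\<close> is the
    squared radius minus the squared distance. The term c q provides the Hopf slope;
    \<open>c\<close> is chosen so that its unfavourable contribution c (k + 2 n) is exactly half of
    the gain 8 a near the lateral boundary.\<close>
  define c where "c = 4 * a / (k + 2 * n)"
  have c: "c > 0" "c * (k + 2 * n) = 4 * a" using a k n by (auto simp: c_def)
  define \<beta> where "\<beta> = 2 * k + 8 + 4 * n"
  \<comment> \<open>The decay rate for which \<beta> r \<le> \<alpha> r^2 + 4 a holds for all r; the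
    remaining 4 a of the gain is thereby used up.\<close>
  define \<alpha> where "\<alpha> = \<beta>\<^sup>2 / (16 * a)"
  have \<alpha>: "\<alpha> > 0" using a k n by (simp add: \<alpha>_def \<beta>_def add_pos_pos)
  define \<epsilon> where "\<epsilon> = m / (a\<^sup>2 + c * a)"
  have \<epsilon>: "\<epsilon> > 0" "\<epsilon> * (a\<^sup>2 + c * a) = m"
  proof -
    have "a\<^sup>2 + c * a > 0" using a c by (intro add_pos_pos mult_pos_pos) auto
    then show "\<epsilon> > 0" "\<epsilon> * (a\<^sup>2 + c * a) = m" using m by (auto simp: \<epsilon>_def)
  qed
  define q where "q = (\<lambda>x s. a + k * s - (norm (x - y))\<^sup>2)"
  define \<phi> where "\<phi> = (\<lambda>x s. \<epsilon> * exp (- \<alpha> * s) * ((q x s)\<^sup>2 + c * q x s))"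
  define W where "W = (\<lambda>x s. w x (t0 + s) - \<phi> x s)"
  define O' where "O' = {p. q (fst p) (snd p) > 0}"
  define Q where "Q = O' \<inter> {p. 0 < snd p \<and> snd p \<le> T}"
  have qc: "continuous_on S (\<lambda>p. q (fst p) (snd p))" for S :: "('a \<times> real) set"
    unfolding q_def by (intro continuous_intros)
  have O': "open O'" unfolding O'_def by (intro open_Collect_less continuous_on_const qc)
  have kT: "a + k * s \<le> R\<^sup>2" if "s \<le> T" for s
  proof -
    have "k * s \<le> k * T" using that k by simp
    also have "\<dots> = R\<^sup>2 - a" using T by (simp add: k_def)
    finally show ?thesis by simp
  qed
  have inb: "norm (x - y) \<le> R" if "q x s \<ge> 0" "s \<le> T" for x s
  proof -
    have "(norm (x - y))\<^sup>2 \<le> R\<^sup>2" using that kT[of s] by (simp add: q_def)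
    then show ?thesis by (rule power2_le_imp_le) (use R in simp)
  qed
  have inb': "norm (x - y) < R" if "q x s > 0" "s \<le> T" for x s
  proof -
    have "(norm (x - y))\<^sup>2 < R\<^sup>2" using that kT[of s] by (simp add: q_def)
    then show ?thesis by (rule power2_less_imp_less) (use R in simp)
  qed
  define S where "S = cball y R \<times> {0..T}"
  have QS: "Q \<subseteq> S"
  proof
    fix p assume "p \<in> Q"
    then have "q (fst p) (snd p) > 0" "0 < snd p" "snd p \<le> T" by (auto simp: Q_def O'_def)
    then show "p \<in> S" using inb[of "fst p" "snd p"]
      by (simp add: S_def mem_Times_iff dist_norm norm_minus_commute[of y])
  qed
  have clQ: "closure Q \<subseteq> S \<inter> {p. q (fst p) (snd p) \<ge> 0}"
  proof (rule closure_minimal)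
    show "Q \<subseteq> S \<inter> {p. q (fst p) (snd p) \<ge> 0}" using QS by (auto simp: Q_def O'_def)
    show "closed (S \<inter> {p. q (fst p) (snd p) \<ge> 0})" unfolding S_def
      by (intro closed_Int closed_Times closed_cball closed_atLeastAtMost closed_Collect_le continuous_on_const qc)
  qed
  have wc: "continuous_on S (\<lambda>p. w (fst p) (t0 + snd p))"
  proof -
    have "continuous_on S (\<lambda>p. (fst p, t0 + snd p))" by (intro continuous_intros)
    from continuous_on_compose2[OF cont this] show ?thesis
      by (simp add: S_def T_def image_subset_iff)
  qed
  have Wc: "continuous_on S (\<lambda>(x, s). W x s)"
    unfolding W_def \<phi>_def split_beta by (intro continuous_intros wc qc)
  have "compact ((\<lambda>(x, s). W x s) ` S)"
    by (rule compact_continuous_image[OF Wc]) (simp add: S_def compact_Times)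
  then obtain M where M: "\<And>v. v \<in> (\<lambda>(x, s). W x s) ` S \<Longrightarrow> \<bar>v\<bar> \<le> M"
    using compact_imp_bounded bounded_real by metis
  have "0 \<le> W x T" if x: "x \<in> ball y R" for x
  proof (rule heat_min_principle[where Z = "{}" and w = W and x = x and t = T and M = M, OF O' Q_def])
    show "bounded Q" by (rule bounded_subset[OF _ QS]) (simp add: S_def bounded_Times)
    show "continuous_on Q (\<lambda>(x, t). W x t)" by (rule continuous_on_subset[OF Wc QS])
    show "- M \<le> W x t" if "(x, t) \<in> Q" for x t
    proof -
      have "(\<lambda>(x, s). W x s) (x, t) \<in> (\<lambda>(x, s). W x s) ` S" using that QS by (intro imageI) auto
      from M[OF this] show ?thesis by simp
    qed
    show "(x, T) \<in> Q"
    proof -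
      have "(norm (x - y))\<^sup>2 < R\<^sup>2" using x R by (intro power_strict_mono) (auto simp: dist_norm norm_minus_commute)
      moreover have "a + k * T = R\<^sup>2" using T by (simp add: k_def)
      ultimately show ?thesis using T by (simp add: Q_def O'_def q_def)
    qed
    show "\<forall>\<^sub>F p in at (x, s) within Q. - e < W (fst p) (snd p)"
      if "(x, s) \<in> closure Q" "(x, s) \<notin> Q" "0 < e" for x s e
    proof (rule eventually_within_continuous_ge[OF Wc _ QS _ \<open>0 < e\<close>])
      show xS: "(x, s) \<in> S" using that clQ by auto
      then have xs: "x \<in> cball y R" "0 \<le> s" "s \<le> T" by (auto simp: S_def)
      have q0: "q x s \<ge> 0" using that clQ by auto
      show "0 \<le> W x s"
      proof (cases "s = 0")
        case True
        have qa: "q x 0 \<le> a" by (simp add: q_def)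
        have "(norm (x - y))\<^sup>2 \<le> a" using q0 True by (simp add: q_def)
        then have "w x t0 \<ge> m" by (rule init)
        moreover have "\<phi> x 0 \<le> m"
        proof -
          have "(q x 0)\<^sup>2 + c * q x 0 \<le> a\<^sup>2 + c * a" using qa q0 True c by (intro add_mono power_mono mult_left_mono) auto
          then have "\<epsilon> * ((q x 0)\<^sup>2 + c * q x 0) \<le> \<epsilon> * (a\<^sup>2 + c * a)" using \<epsilon> by (intro mult_left_mono) auto
          then show ?thesis using \<epsilon>(2) by (simp add: \<phi>_def)
        qed
        ultimately show ?thesis using True by (simp add: W_def)
      next
        case False
        then have "q x s = 0" using that q0 xs by (auto simp: Q_def O'_def)
        moreover have "w x (t0 + s) \<ge> 0" using xs by (intro nonneg) (auto simp: T_def)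
        ultimately show ?thesis by (simp add: W_def \<phi>_def)
      qed
    qed
    show "heat_supersolution Q W" unfolding heat_supersolution_def
    proof (intro allI impI)
      fix x s assume xs: "(x, s) \<in> Q"
      then have s: "0 < s" "s \<le> T" "q x s > 0" by (auto simp: Q_def O'_def)
      have xb: "x \<in> ball y R" using inb'[OF s(3,2)] by (simp add: dist_norm norm_minus_commute)
      obtain L where L: "has_lap (\<lambda>z. w z (t0 + s)) L x" "((\<lambda>s. w x s) has_real_derivative L) (at (t0 + s))"
        using heat[of x "t0 + s"] xb s by (auto simp: T_def)
      have Lt: "((\<lambda>s. w x (t0 + s)) has_real_derivative L) (at s)"
      proof -
        have "((\<lambda>s. t0 + s) has_real_derivative 1) (at s)" by (auto intro!: derivative_eq_intros)
        from DERIV_chain2[where f = "w x" and g = "\<lambda>s. t0 + s", OF L(2) this] show ?thesis by simp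
      qed
      define E where "E = \<epsilon> * exp (- \<alpha> * s)"
      have E: "E > 0" using \<epsilon> by (simp add: E_def)
      define A where "A = a + k * s"
      define N where "N = (norm (x - y))\<^sup>2"
      have qN: "q x s = A - N" by (simp add: q_def A_def N_def)
      define \<psi> where "\<psi> = (\<lambda>z. E * ((A - z)\<^sup>2 + c * (A - z)))"
      have p1: "(\<psi> has_real_derivative E * (- 2 * (A - z) - c)) (at z)" for z
        unfolding \<psi>_def by (auto intro!: derivative_eq_intros simp: algebra_simps)
      have p2: "((\<lambda>z. E * (- 2 * (A - z) - c)) has_real_derivative 2 * E) (at z)" for z
        by (auto intro!: derivative_eq_intros)
      have l: "has_lap (\<lambda>x. \<psi> ((norm (x - y))\<^sup>2)) (2 * E * (norm (2 *\<^sub>R (x - y)))\<^sup>2 +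
          E * (- 2 * (A - N) - c) * (\<Sum>i\<in>(Basis :: 'a set). 2 * (i \<bullet> i))) x"
        unfolding N_def by (rule jet2_compose[OF jet2_norm_sq _ p2]) (intro always_eventually allI p1)
      have l1: "(norm (2 *\<^sub>R (x - y)))\<^sup>2 = 4 * N" by (simp add: N_def power_mult_distrib)
      have l2: "(\<Sum>i\<in>(Basis :: 'a set). 2 * (i \<bullet> i)) = 2 * n" by (simp add: n_def)
      have l3: "(\<lambda>x. \<psi> ((norm (x - y))\<^sup>2)) = (\<lambda>x. \<phi> x s)"
        by (rule ext) (simp add: \<psi>_def \<phi>_def q_def A_def E_def)
      have L\<phi>: "has_lap (\<lambda>x. \<phi> x s) (2 * E * (4 * N) + E * (- 2 * (A - N) - c) * (2 * n)) x"
        using l unfolding l1 l2 l3 .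
      have dq: "((\<lambda>s. q x s) has_real_derivative k) (at s)"
        unfolding q_def by (auto intro!: derivative_eq_intros)
      have de: "((\<lambda>s. \<epsilon> * exp (- \<alpha> * s)) has_real_derivative - \<alpha> * E) (at s)"
        unfolding E_def by (auto intro!: derivative_eq_intros)
      have d\<phi>: "((\<lambda>s. \<phi> x s) has_real_derivative - \<alpha> * E * ((A - N)\<^sup>2 + c * (A - N)) + E * (2 * (A - N) * k + c * k)) (at s)"
        unfolding \<phi>_def
        by (rule DERIV_cong[OF DERIV_mult[OF de DERIV_add[OF DERIV_power[OF dq, of 2] DERIV_cmult[OF dq, of c]]]])
           (simp add: E_def qN algebra_simps)
      define r where "r = A - N"
      have r: "r > 0" "N = A - r" using s(3) by (auto simp: r_def qN)
      have A: "A \<ge> a" using s k by (simp add: A_def)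
      have key: "- \<alpha> * (r\<^sup>2 + c * r) + (2 * r * k + c * k) \<le> 2 * (4 * N) + (- 2 * r - c) * (2 * n)"
      proof -
        \<comment> \<open>The inequality between the arithmetic and geometric mean that dictated
          \<open>\<alpha>\<close>, after multiplication by 16 a.\<close>
        have "0 \<le> (\<beta> * r - 8 * a)\<^sup>2" by simp
        then have "0 \<le> \<beta>\<^sup>2 * r\<^sup>2 - 16 * a * (\<beta> * r) + 64 * a\<^sup>2"
          by (simp add: power2_eq_square algebra_simps)
        then have "16 * a * (\<beta> * r) \<le> 16 * a * (\<alpha> * r\<^sup>2 + 4 * a)"
          using a by (simp add: \<alpha>_def power2_eq_square algebra_simps)
        then have 1: "\<beta> * r \<le> \<alpha> * r\<^sup>2 + 4 * a" using a by simp
        have 2: "\<alpha> * (c * r) \<ge> 0" using \<alpha> c r by simp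
        have "- \<alpha> * (r\<^sup>2 + c * r) + (2 * r * k + c * k) - (2 * (4 * N) + (- 2 * r - c) * (2 * n))
          = - (\<alpha> * r\<^sup>2) - \<alpha> * (c * r) + \<beta> * r + c * (k + 2 * n) - 8 * A"
          unfolding r(2) \<beta>_def by (simp add: algebra_simps)
        also have "\<dots> \<le> 0" using 1 2 c(2) A a by linarith
        finally show ?thesis by simp
      qed
      have "- \<alpha> * E * ((A - N)\<^sup>2 + c * (A - N)) + E * (2 * (A - N) * k + c * k)
         = E * (- \<alpha> * (r\<^sup>2 + c * r) + (2 * r * k + c * k))" by (simp add: r_def[symmetric] algebra_simps)
      also have "\<dots> \<le> E * (2 * (4 * N) + (- 2 * r - c) * (2 * n))" using key E by (intro mult_left_mono) auto
      also have "\<dots> = 2 * E * (4 * N) + E * (- 2 * (A - N) - c) * (2 * n)" by (simp add: r_def[symmetric] algebra_simps)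
      finally have le: "- \<alpha> * E * ((A - N)\<^sup>2 + c * (A - N)) + E * (2 * (A - N) * k + c * k)
         \<le> 2 * E * (4 * N) + E * (- 2 * (A - N) - c) * (2 * n)" .
      have "has_lap (\<lambda>z. W z s) (L - (2 * E * (4 * N) + E * (- 2 * (A - N) - c) * (2 * n))) x"
        unfolding W_def by (rule has_lap_diff[OF L(1) L\<phi>])
      moreover have "((\<lambda>s. W x s) has_real_derivative (L - (- \<alpha> * E * ((A - N)\<^sup>2 + c * (A - N)) + E * (2 * (A - N) * k + c * k))))
         (at s within {..s})"
        unfolding W_def by (rule DERIV_subset[OF DERIV_diff[OF Lt d\<phi>]]) simp
      ultimately show "\<exists>L d. has_lap (\<lambda>y. W y s) L x \<and> ((\<lambda>r. W x r) has_real_derivative d) (at s within {..s}) \<and> L \<le> d"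
        using le by (meson diff_left_mono)
    qed
  qed auto
  then have W: "w x t1 \<ge> \<phi> x T" if "x \<in> ball y R" for x using that by (auto simp: W_def T_def)
  define \<epsilon>' where "\<epsilon>' = \<epsilon> * exp (- \<alpha> * T) * c"
  have "\<epsilon>' > 0" using \<epsilon> c by (simp add: \<epsilon>'_def)
  moreover have "w x t1 \<ge> \<epsilon>' * (R\<^sup>2 - (norm (x - y))\<^sup>2)" if "x \<in> ball y R" for x
  proof -
    have "q x T = R\<^sup>2 - (norm (x - y))\<^sup>2" using T by (simp add: q_def k_def)
    then have "\<phi> x T = \<epsilon> * exp (- \<alpha> * T) * ((R\<^sup>2 - (norm (x - y))\<^sup>2)\<^sup>2 + c * (R\<^sup>2 - (norm (x - y))\<^sup>2))" by (simp add: \<phi>_def)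
    moreover have "\<epsilon> * exp (- \<alpha> * T) * (c * (R\<^sup>2 - (norm (x - y))\<^sup>2)) \<le> \<epsilon> * exp (- \<alpha> * T) * ((R\<^sup>2 - (norm (x - y))\<^sup>2)\<^sup>2 + c * (R\<^sup>2 - (norm (x - y))\<^sup>2))"
      using \<epsilon> by (intro mult_left_mono) auto
    ultimately show ?thesis using W[OF that] by (simp add: \<epsilon>'_def)
  qed
  ultimately show ?thesis using that by blast
qed

section \<open>Reflections in hyperplanes, and geometry at a touching point\<close>

definition rf :: "'a::euclidean_space \<Rightarrow> 'a \<Rightarrow> 'a" where
  "rf e v = v - (2 * (v \<bullet> e)) *\<^sub>R e"

definition reflect :: "'a::euclidean_space \<Rightarrow> real \<Rightarrow> 'a \<Rightarrow> 'a" where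
  "reflect e \<mu> x = rf e x + (2 * \<mu>) *\<^sub>R e"

lemma rf_linear: "linear (rf e)"
  by (rule linearI) (simp_all add: rf_def inner_add_left algebra_simps)

lemma rf_adjoint: "p \<bullet> rf e v = rf e p \<bullet> v"
  by (simp add: rf_def inner_diff_left inner_diff_right inner_commute)

lemma reflect_curve: "reflect e \<mu> (x + s *\<^sub>R v + r *\<^sub>R m) = reflect e \<mu> x + s *\<^sub>R rf e v + r *\<^sub>R rf e m"
  by (simp add: reflect_def linear_add[OF rf_linear] linear_cmul[OF rf_linear])

lemma reflect_diff: "reflect e \<mu> x - reflect e \<mu> y = rf e (x - y)"
  by (simp add: reflect_def linear_diff[OF rf_linear])

lemma continuous_on_reflect: "continuous_on S (reflect e \<mu>)"
  unfolding reflect_def[abs_def] rf_def by (intro continuous_intros)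

context
  fixes e :: "'a::euclidean_space" assumes e: "norm e = 1"
begin

lemma e_sq: "e \<bullet> e = 1" using e by (simp add: norm_eq_1)

lemma rf_rf [simp]: "rf e (rf e v) = v"
  by (simp add: rf_def inner_diff_left e_sq algebra_simps)

lemma inner_rf_rf: "rf e v \<bullet> rf e w = v \<bullet> w"
  using rf_adjoint[of "rf e v" e w] by simp

lemma norm_rf [simp]: "norm (rf e v) = norm v"
  using inner_rf_rf[of v v] by (simp add: norm_eq_sqrt_inner)

lemma rf_inner_e: "rf e v \<bullet> e = - (v \<bullet> e)"
  by (simp add: rf_def inner_diff_left e_sq)

lemma reflect_reflect [simp]: "reflect e \<mu> (reflect e \<mu> x) = x"
proof -
  have "rf e e = - e" by (simp add: rf_def e_sq scaleR_2)
  then show ?thesis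
    by (simp add: reflect_def linear_add[OF rf_linear] linear_cmul[OF rf_linear])
qed

lemma reflect_inner_e [simp]: "reflect e \<mu> x \<bullet> e = 2 * \<mu> - x \<bullet> e"
  by (simp add: reflect_def inner_add_left rf_inner_e e_sq)

lemma reflect_on_plane: "x \<bullet> e = \<mu> \<Longrightarrow> reflect e \<mu> x = x"
  by (simp add: reflect_def rf_def)

lemma dist_reflect [simp]: "dist (reflect e \<mu> x) (reflect e \<mu> y) = dist x y"
  by (simp add: dist_norm reflect_diff)

lemma reflect_ball: "x \<in> ball (reflect e \<mu> y) r \<longleftrightarrow> reflect e \<mu> x \<in> ball y r"
  by (metis dist_reflect mem_ball reflect_reflect)

lemma reflect_cball: "x \<in> cball (reflect e \<mu> y) r \<longleftrightarrow> reflect e \<mu> x \<in> cball y r"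
  by (metis dist_reflect mem_cball reflect_reflect)

lemma open_reflect: "open S \<Longrightarrow> open {x. reflect e \<mu> x \<in> S}"
  using open_vimage[of S "reflect e \<mu>"] continuous_on_reflect[of UNIV e \<mu>] by (simp add: vimage_def)

lemma closed_reflect: "closed S \<Longrightarrow> closed {x. reflect e \<mu> x \<in> S}"
  using closed_vimage[of S "reflect e \<mu>"] continuous_on_reflect[of UNIV e \<mu>] by (simp add: vimage_def)

lemma jet2_reflect:
  assumes "jet2 f (reflect e \<mu> x) p A"
  shows "jet2 (\<lambda>x. f (reflect e \<mu> x)) x (rf e p) (\<lambda>v w. A (rf e v) (rf e w))"
  unfolding jet2_def
proof (intro allI)
  fix v m
  show "has_d2 (\<lambda>s. f (reflect e \<mu> (x + s *\<^sub>R v + s\<^sup>2 *\<^sub>R m))) (rf e p \<bullet> v)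
    (A (rf e v) (rf e v) + 2 * (rf e p \<bullet> m))"
    using assms[unfolded jet2_def, rule_format, of "rf e v" "rf e m"]
    by (simp add: reflect_curve rf_adjoint)
qed

lemma trace_rf:
  fixes A :: "'a \<Rightarrow> 'a \<Rightarrow> real"
  assumes "bilinear A" shows "(\<Sum>i\<in>Basis. A (rf e i) (rf e i)) = (\<Sum>i\<in>Basis. A i i)"
  unfolding rf_def bilinear_trace_reflect[OF assms, of 2 e] by (simp add: e_sq)

lemma C2_has_lap_reflect:
  assumes "open U" "Ck_on 2 U f" "reflect e \<mu> x \<in> U"
  shows "has_lap (\<lambda>x. f (reflect e \<mu> x)) (laplacian f (reflect e \<mu> x)) x"
  using jet2_has_lap[OF jet2_reflect[OF C2_jet2[OF assms]]] trace_rf[OF hess_bilinear[OF assms]]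
  by (simp add: laplacian_hess)

end

text \<open>In a ball tangent at \<open>x\<close> one has |\<xi>|^2 < -2 r \<xi> . \<nu>, so the
  quadratic Taylor terms, at most (K + 1) |\<xi>|^2, are beaten by the linear term N \<xi> . \<nu>
  once 2 (K + 1) r < N.\<close>

lemma interior_ball_condition:
  assumes ld: "local_defining \<Omega> U \<rho>" and x: "x \<in> U" "\<rho> x = 0"
  obtains r0 where "r0 > 0" "\<And>r. 0 < r \<Longrightarrow> r \<le> r0 \<Longrightarrow> ball (x - r *\<^sub>R (grad \<rho> x /\<^sub>R norm (grad \<rho> x))) r \<subseteq> \<Omega>"
proof -
  note D = local_definingD[OF ld]
  define N where "N = norm (grad \<rho> x)"
  define \<nu> where "\<nu> = grad \<rho> x /\<^sub>R N"
  have N: "N > 0" "grad \<rho> x = N *\<^sub>R \<nu>" "norm \<nu> = 1" using D(4)[OF x(1)] by (auto simp: N_def \<nu>_def)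
  obtain r1 where r1: "r1 > 0" "cball x r1 \<subseteq> U"
    "\<And>\<xi>. norm \<xi> \<le> r1 \<Longrightarrow> \<bar>\<rho> (x + \<xi>) - \<rho> x - grad \<rho> x \<bullet> \<xi> - hess \<rho> x \<xi> \<xi> / 2\<bar> \<le> 1 * (norm \<xi>)\<^sup>2"
    by (rule C2_taylor[OF D(1,2) x(1), of 1]) auto
  obtain K where K: "K > 0" "\<And>v w. \<bar>hess \<rho> x v w\<bar> \<le> K * norm v * norm w"
    using bilinear_bounded[OF hess_bilinear[OF D(1,2) x(1)]] by blast
  define r0 where "r0 = min (r1 / 2) (N / (2 * (K + 1)) / 2)"
  have r0: "r0 > 0" using r1 N K by (simp add: r0_def)
  have "ball (x - r *\<^sub>R \<nu>) r \<subseteq> \<Omega>" if r: "0 < r" "r \<le> r0" for r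
  proof
    fix z assume z: "z \<in> ball (x - r *\<^sub>R \<nu>) r"
    define \<xi> where "\<xi> = z - x"
    have "norm (\<xi> + r *\<^sub>R \<nu>) < r" using z by (simp add: \<xi>_def dist_norm norm_minus_commute algebra_simps)
    then have "(norm (\<xi> + r *\<^sub>R \<nu>))\<^sup>2 < r\<^sup>2" by (intro power_strict_mono) auto
    moreover have "(norm (\<xi> + r *\<^sub>R \<nu>))\<^sup>2 = (norm \<xi>)\<^sup>2 + 2 * r * (\<xi> \<bullet> \<nu>) + r\<^sup>2"
    proof -
      have "\<nu> \<bullet> \<nu> = 1" using N(3) by (simp add: norm_eq_1)
      then have "(\<xi> + r *\<^sub>R \<nu>) \<bullet> (\<xi> + r *\<^sub>R \<nu>) = \<xi> \<bullet> \<xi> + 2 * r * (\<xi> \<bullet> \<nu>) + r * r"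
        by (simp add: inner_add_left inner_add_right inner_commute algebra_simps)
      then show ?thesis unfolding power2_norm_eq_inner power2_eq_square[of r] .
    qed
    ultimately have 1: "(norm \<xi>)\<^sup>2 < - (2 * r * (\<xi> \<bullet> \<nu>))" by simp
    have n\<xi>: "norm \<xi> < 2 * r"
      using norm_triangle_ineq4[of "\<xi> + r *\<^sub>R \<nu>" "r *\<^sub>R \<nu>"] \<open>norm (\<xi> + r *\<^sub>R \<nu>) < r\<close> N(3) r by simp
    then have "norm \<xi> \<le> r1" using r by (simp add: r0_def)
    from r1(3)[OF this] have z1: "\<rho> z \<le> N * (\<xi> \<bullet> \<nu>) + hess \<rho> x \<xi> \<xi> / 2 + (norm \<xi>)\<^sup>2"
      using x(2) unfolding N(2) by (simp add: \<xi>_def inner_commute)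
    have z2: "hess \<rho> x \<xi> \<xi> \<le> K * (norm \<xi>)\<^sup>2" using K(2)[of \<xi> \<xi>] by (simp add: power2_eq_square mult.assoc)
    have z3: "K * (norm \<xi>)\<^sup>2 \<ge> 0" using K by simp
    have 2: "\<rho> z \<le> N * (\<xi> \<bullet> \<nu>) + (K + 1) * (norm \<xi>)\<^sup>2"
      unfolding distrib_right using z1 z2 z3 by linarith
    have "0 \<le> (norm \<xi>)\<^sup>2" by simp
    then have "r * (\<xi> \<bullet> \<nu>) < 0" using 1 by linarith
    then have "\<xi> \<bullet> \<nu> < 0" using r by (simp add: mult_less_0_iff)
    have "(K + 1) * (norm \<xi>)\<^sup>2 \<le> (K + 1) * (- (2 * r * (\<xi> \<bullet> \<nu>)))" using 1 K by (intro mult_left_mono) auto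
    also have "\<dots> = (2 * (K + 1) * r) * (- (\<xi> \<bullet> \<nu>))" by (simp add: algebra_simps)
    also have "\<dots> < N * (- (\<xi> \<bullet> \<nu>))"
    proof (rule mult_strict_right_mono)
      have "2 * (K + 1) * r \<le> 2 * (K + 1) * (N / (2 * (K + 1)) / 2)" using r K by (intro mult_left_mono) (auto simp: r0_def)
      also have "\<dots> = N / 2" using K by (simp add: field_simps)
      also have "\<dots> < N" using N by simp
      finally show "2 * (K + 1) * r < N" .
    qed (use \<open>\<xi> \<bullet> \<nu> < 0\<close> in simp)
    finally have "\<rho> z < 0" using 2 by simp
    moreover have "z \<in> U" using \<open>norm \<xi> \<le> r1\<close> r1(2) by (auto simp: \<xi>_def dist_norm norm_minus_commute)
    ultimately show "z \<in> \<Omega>" using D(3) by blast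
  qed
  with r0 that show ?thesis by (auto simp: \<nu>_def N_def)
qed

text \<open>If the unit normals differ, their difference is a direction that enters the first
  half-space strictly and leaves the second one. This identifies normals at a touching point, where
  only an inclusion of domains is known.\<close>

lemma half_space_normal_eq:
  fixes a b :: "'a::euclidean_space"
  assumes ab: "a \<noteq> 0" "b \<noteq> 0" and h: "\<And>v. a \<bullet> v < 0 \<Longrightarrow> b \<bullet> v \<le> 0"
  shows "a /\<^sub>R norm a = b /\<^sub>R norm b"
proof (rule ccontr)
  define a' b' where "a' = a /\<^sub>R norm a" and "b' = b /\<^sub>R norm b"
  assume "a /\<^sub>R norm a \<noteq> b /\<^sub>R norm b"
  then have ne: "a' \<noteq> b'" by (simp add: a'_def b'_def)
  have n: "norm a' = 1" "norm b' = 1" using ab by (auto simp: a'_def b'_def)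
  have aa: "a = norm a *\<^sub>R a'" "b = norm b *\<^sub>R b'" using ab by (auto simp: a'_def b'_def)
  have "0 < (norm (a' - b'))\<^sup>2" using ne by simp
  then have lt: "a' \<bullet> b' < 1" using n
    by (simp add: power2_norm_eq_inner inner_diff_left inner_diff_right inner_commute norm_eq_1)
  have "a' \<bullet> (b' - a') < 0" using lt n by (simp add: inner_diff_right norm_eq_1)
  then have "a \<bullet> (b' - a') < 0" using ab by (subst aa(1)) (simp add: mult_pos_neg)
  then have "b \<bullet> (b' - a') \<le> 0" by (rule h)
  then have "norm b * (b' \<bullet> (b' - a')) \<le> 0" by (subst (asm) aa(2)) simp
  then have "b' \<bullet> (b' - a') \<le> 0" using ab by (simp add: mult_le_0_iff)
  then show False using lt n by (simp add: inner_diff_right norm_eq_1 inner_commute)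
qed

section \<open>Orthogonal tangency of surfaces of constant mean curvature\<close>

lemma has_d2_strict_right:
  assumes f: "has_d2 f 0 b" and b: "b > 0"
  shows "\<forall>\<^sub>F s in at_right 0. f s \<ge> f 0"
proof -
  obtain f' where *: "\<forall>\<^sub>F s in nhds 0. (f has_real_derivative f' s) (at s)" "f' 0 = 0"
      "(f' has_real_derivative b) (at 0)"
    using f unfolding has_d2_def by blast
  obtain d where d: "d > 0" "\<And>s. \<bar>s\<bar> < d \<Longrightarrow> (f has_real_derivative f' s) (at s)"
    using *(1) unfolding eventually_nhds_metric by (auto simp: dist_real_def)
  obtain d2 where d2: "d2 > 0" "\<And>h. h > 0 \<Longrightarrow> h < d2 \<Longrightarrow> f' 0 < f' (0 + h)"
    using DERIV_pos_inc_right[OF *(3) b] by blast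
  have "f s \<ge> f 0" if s: "0 < s" "s < min d d2" for s
  proof -
    have "\<exists>z. 0 < z \<and> z < s \<and> f s - f 0 = (s - 0) * f' z"
      by (rule MVT2) (use s d in auto)
    then obtain z where z: "0 < z" "z < s" "f s - f 0 = s * f' z" by auto
    have "f' z > 0" using d2(2)[of z] z s *(2) by auto
    then have "s * f' z > 0" using s by simp
    then show ?thesis using z by linarith
  qed
  moreover have "min d d2 > 0" using d d2 by simp
  ultimately show ?thesis unfolding eventually_at_right_field by blast
qed

lemma has_d2_strict:
  assumes f: "has_d2 f 0 b" and b: "b > 0"
  shows "\<forall>\<^sub>F s in nhds 0. f s \<ge> f 0"
proof -
  have "has_d2 (\<lambda>s. f (- s)) 0 b" using has_d2_mirror[OF f] by simp
  from has_d2_strict_right[OF this b] have "\<forall>\<^sub>F s in at_right 0. f (- s) \<ge> f 0" by simp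
  then have l: "\<forall>\<^sub>F s in at_left 0. f s \<ge> f 0"
    by (simp add: at_left_minus[of 0] eventually_filtermap)
  have "\<forall>\<^sub>F s in at 0. f s \<ge> f 0"
    unfolding eventually_at_split using l has_d2_strict_right[OF f b] by blast
  then show ?thesis by (subst eventually_nhds_conv_at) simp
qed

lemma tendsto_curve: "((\<lambda>s::real. x + s *\<^sub>R v + s\<^sup>2 *\<^sub>R m) \<longlongrightarrow> (x::'a::real_normed_vector)) (nhds 0)"
proof -
  have "((\<lambda>s::real. x + s *\<^sub>R v + s\<^sup>2 *\<^sub>R m) \<longlongrightarrow> x + 0 *\<^sub>R v + 0\<^sup>2 *\<^sub>R m) (nhds 0)"
    by (intro tendsto_intros filterlim_ident)
  then show ?thesis by simp
qed

lemma jet2_local_min: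
  assumes j: "jet2 F x p A" and m: "\<forall>\<^sub>F y in nhds x. F y \<ge> F x"
  shows "p = 0"
proof -
  have "\<forall>\<^sub>F s in nhds 0. F (x + s *\<^sub>R p + s\<^sup>2 *\<^sub>R 0) \<ge> F (x + 0 *\<^sub>R p + 0\<^sup>2 *\<^sub>R 0)"
    using eventually_compose_filterlim[OF m tendsto_curve[of x p 0]] by simp
  from has_d2_local_min(1)[OF j[unfolded jet2_def, rule_format, of p 0] this] show ?thesis by simp
qed

text \<open>These are the Lagrange conditions of first and second order under the constraint \<rho>
  \<ge> 0. Admissible test curves are parabolas with tangent \<open>v\<close> bent along
  \<open>n\<close>: they stay in the constraint set if A v v + 2 \<alpha> > 0, and letting this
  quantity tend to 0 gives the second-order condition.\<close>

lemma jet2_constrained_min: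
  assumes jF: "jet2 F x pF AF" and jr: "jet2 \<rho> x p A" and p: "p \<noteq> 0" and r0: "\<rho> x = 0"
    and m: "\<forall>\<^sub>F y in nhds x. \<rho> y \<ge> 0 \<longrightarrow> F y \<ge> F x"
  obtains \<nu> where "\<nu> \<ge> 0" "pF = \<nu> *\<^sub>R p" "\<And>v. p \<bullet> v = 0 \<Longrightarrow> AF v v \<ge> \<nu> * A v v"
proof -
  \<comment> \<open>Normalised by p . n = 1 rather than by length, so that a bend \<alpha> n adds 2
    \<alpha> to the second derivative of \<rho>.\<close>
  define n where "n = p /\<^sub>R (p \<bullet> p)"
  have pn: "p \<bullet> n = 1" using p by (simp add: n_def)
  have key: "pF \<bullet> v = 0 \<and> AF v v + 2 * \<alpha> * (pF \<bullet> n) \<ge> 0" if v: "p \<bullet> v = 0" and \<alpha>: "A v v + 2 * \<alpha> > 0" for v \<alpha>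
  proof -
    let ?\<gamma> = "\<lambda>s::real. x + s *\<^sub>R v + s\<^sup>2 *\<^sub>R (\<alpha> *\<^sub>R n)"
    have "has_d2 (\<lambda>s. \<rho> (?\<gamma> s)) 0 (A v v + 2 * \<alpha>)"
      using jr[unfolded jet2_def, rule_format, of v "\<alpha> *\<^sub>R n"] v pn by simp
    from has_d2_strict[OF this \<alpha>] have "\<forall>\<^sub>F s in nhds 0. \<rho> (?\<gamma> s) \<ge> 0" using r0 by simp
    moreover have "\<forall>\<^sub>F s in nhds 0. \<rho> (?\<gamma> s) \<ge> 0 \<longrightarrow> F (?\<gamma> s) \<ge> F x"
      using eventually_compose_filterlim[OF m tendsto_curve[of x v "\<alpha> *\<^sub>R n"]] .
    ultimately have "\<forall>\<^sub>F s in nhds 0. F (?\<gamma> s) \<ge> F (?\<gamma> 0)" by eventually_elim simp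
    from has_d2_local_min[OF jF[unfolded jet2_def, rule_format, of v "\<alpha> *\<^sub>R n"] this]
    show ?thesis by simp
  qed
  define \<nu> where "\<nu> = pF \<bullet> n"
  have "\<nu> \<ge> 0" unfolding \<nu>_def
  proof -
    let ?\<gamma> = "\<lambda>s::real. x + s *\<^sub>R n + s\<^sup>2 *\<^sub>R 0"
    have "((\<lambda>s. \<rho> (?\<gamma> s)) has_real_derivative 1) (at 0)"
      using has_d2_deriv[OF jr[unfolded jet2_def, rule_format, of n 0]] pn by simp
    from DERIV_pos_inc_right[OF this] obtain d where "d > 0" "\<And>h. 0 < h \<Longrightarrow> h < d \<Longrightarrow> \<rho> (?\<gamma> 0) < \<rho> (?\<gamma> (0 + h))" by auto
    then have "\<forall>\<^sub>F s in at_right 0. \<rho> (?\<gamma> s) \<ge> 0" unfolding eventually_at_right_field using r0 by (intro exI[of _ d]) (auto simp: less_imp_le)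
    moreover have "\<forall>\<^sub>F s in at_right 0. \<rho> (?\<gamma> s) \<ge> 0 \<longrightarrow> F (?\<gamma> s) \<ge> F x"
      using filter_leD[OF at_within_le_nhds eventually_compose_filterlim[OF m tendsto_curve[of x n 0]]] .
    ultimately have "\<forall>\<^sub>F s in at_right 0. F (?\<gamma> s) \<ge> F (?\<gamma> 0)" by eventually_elim simp
    from has_d2_right_min_deriv[OF jF[unfolded jet2_def, rule_format, of n 0] this] show "pF \<bullet> n \<ge> 0" .
  qed
  moreover have "pF = \<nu> *\<^sub>R p"
  proof -
    define r where "r = pF - \<nu> *\<^sub>R p"
    have "p \<bullet> r = 0" using p by (simp add: r_def \<nu>_def n_def inner_diff_right inner_commute)
    moreover have "A r r + 2 * (1 + \<bar>A r r\<bar>) > 0"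
      using abs_ge_minus_self[of "A r r"] abs_ge_zero[of "A r r"] unfolding distrib_left by linarith
    ultimately have "pF \<bullet> r = 0" using key by blast
    then have "r \<bullet> r = 0" using \<open>p \<bullet> r = 0\<close> by (simp add: r_def inner_diff_left)
    then show ?thesis by (simp add: r_def)
  qed
  moreover have "AF v v \<ge> \<nu> * A v v" if v: "p \<bullet> v = 0" for v
  proof (rule field_le_epsilon)
    fix e :: real assume e: "e > 0"
    have \<nu>1: "\<nu> + 1 > 0" using \<open>\<nu> \<ge> 0\<close> by simp
    define w where "w = e / (\<nu> + 1)"
    have "w * (\<nu> + 1) = e" using \<nu>1 by (simp add: w_def)
    then have w: "w > 0" "w * \<nu> + w = e" using e \<nu>1 by (auto simp: w_def distrib_left)
    \<comment> \<open>Leaves the small positive amount \<open>w\<close> for the strict constraint;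
      \<open>w\<close> is chosen with \<open>w * \<nu> \<le> e\<close>.\<close>
    define \<alpha> where "\<alpha> = (w - A v v) / 2"
    have "2 * \<alpha> = w - A v v" by (simp add: \<alpha>_def)
    then have "A v v + 2 * \<alpha> > 0" using w by linarith
    then have "AF v v + 2 * \<alpha> * \<nu> \<ge> 0" using key[OF v] by (simp add: \<nu>_def)
    moreover have "2 * \<alpha> * \<nu> = w * \<nu> - \<nu> * A v v" by (simp add: \<alpha>_def left_diff_distrib)
    moreover have "w * \<nu> \<le> e" using w by linarith
    ultimately show "\<nu> * A v v \<le> AF v v + e" by linarith
  qed
  ultimately show ?thesis using that by blast
qed

text \<open>A denominator-free form of mean curvature minus \<open>c\<close>, in terms of the gradient \<open>p\<close> and Hessian \<open>A\<close>.\<close>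

definition curv_defect :: "real \<Rightarrow> ('a::euclidean_space \<Rightarrow> 'a \<Rightarrow> real) \<Rightarrow> 'a \<Rightarrow> real" where
  "curv_defect c A p = (norm p)\<^sup>2 * (\<Sum>i\<in>Basis. A i i) - A p p - c * norm p ^ 3"

lemma curv_defect_mean_curv:
  assumes "bilinear (hess \<rho> x)" "grad \<rho> x \<noteq> 0" "mean_curv \<rho> x = c"
  shows "curv_defect c (hess \<rho> x) (grad \<rho> x) = 0"
proof -
  define N where "N = norm (grad \<rho> x)"
  have N: "N > 0" using assms(2) by (simp add: N_def)
  define h where "h = hess \<rho> x (grad \<rho> x) (grad \<rho> x)"
  define t where "t = (\<Sum>i\<in>Basis. hess \<rho> x i i)"
  have "c = (t - inverse N * (inverse N * h)) / N"
    using assms(3) unfolding mean_curv_def N_def t_def h_def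
    by (simp add: bilinear_lmul[OF assms(1)] bilinear_rmul[OF assms(1)])
  then have "N\<^sup>2 * t - h = c * N ^ 3" using N by (simp add: field_simps power2_eq_square power3_eq_cube)
  then show ?thesis by (simp add: curv_defect_def N_def t_def h_def)
qed

text \<open>At the minimum the gradients are parallel and the tangential Hessians ordered, so the
  mean curvatures are ordered. \<open>curv_defect\<close> is homogeneous of degree 3 in gradient and
  Hessian together, and therefore the argument covers a vanishing multiplier as well.\<close>

lemma curv_defect_constrained_min:
  fixes \<rho> F :: "'a::euclidean_space \<Rightarrow> real"
  assumes jF: "jet2 F x pF AF" "bilinear AF" and jr: "jet2 \<rho> x p A" "bilinear A"
    and p: "p \<noteq> 0" and r0: "\<rho> x = 0" and c: "curv_defect c A p = 0"
    and m: "\<forall>\<^sub>F y in nhds x. \<rho> y \<ge> 0 \<longrightarrow> F y \<ge> F x"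
  shows "curv_defect c AF pF \<ge> 0"
proof -
  obtain \<nu> where \<nu>: "\<nu> \<ge> 0" "pF = \<nu> *\<^sub>R p" "\<And>v. p \<bullet> v = 0 \<Longrightarrow> AF v v \<ge> \<nu> * A v v"
    by (rule jet2_constrained_min[OF jF(1) jr(1) p r0 m]) blast
  define N where "N = norm p"
  have N: "N > 0" using p by (simp add: N_def)
  define n where "n = p /\<^sub>R N"
  have "norm n = 1" using p by (simp add: n_def N_def)
  then have nn: "n \<bullet> n = 1" by (simp add: norm_eq_1)
  have pn: "p = N *\<^sub>R n" using N by (simp add: n_def)
  have tr: "(\<Sum>i\<in>Basis. B (i - (1 * (i \<bullet> n)) *\<^sub>R n) (i - (1 * (i \<bullet> n)) *\<^sub>R n)) = (\<Sum>i\<in>Basis. B i i) - B n n"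
    if "bilinear B" for B :: "'a \<Rightarrow> 'a \<Rightarrow> real"
    unfolding bilinear_trace_reflect[OF that, of 1 n] nn by simp
  have orth: "p \<bullet> (i - (1 * (i \<bullet> n)) *\<^sub>R n) = 0" for i
    by (simp add: pn inner_diff_right nn inner_commute)
  have "(\<Sum>i\<in>Basis. \<nu> * A (i - (1 * (i \<bullet> n)) *\<^sub>R n) (i - (1 * (i \<bullet> n)) *\<^sub>R n))
     \<le> (\<Sum>i\<in>Basis. AF (i - (1 * (i \<bullet> n)) *\<^sub>R n) (i - (1 * (i \<bullet> n)) *\<^sub>R n))"
    by (intro sum_mono \<nu>(3) orth)
  then have le: "\<nu> * ((\<Sum>i\<in>Basis. A i i) - A n n) \<le> (\<Sum>i\<in>Basis. AF i i) - AF n n"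
    unfolding sum_distrib_left[symmetric] tr[OF jF(2)] tr[OF jr(2)] .
  have A: "N\<^sup>2 * ((\<Sum>i\<in>Basis. A i i) - A n n) = c * N ^ 3"
  proof -
    have "A p p = N\<^sup>2 * A n n" unfolding pn by (simp add: bilinear_lmul[OF jr(2)] bilinear_rmul[OF jr(2)] power2_eq_square)
    then show ?thesis using c by (simp add: curv_defect_def N_def algebra_simps)
  qed
  have "AF pF pF = (\<nu> * N)\<^sup>2 * AF n n"
    unfolding \<nu>(2) pn by (simp add: bilinear_lmul[OF jF(2)] bilinear_rmul[OF jF(2)] power2_eq_square)
  moreover have "norm pF = \<nu> * N" using \<nu> by (simp add: N_def)
  ultimately have "curv_defect c AF pF = (\<nu> * N)\<^sup>2 * ((\<Sum>i\<in>Basis. AF i i) - AF n n) - c * (\<nu> * N) ^ 3"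
    by (simp add: curv_defect_def algebra_simps)
  also have "\<dots> \<ge> (\<nu> * N)\<^sup>2 * (\<nu> * ((\<Sum>i\<in>Basis. A i i) - A n n)) - c * (\<nu> * N) ^ 3"
    using le by (intro diff_right_mono mult_left_mono) auto
  moreover have "(\<nu> * N)\<^sup>2 * (\<nu> * ((\<Sum>i\<in>Basis. A i i) - A n n)) - c * (\<nu> * N) ^ 3
      = \<nu> ^ 3 * (N\<^sup>2 * ((\<Sum>i\<in>Basis. A i i) - A n n)) - c * (\<nu> * N) ^ 3"
    by (simp add: power2_eq_square power3_eq_cube)
  moreover have "\<dots> = 0" unfolding A by (simp add: power_mult_distrib)
  ultimately show ?thesis by linarith
qed

text \<open>The Hessian of s + M s^2 - |x - Q|^2, where s is the signed distance from a plane
  orthogonal to \<open>e\<close>; see \<open>jet2_slope\<close>.\<close>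

definition slope_form :: "real \<Rightarrow> 'a::euclidean_space \<Rightarrow> 'a \<Rightarrow> 'a \<Rightarrow> real" where
  "slope_form M e v w = 2 * M * (v \<bullet> e) * (w \<bullet> e) - 2 * (v \<bullet> w)"

text \<open>The decisive term is -2 \<epsilon> M (|p|^2 - (p . e)^2): bending in the direction
  \<open>e\<close> lowers the curvature as long as the normal is not parallel to \<open>e\<close>,
  which \<open>\<kappa>\<close> quantifies. Replacing \<open>p\<close> by \<open>p - q\<close> costs
  terms linear in the norm of \<open>q\<close>, with constants independent of \<open>M\<close>
  except for one that carries a factor \<epsilon>.\<close>

lemma curv_defect_perturb:
  fixes A :: "'a::euclidean_space \<Rightarrow> 'a \<Rightarrow> real" and c K M \<epsilon> \<kappa> :: real
  assumes A: "bilinear A" "\<And>v w. \<bar>A v w\<bar> \<le> K * norm v * norm w" and K: "K \<ge> 1"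
    and p: "norm p \<le> K" and q: "norm q \<le> 1" and e: "norm e = 1" and M: "M \<ge> 0" and \<epsilon>: "\<epsilon> \<ge> 0"
    and \<kappa>: "(norm p)\<^sup>2 - (p \<bullet> e)\<^sup>2 \<ge> \<kappa>"
  shows "curv_defect c (\<lambda>v w. A v w - \<epsilon> * slope_form M e v w) (p - q) \<le>
    curv_defect c A p - \<epsilon> * (2 * M * \<kappa> - 2 * DIM('a) * K\<^sup>2)
    + ((2 * K + 1) * (DIM('a) * K) + (2 * K + 1) * K + 3 * \<bar>c\<bar> * (K + 1)\<^sup>2) * norm q
    + \<epsilon> * ((2 * K + 1) * (4 * M + 2 * DIM('a) + 2)) * norm q"
proof -
  define n where "n = real DIM('a)"
  have n: "n \<ge> 1" using DIM_positive[where 'a='a] unfolding n_def by linarith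
  define t where "t = (\<Sum>i\<in>Basis. A i i)"
  define d where "d = (norm (p - q))\<^sup>2 - (norm p)\<^sup>2"
  have "norm q * norm q = q \<bullet> q" unfolding power2_eq_square[symmetric] power2_norm_eq_inner ..
  then have "d = norm q * norm q - 2 * (p \<bullet> q)"
    unfolding d_def power2_norm_eq_inner by (simp add: inner_diff_left inner_diff_right inner_commute)
  moreover have "\<bar>p \<bullet> q\<bar> \<le> K * norm q"
    using Cauchy_Schwarz_ineq2[of p q] mult_right_mono[OF p, of "norm q"] by simp
  moreover have "norm q * norm q \<le> 1 * norm q" using q by (intro mult_right_mono) auto
  ultimately have d: "\<bar>d\<bar> \<le> (2 * K + 1) * norm q"
    using zero_le_square[of "norm q"] unfolding distrib_right abs_le_iff mult.assoc mult_1 by linarith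
  have t: "\<bar>t\<bar> \<le> n * K"
  proof -
    have "\<bar>t\<bar> \<le> (\<Sum>i\<in>(Basis::'a set). \<bar>A i i\<bar>)" unfolding t_def by (rule sum_abs)
    also have "\<dots> \<le> (\<Sum>i\<in>(Basis::'a set). K)" using A(2) by (intro sum_mono) (metis mult.right_neutral norm_Basis)
    finally show ?thesis by (simp add: n_def)
  qed
  have 1: "d * t \<le> ((2 * K + 1) * norm q) * (n * K)"
    using mult_mono[OF d t] K by (simp add: abs_mult[symmetric] abs_le_iff)
  have 2: "A p p - A (p - q) (p - q) \<le> (2 * K + 1) * K * norm q"
  proof -
    have "A p p - A (p - q) (p - q) = A p q + A q p - A q q"
      by (simp add: bilinear_lsub[OF A(1)] bilinear_rsub[OF A(1)])
    moreover have "\<bar>A p q\<bar> \<le> K * K * norm q" "\<bar>A q p\<bar> \<le> K * K * norm q" "\<bar>A q q\<bar> \<le> K * 1 * norm q"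
    proof -
      have "\<bar>A p q\<bar> \<le> K * norm p * norm q" by (rule A)
      also have "\<dots> \<le> K * K * norm q" using p K by (intro mult_right_mono mult_left_mono) auto
      finally show "\<bar>A p q\<bar> \<le> K * K * norm q" .
      have "\<bar>A q p\<bar> \<le> K * norm q * norm p" by (rule A)
      also have "\<dots> \<le> K * norm q * K" using p K by (intro mult_left_mono) auto
      finally show "\<bar>A q p\<bar> \<le> K * K * norm q" by (simp add: mult.commute mult.left_commute)
      have "\<bar>A q q\<bar> \<le> K * norm q * norm q" by (rule A)
      also have "\<dots> \<le> K * 1 * norm q" using q K by (intro mult_right_mono mult_left_mono) auto
      finally show "\<bar>A q q\<bar> \<le> K * 1 * norm q" .
    qed
    ultimately have "A p p - A (p - q) (p - q) \<le> K * K * norm q + K * K * norm q + K * 1 * norm q" by linarith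
    then show ?thesis by (simp add: algebra_simps)
  qed
  have 3: "c * norm p ^ 3 - c * norm (p - q) ^ 3 \<le> 3 * \<bar>c\<bar> * (K + 1)\<^sup>2 * norm q"
  proof -
    define a b where "a = norm p" and "b = norm (p - q)"
    have ab: "a \<ge> 0" "b \<ge> 0" "a \<le> K + 1" "b \<le> K + 1"
      using p q norm_triangle_ineq4[of p q] by (auto simp: a_def b_def)
    have diff: "\<bar>a - b\<bar> \<le> norm q" using norm_triangle_ineq3[of p "p - q"] by (simp add: a_def b_def)
    have "c * a ^ 3 - c * b ^ 3 = c * ((a - b) * (a\<^sup>2 + a * b + b\<^sup>2))"
      by (simp add: power2_eq_square power3_eq_cube algebra_simps)
    also have "\<dots> \<le> \<bar>c\<bar> * (\<bar>a - b\<bar> * \<bar>a\<^sup>2 + a * b + b\<^sup>2\<bar>)"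
      unfolding abs_mult[symmetric] by (rule abs_ge_self)
    also have "\<dots> \<le> \<bar>c\<bar> * (norm q * (3 * (K + 1)\<^sup>2))"
    proof (intro mult_left_mono mult_mono diff)
      have "a\<^sup>2 \<le> (K + 1)\<^sup>2" "b\<^sup>2 \<le> (K + 1)\<^sup>2" "a * b \<le> (K + 1) * (K + 1)"
        using ab K by (auto intro!: power_mono mult_mono)
      moreover have "a\<^sup>2 + a * b + b\<^sup>2 \<ge> 0" using ab by simp
      ultimately show "\<bar>a\<^sup>2 + a * b + b\<^sup>2\<bar> \<le> 3 * (K + 1)\<^sup>2" by (simp add: power2_eq_square)
    qed auto
    finally show ?thesis by (simp add: a_def b_def algebra_simps)
  qed
  have ee: "e \<bullet> e = 1" using e by (simp add: norm_eq_1)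
  have trZ: "(\<Sum>i\<in>Basis. slope_form M e i i) = 2 * M - 2 * n"
  proof -
    have "(\<Sum>i\<in>(Basis::'a set). (i \<bullet> e) * (i \<bullet> e)) = 1" using euclidean_inner[of e e] ee by (simp add: inner_commute)
    then have "(\<Sum>i\<in>(Basis::'a set). 2 * M * ((i \<bullet> e) * (i \<bullet> e))) = 2 * M" by (simp add: sum_distrib_left[symmetric])
    then show ?thesis by (simp add: slope_form_def sum_subtractf n_def mult.assoc)
  qed
  have Zb: "\<bar>slope_form M e v w\<bar> \<le> (2 * M + 2) * (norm v * norm w)" for v w
  proof -
    have "\<bar>v \<bullet> e\<bar> \<le> norm v" "\<bar>w \<bullet> e\<bar> \<le> norm w" "\<bar>v \<bullet> w\<bar> \<le> norm v * norm w"
      using Cauchy_Schwarz_ineq2[of v e] Cauchy_Schwarz_ineq2[of w e] Cauchy_Schwarz_ineq2[of v w] e by auto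
    then have "\<bar>v \<bullet> e\<bar> * \<bar>w \<bullet> e\<bar> \<le> norm v * norm w" by (intro mult_mono) auto
    then have "2 * M * (\<bar>v \<bullet> e\<bar> * \<bar>w \<bullet> e\<bar>) \<le> 2 * M * (norm v * norm w)" using M by (intro mult_left_mono) auto
    moreover have "\<bar>slope_form M e v w\<bar> \<le> 2 * M * (\<bar>v \<bullet> e\<bar> * \<bar>w \<bullet> e\<bar>) + 2 * \<bar>v \<bullet> w\<bar>"
      unfolding slope_form_def using abs_triangle_ineq4[of "2 * M * (v \<bullet> e) * (w \<bullet> e)" "2 * (v \<bullet> w)"] M
      by (simp add: abs_mult mult.assoc)
    ultimately show ?thesis using \<open>\<bar>v \<bullet> w\<bar> \<le> norm v * norm w\<close> by (simp add: algebra_simps)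
  qed
  have Zd: "slope_form M e (p - q) (p - q) - slope_form M e p p \<le> (2 * K + 1) * (2 * M + 2) * norm q"
  proof -
    have "slope_form M e (p - q) (p - q) - slope_form M e p p
        = slope_form M e q q - 2 * slope_form M e p q"
      by (simp add: slope_form_def inner_diff_left inner_diff_right inner_commute algebra_simps)
    moreover have "\<bar>slope_form M e q q\<bar> \<le> (2 * M + 2) * (1 * norm q)"
      by (rule order_trans[OF Zb]) (use M q in \<open>intro mult_left_mono mult_right_mono, auto\<close>)
    moreover have "\<bar>slope_form M e p q\<bar> \<le> (2 * M + 2) * (K * norm q)"
      by (rule order_trans[OF Zb]) (use M p in \<open>intro mult_left_mono mult_right_mono, auto\<close>)
    ultimately have "slope_form M e (p - q) (p - q) - slope_form M e p p
        \<le> (2 * M + 2) * (1 * norm q) + 2 * ((2 * M + 2) * (K * norm q))" by linarith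
    then show ?thesis by (simp add: algebra_simps)
  qed
  have dZ: "- d * (2 * M - 2 * n) \<le> ((2 * K + 1) * norm q) * (2 * M + 2 * n)"
  proof -
    have "- d * (2 * M - 2 * n) \<le> \<bar>d\<bar> * \<bar>2 * M - 2 * n\<bar>" using abs_ge_self[of "- d * (2 * M - 2 * n)"] by (simp add: abs_mult)
    also have "\<dots> \<le> ((2 * K + 1) * norm q) * (2 * M + 2 * n)" using M n K by (intro mult_mono d) auto
    finally show ?thesis .
  qed
  have main: "(norm p)\<^sup>2 * (2 * M - 2 * n) - slope_form M e p p \<ge> 2 * M * \<kappa> - 2 * n * K\<^sup>2"
  proof -
    define P b where "P = (norm p)\<^sup>2" and "b = (p \<bullet> e)\<^sup>2"
    have "P \<le> K\<^sup>2" unfolding P_def using p by (intro power_mono) auto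
    then have "n * P \<le> n * K\<^sup>2" using n by (intro mult_left_mono) auto
    moreover have "M * \<kappa> \<le> M * P - M * b"
      unfolding P_def b_def right_diff_distrib[symmetric] using M \<kappa> by (intro mult_left_mono) auto
    moreover have "slope_form M e p p = 2 * (M * b) - 2 * P"
      by (simp add: slope_form_def power2_norm_eq_inner[symmetric] power2_eq_square[of "p \<bullet> e"] P_def b_def mult.assoc)
    moreover have "P \<ge> 0" by (simp add: P_def)
    ultimately have "2 * (M * P) - 2 * (n * P) - slope_form M e p p \<ge> 2 * (M * \<kappa>) - 2 * (n * K\<^sup>2)" by linarith
    then show ?thesis unfolding P_def[symmetric] by (simp add: algebra_simps)
  qed
  define Zpq Zp where "Zpq = slope_form M e (p - q) (p - q)" and "Zp = slope_form M e p p"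
  have tF: "(\<Sum>i\<in>Basis. A i i - \<epsilon> * slope_form M e i i) = t - \<epsilon> * (2 * M - 2 * n)"
    unfolding t_def sum_subtractf sum_distrib_left[symmetric] trZ ..
  have np: "(norm (p - q))\<^sup>2 = (norm p)\<^sup>2 + d" by (simp add: d_def)
  have "curv_defect c (\<lambda>v w. A v w - \<epsilon> * slope_form M e v w) (p - q) =
     curv_defect c A p - \<epsilon> * ((norm p)\<^sup>2 * (2 * M - 2 * n) - Zp)
      + (d * t + (A p p - A (p - q) (p - q)) + (c * norm p ^ 3 - c * norm (p - q) ^ 3))
      + \<epsilon> * (- d * (2 * M - 2 * n) + (Zpq - Zp))"
    unfolding curv_defect_def tF np t_def[symmetric] Zpq_def[symmetric] by (simp add: algebra_simps)
  also have "\<dots> \<le> curv_defect c A p - \<epsilon> * (2 * M * \<kappa> - 2 * n * K\<^sup>2)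
      + (((2 * K + 1) * norm q) * (n * K) + (2 * K + 1) * K * norm q + 3 * \<bar>c\<bar> * (K + 1)\<^sup>2 * norm q)
      + \<epsilon> * (((2 * K + 1) * norm q) * (2 * M + 2 * n) + (2 * K + 1) * (2 * M + 2) * norm q)"
    using \<epsilon> by (intro add_mono diff_mono mult_left_mono 1 2 3 dZ order_refl main[folded Zp_def] Zd[folded Zpq_def Zp_def]) auto
  also have "\<dots> = curv_defect c A p - \<epsilon> * (2 * M * \<kappa> - 2 * n * K\<^sup>2)
    + ((2 * K + 1) * (n * K) + (2 * K + 1) * K + 3 * \<bar>c\<bar> * (K + 1)\<^sup>2) * norm q
    + \<epsilon> * ((2 * K + 1) * (4 * M + 2 * n + 2)) * norm q" by (simp add: algebra_simps)
  finally show ?thesis by (simp add: n_def)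
qed

section \<open>Lipschitz bounds for gradients, Hessians and the curvature defect\<close>

definition lip_bounded :: "'a::real_normed_vector set \<Rightarrow> ('a \<Rightarrow> real) \<Rightarrow> bool" where
  "lip_bounded V f \<longleftrightarrow> (\<exists>K\<ge>0. (\<forall>x\<in>V. \<bar>f x\<bar> \<le> K) \<and> (\<forall>x\<in>V. \<forall>y\<in>V. \<bar>f x - f y\<bar> \<le> K * norm (x - y)))"

lemma lip_boundedI:
  assumes "\<And>x. x \<in> V \<Longrightarrow> \<bar>f x\<bar> \<le> K" "\<And>x y. x \<in> V \<Longrightarrow> y \<in> V \<Longrightarrow> \<bar>f x - f y\<bar> \<le> L * norm (x - y)"
  shows "lip_bounded V f"
  unfolding lip_bounded_def
proof (intro exI[of _ "max 0 (max K L)"] conjI ballI)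
  show "\<bar>f x\<bar> \<le> max 0 (max K L)" if "x \<in> V" for x using assms(1)[OF that] by linarith
  show "\<bar>f x - f y\<bar> \<le> max 0 (max K L) * norm (x - y)" if "x \<in> V" "y \<in> V" for x y
    by (rule order_trans[OF assms(2)[OF that] mult_right_mono]) auto
qed simp

lemma lip_bounded_const: "lip_bounded V (\<lambda>x. c)"
  by (rule lip_boundedI[of _ _ "\<bar>c\<bar>" 0]) auto

lemma lip_bounded_add:
  assumes "lip_bounded V f" "lip_bounded V g" shows "lip_bounded V (\<lambda>x. f x + g x)"
proof -
  obtain K L where *: "\<And>x. x \<in> V \<Longrightarrow> \<bar>f x\<bar> \<le> K" "\<And>x y. x \<in> V \<Longrightarrow> y \<in> V \<Longrightarrow> \<bar>f x - f y\<bar> \<le> K * norm (x - y)"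
    "\<And>x. x \<in> V \<Longrightarrow> \<bar>g x\<bar> \<le> L" "\<And>x y. x \<in> V \<Longrightarrow> y \<in> V \<Longrightarrow> \<bar>g x - g y\<bar> \<le> L * norm (x - y)"
    using assms unfolding lip_bounded_def by blast
  show ?thesis
  proof (rule lip_boundedI)
    show "\<bar>f x + g x\<bar> \<le> K + L" if "x \<in> V" for x using *(1,3)[OF that] by linarith
    show "\<bar>f x + g x - (f y + g y)\<bar> \<le> (K + L) * norm (x - y)" if "x \<in> V" "y \<in> V" for x y
      using *(2,4)[OF that] unfolding distrib_right by linarith
  qed
qed

text \<open>Products are the reason why \<open>lip_bounded\<close> includes a bound on the function
  itself.\<close>

lemma lip_bounded_mult:
  assumes "lip_bounded V f" "lip_bounded V g" shows "lip_bounded V (\<lambda>x. f x * g x)"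
proof -
  obtain K L where *: "\<And>x. x \<in> V \<Longrightarrow> \<bar>f x\<bar> \<le> K" "\<And>x y. x \<in> V \<Longrightarrow> y \<in> V \<Longrightarrow> \<bar>f x - f y\<bar> \<le> K * norm (x - y)"
    "\<And>x. x \<in> V \<Longrightarrow> \<bar>g x\<bar> \<le> L" "\<And>x y. x \<in> V \<Longrightarrow> y \<in> V \<Longrightarrow> \<bar>g x - g y\<bar> \<le> L * norm (x - y)"
    and K: "K \<ge> 0" "L \<ge> 0"
    using assms unfolding lip_bounded_def by blast
  show ?thesis
  proof (rule lip_boundedI)
    show "\<bar>f x * g x\<bar> \<le> K * L" if "x \<in> V" for x
      unfolding abs_mult by (intro mult_mono * that K) auto
    show "\<bar>f x * g x - f y * g y\<bar> \<le> (K * L + K * L) * norm (x - y)" if "x \<in> V" "y \<in> V" for x y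
    proof -
      have "f x * g x - f y * g y = f x * (g x - g y) + (f x - f y) * g y" by (simp add: algebra_simps)
      then have "\<bar>f x * g x - f y * g y\<bar> \<le> \<bar>f x\<bar> * \<bar>g x - g y\<bar> + \<bar>f x - f y\<bar> * \<bar>g y\<bar>"
        using abs_triangle_ineq[of "f x * (g x - g y)" "(f x - f y) * g y"] by (simp add: abs_mult)
      also have "\<dots> \<le> K * (L * norm (x - y)) + (K * norm (x - y)) * L"
        by (intro add_mono mult_mono * that K mult_nonneg_nonneg) auto
      finally show ?thesis by (simp add: algebra_simps)
    qed
  qed
qed

lemma lip_bounded_diff:
  assumes "lip_bounded V f" "lip_bounded V g" shows "lip_bounded V (\<lambda>x. f x - g x)"
  using lip_bounded_add[OF assms(1) lip_bounded_mult[OF lip_bounded_const[of V "-1"] assms(2)]] by simp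

lemma lip_bounded_sum:
  assumes "finite S" "\<And>i. i \<in> S \<Longrightarrow> lip_bounded V (f i)" shows "lip_bounded V (\<lambda>x. \<Sum>i\<in>S. f i x)"
  using assms by (induction S rule: finite_induct) (auto intro: lip_bounded_const lip_bounded_add)

lemma lip_bounded_cong:
  assumes "\<And>x. x \<in> V \<Longrightarrow> f x = g x" "lip_bounded V f" shows "lip_bounded V g"
  using assms unfolding lip_bounded_def by (metis (no_types, lifting))

lemma lip_bounded_C2:
  fixes f :: "'a::euclidean_space \<Rightarrow> real"
  assumes U: "open U" "Ck_on 2 U f" and V: "compact V" "convex V" "V \<subseteq> U"
  shows "lip_bounded V f"
proof -
  have "continuous_on V f" "continuous_on V (\<lambda>x. norm (grad f x))"
    using continuous_on_subset[OF C2_cont[OF U] V(3)] continuous_on_subset[OF C2_cont_grad[OF U] V(3)]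
    by (auto intro: continuous_on_norm)
  then have "bounded (f ` V)" "bounded ((\<lambda>x. norm (grad f x)) ` V)"
    using V(1) by (auto intro: compact_imp_bounded compact_continuous_image)
  then obtain K L where K: "\<And>x. x \<in> V \<Longrightarrow> \<bar>f x\<bar> \<le> K" and L: "\<And>x. x \<in> V \<Longrightarrow> norm (grad f x) \<le> L"
    unfolding bounded_iff by fastforce
  show ?thesis
  proof (rule lip_boundedI[OF K])
    fix x y assume xy: "x \<in> V" "y \<in> V"
    have "norm (f x - f y) \<le> L * norm (x - y)"
    proof (rule differentiable_bound[OF V(2) _ _ xy(1,2)])
      show "(f has_derivative (\<lambda>h. grad f z \<bullet> h)) (at z within V)" if "z \<in> V" for z
        using C2_grad[OF U, of z] V(3) that by (auto intro: has_derivative_at_withinI)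
      show "onorm (\<lambda>h. grad f z \<bullet> h) \<le> L" if "z \<in> V" for z
      proof (rule onorm_le)
        fix h
        have "\<bar>grad f z \<bullet> h\<bar> \<le> norm (grad f z) * norm h" by (rule Cauchy_Schwarz_ineq2)
        also have "\<dots> \<le> L * norm h" by (intro mult_right_mono L that) auto
        finally show "norm (grad f z \<bullet> h) \<le> L * norm h" by simp
      qed
    qed
    then show "\<bar>f x - f y\<bar> \<le> L * norm (x - y)" by simp
  qed
qed

lemma lip_bounded_norm:
  fixes p :: "'a::euclidean_space \<Rightarrow> 'b::euclidean_space"
  assumes "\<And>i. i \<in> Basis \<Longrightarrow> lip_bounded V (\<lambda>x. p x \<bullet> i)"
  shows "lip_bounded V (\<lambda>x. norm (p x))"
proof -
  have "\<forall>i\<in>Basis. \<exists>K. (\<forall>x\<in>V. \<bar>p x \<bullet> i\<bar> \<le> K) \<and> (\<forall>x\<in>V. \<forall>y\<in>V. \<bar>p x \<bullet> i - p y \<bullet> i\<bar> \<le> K * norm (x - y))"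
    using assms unfolding lip_bounded_def by blast
  from bchoice[OF this] obtain K where K: "\<And>i x. i \<in> Basis \<Longrightarrow> x \<in> V \<Longrightarrow> \<bar>p x \<bullet> i\<bar> \<le> K i"
    "\<And>i x y. i \<in> Basis \<Longrightarrow> x \<in> V \<Longrightarrow> y \<in> V \<Longrightarrow> \<bar>p x \<bullet> i - p y \<bullet> i\<bar> \<le> K i * norm (x - y)" by blast
  show ?thesis
  proof (rule lip_boundedI)
    show "\<bar>norm (p x)\<bar> \<le> (\<Sum>i\<in>Basis. K i)" if "x \<in> V" for x
    proof -
      have "norm (p x) \<le> (\<Sum>i\<in>Basis. \<bar>p x \<bullet> i\<bar>)" by (rule norm_le_l1)
      also have "\<dots> \<le> (\<Sum>i\<in>Basis. K i)" by (intro sum_mono K that)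
      finally show ?thesis by simp
    qed
    show "\<bar>norm (p x) - norm (p y)\<bar> \<le> (\<Sum>i\<in>Basis. K i) * norm (x - y)" if "x \<in> V" "y \<in> V" for x y
    proof -
      have "\<bar>norm (p x) - norm (p y)\<bar> \<le> norm (p x - p y)" by (rule norm_triangle_ineq3)
      also have "\<dots> \<le> (\<Sum>i\<in>Basis. \<bar>(p x - p y) \<bullet> i\<bar>)" by (rule norm_le_l1)
      also have "\<dots> \<le> (\<Sum>i\<in>Basis. K i * norm (x - y))"
        unfolding inner_diff_left by (intro sum_mono K that)
      finally show ?thesis by (simp add: sum_distrib_right)
    qed
  qed
qed

lemma bilinear_expand:
  fixes A :: "'a::euclidean_space \<Rightarrow> 'a \<Rightarrow> real"
  assumes "bilinear A" shows "A v w = (\<Sum>i\<in>Basis. \<Sum>j\<in>Basis. (v \<bullet> i) * (w \<bullet> j) * A i j)"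
proof -
  have l: "linear (A x)" "linear (\<lambda>x. A x y)" for x y using assms by (auto simp: bilinear_def)
  have "A v w = A (\<Sum>i\<in>Basis. (v \<bullet> i) *\<^sub>R i) (\<Sum>j\<in>Basis. (w \<bullet> j) *\<^sub>R j)" by (simp add: euclidean_representation)
  also have "\<dots> = (\<Sum>i\<in>Basis. (v \<bullet> i) * A i (\<Sum>j\<in>Basis. (w \<bullet> j) *\<^sub>R j))"
    by (simp only: linear_sum[OF l(2)] bilinear_lmul[OF assms] real_scaleR_def)
  also have "\<dots> = (\<Sum>i\<in>Basis. (v \<bullet> i) * (\<Sum>j\<in>Basis. (w \<bullet> j) * A i j))"
    by (simp only: linear_sum[OF l(1)] bilinear_rmul[OF assms] real_scaleR_def)
  finally show ?thesis by (simp add: sum_distrib_left mult.assoc)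
qed

text \<open>Smoothness of \<rho> beyond C^2 enters here: the entries of the Hessian are themselves
  of class C^2, hence Lipschitz on compact convex sets.\<close>

lemma smooth_components_lip:
  fixes \<rho> :: "'a::euclidean_space \<Rightarrow> real"
  assumes U: "open U" "smooth_on U \<rho>" and V: "compact V" "convex V" "V \<subseteq> U"
  shows "lip_bounded V (\<lambda>x. grad \<rho> x \<bullet> i)" "lip_bounded V (\<lambda>x. hess \<rho> x i j)"
proof -
  have c: "Ck_on k U (\<lambda>x. frechet_derivative \<rho> (at x) i)" for k
    using smooth_on_Ck[OF U(2), of "Suc k"] by simp
  have "Ck_on 2 U (\<lambda>x. frechet_derivative \<rho> (at x) i)" by (rule c)
  then have "lip_bounded V (\<lambda>x. frechet_derivative \<rho> (at x) i)" by (rule lip_bounded_C2[OF U(1) _ V])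
  then show "lip_bounded V (\<lambda>x. grad \<rho> x \<bullet> i)"
    by (rule lip_bounded_cong[rotated])
       (use V(3) in \<open>auto simp: frechet_derivative_grad[OF C2_differentiable[OF U(1) smooth_on_Ck[OF U(2)]]]\<close>)
  have "Ck_on 2 U (\<lambda>x. hess \<rho> x i j)" using c[of "Suc 2"] unfolding hess_def Ck_on.simps by blast
  then show "lip_bounded V (\<lambda>x. hess \<rho> x i j)" by (rule lip_bounded_C2[OF U(1) _ V])
qed

text \<open>The defect is a polynomial in the entries of gradient and Hessian and the norm of the
  gradient. The Lipschitz bound makes it small at points near the boundary, where it vanishes by
  constant mean curvature.\<close>

lemma curv_defect_lip:
  fixes \<rho> :: "'a::euclidean_space \<Rightarrow> real"
  assumes U: "open U" "smooth_on U \<rho>" and V: "compact V" "convex V" "V \<subseteq> U"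
  shows "lip_bounded V (\<lambda>x. curv_defect c (hess \<rho> x) (grad \<rho> x))"
proof -
  note lb = smooth_components_lip[OF U V]
  have n: "lip_bounded V (\<lambda>x. norm (grad \<rho> x))" by (rule lip_bounded_norm) (rule lb)
  have "lip_bounded V (\<lambda>x. norm (grad \<rho> x) * norm (grad \<rho> x) * (\<Sum>i\<in>Basis. hess \<rho> x i i)
     - (\<Sum>i\<in>Basis. \<Sum>j\<in>Basis. (grad \<rho> x \<bullet> i) * (grad \<rho> x \<bullet> j) * hess \<rho> x i j)
     - c * (norm (grad \<rho> x) * (norm (grad \<rho> x) * norm (grad \<rho> x))))"
    by (intro lip_bounded_diff lip_bounded_mult lip_bounded_sum n lb lip_bounded_const finite_Basis)
  then show ?thesis
  proof (rule lip_bounded_cong[rotated])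
    fix x assume "x \<in> V"
    then have bl: "bilinear (hess \<rho> x)" using hess_bilinear[OF U(1) smooth_on_Ck[OF U(2)]] V(3) by blast
    show "norm (grad \<rho> x) * norm (grad \<rho> x) * (\<Sum>i\<in>Basis. hess \<rho> x i i)
     - (\<Sum>i\<in>Basis. \<Sum>j\<in>Basis. (grad \<rho> x \<bullet> i) * (grad \<rho> x \<bullet> j) * hess \<rho> x i j)
     - c * (norm (grad \<rho> x) * (norm (grad \<rho> x) * norm (grad \<rho> x))) = curv_defect c (hess \<rho> x) (grad \<rho> x)"
      unfolding curv_defect_def bilinear_expand[OF bl, of "grad \<rho> x" "grad \<rho> x"]
      by (simp add: power2_eq_square power3_eq_cube)
  qed
qed

lemma smooth_bounds:
  fixes \<rho> :: "'a::euclidean_space \<Rightarrow> real"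
  assumes U: "open U" "smooth_on U \<rho>" and V: "compact V" "convex V" "V \<subseteq> U"
  obtains K where "K \<ge> 1" "\<And>y. y \<in> V \<Longrightarrow> norm (grad \<rho> y) \<le> K"
    "\<And>y v w. y \<in> V \<Longrightarrow> \<bar>hess \<rho> y v w\<bar> \<le> K * norm v * norm w"
proof -
  note lb = smooth_components_lip[OF U V]
  have "lip_bounded V (\<lambda>x. norm (grad \<rho> x))" by (rule lip_bounded_norm) (rule lb)
  then obtain K1 where K1: "\<And>y. y \<in> V \<Longrightarrow> norm (grad \<rho> y) \<le> K1" unfolding lip_bounded_def by fastforce
  have "\<exists>k. \<forall>y\<in>V. \<bar>hess \<rho> y i j\<bar> \<le> k" for i j using lb(2)[of i j] unfolding lip_bounded_def by blast
  then obtain k where k: "\<And>i j y. y \<in> V \<Longrightarrow> \<bar>hess \<rho> y i j\<bar> \<le> k i j" by metis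
  define K2 where "K2 = (\<Sum>i\<in>(Basis::'a set). \<Sum>j\<in>(Basis::'a set). k i j)"
  have 2: "\<bar>hess \<rho> y v w\<bar> \<le> K2 * (norm v * norm w)" if y: "y \<in> V" for y v w
  proof -
    have bl: "bilinear (hess \<rho> y)" using hess_bilinear[OF U(1) smooth_on_Ck[OF U(2)]] V(3) y by blast
    have "\<bar>hess \<rho> y v w\<bar> \<le> (\<Sum>i\<in>Basis. \<bar>\<Sum>j\<in>Basis. (v \<bullet> i) * (w \<bullet> j) * hess \<rho> y i j\<bar>)"
      unfolding bilinear_expand[OF bl, of v w] by (rule sum_abs)
    also have "\<dots> \<le> (\<Sum>i\<in>Basis. \<Sum>j\<in>Basis. \<bar>(v \<bullet> i) * (w \<bullet> j) * hess \<rho> y i j\<bar>)"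
      by (intro sum_mono sum_abs)
    also have "\<dots> \<le> (\<Sum>i\<in>(Basis::'a set). \<Sum>j\<in>(Basis::'a set). (norm v * norm w) * k i j)"
      unfolding abs_mult by (intro sum_mono mult_mono k y Basis_le_norm) auto
    also have "\<dots> = K2 * (norm v * norm w)" unfolding K2_def sum_distrib_right by (simp add: mult.commute)
    finally show ?thesis .
  qed
  show ?thesis
  proof (rule that[of "max 1 (max K1 K2)"])
    show "norm (grad \<rho> y) \<le> max 1 (max K1 K2)" if "y \<in> V" for y using K1[OF that] by linarith
    show "\<bar>hess \<rho> y v w\<bar> \<le> max 1 (max K1 K2) * norm v * norm w" if "y \<in> V" for y v w
      unfolding mult.assoc by (rule order_trans[OF 2[OF that] mult_right_mono]) auto
  qed simp
qed

lemma jet2_slope: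
  fixes Q e :: "'a::euclidean_space"
  defines "s \<equiv> \<lambda>x. (- e) \<bullet> (x - Q)"
  shows "jet2 (\<lambda>x. s x + M * (s x * s x) - (norm (x - Q))\<^sup>2) x (- (1 + 2 * M * s x) *\<^sub>R e - 2 *\<^sub>R (x - Q)) (slope_form M e)"
proof -
  have js: "jet2 s x (- e) (\<lambda>v w. 0)" unfolding s_def by (rule jet2_linear)
  have "jet2 (\<lambda>x. s x - (- M) * (s x * s x) - (norm (x - Q))\<^sup>2) x
      ((- e) - (- M) *\<^sub>R (s x *\<^sub>R (- e) + s x *\<^sub>R (- e)) - 2 *\<^sub>R (x - Q))
      (\<lambda>v w. 0 - (- M) * (s x * 0 + 2 * ((- e) \<bullet> v) * ((- e) \<bullet> w) + s x * 0) - 2 * (v \<bullet> w))"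
    by (intro jet2_diff jet2_cmult jet2_mult js jet2_norm_sq)
  moreover have "(\<lambda>x. s x - (- M) * (s x * s x) - (norm (x - Q))\<^sup>2) = (\<lambda>x. s x + M * (s x * s x) - (norm (x - Q))\<^sup>2)" by simp
  moreover have "(- e) - (- M) *\<^sub>R (s x *\<^sub>R (- e) + s x *\<^sub>R (- e)) - 2 *\<^sub>R (x - Q) = - (1 + 2 * M * s x) *\<^sub>R e - 2 *\<^sub>R (x - Q)"
    by (simp add: scaleR_add_left[symmetric] algebra_simps)
  moreover have "(\<lambda>v w. 0 - (- M) * (s x * 0 + 2 * ((- e) \<bullet> v) * ((- e) \<bullet> w) + s x * 0) - 2 * (v \<bullet> w)) = slope_form M e"
    by (intro ext) (simp add: slope_form_def inner_commute)
  ultimately show ?thesis by metis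
qed

text \<open>The boundary-point case of Alexandrov's reflection argument. The reflected defining function,
  lowered by a small multiple of a function \<open>z\<close> whose Hessian is large in the direction \<open>e\<close>, would
  have a minimum on \<open>{\<rho> \<ge> 0}\<close> at which its level set curves less than \<open>c\<close>.\<close>

lemma corner_contradiction:
  fixes \<rho> :: "'a::euclidean_space \<Rightarrow> real"
  assumes e: "norm e = 1" and U: "open U" "smooth_on U \<rho>" and nz: "\<And>y. y \<in> U \<Longrightarrow> grad \<rho> y \<noteq> 0"
    and Q: "Q \<in> U" "Q \<bullet> e = \<mu>" "\<rho> Q = 0" "grad \<rho> Q \<bullet> e = 0"
    and curv: "\<And>x. x \<in> U \<Longrightarrow> \<rho> x = 0 \<Longrightarrow> mean_curv \<rho> x = c"
    and order: "\<And>x. x \<in> U \<Longrightarrow> reflect e \<mu> x \<in> U \<Longrightarrow> x \<bullet> e < \<mu> \<Longrightarrow> \<rho> (reflect e \<mu> x) \<le> 0 \<Longrightarrow> \<rho> x < 0"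
  shows False
proof -
  note C2 = smooth_on_Ck[OF U(2), of 2]
  define R where "R = reflect e \<mu>"
  have RQ: "R Q = Q" unfolding R_def by (rule reflect_on_plane[OF e Q(2)])
  have RR: "R (R x) = x" for x unfolding R_def by (simp add: reflect_reflect[OF e])
  define g0 where "g0 = norm (grad \<rho> Q)"
  have g0: "g0 > 0" using nz[OF Q(1)] by (simp add: g0_def)
  define n0 where "n0 = grad \<rho> Q /\<^sub>R g0"
  have n0: "norm n0 = 1" "grad \<rho> Q \<bullet> n0 = g0" "n0 \<bullet> e = 0"
    using g0 Q(4) by (auto simp: n0_def g0_def[symmetric] dot_square_norm power2_eq_square)
  \<comment> \<open>Half of the values attained at \<open>Q\<close>, where the gradient is
    orthogonal to \<open>e\<close>, so that both lower bounds persist on a small ball.\<close>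
  define \<kappa> k1 where "\<kappa> = g0\<^sup>2 / 2" and "k1 = g0 / 2"
  have \<kappa>: "\<kappa> > 0" and k1: "k1 > 0" using g0 by (auto simp: \<kappa>_def k1_def)
  have cg: "isCont (grad \<rho>) Q" using C2_cont_grad[OF U(1) C2] U(1) Q(1) by (simp add: continuous_on_eq_continuous_at)
  then have gl: "(grad \<rho> \<longlongrightarrow> grad \<rho> Q) (nhds Q)" by (simp add: isCont_def tendsto_nhds_iff)
  have "((\<lambda>y. (norm (grad \<rho> y))\<^sup>2 - (grad \<rho> y \<bullet> e)\<^sup>2) \<longlongrightarrow> g0\<^sup>2 - 0\<^sup>2) (nhds Q)"
    unfolding g0_def Q(4)[symmetric] by (intro tendsto_intros gl)
  then have ev1: "\<forall>\<^sub>F y in nhds Q. (norm (grad \<rho> y))\<^sup>2 - (grad \<rho> y \<bullet> e)\<^sup>2 > \<kappa>"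
    by (rule order_tendstoD(1)) (use g0 in \<open>simp add: \<kappa>_def\<close>)
  have "((\<lambda>y. grad \<rho> y \<bullet> n0) \<longlongrightarrow> g0) (nhds Q)" unfolding n0(2)[symmetric] by (intro tendsto_intros gl)
  then have ev2: "\<forall>\<^sub>F y in nhds Q. grad \<rho> y \<bullet> n0 > k1"
    by (rule order_tendstoD(1)) (use g0 in \<open>simp add: k1_def\<close>)
  have ev3: "\<forall>\<^sub>F y in nhds Q. y \<in> U" using U(1) Q(1) by (rule eventually_nhds_in_open)
  obtain r0 where r0: "r0 > 0" "\<And>y. y \<in> cball Q r0 \<Longrightarrow> y \<in> U"
    "\<And>y. y \<in> cball Q r0 \<Longrightarrow> (norm (grad \<rho> y))\<^sup>2 - (grad \<rho> y \<bullet> e)\<^sup>2 \<ge> \<kappa>"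
    "\<And>y. y \<in> cball Q r0 \<Longrightarrow> grad \<rho> y \<bullet> n0 \<ge> k1"
    by (rule eventually_nhds_cball[OF eventually_conj[OF ev3 eventually_conj[OF ev1 ev2]]]) (use less_imp_le in blast)
  define V where "V = cball Q r0"
  have V: "compact V" "convex V" "V \<subseteq> U" using r0(2) by (auto simp: V_def)
  obtain K where K: "K \<ge> 1" "\<And>y. y \<in> V \<Longrightarrow> norm (grad \<rho> y) \<le> K"
    "\<And>y v w. y \<in> V \<Longrightarrow> \<bar>hess \<rho> y v w\<bar> \<le> K * norm v * norm w"
    by (rule smooth_bounds[OF U V]) blast
  define \<tau> where "\<tau> = (\<lambda>x. curv_defect c (hess \<rho> x) (grad \<rho> x))"
  obtain L where L: "L \<ge> 0" "\<And>x y. x \<in> V \<Longrightarrow> y \<in> V \<Longrightarrow> \<bar>\<tau> x - \<tau> y\<bar> \<le> L * norm (x - y)"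
    using curv_defect_lip[OF U V, of c] unfolding lip_bounded_def \<tau>_def by blast
  have \<tau>0: "\<tau> x = 0" if "x \<in> U" "\<rho> x = 0" for x
    unfolding \<tau>_def by (rule curv_defect_mean_curv[OF hess_bilinear[OF U(1) C2] nz curv]) (use that in auto)
  define n where "n = real DIM('a)"
  define C0 where "C0 = (2 * K + 1) * (n * K) + (2 * K + 1) * K + 3 * \<bar>c\<bar> * (K + 1)\<^sup>2"
  have C0: "C0 \<ge> 0" unfolding C0_def n_def using K(1) by (intro add_nonneg_nonneg mult_nonneg_nonneg) auto
  \<comment> \<open>Balanced so that in 2 M \<kappa> the term L / k1 pays for the defect at the
    reflected point, 2 n K^2 for the isotropic part of the perturbation, and 5 C0 for its gradient,
    of norm at most 5 \<epsilon>. Of the remaining 2, at most 1 goes to the error that depends on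
    \<open>M\<close>.\<close>
  define M where "M = (L / k1 + 2 * n * K\<^sup>2 + 5 * C0 + 2) / (2 * \<kappa>)"
  have M: "M \<ge> 0" unfolding M_def n_def using L k1 C0 \<kappa> K
    by (intro divide_nonneg_nonneg add_nonneg_nonneg mult_nonneg_nonneg) auto
  have M2: "2 * M * \<kappa> = L / k1 + 2 * n * K\<^sup>2 + 5 * C0 + 2" using \<kappa> by (simp add: M_def)
  define C1 where "C1 = (2 * K + 1) * (4 * M + 2 * n + 2)"
  have C1: "C1 > 0" unfolding C1_def n_def using K(1) M by (intro mult_pos_pos add_nonneg_pos) auto
  \<comment> \<open>M r1 \<le> 1 and r1 \<le> 1 / 2 give z \<le> 1 and a gradient of
    \<open>z\<close> of norm at most 5; r0 / 2 leaves room in \<open>V\<close> for a further segment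
    of length r0 / 2.\<close>
  define r1 where "r1 = min (min (r0 / 2) (1 / (M + 1))) (1 / 2)"
  have r1: "r1 > 0" "r1 \<le> r0 / 2" "r1 \<le> 1 / 2" "M * r1 \<le> 1"
  proof -
    show "r1 > 0" "r1 \<le> r0 / 2" "r1 \<le> 1 / 2" using r0(1) M by (auto simp: r1_def)
    have "M * r1 \<le> M * (1 / (M + 1))" using M by (intro mult_left_mono) (auto simp: r1_def)
    also have "\<dots> \<le> 1" using M by (simp add: field_simps)
    finally show "M * r1 \<le> 1" .
  qed
  have r1V: "cball Q r1 \<subseteq> V" unfolding V_def using r1 r0(1) by (intro subset_cball) auto
  have RV: "R x \<in> cball Q r \<longleftrightarrow> x \<in> cball Q r" for x r
    using reflect_cball[OF e, of x \<mu> Q r] RQ unfolding R_def by simp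
  define s where "s = (\<lambda>x. (- e) \<bullet> (x - Q))"
  have s: "s x = \<mu> - x \<bullet> e" for x by (simp add: s_def Q(2)[symmetric] inner_diff_right inner_commute)
  \<comment> \<open>The linear term makes \<open>z\<close> positive on entering the side s > 0, the
    term with \<open>M\<close> provides the bending in the direction \<open>e\<close>, and the last
    term makes \<open>z\<close> negative on the plane away from \<open>Q\<close>.\<close>
  define z where "z = (\<lambda>x. s x + M * (s x * s x) - (norm (x - Q))\<^sup>2)"
  define \<zeta> where "\<zeta> = (\<lambda>x. - (1 + 2 * M * s x) *\<^sub>R e - 2 *\<^sub>R (x - Q))"
  have jz: "jet2 z x (\<zeta> x) (slope_form M e)" for x unfolding z_def \<zeta>_def s_def by (rule jet2_slope)
  have sb: "\<bar>s x\<bar> \<le> r1" if "x \<in> cball Q r1" for x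
  proof -
    have "\<bar>s x\<bar> \<le> norm (x - Q)" using Cauchy_Schwarz_ineq2[of "- e" "x - Q"] e by (simp add: s_def)
    then show ?thesis using that by (simp add: dist_norm norm_minus_commute)
  qed
  have Msb: "M * \<bar>s x\<bar> \<le> 1" if "x \<in> cball Q r1" for x
    using mult_left_mono[OF sb[OF that] M] r1(4) by linarith
  have z1: "z x \<le> 1" if "x \<in> cball Q r1" for x
  proof -
    have "M * (s x * s x) = (M * \<bar>s x\<bar>) * \<bar>s x\<bar>" by (simp add: mult.assoc)
    also have "\<dots> \<le> 1 * \<bar>s x\<bar>" using Msb[OF that] by (intro mult_right_mono) auto
    finally have "M * (s x * s x) \<le> \<bar>s x\<bar>" by simp
    moreover have "(norm (x - Q))\<^sup>2 \<ge> 0" by simp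
    ultimately show ?thesis using sb[OF that] r1(3) unfolding z_def by linarith
  qed
  have \<zeta>5: "norm (\<zeta> x) \<le> 5" if "x \<in> cball Q r1" for x
  proof -
    have "norm (\<zeta> x) \<le> \<bar>1 + 2 * M * s x\<bar> + 2 * norm (x - Q)"
      unfolding \<zeta>_def using norm_triangle_ineq4[of "- (1 + 2 * M * s x) *\<^sub>R e" "2 *\<^sub>R (x - Q)"] e by simp
    moreover have "\<bar>M * s x\<bar> \<le> 1" using Msb[OF that] M by (simp add: abs_mult)
    then have "\<bar>1 + 2 * M * s x\<bar> \<le> 3" unfolding mult.assoc by linarith
    moreover have "norm (x - Q) \<le> 1 / 2" using that r1(3) by (simp add: dist_norm norm_minus_commute)
    ultimately show ?thesis by linarith
  qed
  have cont\<rho>: "continuous_on V \<rho>" by (rule continuous_on_subset[OF C2_cont[OF U(1) C2] V(3)])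
  have cont\<rho>1: "continuous_on (cball Q r1) \<rho>" by (rule continuous_on_subset[OF cont\<rho> r1V])
  have contR: "continuous_on (cball Q r1) (\<lambda>x. \<rho> (R x))"
    by (rule continuous_on_compose2[OF cont\<rho>1 continuous_on_reflect[of _ e \<mu>, folded R_def]]) (use RV in auto)
  have cs: "continuous_on S s" for S unfolding s_def by (intro continuous_intros)
  have cz: "continuous_on S z" for S unfolding z_def by (intro continuous_intros cs)
  have order': "\<rho> (R x) > 0" if "x \<in> cball Q r1" "s x > 0" "\<rho> x \<ge> 0" for x
  proof (rule ccontr)
    assume "\<not> \<rho> (R x) > 0"
    moreover have "x \<in> U" "R x \<in> U" using that(1) RV[of x r1] r1V V(3) by blast+
    ultimately have "\<rho> x < 0" using order[of x] that(2) unfolding R_def s by simp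
    then show False using that(3) by simp
  qed
  define G where "G = {x \<in> cball Q r1. \<rho> x \<ge> 0} \<inter> {x. s x \<ge> 0}"
  have G: "compact G"
  proof -
    have "closed (cball Q r1 \<inter> \<rho> -` {0..})" by (rule continuous_closed_preimage[OF cont\<rho>1]) auto
    then have "compact (cball Q r1 \<inter> (cball Q r1 \<inter> \<rho> -` {0..}))" by (intro compact_Int_closed compact_cball)
    moreover have "cball Q r1 \<inter> (cball Q r1 \<inter> \<rho> -` {0..}) = {x \<in> cball Q r1. \<rho> x \<ge> 0}" by auto
    moreover have "closed {x. s x \<ge> 0}" by (intro closed_Collect_le continuous_on_const cs)
    ultimately show ?thesis unfolding G_def by (simp add: compact_Int_closed)
  qed
  \<comment> \<open>On the sphere, negativity of \<open>F\<close> forces z > 0 and hence s > 0,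
    where the ordering makes \<open>\<rho> (R x)\<close> positive. By compactness it is at least
    some \<open>m0 > 0\<close>, so a small \<epsilon> keeps the negative minimum away from the
    sphere.\<close>
  define W where "W = G \<inter> (sphere Q r1 \<inter> {x. z x \<ge> 0})"
  have W: "compact W" unfolding W_def
    by (intro compact_Int_closed G closed_Int closed_sphere closed_Collect_le continuous_on_const cz)
  have Wpos: "\<rho> (R x) > 0" if "x \<in> W" for x
  proof (rule order')
    have x: "s x \<ge> 0" "norm (x - Q) = r1" "z x \<ge> 0" "\<rho> x \<ge> 0"
      using that by (auto simp: W_def G_def dist_norm norm_minus_commute)
    have "s x \<noteq> 0" using x r1(1) by (auto simp: z_def)
    then show "s x > 0" using x by simp
    show "x \<in> cball Q r1" "\<rho> x \<ge> 0" using that by (auto simp: W_def G_def)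
  qed
  obtain m0 where m0: "m0 > 0" "\<And>x. x \<in> W \<Longrightarrow> \<rho> (R x) \<ge> m0"
  proof (cases "W = {}")
    case True then show ?thesis using that[of 1] by simp
  next
    case False
    have "continuous_on W (\<lambda>x. \<rho> (R x))" by (rule continuous_on_subset[OF contR]) (auto simp: W_def G_def)
    from continuous_attains_inf[OF W False this] obtain x where "x \<in> W" "\<forall>y\<in>W. \<rho> (R x) \<le> \<rho> (R y)" by blast
    then show ?thesis using that[of "\<rho> (R x)"] Wpos by blast
  qed
  \<comment> \<open>The bounds serve in turn: perturbation gradient of norm at most 1; no minimum on
    the sphere; no vanishing of the full gradient; a segment of length \<epsilon> / k1 that fits
    into \<open>V\<close>; and the error with \<open>C1\<close> at most \<epsilon>.\<close>
  define \<epsilon> where "\<epsilon> = min (min (1 / 5) (m0 / 2)) (min (\<kappa> / 26) (min (k1 * (r0 / 2)) (1 / (5 * C1))))"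
  have \<epsilon>: "\<epsilon> > 0" "\<epsilon> \<le> 1 / 5" "\<epsilon> < m0" "25 * \<epsilon> < \<kappa>" "\<epsilon> \<le> k1 * (r0 / 2)" "5 * \<epsilon> * C1 \<le> 1"
  proof -
    show "\<epsilon> > 0" using m0 \<kappa> k1 r0(1) C1 by (simp add: \<epsilon>_def)
    have le: "\<epsilon> \<le> 1 / 5" "\<epsilon> \<le> m0 / 2" "\<epsilon> \<le> \<kappa> / 26" "\<epsilon> \<le> k1 * (r0 / 2)" "\<epsilon> \<le> 1 / (5 * C1)" unfolding \<epsilon>_def by linarith+
    show "\<epsilon> \<le> 1 / 5" "\<epsilon> < m0" "25 * \<epsilon> < \<kappa>" "\<epsilon> \<le> k1 * (r0 / 2)" using le m0(1) \<kappa> by linarith+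
    have "\<epsilon> * (5 * C1) \<le> 1 / (5 * C1) * (5 * C1)" using le(5) C1 by (intro mult_right_mono) auto
    then show "5 * \<epsilon> * C1 \<le> 1" using C1 by (simp add: algebra_simps)
  qed
  define F where "F = (\<lambda>x. \<rho> (R x) - \<epsilon> * z x)"
  have contF: "continuous_on (cball Q r1) F" unfolding F_def by (intro continuous_intros contR cz)
  have jF: "jet2 F x (rf e (grad \<rho> (R x)) - \<epsilon> *\<^sub>R \<zeta> x)
     (\<lambda>v w. hess \<rho> (R x) (rf e v) (rf e w) - \<epsilon> * slope_form M e v w)" if "R x \<in> U" for x
    unfolding F_def R_def by (intro jet2_diff jet2_cmult jz jet2_reflect[OF e] C2_jet2[OF U(1) C2] that[unfolded R_def])
  \<comment> \<open>Because the gradient at \<open>Q\<close> is orthogonal to \<open>e\<close>, the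
    reflected \<rho> is stationary in the direction -e, so \<open>F\<close> starts at 0 with slope
    -\<epsilon>. The quadratic bend along \<open>n0\<close> keeps the curve in the set \<rho> \<ge>
    0.\<close>
  have "\<exists>x\<in>G. F x < 0"
  proof -
    define \<alpha> where "\<alpha> = (\<bar>hess \<rho> Q (- e) (- e)\<bar> + 1) / g0"
    let ?\<gamma> = "\<lambda>s::real. Q + s *\<^sub>R (- e) + s\<^sup>2 *\<^sub>R (\<alpha> *\<^sub>R n0)"
    have "has_d2 (\<lambda>s. \<rho> (?\<gamma> s)) 0 (hess \<rho> Q (- e) (- e) + 2 * (\<bar>hess \<rho> Q (- e) (- e)\<bar> + 1))"
      using C2_jet2[OF U(1) C2 Q(1), unfolded jet2_def, rule_format, of "- e" "\<alpha> *\<^sub>R n0"] g0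
      by (simp add: Q(4) n0(2) \<alpha>_def)
    moreover have "hess \<rho> Q (- e) (- e) + 2 * (\<bar>hess \<rho> Q (- e) (- e)\<bar> + 1) > 0"
      using abs_ge_minus_self[of "hess \<rho> Q (- e) (- e)"] abs_ge_zero[of "hess \<rho> Q (- e) (- e)"]
      unfolding distrib_left by linarith
    ultimately have "\<forall>\<^sub>F s in nhds 0. \<rho> (?\<gamma> s) \<ge> 0" using has_d2_strict Q(3) by fastforce
    then have 1: "\<forall>\<^sub>F s in at_right 0. \<rho> (?\<gamma> s) \<ge> 0" by (rule filter_leD[OF at_within_le_nhds])
    have "\<forall>\<^sub>F s in nhds 0. ?\<gamma> s \<in> ball Q r1"
      using topological_tendstoD[OF tendsto_curve[of Q "- e" "\<alpha> *\<^sub>R n0"] open_ball, of Q r1] r1(1) by simp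
    then have 2: "\<forall>\<^sub>F s in at_right 0. ?\<gamma> s \<in> ball Q r1" by (rule filter_leD[OF at_within_le_nhds])
    have RQU: "R Q \<in> U" using RQ Q(1) by simp
    have "rf e (grad \<rho> (R Q)) \<bullet> (- e) = 0" using rf_inner_e[OF e, of "grad \<rho> Q"] Q(4) by (simp add: RQ)
    moreover have "\<zeta> Q \<bullet> (- e) = 1" by (simp add: \<zeta>_def s_def e_sq[OF e])
    ultimately have "(rf e (grad \<rho> (R Q)) - \<epsilon> *\<^sub>R \<zeta> Q) \<bullet> (- e) = - \<epsilon>" by (simp add: inner_diff_left)
    then have "((\<lambda>s. F (?\<gamma> s)) has_real_derivative - \<epsilon>) (at 0)"
      using has_d2_deriv[OF jF[OF RQU, unfolded jet2_def, rule_format, of "- e" "\<alpha> *\<^sub>R n0"]] by simp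
    from DERIV_neg_dec_right[OF this] obtain d where d: "d > 0" "\<And>h. 0 < h \<Longrightarrow> h < d \<Longrightarrow> F (?\<gamma> (0 + h)) < F (?\<gamma> 0)"
      using \<epsilon>(1) by auto
    have FQ: "F (?\<gamma> 0) = 0" by (simp add: F_def RQ Q(3) z_def s_def)
    have "\<forall>\<^sub>F h in at_right 0. 0 < h \<and> h < d"
      using d(1) eventually_at_right_real by (auto elim: eventually_mono)
    with 1 2 have "\<forall>\<^sub>F h in at_right 0. ?\<gamma> h \<in> G \<and> F (?\<gamma> h) < 0"
    proof eventually_elim
      case (elim h)
      have "s (?\<gamma> h) = h" unfolding s by (simp add: inner_add_left inner_diff_left e_sq[OF e] n0(3) Q(2))
      then show ?case using elim d(2)[of h] FQ by (simp add: G_def less_imp_le)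
    qed
    then have "\<exists>h. ?\<gamma> h \<in> G \<and> F (?\<gamma> h) < 0" using eventually_happens by fastforce
    then show ?thesis by blast
  qed
  then obtain xg where xg: "xg \<in> G" "F xg < 0" by blast
  have "continuous_on G F" by (rule continuous_on_subset[OF contF]) (auto simp: G_def)
  then obtain x0 where x0: "x0 \<in> G" "\<And>y. y \<in> G \<Longrightarrow> F x0 \<le> F y"
    using continuous_attains_inf[OF G] xg(1) by blast
  have Fneg: "F x0 < 0" using x0(2)[OF xg(1)] xg(2) by simp
  have x0b: "x0 \<in> cball Q r1" "\<rho> x0 \<ge> 0" "s x0 \<ge> 0" using x0(1) by (auto simp: G_def)
  have s0: "s x0 > 0"
  proof (rule ccontr)
    assume "\<not> s x0 > 0"
    then have "s x0 = 0" using x0b by simp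
    then have "R x0 = x0" "z x0 \<le> 0" using reflect_on_plane[OF e, of x0 \<mu>] s[of x0] by (auto simp: R_def z_def)
    moreover have "\<epsilon> * z x0 \<le> 0" using \<open>z x0 \<le> 0\<close> \<epsilon>(1) by (simp add: mult_nonneg_nonpos)
    ultimately have "F x0 \<ge> 0" using x0b unfolding F_def by simp
    then show False using Fneg by simp
  qed
  have \<rho>R: "\<rho> (R x0) > 0" by (rule order'[OF x0b(1) s0 x0b(2)])
  have zlt: "\<rho> (R x0) < \<epsilon> * z x0" using Fneg by (simp add: F_def)
  then have "\<epsilon> * z x0 > 0" using \<rho>R by linarith
  then have zpos: "z x0 > 0" using \<epsilon>(1) by (simp add: zero_less_mult_iff)
  have "\<epsilon> * z x0 \<le> \<epsilon> * 1" using z1[OF x0b(1)] \<epsilon>(1) by (intro mult_left_mono) auto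
  then have \<rho>\<epsilon>: "\<rho> (R x0) < \<epsilon>" using zlt by simp
  have x0in: "x0 \<in> ball Q r1"
  proof (rule ccontr)
    assume "x0 \<notin> ball Q r1"
    then have "x0 \<in> W" using x0(1) x0b zpos by (auto simp: W_def)
    then show False using m0(2) \<rho>\<epsilon> \<epsilon>(3) by fastforce
  qed
  have x0U: "x0 \<in> U" "R x0 \<in> U" "R x0 \<in> V" using x0b(1) RV[of x0 r1] r1V V(3) by blast+
  have locmin: "\<forall>\<^sub>F y in nhds x0. \<rho> y \<ge> 0 \<longrightarrow> F y \<ge> F x0"
  proof -
    have "open {x. s x > 0}" by (intro open_Collect_less continuous_on_const cs)
    then have "\<forall>\<^sub>F y in nhds x0. s y > 0" using eventually_nhds_in_open[of "{x. s x > 0}" x0] s0 by simp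
    moreover have "\<forall>\<^sub>F y in nhds x0. y \<in> ball Q r1" using x0in by (intro eventually_nhds_in_open) auto
    ultimately show ?thesis
      by eventually_elim (use x0(2) in \<open>auto simp: G_def less_imp_le\<close>)
  qed
  define p A where "p = rf e (grad \<rho> (R x0))" and "A = (\<lambda>v w. hess \<rho> (R x0) (rf e v) (rf e w))"
  have blH: "bilinear (hess \<rho> (R x0))" by (rule hess_bilinear[OF U(1) C2 x0U(2)])
  have blA: "bilinear A" unfolding A_def
    using blH linear_compose[OF rf_linear[of e]] unfolding bilinear_def by (auto simp: o_def)
  have blZ: "bilinear (\<lambda>v w. A v w - \<epsilon> * slope_form M e v w)"
    unfolding bilinear_def slope_form_def
    by (auto intro!: linearI simp: bilinear_ladd[OF blA] bilinear_radd[OF blA] bilinear_lmul[OF blA]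
        bilinear_rmul[OF blA] inner_add_left inner_add_right algebra_simps)
  have pK: "norm p \<le> K" using K(2)[OF x0U(3)] by (simp add: p_def norm_rf[OF e])
  have p\<kappa>: "(norm p)\<^sup>2 - (p \<bullet> e)\<^sup>2 \<ge> \<kappa>"
    using r0(3)[of "R x0"] x0U(3) by (simp add: p_def norm_rf[OF e] rf_inner_e[OF e] V_def)
  have AK: "\<bar>A v w\<bar> \<le> K * norm v * norm w" for v w
    using K(3)[OF x0U(3), of "rf e v" "rf e w"] by (simp add: A_def norm_rf[OF e])
  define q where "q = \<epsilon> *\<^sub>R \<zeta> x0"
  have q5: "norm q \<le> 5 * \<epsilon>" using mult_left_mono[OF \<zeta>5[OF x0b(1)], of \<epsilon>] \<epsilon>(1) by (simp add: q_def)
  have q1: "norm q \<le> 1" using q5 \<epsilon>(2) by simp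
  have jF0: "jet2 F x0 (p - q) (\<lambda>v w. A v w - \<epsilon> * slope_form M e v w)"
    using jF[OF x0U(2)] by (simp add: p_def q_def A_def)
  \<comment> \<open>Off the boundary the minimum would be unconstrained, forcing p = q; but |p|^2
    \<ge> \<kappa>, while \<open>q\<close> is small.\<close>
  have \<rho>0: "\<rho> x0 = 0"
  proof (rule ccontr)
    assume "\<rho> x0 \<noteq> 0"
    then have pos: "\<rho> x0 > 0" using x0b by simp
    have "isCont \<rho> x0" using C2_cont[OF U(1) C2] U(1) x0U(1) by (simp add: continuous_on_eq_continuous_at)
    then have "(\<rho> \<longlongrightarrow> \<rho> x0) (nhds x0)" by (simp add: isCont_def tendsto_nhds_iff)
    then have "\<forall>\<^sub>F y in nhds x0. \<rho> y > 0" using pos by (rule order_tendstoD(1))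
    with locmin have "\<forall>\<^sub>F y in nhds x0. F y \<ge> F x0" by eventually_elim simp
    then have "p - q = 0" by (rule jet2_local_min[OF jF0])
    then have "(norm p)\<^sup>2 \<le> (5 * \<epsilon>)\<^sup>2" using q5 by (intro power_mono) auto
    also have "\<dots> = 25 * \<epsilon> * \<epsilon>" by (simp add: power2_eq_square)
    also have "\<dots> \<le> 25 * \<epsilon> * 1" using \<epsilon>(1,2) by (intro mult_left_mono) auto
    finally have "(norm p)\<^sup>2 < \<kappa>" using \<epsilon>(4) by simp
    moreover have "(p \<bullet> e)\<^sup>2 \<ge> 0" by simp
    ultimately show False using p\<kappa> by linarith
  qed
  have "curv_defect c (\<lambda>v w. A v w - \<epsilon> * slope_form M e v w) (p - q) \<ge> 0"
    by (rule curv_defect_constrained_min[OF jF0 blZ C2_jet2[OF U(1) C2 x0U(1)] hess_bilinear[OF U(1) C2 x0U(1)]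
          nz[OF x0U(1)] \<rho>0 \<tau>0[OF x0U(1) \<rho>0, unfolded \<tau>_def] locmin])
  also have "curv_defect c (\<lambda>v w. A v w - \<epsilon> * slope_form M e v w) (p - q) \<le>
    curv_defect c A p - \<epsilon> * (2 * M * \<kappa> - 2 * n * K\<^sup>2) + C0 * norm q + \<epsilon> * C1 * norm q"
    using curv_defect_perturb[OF blA AK K(1) pK q1 e M less_imp_le[OF \<epsilon>(1)] p\<kappa>, of c]
    unfolding C0_def C1_def n_def by simp
  also have "\<dots> \<le> \<epsilon> * (L / k1) - \<epsilon> * (2 * M * \<kappa> - 2 * n * K\<^sup>2) + C0 * (5 * \<epsilon>) + \<epsilon> * C1 * (5 * \<epsilon>)"
  proof (intro add_mono diff_right_mono mult_left_mono q5)
    define y0 where "y0 = R x0"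
    have y0: "y0 \<in> cball Q r1" "0 < \<rho> y0" "\<rho> y0 < \<epsilon>" using RV[of x0 r1] x0b(1) \<rho>R \<rho>\<epsilon> by (auto simp: y0_def)
    have "curv_defect c A p = \<tau> y0"
      unfolding curv_defect_def \<tau>_def A_def p_def y0_def
      by (simp add: trace_rf[OF e blH] norm_rf[OF e] rf_rf[OF e])
    \<comment> \<open>The reflected minimum satisfies 0 < \<rho> < \<epsilon>, and \<rho> decreases
      at rate at least \<open>k1\<close> along -n0. So the boundary, where the defect is 0, lies
      within distance \<epsilon> / k1, and the Lipschitz bound applies.\<close>
    also have "\<tau> y0 \<le> \<epsilon> * (L / k1)"
    proof -
      have inV: "y0 + \<theta> *\<^sub>R (- n0) \<in> V" if "0 \<le> \<theta>" "\<theta> \<le> \<epsilon> / k1" for \<theta>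
      proof -
        have "\<epsilon> / k1 \<le> r0 / 2" using \<epsilon>(5) k1 by (simp add: pos_divide_le_eq mult.commute)
        then have "\<theta> \<le> r0 / 2" using that(2) by linarith
        moreover have "dist Q y0 \<le> r1" using y0(1) by simp
        moreover have "dist y0 (y0 + \<theta> *\<^sub>R (- n0)) = \<theta>" using that(1) n0(1) by (simp add: dist_norm)
        ultimately have "dist Q (y0 + \<theta> *\<^sub>R (- n0)) \<le> r1 + r0 / 2"
          using dist_triangle[of Q "y0 + \<theta> *\<^sub>R (- n0)" y0] by linarith
        then show ?thesis using r1(2) by (simp add: V_def)
      qed
      define h where "h = (\<lambda>\<theta>. \<rho> (y0 + \<theta> *\<^sub>R (- n0)))"
      define h' where "h' = (\<lambda>\<theta>. - (grad \<rho> (y0 + \<theta> *\<^sub>R (- n0)) \<bullet> n0))"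
      have dh: "(h has_real_derivative h' \<theta>) (at \<theta>)" if "0 \<le> \<theta>" "\<theta> \<le> \<epsilon> / k1" for \<theta>
      proof -
        have inU: "y0 + \<theta> *\<^sub>R (- n0) \<in> U" using inV[OF that] V(3) by blast
        have "((\<lambda>\<theta>. y0 + \<theta> *\<^sub>R (- n0)) has_derivative (\<lambda>k. k *\<^sub>R (- n0))) (at \<theta>)" by (auto intro!: derivative_eq_intros)
        from has_derivative_compose[OF this C2_grad[OF U(1) C2 inU]]
        have "(h has_derivative (\<lambda>k. grad \<rho> (y0 + \<theta> *\<^sub>R (- n0)) \<bullet> (k *\<^sub>R (- n0)))) (at \<theta>)" unfolding h_def .
        moreover have "(\<lambda>k. grad \<rho> (y0 + \<theta> *\<^sub>R (- n0)) \<bullet> (k *\<^sub>R (- n0))) = (*) (h' \<theta>)"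
          by (rule ext) (simp add: h'_def mult.commute)
        ultimately show ?thesis by (simp add: has_field_derivative_def)
      qed
      have e0: "0 \<le> \<epsilon> / k1" using \<epsilon>(1) k1 by simp
      have "h (\<epsilon> / k1) - h 0 \<le> (- k1) * (\<epsilon> / k1) - (- k1) * 0"
      proof (rule DERIV_le_mono[OF e0 dh])
        show "((\<lambda>x. - k1 * x) has_real_derivative - k1) (at x)" for x by (auto intro!: derivative_eq_intros)
        show "h' x \<le> - k1" if "0 \<le> x" "x \<le> \<epsilon> / k1" for x
          using r0(4) inV[OF that] by (simp add: h'_def V_def)
      qed
      then have "h (\<epsilon> / k1) \<le> 0" using y0(3) k1 by (simp add: h_def)
      moreover have "h 0 \<ge> 0" using y0(2) by (simp add: h_def)
      moreover have "continuous_on {0..\<epsilon> / k1} h"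
        by (intro continuous_at_imp_continuous_on ballI DERIV_isCont[OF dh]) auto
      ultimately obtain \<theta> where \<theta>: "0 \<le> \<theta>" "\<theta> \<le> \<epsilon> / k1" "h \<theta> = 0"
        using IVT2'[of h "\<epsilon> / k1" 0 0] e0 by auto
      define y1 where "y1 = y0 + \<theta> *\<^sub>R (- n0)"
      have y1: "y1 \<in> V" "\<rho> y1 = 0" using inV[OF \<theta>(1,2)] \<theta>(3) by (auto simp: y1_def h_def)
      have "y0 \<in> V" using y0(1) r1V by blast
      from L(2)[OF this y1(1)] have "\<tau> y0 \<le> L * norm (y0 - y1)"
        using \<tau>0[OF subsetD[OF V(3) y1(1)] y1(2)] by simp
      also have "norm (y0 - y1) = \<theta>" using n0(1) \<theta>(1) by (simp add: y1_def)
      also have "L * \<theta> \<le> L * (\<epsilon> / k1)" using L(1) \<theta>(2) by (intro mult_left_mono) auto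
      finally show ?thesis by (simp add: mult.commute)
    qed
    finally show "curv_defect c A p \<le> \<epsilon> * (L / k1)" .
  qed (use C0 C1 \<epsilon> in auto)
  also have "\<dots> = \<epsilon> * (5 * \<epsilon> * C1 - 2)" unfolding M2 by (simp add: algebra_simps)
  also have "\<dots> < 0" using \<epsilon>(1,6) by (simp add: mult_pos_neg)
  finally show False by simp
qed

section \<open>Moving planes\<close>

text \<open>Near a boundary point the frontier meets each line in the direction of the normal at most
  once, so it has arbitrarily many disjoint translates in a bounded set.\<close>

lemma negligible_frontier_smooth_domain:
  fixes \<Omega> :: "'a::euclidean_space set"
  assumes sm: "smooth_bounded_domain \<Omega>" shows "negligible (frontier \<Omega>)"
proof (subst locally_negligible_alt, intro ballI)
  note S = smooth_bounded_domainD[OF sm]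
  fix x assume x: "x \<in> frontier \<Omega>"
  obtain U \<rho> where U: "local_defining \<Omega> U \<rho>" "x \<in> U" using smooth_bounded_domain_local[OF sm x] by blast
  note D = local_definingD[OF U(1)]
  define v where "v = grad \<rho> x"
  have v: "v \<noteq> 0" using D(4)[OF U(2)] by (simp add: v_def)
  have "isCont (grad \<rho>) x" using C2_cont_grad[OF D(1,2)] D(1) U(2) by (simp add: continuous_on_eq_continuous_at)
  then have "(grad \<rho> \<longlongrightarrow> grad \<rho> x) (nhds x)" by (simp add: isCont_def tendsto_nhds_iff)
  then have "((\<lambda>y. grad \<rho> y \<bullet> v) \<longlongrightarrow> v \<bullet> v) (nhds x)" unfolding v_def by (intro tendsto_intros)
  then have "\<forall>\<^sub>F y in nhds x. grad \<rho> y \<bullet> v > 0" by (rule order_tendstoD(1)) (use v in simp)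
  moreover have "\<forall>\<^sub>F y in nhds x. y \<in> U" using D(1) U(2) by (rule eventually_nhds_in_open)
  ultimately obtain r where r: "r > 0" "\<And>y. y \<in> cball x r \<Longrightarrow> grad \<rho> y \<bullet> v > 0" "\<And>y. y \<in> cball x r \<Longrightarrow> y \<in> U"
    using eventually_nhds_cball[OF eventually_conj] by (metis (no_types, lifting))
  define A where "A = frontier \<Omega> \<inter> cball x r"
  have inj: "\<not> (y \<in> A \<and> y + s *\<^sub>R v \<in> A)" if "s > 0" for y s
  proof
    assume *: "y \<in> A \<and> y + s *\<^sub>R v \<in> A"
    then have yU: "y \<in> cball x r" "y + s *\<^sub>R v \<in> cball x r" by (auto simp: A_def)
    have 0: "\<rho> y = 0" "\<rho> (y + s *\<^sub>R v) = 0"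
      using * yU r(3) local_defining_frontier[OF S(1) U(1)] by (auto simp: A_def)
    have seg: "y + \<theta> *\<^sub>R v \<in> cball x r" if "0 \<le> \<theta>" "\<theta> \<le> s" for \<theta>
    proof -
      have "(1 - \<theta> / s) *\<^sub>R y + (\<theta> / s) *\<^sub>R (y + s *\<^sub>R v) \<in> cball x r"
        by (rule convexD[OF convex_cball yU]) (use that \<open>s > 0\<close> in auto)
      then show ?thesis using \<open>s > 0\<close> by (simp add: algebra_simps)
    qed
    have "\<exists>z. 0 < z \<and> z < s \<and> \<rho> (y + s *\<^sub>R v) - \<rho> (y + 0 *\<^sub>R v) = (s - 0) * (grad \<rho> (y + z *\<^sub>R v) \<bullet> v)"
    proof (rule MVT2[OF that])
      fix \<theta> assume "0 \<le> \<theta>" "\<theta> \<le> s"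
      then have "y + \<theta> *\<^sub>R v \<in> U" using seg r(3) by blast
      moreover have "((\<lambda>\<theta>. y + \<theta> *\<^sub>R v) has_derivative (\<lambda>h. h *\<^sub>R v)) (at \<theta>)" by (auto intro!: derivative_eq_intros)
      ultimately have "((\<lambda>\<theta>. \<rho> (y + \<theta> *\<^sub>R v)) has_derivative (\<lambda>h. grad \<rho> (y + \<theta> *\<^sub>R v) \<bullet> (h *\<^sub>R v))) (at \<theta>)"
        using has_derivative_compose C2_grad[OF D(1,2)] by blast
      then show "((\<lambda>\<theta>. \<rho> (y + \<theta> *\<^sub>R v)) has_real_derivative grad \<rho> (y + \<theta> *\<^sub>R v) \<bullet> v) (at \<theta>)"
        by (simp add: has_field_derivative_def mult_commute_abs)
    qed
    then obtain z where z: "0 < z" "z < s" "0 = s * (grad \<rho> (y + z *\<^sub>R v) \<bullet> v)" using 0 by auto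
    have "grad \<rho> (y + z *\<^sub>R v) \<bullet> v > 0" by (rule r(2)[OF seg]) (use z in auto)
    then show False using z(3) that by simp
  qed
  have A: "A \<in> lmeasurable" unfolding A_def by (intro lmeasurable_compact closed_Int_compact frontier_closed compact_cball)
  define m where "m = measure lebesgue A"
  define T where "T = cball x (r + norm v)"
  have bound: "real N * m \<le> measure lebesgue T" for N
  proof (cases "N = 0")
    case False
    \<comment> \<open>Equally spaced shifts along \<open>v\<close> of total length at most |v|: the
      translates stay in one ball and are disjoint, since no line parallel to \<open>v\<close> meets
      \<open>A\<close> twice.\<close>
    define h where "h = (\<lambda>k. (real k / real N) *\<^sub>R v)"
    define F where "F = (\<lambda>k. (+) (h k) ` A)"
    have Fm: "F k \<in> lmeasurable" "measure lebesgue (F k) = m" for k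
      unfolding F_def m_def by (auto intro: measurable_translation A measure_translation)
    have disj: "F k \<inter> F l = {}" if "k < l" for k l
    proof (rule ccontr)
      assume "F k \<inter> F l \<noteq> {}"
      then obtain a b where ab: "a \<in> A" "b \<in> A" "h k + a = h l + b" by (auto simp: F_def)
      then have "a = b + (h l - h k)" by (simp add: algebra_simps)
      also have "h l - h k = ((real l - real k) / real N) *\<^sub>R v"
        by (simp add: h_def scaleR_diff_left[symmetric] diff_divide_distrib)
      finally have "b + ((real l - real k) / real N) *\<^sub>R v \<in> A" using ab(1) by simp
      moreover have "(real l - real k) / real N > 0" using that False by simp
      ultimately show False using inj ab(2) by blast
    qed
    have "pairwise (\<lambda>k l. negligible (F k \<inter> F l)) {..<N}"
      unfolding pairwise_def using disj by (metis Int_commute linorder_neqE_nat negligible_empty)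
    then have "measure lebesgue (\<Union>(F ` {..<N})) = (\<Sum>k<N. measure lebesgue (F k))"
      by (intro measure_negligible_finite_Union_image Fm) auto
    then have "real N * m = measure lebesgue (\<Union>(F ` {..<N}))" using Fm(2) by simp
    also have "\<dots> \<le> measure lebesgue T"
    proof (rule measure_mono_fmeasurable)
      show "\<Union>(F ` {..<N}) \<subseteq> T"
      proof
        fix y assume "y \<in> \<Union>(F ` {..<N})"
        then obtain k a where k: "k < N" "a \<in> A" "y = h k + a" by (auto simp: F_def)
        have "norm (h k) \<le> norm v"
          using mult_right_mono[of "real k / real N" 1 "norm v"] k(1) by (simp add: h_def)
        moreover have "norm (x - a) \<le> r" using k(2) by (simp add: A_def dist_norm)
        moreover have "dist x y \<le> norm (x - a) + norm (h k)"
          unfolding dist_norm k(3) using norm_triangle_ineq4[of "x - a" "h k"] by (simp add: algebra_simps)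
        ultimately show "y \<in> T" by (simp add: T_def)
      qed
      show "\<Union>(F ` {..<N}) \<in> sets lebesgue" using Fm(1) by (intro sets.finite_UN) auto
      show "T \<in> lmeasurable" by (simp add: T_def)
    qed
    finally show ?thesis .
  qed simp
  have "m = 0"
  proof (rule ccontr)
    assume "m \<noteq> 0"
    then have "m > 0" by (simp add: m_def less_le)
    then obtain N :: nat where "measure lebesgue T < real N * m" using reals_Archimedean3 by blast
    then show False using bound[of N] by simp
  qed
  then have "negligible A" using A by (simp add: m_def negligible_iff_measure0)
  then have "negligible (frontier \<Omega> \<inter> ball x r)" by (rule negligible_subset) (auto simp: A_def)
  then show "\<exists>V. openin (top_of_set (frontier \<Omega>)) V \<and> x \<in> V \<and> negligible V"
    using x r(1) by (intro exI[of _ "frontier \<Omega> \<inter> ball x r"]) (auto simp: openin_open_Int)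
qed

section \<open>Moving planes for one time with constant normal derivative and constant mean
  curvature\<close>

locale overdetermined_heat = heat_from_one \<Omega> u
  for \<Omega> :: "'a::euclidean_space set" and u :: "'a \<Rightarrow> real \<Rightarrow> real" +
  fixes \<tau> b c :: real
  assumes sm: "smooth_bounded_domain \<Omega>" and \<tau>: "\<tau> > 0"
    and nd: "\<And>x. x \<in> frontier \<Omega> \<Longrightarrow> normal_deriv_eq \<Omega> (\<lambda>y. u y \<tau>) x b"
    and curv: "\<And>U \<rho> x. local_defining \<Omega> U \<rho> \<Longrightarrow> x \<in> U \<Longrightarrow> \<rho> x = 0 \<Longrightarrow> mean_curv \<rho> x = c"
begin

lemma frontier_iff: "x \<in> frontier \<Omega> \<longleftrightarrow> x \<in> closure \<Omega> \<and> x \<notin> \<Omega>"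
  by (simp add: frontier_def interior_open[OF op])

lemma u_cont_at:
  assumes "x \<in> \<Omega>" "\<epsilon> > 0"
  shows "\<exists>t0>0. \<forall>t. 0 < t \<longrightarrow> t < t0 \<longrightarrow> u x t > 1 - \<epsilon>"
proof -
  have "continuous_on {0..} (\<lambda>t. u x t)"
  proof -
    have "continuous_on {0..} (\<lambda>t::real. (x, t))" by (intro continuous_intros)
    from continuous_on_compose2[OF u_cont this] show ?thesis using assms(1) by auto
  qed
  then have "((\<lambda>t. u x t) \<longlongrightarrow> u x 0) (at 0 within {0..})" by (auto simp: continuous_on_def)
  then have "\<forall>\<^sub>F t in at 0 within {0..}. u x t > 1 - \<epsilon>"
    by (rule order_tendstoD(1)) (use assms u_init in simp)
  then obtain d where "d > 0" "\<And>t. t \<in> {0..} \<Longrightarrow> t \<noteq> 0 \<Longrightarrow> dist t 0 < d \<Longrightarrow> u x t > 1 - \<epsilon>"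
    unfolding eventually_at by auto
  then show ?thesis by (intro exI[of _ d]) (auto simp: dist_real_def)
qed

text \<open>At small times \<open>u x\<close> is near 1 by continuity at time 0, and positivity
  spreads from there to later times.\<close>

lemma u_pos:
  assumes x: "x \<in> \<Omega>" and t: "t > 0" shows "u x t > 0"
proof -
  obtain R where R: "R > 0" "cball x R \<subseteq> \<Omega>" using op x open_contains_cball by blast
  obtain t0 where t0: "t0 > 0" "\<And>s. 0 < s \<Longrightarrow> s < t0 \<Longrightarrow> u x s > 1 - 1 / 2"
    using u_cont_at[OF x, of "1 / 2"] by auto
  define s where "s = min t0 t / 2"
  have s: "0 < s" "s < t0" "s < t" using t0(1) t by (auto simp: s_def)
  have bO: "y \<in> \<Omega>" if "y \<in> ball x R" for y using that R(2) ball_subset_cball by blast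
  obtain \<epsilon> where "\<epsilon> > 0" "\<And>y. y \<in> ball x R \<Longrightarrow> u y t \<ge> \<epsilon> * (R\<^sup>2 - (norm (y - x))\<^sup>2)"
  proof (rule heat_positivity_spreads[OF R(1) s(3), of x u])
    show "\<exists>L. has_lap (\<lambda>z. u z r) L y \<and> ((\<lambda>s. u y s) has_real_derivative L) (at r)"
      if "y \<in> ball x R" "s < r" for y r using u_lap[OF bO[OF that(1)], of r] u_deriv[OF bO[OF that(1)], of r] that s by auto
    show "continuous_on (cball x R \<times> {s..t}) (\<lambda>(x, t). u x t)"
      by (rule continuous_on_subset[OF u_cont]) (use R(2) closure_subset[of \<Omega>] s in auto)
    show "u y r \<ge> 0" if "y \<in> cball x R" "s \<le> r" for y r
    proof -
      have "y \<in> closure \<Omega>" using that(1) R(2) closure_subset[of \<Omega>] by blast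
      then show ?thesis using u_nonneg[of y r] that(2) s by simp
    qed
    show "u x s > 0" using t0(2)[OF s(1,2)] by simp
  qed (use that in blast)
  from this(1) this(2)[of x] R(1) show ?thesis by (auto intro: less_le_trans[rotated])
qed

end

text \<open>A plane for which the open cap reflects into \<Omega>; this includes the critical one.
  \<open>Sg\<close> is the reflected cap, and \<open>w\<close> is \<open>u\<close> minus its
  reflection there.\<close>

locale moving_plane = overdetermined_heat \<Omega> u \<tau> b c
  for \<Omega> :: "'a::euclidean_space set" and u :: "'a \<Rightarrow> real \<Rightarrow> real" and \<tau> b c +
  fixes e :: 'a and \<mu> :: real
  assumes e: "norm e = 1"
    and good: "\<And>x. x \<in> \<Omega> \<Longrightarrow> x \<bullet> e > \<mu> \<Longrightarrow> reflect e \<mu> x \<in> \<Omega>"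
begin

abbreviation "R \<equiv> reflect e \<mu>"

definition Sg where "Sg = {z. z \<bullet> e < \<mu> \<and> R z \<in> \<Omega>}"

definition w where "w z t = u z t - u (R z) t"

lemma RR [simp]: "R (R x) = x" by (rule reflect_reflect[OF e])

lemma R_e [simp]: "R x \<bullet> e = 2 * \<mu> - x \<bullet> e" by (rule reflect_inner_e[OF e])

lemma R_plane: "x \<bullet> e = \<mu> \<Longrightarrow> R x = x" by (rule reflect_on_plane[OF e])

lemma Sg_sub: "Sg \<subseteq> \<Omega>"
proof
  fix z assume "z \<in> Sg"
  then show "z \<in> \<Omega>" using good[of "R z"] by (simp add: Sg_def)
qed

lemma Sg_open: "open Sg"
proof -
  have "open ({z. z \<bullet> e < \<mu>} \<inter> {z. R z \<in> \<Omega>})"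
    by (intro open_Int open_reflect[OF e op] open_Collect_less continuous_intros)
  then show ?thesis by (simp add: Sg_def Collect_conj_eq)
qed

lemma Sg_closure: "z \<in> closure Sg \<Longrightarrow> z \<bullet> e \<le> \<mu> \<and> R z \<in> closure \<Omega> \<and> z \<in> closure \<Omega>"
proof -
  assume z: "z \<in> closure Sg"
  have "closed ({z. z \<bullet> e \<le> \<mu>} \<inter> {z. R z \<in> closure \<Omega>})"
    by (intro closed_Int closed_reflect[OF e closed_closure] closed_Collect_le continuous_intros)
  moreover have "Sg \<subseteq> {z. z \<bullet> e \<le> \<mu>} \<inter> {z. R z \<in> closure \<Omega>}"
    using closure_subset[of \<Omega>] by (auto simp: Sg_def)
  ultimately have "z \<in> {z. z \<bullet> e \<le> \<mu>} \<inter> {z. R z \<in> closure \<Omega>}" using closure_minimal z by blast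
  moreover have "z \<in> closure \<Omega>" using closure_mono[OF Sg_sub] z by blast
  ultimately show ?thesis by simp
qed

lemma w_cont: "continuous_on (closure Sg \<times> {0<..}) (\<lambda>(z, t). w z t)"
proof -
  have 1: "continuous_on (closure Sg \<times> {0<..}) (\<lambda>p. u (fst p) (snd p))"
    using continuous_on_subset[OF u_cont, of "closure Sg \<times> {0<..}"] Sg_closure by (force simp: split_beta)
  have Rc: "continuous_on (closure Sg \<times> {0<..}) (\<lambda>p. (R (fst p), snd p))"
    by (intro continuous_intros continuous_on_compose2[OF continuous_on_reflect[of UNIV]]) auto
  have 2: "continuous_on (closure Sg \<times> {0<..}) (\<lambda>p. u (R (fst p)) (snd p))"
    using continuous_on_compose2[OF u_cont Rc] Sg_closure by (auto simp: image_subset_iff)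
  show ?thesis unfolding w_def split_beta by (intro continuous_on_diff 1 2)
qed

lemma w_heat:
  assumes "z \<in> Sg" "t > 0"
  shows "\<exists>L. has_lap (\<lambda>y. w y t) L z \<and> ((\<lambda>s. w z s) has_real_derivative L) (at t)"
proof -
  have z: "z \<in> \<Omega>" "R z \<in> \<Omega>" using assms Sg_sub by (auto simp: Sg_def)
  have "has_lap (\<lambda>y. w y t) (laplacian (\<lambda>y. u y t) z - laplacian (\<lambda>y. u y t) (R z)) z"
    unfolding w_def by (intro has_lap_diff u_lap z assms C2_has_lap_reflect[OF e op u_C2])
  moreover have "((\<lambda>s. w z s) has_real_derivative (laplacian (\<lambda>y. u y t) z - laplacian (\<lambda>y. u y t) (R z))) (at t)"
    unfolding w_def by (intro DERIV_diff u_deriv z assms)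
  ultimately show ?thesis by blast
qed

lemma w_boundary:
  assumes z: "z \<in> closure Sg" "z \<notin> Sg" and t: "t > 0" shows "w z t \<ge> 0"
proof (cases "z \<bullet> e = \<mu>")
  case True then show ?thesis by (simp add: w_def R_plane)
next
  case False
  then have "R z \<in> frontier \<Omega>" using Sg_closure[OF z(1)] z(2) by (auto simp: Sg_def frontier_iff)
  then show ?thesis using u_bdry[of "R z" t] u_nonneg[of z t] Sg_closure[OF z(1)] t by (simp add: w_def)
qed

text \<open>At time 0 the mirror point may lie on the frontier, where \<open>u\<close> has no
  initial value to compare with. The bound u \<le> 1 at the mirror point gives w \<ge> u - 1, which
  tends to 0 at points of \<Omega>; frontier points themselves belong to the exceptional
  set.\<close>

lemma w_nonneg:
  assumes z: "z \<in> closure Sg" and t: "t > 0" shows "w z t \<ge> 0"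
proof (cases "z \<in> Sg")
  case False then show ?thesis using w_boundary z t by blast
next
  case True
  have Scl: "Sg \<subseteq> closure Sg" by (rule closure_subset)
  have wge: "w z t \<ge> u z t - 1" if "z \<in> closure Sg" "t > 0" for z t
    using u_le_one[of "R z" t] Sg_closure[OF that(1)] that(2) by (simp add: w_def)
  show ?thesis
  proof (rule heat_min_principle_cylinder[where D = Sg and T = t and w = w and M = 1 and Z = "frontier \<Omega>",
        OF Sg_open _ _ _ _ compact_frontier_dom neg _ True t order_refl])
    show "bounded Sg" by (rule bounded_subset[OF bounded_dom Sg_sub])
    show "heat_supersolution (Sg \<times> {0<..t}) w" unfolding heat_supersolution_def
    proof (intro allI impI)
      fix x r assume "(x, r) \<in> Sg \<times> {0<..t}"
      then have "x \<in> Sg" "r > 0" by auto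
      from w_heat[OF this] show "\<exists>L d. has_lap (\<lambda>y. w y r) L x \<and> ((\<lambda>s. w x s) has_real_derivative d) (at r within {..r}) \<and> L \<le> d"
        using DERIV_subset[of "\<lambda>s. w x s" _ r UNIV "{..r}"] by blast
    qed
    show "continuous_on (Sg \<times> {0<..t}) (\<lambda>(x, t). w x t)"
      by (rule continuous_on_subset[OF w_cont]) (use Scl in auto)
    show "- 1 \<le> w x r" if "x \<in> Sg" "0 < r" for x r
      using wge[of x r] u_nonneg[of x r] Sg_closure[of x] that Scl by force
    fix x r and \<epsilon> :: real
    assume x: "x \<in> closure Sg" "0 \<le> r" "r \<le> t" "x \<notin> Sg \<or> r = 0" "\<not> (r = 0 \<and> x \<in> frontier \<Omega>)" "\<epsilon> > 0"
    show "\<forall>\<^sub>F p in at (x, r) within Sg \<times> {0<..t}. - \<epsilon> < w (fst p) (snd p)"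
    proof (cases "r = 0")
      case False
      then show ?thesis
        by (intro eventually_within_continuous_ge[OF w_cont]) (use x w_boundary Scl in auto)
    next
      case True
      then have xO: "x \<in> \<Omega>" using x(1,5) Sg_closure[OF x(1)] by (auto simp: frontier_iff)
      have "continuous_on ((closure \<Omega> \<times> {0<..}) \<union> (\<Omega> \<times> {0..})) (\<lambda>(x, t). u x t - 1)"
        using continuous_on_diff[OF u_cont continuous_on_const[of _ 1]] by (simp add: split_beta)
      then have "\<forall>\<^sub>F p in at (x, r) within Sg \<times> {0<..t}. u (fst p) (snd p) - 1 > - \<epsilon>"
        by (rule eventually_within_continuous_ge) (use xO x u_init True Sg_sub in auto)
      moreover have "\<forall>\<^sub>F p in at (x, r) within Sg \<times> {0<..t}. p \<in> Sg \<times> {0<..t}" by (simp add: eventually_at_filter)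
      ultimately show ?thesis
      proof eventually_elim
        case (elim p)
        then have "fst p \<in> closure Sg" "snd p > 0" using Scl by auto
        from wge[OF this] elim(1) show ?case by simp
      qed
    qed
  qed
qed

lemma w_spread:
  assumes Rb: "r > 0" "ball y r \<subseteq> Sg" and t: "0 < t0" "t0 < t1" and pos: "w y t0 > 0"
  obtains \<epsilon> where "\<epsilon> > 0" "\<And>x. x \<in> ball y r \<Longrightarrow> w x t1 \<ge> \<epsilon> * (r\<^sup>2 - (norm (x - y))\<^sup>2)"
proof (rule heat_positivity_spreads[OF Rb(1) t(2), of y w])
  have cb: "cball y r \<subseteq> closure Sg" using closure_mono[OF Rb(2)] Rb(1) by simp
  show "\<exists>L. has_lap (\<lambda>z. w z s) L x \<and> ((\<lambda>s. w x s) has_real_derivative L) (at s)"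
    if "x \<in> ball y r" "t0 < s" for x s using w_heat[of x s] Rb(2) that t by auto
  show "continuous_on (cball y r \<times> {t0..t1}) (\<lambda>(x, t). w x t)"
    by (rule continuous_on_subset[OF w_cont]) (use cb t in auto)
  show "w x s \<ge> 0" if "x \<in> cball y r" "t0 \<le> s" for x s
    using w_nonneg[of x s] cb that t by auto
qed (use pos that in auto)

text \<open>If \<open>w\<close> vanishes somewhere, the set where it vanishes, its mirror image and the part of
  the plane between them fill up \<open>\<Omega>\<close>.\<close>

lemma symmetric_if_w_zero:
  assumes z0: "z0 \<in> Sg" and t0: "t0 > 0" and w0: "w z0 t0 = 0"
  shows "\<forall>x\<in>\<Omega>. R x \<in> \<Omega>"
proof -
  \<comment> \<open>Only times before \<open>t0\<close> occur: positivity spreads forward in time,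
    so a zero at \<open>t0\<close> forces zeros at all earlier times.\<close>
  define A where "A = {z \<in> Sg. \<forall>t. 0 < t \<and> t < t0 \<longrightarrow> w z t = 0}"
  have AS: "A \<subseteq> Sg" by (auto simp: A_def)
  have z0A: "z0 \<in> A"
  proof (rule ccontr)
    assume "z0 \<notin> A"
    then obtain t where t: "0 < t" "t < t0" "w z0 t \<noteq> 0" using z0 by (auto simp: A_def)
    then have "w z0 t > 0" using w_nonneg[of z0 t] z0 closure_subset[of Sg] by force
    obtain r where r: "r > 0" "ball z0 r \<subseteq> Sg" using Sg_open z0 open_contains_ball by blast
    obtain \<epsilon> where "\<epsilon> > 0" "\<And>x. x \<in> ball z0 r \<Longrightarrow> w x t0 \<ge> \<epsilon> * (r\<^sup>2 - (norm (x - z0))\<^sup>2)"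
      by (rule w_spread[OF r t(1,2) \<open>w z0 t > 0\<close>]) blast
    from this(1) this(2)[of z0] r(1) w0 show False by (simp add: mult_le_0_iff)
  qed
  have A_near: "z \<in> A" if x: "x \<in> A" and r: "ball z r \<subseteq> Sg" "x \<in> ball z r" for x z r
  proof (rule ccontr)
    assume "z \<notin> A"
    have r0: "r > 0" using r(2) by (metis ball_eq_empty empty_iff not_le)
    then have zS: "z \<in> Sg" using r(1) by auto
    with \<open>z \<notin> A\<close> obtain t where t: "0 < t" "t < t0" "w z t \<noteq> 0" by (auto simp: A_def)
    then have wp: "w z t > 0" using w_nonneg[of z t] zS closure_subset[of Sg] by force
    obtain t' where t': "t < t'" "t' < t0" using dense t(2) by blast
    obtain \<epsilon> where eps: "\<epsilon> > 0" "\<And>x. x \<in> ball z r \<Longrightarrow> w x t' \<ge> \<epsilon> * (r\<^sup>2 - (norm (x - z))\<^sup>2)"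
      by (rule w_spread[OF r0 r(1) t(1) t'(1) wp]) blast
    have "norm (x - z) < r" using r(2) by (simp add: dist_norm norm_minus_commute)
    then have "(norm (x - z))\<^sup>2 < r\<^sup>2" by (intro power_strict_mono) auto
    then have "\<epsilon> * (r\<^sup>2 - (norm (x - z))\<^sup>2) > 0" using eps(1) by simp
    then have "w x t' > 0" using eps(2)[OF r(2)] by linarith
    then show False using x t' t by (auto simp: A_def)
  qed
  \<comment> \<open>By \<open>A_near\<close>, applied in both roles of the two points,
    \<open>A\<close> is open and closed relative to \<open>C\<close>.\<close>
  have A_convex: "C \<subseteq> A" if C: "open C" "convex C" "C \<subseteq> Sg" "C \<inter> A \<noteq> {}" for C
  proof -
    have "open (C \<inter> A)" unfolding open_contains_ball
    proof
      fix x assume x: "x \<in> C \<inter> A"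
      then obtain r where r: "r > 0" "ball x r \<subseteq> C" using C(1) open_contains_ball by blast
      have "ball x (r / 2) \<subseteq> A"
      proof
        fix z assume z: "z \<in> ball x (r / 2)"
        have "ball z (r / 2) \<subseteq> ball x r"
        proof
          fix y assume "y \<in> ball z (r / 2)"
          then have "dist z y < r / 2" by simp
          moreover have "dist x z < r / 2" using z by simp
          ultimately show "y \<in> ball x r" using dist_triangle[of x y z] by simp
        qed
        then show "z \<in> A" using A_near[of x z "r / 2"] x z r C(3) by (auto simp: dist_commute)
      qed
      moreover have "ball x (r / 2) \<subseteq> C" using r subset_ball[of "r / 2" r x] by auto
      ultimately show "\<exists>e>0. ball x e \<subseteq> C \<inter> A" using r(1) by (intro exI[of _ "r / 2"]) auto
    qed
    moreover have "open (C - A)" unfolding open_contains_ball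
    proof
      fix x assume x: "x \<in> C - A"
      then obtain r where r: "r > 0" "ball x r \<subseteq> C" using C(1) open_contains_ball by blast
      have "ball x r \<inter> A = {}" using A_near[of _ x r] r C(3) x by blast
      then show "\<exists>e>0. ball x e \<subseteq> C - A" using r by (intro exI[of _ r]) auto
    qed
    ultimately have "C \<inter> A \<inter> C = {} \<or> (C - A) \<inter> C = {}"
      by (intro connectedD[OF convex_connected[OF C(2)]]) auto
    then show ?thesis using C(4) by blast
  qed
  define X where "X = A \<union> {x. R x \<in> A} \<union> {z \<in> \<Omega>. z \<bullet> e = \<mu> \<and> z \<in> closure A}"
  have "R x \<in> A \<Longrightarrow> x \<in> \<Omega>" for x using AS by (auto simp: Sg_def)
  then have XO: "X \<subseteq> \<Omega>" using AS Sg_sub by (auto simp: X_def)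
  have XR: "R x \<in> X" if "x \<in> X" for x
  proof -
    from that consider "x \<in> A" | "R x \<in> A" | "R x = x" using R_plane by (auto simp: X_def)
    then show ?thesis using that by cases (auto simp: X_def)
  qed
  have X_open: "open X"
    unfolding open_contains_ball
  proof
    fix x assume "x \<in> X"
    have A_open: "open A" unfolding open_contains_ball
    proof
      fix x assume x: "x \<in> A"
      then obtain r where r: "r > 0" "ball x r \<subseteq> Sg" using Sg_open AS open_contains_ball by blast
      have "ball x r \<inter> A \<noteq> {}" using x centre_in_ball[of x r] r(1) by blast
      then have "ball x r \<subseteq> A" by (rule A_convex[OF open_ball convex_ball r(2)])
      then show "\<exists>e>0. ball x e \<subseteq> A" using r by blast
    qed
    from \<open>x \<in> X\<close> consider "x \<in> A" | "R x \<in> A" | "x \<in> \<Omega>" "x \<bullet> e = \<mu>" "x \<in> closure A" by (auto simp: X_def)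
    then show "\<exists>e>0. ball x e \<subseteq> X"
    proof cases
      case 1
      then obtain r where "r > 0" "ball x r \<subseteq> A" using A_open open_contains_ball by blast
      then show ?thesis by (auto simp: X_def)
    next
      case 2
      then obtain r where "r > 0" "ball x r \<subseteq> {x. R x \<in> A}" using open_reflect[OF e A_open, of \<mu>] open_contains_ball by blast
      then show ?thesis by (auto simp: X_def)
    next
      case 3
      obtain r where r: "r > 0" "ball x r \<subseteq> \<Omega>" using op 3(1) open_contains_ball by blast
      have Rx: "R x = x" using 3(2) by (rule R_plane)
      have Rb: "R y \<in> ball x r \<longleftrightarrow> y \<in> ball x r" for y using reflect_ball[OF e, of y \<mu> x r] Rx by simp
      define C where "C = ball x r \<inter> {z. z \<bullet> e < \<mu>}"
      have CA: "C \<subseteq> A"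
      proof (rule A_convex)
        show "open C" unfolding C_def by (intro open_Int open_ball open_Collect_less continuous_intros)
        show "convex C" unfolding C_def
          using convex_halfspace_lt[of e \<mu>] by (intro convex_Int convex_ball) (simp add: inner_commute)
        show "C \<subseteq> Sg" using r(2) Rb by (auto simp: C_def Sg_def)
        obtain a where "a \<in> A" "a \<in> ball x r" using 3(3) r(1)
          by (metis closure_approachable dist_commute mem_ball)
        then show "C \<inter> A \<noteq> {}" using AS by (auto simp: C_def Sg_def)
      qed
      have "ball x r \<subseteq> X"
      proof
        fix y assume y: "y \<in> ball x r"
        consider "y \<bullet> e < \<mu>" | "y \<bullet> e > \<mu>" | "y \<bullet> e = \<mu>" by linarith
        then show "y \<in> X"
        proof cases
          case 1 then show ?thesis using CA y by (auto simp: X_def C_def)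
        next
          case 2
          then have "R y \<in> C" using y Rb by (simp add: C_def)
          then show ?thesis using CA by (auto simp: X_def)
        next
          case 3
          have "y \<in> closure C"
          proof (subst closure_approachable, intro allI impI)
            fix \<epsilon> :: real assume "\<epsilon> > 0"
            define s where "s = min \<epsilon> (r - dist x y) / 2"
            have s: "s > 0" "s < \<epsilon>" "s < r - dist x y" using \<open>\<epsilon> > 0\<close> y by (auto simp: s_def)
            have d: "dist (y - s *\<^sub>R e) y = s" using e s(1) by (simp add: dist_norm)
            then have "dist x (y - s *\<^sub>R e) < r" using dist_triangle[of x "y - s *\<^sub>R e" y] s by (simp add: dist_commute)
            moreover have "(y - s *\<^sub>R e) \<bullet> e < \<mu>" using 3 s(1) e_sq[OF e] by (simp add: inner_diff_left)
            ultimately show "\<exists>z\<in>C. dist z y < \<epsilon>" using d s by (intro bexI[of _ "y - s *\<^sub>R e"]) (auto simp: C_def)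
          qed
          then have "y \<in> closure A" using closure_mono[OF CA] by blast
          then show ?thesis using 3 y r(2) by (auto simp: X_def)
        qed
      qed
      then show ?thesis using r(1) by blast
    qed
  qed
  have clA: "z \<in> A" if z: "z \<in> closure A" "z \<in> \<Omega>" "z \<bullet> e < \<mu>" for z
  proof -
    have zS: "z \<in> closure Sg" using closure_mono[OF AS] z by blast
    have w0: "w z t = 0" if t: "0 < t" "t < t0" for t
    proof -
      have c1: "continuous_on (closure Sg) (\<lambda>z. w z t)"
      proof -
        have "continuous_on (closure Sg) (\<lambda>z. (z, t))" by (intro continuous_intros)
        from continuous_on_compose2[OF w_cont this] show ?thesis using t by auto
      qed
      have "closed {z \<in> closure Sg. w z t = 0}"
        using continuous_closed_preimage_constant[OF c1 closed_closure] by simp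
      moreover have "A \<subseteq> {z \<in> closure Sg. w z t = 0}" using AS closure_subset[of Sg] t by (auto simp: A_def)
      ultimately have "closure A \<subseteq> {z \<in> closure Sg. w z t = 0}" by (rule closure_minimal[rotated])
      then show ?thesis using z by blast
    qed
    \<comment> \<open>If the mirror point lay on the frontier, then w would equal u > 0 at
      z.\<close>
    have "R z \<in> \<Omega>"
    proof (rule ccontr)
      assume "R z \<notin> \<Omega>"
      then have "R z \<in> frontier \<Omega>" using Sg_closure[OF zS] by (simp add: frontier_iff)
      then have "w z (t0 / 2) = u z (t0 / 2)" using u_bdry t0 by (simp add: w_def)
      then show False using w0[of "t0 / 2"] t0 u_pos[OF z(2), of "t0 / 2"] by simp
    qed
    then show ?thesis using z w0 by (auto simp: A_def Sg_def)
  qed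
  have X_closed: "closedin (top_of_set \<Omega>) X"
  proof -
    have "X = \<Omega> \<inter> (closure A \<union> {x. R x \<in> closure A})"
    proof
      show "X \<subseteq> \<Omega> \<inter> (closure A \<union> {x. R x \<in> closure A})" using XO closure_subset[of A] by (auto simp: X_def)
      show "\<Omega> \<inter> (closure A \<union> {x. R x \<in> closure A}) \<subseteq> X"
      proof
        fix x assume x: "x \<in> \<Omega> \<inter> (closure A \<union> {x. R x \<in> closure A})"
        consider "x \<bullet> e < \<mu>" | "x \<bullet> e > \<mu>" | "x \<bullet> e = \<mu>" by linarith
        then show "x \<in> X"
        proof cases
          case 1
          have "R x \<notin> closure A"
          proof
            assume "R x \<in> closure A"
            then have "R x \<bullet> e \<le> \<mu>" using Sg_closure closure_mono[OF AS] by blast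
            then show False using 1 by simp
          qed
          then show ?thesis using clA[of x] 1 x by (auto simp: X_def)
        next
          case 2
          have "x \<notin> closure A"
          proof
            assume "x \<in> closure A"
            then have "x \<bullet> e \<le> \<mu>" using Sg_closure closure_mono[OF AS] by blast
            then show False using 2 by simp
          qed
          then have "R x \<in> closure A" using x by auto
          moreover have "R x \<in> \<Omega>" using good[of x] x 2 by simp
          ultimately have "R x \<in> A" using clA[of "R x"] 2 by simp
          then show ?thesis by (simp add: X_def)
        next
          case 3 then show ?thesis using x R_plane[OF 3] by (auto simp: X_def)
        qed
      qed
    qed
    moreover have "closed (closure A \<union> {x. R x \<in> closure A})"
      by (intro closed_Un closed_closure closed_reflect[OF e])
    ultimately show ?thesis by (metis closedin_closed_Int)
  qed
  have "openin (top_of_set \<Omega>) X" using X_open XO by (simp add: open_subset)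
  moreover have "connected \<Omega>" using smooth_bounded_domainD[OF sm] by blast
  moreover have "X \<noteq> {}" using z0A by (auto simp: X_def)
  ultimately have "X = \<Omega>" using X_closed unfolding connected_clopen by blast
  then show ?thesis using XR by blast
qed

lemma closure_good:
  assumes y: "y \<in> closure \<Omega>" "y \<bullet> e > \<mu>" shows "R y \<in> closure \<Omega>"
proof -
  have op': "open {z. z \<bullet> e > \<mu>}" by (intro open_Collect_less continuous_intros)
  have "\<Omega> \<inter> {z. z \<bullet> e > \<mu>} \<subseteq> {x. R x \<in> closure \<Omega>}" using good closure_subset[of \<Omega>] by auto
  then have "closure (\<Omega> \<inter> {z. z \<bullet> e > \<mu>}) \<subseteq> {x. R x \<in> closure \<Omega>}"
    by (rule closure_minimal) (rule closed_reflect[OF e closed_closure])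
  moreover have "y \<in> closure (\<Omega> \<inter> {z. z \<bullet> e > \<mu>})"
    using open_Int_closure_subset[OF op', of \<Omega>] y by (auto simp: Int_commute)
  ultimately show ?thesis by blast
qed

text \<open>Interior tangency is ruled out by the Hopf lemma at the single time \<open>\<tau>\<close>.\<close>

lemma no_touching:
  assumes ns: "\<not> (\<forall>x\<in>\<Omega>. R x \<in> \<Omega>)" and x: "x \<in> frontier \<Omega>" "x \<bullet> e > \<mu>" and Rx: "R x \<in> frontier \<Omega>"
  shows False
proof -
  have wpos: "w z t > 0" if "z \<in> Sg" "t > 0" for z t
    using symmetric_if_w_zero[OF that] ns w_nonneg[of z t] that closure_subset[of Sg] by force
  obtain U \<rho> where U: "local_defining \<Omega> U \<rho>" "x \<in> U" using smooth_bounded_domain_local[OF sm x(1)] by blast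
  obtain U' \<rho>' where U': "local_defining \<Omega> U' \<rho>'" "R x \<in> U'" using smooth_bounded_domain_local[OF sm Rx] by blast
  note D = local_definingD[OF U(1)] and D' = local_definingD[OF U'(1)]
  have 0: "\<rho> x = 0" "\<rho>' (R x) = 0"
    using local_defining_frontier[OF op U] local_defining_frontier[OF op U'] x(1) Rx by auto
  define \<nu> where "\<nu> = grad \<rho> x /\<^sub>R norm (grad \<rho> x)"
  define \<nu>' where "\<nu>' = grad \<rho>' (R x) /\<^sub>R norm (grad \<rho>' (R x))"
  have \<nu>1: "norm \<nu> = 1" using D(4)[OF U(2)] by (simp add: \<nu>_def)
  \<comment> \<open>Near \<open>R x\<close> the reflected cap lies in \<Omega>, so each direction
    entering the former does not leave the latter to first order; hence the outer normals at the
    touching point agree.\<close>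
  have "rf e (grad \<rho> x) /\<^sub>R norm (rf e (grad \<rho> x)) = grad \<rho>' (R x) /\<^sub>R norm (grad \<rho>' (R x))"
  proof (rule half_space_normal_eq)
    show "rf e (grad \<rho> x) \<noteq> 0" using D(4)[OF U(2)] norm_rf[OF e, of "grad \<rho> x"] by (metis norm_eq_zero)
    show "grad \<rho>' (R x) \<noteq> 0" using D'(4)[OF U'(2)] .
    fix v assume v: "rf e (grad \<rho> x) \<bullet> v < 0"
    have "((\<lambda>s. \<rho> (x + s *\<^sub>R rf e v)) has_real_derivative grad \<rho> x \<bullet> rf e v) (at 0)"
      by (rule C2_line_deriv[OF D(1,2) U(2)])
    moreover have "grad \<rho> x \<bullet> rf e v < 0" using v by (simp add: rf_adjoint)
    ultimately obtain d where d: "d > 0" "\<And>h. 0 < h \<Longrightarrow> h < d \<Longrightarrow> \<rho> (x + (0 + h) *\<^sub>R rf e v) < \<rho> (x + 0 *\<^sub>R rf e v)"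
      using DERIV_neg_dec_right by blast
    have "((\<lambda>h. x + h *\<^sub>R rf e v) \<longlongrightarrow> x + 0 *\<^sub>R rf e v) (at_right 0)" by (intro tendsto_intros)
    then have lim: "((\<lambda>h. x + h *\<^sub>R rf e v) \<longlongrightarrow> x) (at_right 0)" by simp
    have "((\<lambda>h. R x + h *\<^sub>R v) \<longlongrightarrow> R x + 0 *\<^sub>R v) (at_right 0)" by (intro tendsto_intros)
    then have lim': "((\<lambda>h. R x + h *\<^sub>R v) \<longlongrightarrow> R x) (at_right 0)" by simp
    have opm: "open {z. z \<bullet> e > \<mu>}" by (intro open_Collect_less continuous_intros)
    have ev: "\<forall>\<^sub>F h in at_right 0. \<rho>' (R x + h *\<^sub>R v) \<le> 0"
    proof -
      have "\<forall>\<^sub>F h in at_right 0. x + h *\<^sub>R rf e v \<in> U" using topological_tendstoD[OF lim D(1) U(2)] .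
      moreover have "\<forall>\<^sub>F h in at_right 0. x + h *\<^sub>R rf e v \<in> {z. z \<bullet> e > \<mu>}" using topological_tendstoD[OF lim opm] x(2) by simp
      moreover have "\<forall>\<^sub>F h in at_right 0. R x + h *\<^sub>R v \<in> U'" using topological_tendstoD[OF lim' D'(1) U'(2)] .
      moreover have "\<forall>\<^sub>F h in at_right 0. 0 < h \<and> h < d"
        using d(1) eventually_at_right_real by (auto elim: eventually_mono)
      ultimately show ?thesis
      proof eventually_elim
        case (elim h)
        then have "\<rho> (x + h *\<^sub>R rf e v) < 0" using d(2)[of h] 0 by simp
        then have "x + h *\<^sub>R rf e v \<in> \<Omega>" using D(3) elim by blast
        then have "R (x + h *\<^sub>R rf e v) \<in> \<Omega>" using good elim by simp
        moreover have "R (x + h *\<^sub>R rf e v) = R x + h *\<^sub>R v"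
          using reflect_curve[of e \<mu> x h "rf e v" 0 0] by (simp add: rf_rf[OF e])
        ultimately show ?case using D'(3)[of "R x + h *\<^sub>R v"] elim by simp
      qed
    qed
    have "((\<lambda>s. \<rho>' (R x + s *\<^sub>R v)) has_real_derivative grad \<rho>' (R x) \<bullet> v) (at 0)"
      by (rule C2_line_deriv[OF D'(1,2) U'(2)])
    then have "((\<lambda>h. \<rho>' (R x + h *\<^sub>R v) / h) \<longlongrightarrow> grad \<rho>' (R x) \<bullet> v) (at 0)"
      by (simp add: has_field_derivative_iff 0)
    then have lim0: "((\<lambda>h. \<rho>' (R x + h *\<^sub>R v) / h) \<longlongrightarrow> grad \<rho>' (R x) \<bullet> v) (at_right 0)"
      by (rule filterlim_mono[OF _ order_refl at_le]) simp
    have "\<forall>\<^sub>F h in at_right (0::real). h > 0" by (simp add: eventually_at_filter)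
    with ev have "\<forall>\<^sub>F h in at_right 0. \<rho>' (R x + h *\<^sub>R v) / h \<le> 0"
      by eventually_elim (simp add: divide_nonpos_pos)
    then show "grad \<rho>' (R x) \<bullet> v \<le> 0" by (intro tendsto_upperbound[OF lim0]) auto
  qed
  then have \<nu>R: "\<nu>' = rf e \<nu>"
    by (simp add: \<nu>_def \<nu>'_def norm_rf[OF e] linear_cmul[OF rf_linear])
  obtain r0 where r0: "r0 > 0" "\<And>r. 0 < r \<Longrightarrow> r \<le> r0 \<Longrightarrow> ball (x - r *\<^sub>R \<nu>) r \<subseteq> \<Omega>"
    using interior_ball_condition[OF U 0(1)] unfolding \<nu>_def by blast
  \<comment> \<open>The ball has diameter at most the height of \<open>x\<close> above the plane, so
    it stays in the cap and its mirror image stays in \<open>Sg\<close>.\<close>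
  define r where "r = min r0 ((x \<bullet> e - \<mu>) / 2)"
  have r: "r > 0" "r \<le> r0" "2 * r \<le> x \<bullet> e - \<mu>" using r0(1) x(2) by (auto simp: r_def min_def)
  define y where "y = x - r *\<^sub>R \<nu>"
  have bS: "ball (R y) r \<subseteq> Sg"
  proof
    fix z assume "z \<in> ball (R y) r"
    then have z: "R z \<in> ball y r" using reflect_ball[OF e] by simp
    then have "R z \<in> \<Omega>" using r0(2)[OF r(1,2)] by (auto simp: y_def)
    have "dist x (R z) < 2 * r"
    proof -
      have "dist x y = r" using \<nu>1 r(1) by (simp add: y_def dist_norm)
      then show ?thesis using z dist_triangle[of x "R z" y] by simp
    qed
    then have "norm (x - R z) < 2 * r" by (simp add: dist_norm)
    moreover have "(x - R z) \<bullet> e \<le> norm (x - R z)" using norm_cauchy_schwarz[of "x - R z" e] e by simp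
    ultimately have "R z \<bullet> e > \<mu>" using r(3) unfolding inner_diff_left by linarith
    then show "z \<in> Sg" using \<open>R z \<in> \<Omega>\<close> by (simp add: Sg_def)
  qed
  have "R y \<in> Sg" using bS r(1) by auto
  then have "w (R y) (\<tau> / 2) > 0" using wpos \<tau> by simp
  from w_spread[OF r(1) bS _ _ this, of \<tau>] \<tau> obtain \<epsilon> where
    \<epsilon>: "\<epsilon> > 0" "\<And>z. z \<in> ball (R y) r \<Longrightarrow> w z \<tau> \<ge> \<epsilon> * (r\<^sup>2 - (norm (z - R y))\<^sup>2)" by auto
  \<comment> \<open>The Hopf slope of \<open>w\<close> at \<open>R x\<close>. It contradicts the
    constancy of the normal derivative, which makes the inward slopes of \<open>u\<close> at
    \<open>x\<close> and at \<open>R x\<close> equal.\<close>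
  have low: "w (R x - h *\<^sub>R \<nu>') \<tau> \<ge> \<epsilon> * r * h" if h: "0 < h" "h < r" for h
  proof -
    have "R x - h *\<^sub>R \<nu>' = R (x - h *\<^sub>R \<nu>)"
      using reflect_curve[of e \<mu> x "- h" \<nu> 0 0] by (simp add: \<nu>R)
    then have "R x - h *\<^sub>R \<nu>' - R y = rf e ((r - h) *\<^sub>R \<nu>)"
      by (simp add: reflect_diff y_def scaleR_diff_left)
    then have n: "norm (R x - h *\<^sub>R \<nu>' - R y) = r - h" using \<nu>1 h by (simp add: norm_rf[OF e])
    then have "dist (R y) (R x - h *\<^sub>R \<nu>') < r" using h by (simp add: dist_norm norm_minus_commute)
    then have "w (R x - h *\<^sub>R \<nu>') \<tau> \<ge> \<epsilon> * (r\<^sup>2 - (r - h)\<^sup>2)" using \<epsilon>(2)[of "R x - h *\<^sub>R \<nu>'"] n by simp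
    moreover have "r * h \<le> r\<^sup>2 - (r - h)\<^sup>2"
      using mult_left_mono[of h r h] h by (simp add: power2_eq_square algebra_simps)
    then have "\<epsilon> * (r * h) \<le> \<epsilon> * (r\<^sup>2 - (r - h)\<^sup>2)" using \<epsilon>(1) by (intro mult_left_mono) auto
    ultimately show ?thesis by (simp add: mult.assoc)
  qed
  have on: "outer_unit_normal \<Omega> x \<nu>" "outer_unit_normal \<Omega> (R x) \<nu>'"
    unfolding \<nu>_def \<nu>'_def by (rule local_defining_outer_normal[OF U 0(1)], rule local_defining_outer_normal[OF U' 0(2)])
  have lim: "((\<lambda>h. u (z - h *\<^sub>R n) \<tau> / h) \<longlongrightarrow> - b) (at_right 0)"
    if z: "z \<in> frontier \<Omega>" and n: "outer_unit_normal \<Omega> z n" for z n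
  proof -
    have "((\<lambda>h. u (z + h *\<^sub>R n) \<tau>) has_real_derivative b) (at_left 0)"
      using nd[OF z] n unfolding normal_deriv_eq_def by blast
    then have "((\<lambda>h. u (z + h *\<^sub>R n) \<tau> / h) \<longlongrightarrow> b) (at_left 0)"
      using u_bdry[OF z \<tau>] by (simp add: has_field_derivative_iff)
    then have "((\<lambda>h. u (z - h *\<^sub>R n) \<tau> / (- h)) \<longlongrightarrow> b) (at_right 0)"
      by (simp add: at_left_minus[of 0] filterlim_filtermap)
    from tendsto_minus[OF this] show ?thesis by simp
  qed
  have "((\<lambda>h. u (R x - h *\<^sub>R \<nu>') \<tau> / h - u (x - h *\<^sub>R \<nu>) \<tau> / h) \<longlongrightarrow> - b - (- b)) (at_right 0)"
    by (intro tendsto_diff lim x(1) Rx on)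
  then have lim0: "((\<lambda>h. u (R x - h *\<^sub>R \<nu>') \<tau> / h - u (x - h *\<^sub>R \<nu>) \<tau> / h) \<longlongrightarrow> 0) (at_right 0)" by simp
  have "\<forall>\<^sub>F h in at_right 0. 0 < h \<and> h < r"
    using r(1) eventually_at_right_real by (auto elim: eventually_mono)
  then have "\<forall>\<^sub>F h in at_right 0. \<epsilon> * r \<le> u (R x - h *\<^sub>R \<nu>') \<tau> / h - u (x - h *\<^sub>R \<nu>) \<tau> / h"
  proof eventually_elim
    case (elim h)
    have "R (R x - h *\<^sub>R \<nu>') = x - h *\<^sub>R \<nu>"
      using reflect_curve[of e \<mu> "R x" "- h" \<nu>' 0 0] by (simp add: \<nu>R rf_rf[OF e])
    then have "w (R x - h *\<^sub>R \<nu>') \<tau> / h = u (R x - h *\<^sub>R \<nu>') \<tau> / h - u (x - h *\<^sub>R \<nu>) \<tau> / h"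
      by (simp add: w_def diff_divide_distrib)
    moreover have "\<epsilon> * r \<le> w (R x - h *\<^sub>R \<nu>') \<tau> / h" using low[of h] elim by (simp add: pos_le_divide_eq)
    ultimately show ?case by simp
  qed
  then have "\<epsilon> * r \<le> 0" by (intro tendsto_lowerbound[OF lim0]) auto
  then show False using \<epsilon>(1) r(1) by (simp add: mult_le_0_iff)
qed

text \<open>What remains for the corner argument is the strict ordering of the two boundary pieces.
  For mirror points inside \<Omega> it is the cap property, and for those on the frontier it follows
  from \<open>no_touching\<close>.\<close>

lemma no_corner:
  assumes ns: "\<not> (\<forall>x\<in>\<Omega>. R x \<in> \<Omega>)" and Q: "Q \<in> frontier \<Omega>" "Q \<bullet> e = \<mu>"
    and U: "local_defining \<Omega> U \<rho>" "Q \<in> U" and perp: "grad \<rho> Q \<bullet> e = 0"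
  shows False
proof (rule corner_contradiction[OF e, of U \<rho> Q \<mu> c])
  note D = local_definingD[OF U(1)]
  show "open U" "Q \<in> U" "Q \<bullet> e = \<mu>" "grad \<rho> Q \<bullet> e = 0" using D(1) U Q perp by auto
  show "smooth_on U \<rho>" using U(1) by (simp add: local_defining_def)
  show "grad \<rho> y \<noteq> 0" if "y \<in> U" for y using D(4)[OF that] .
  show "\<rho> Q = 0" using local_defining_frontier[OF op U] Q(1) by simp
  show "mean_curv \<rho> x = c" if "x \<in> U" "\<rho> x = 0" for x using curv[OF U(1) that] .
  fix x assume x: "x \<in> U" "R x \<in> U" "x \<bullet> e < \<mu>" "\<rho> (R x) \<le> 0"
  have Rcl: "R x \<in> closure \<Omega>" using local_defining_closure[OF U(1) x(2)] x(4) by simp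
  have Re: "R x \<bullet> e > \<mu>" using x(3) by simp
  have "x \<in> \<Omega>"
  proof (cases "R x \<in> \<Omega>")
    case True then show ?thesis using good[OF True Re] by simp
  next
    case False
    then have fr: "R x \<in> frontier \<Omega>" using Rcl by (simp add: frontier_iff)
    have "x \<in> closure \<Omega>" using closure_good[OF Rcl Re] by simp
    moreover have "x \<notin> frontier \<Omega>" using no_touching[OF ns fr Re] by auto
    ultimately show ?thesis by (simp add: frontier_iff)
  qed
  then show "\<rho> x < 0" using D(3)[OF x(1)] by simp
qed

end

context overdetermined_heat
begin

lemma symmetric_plane:
  assumes e: "norm e = 1"
  obtains \<mu> where "\<And>x. x \<in> \<Omega> \<Longrightarrow> reflect e \<mu> x \<in> \<Omega>"
    "\<And>\<nu> x. \<mu> \<le> \<nu> \<Longrightarrow> x \<in> \<Omega> \<Longrightarrow> x \<bullet> e > \<nu> \<Longrightarrow> reflect e \<nu> x \<in> \<Omega>"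
proof -
  \<comment> \<open>Quantifying over all planes beyond \<mu> makes the set upward closed, and this
    stronger property is needed at the end to recognise the ball.\<close>
  define \<Lambda> where "\<Lambda> = {\<mu>. \<forall>\<nu>\<ge>\<mu>. \<forall>x\<in>\<Omega>. x \<bullet> e > \<nu> \<longrightarrow> reflect e \<nu> x \<in> \<Omega>}"
  obtain B where B: "B > 0" "\<And>x. x \<in> \<Omega> \<Longrightarrow> norm x \<le> B" using bounded_dom unfolding bounded_pos by blast
  have Be: "\<bar>x \<bullet> e\<bar> \<le> B" if "x \<in> \<Omega>" for x
    using Cauchy_Schwarz_ineq2[of x e] B(2)[OF that] e by simp
  have "\<not> x \<bullet> e > \<nu>" if "x \<in> \<Omega>" "B \<le> \<nu>" for x \<nu> using Be[OF that(1)] that(2) by linarith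
  then have BL: "B \<in> \<Lambda>" unfolding \<Lambda>_def by blast
  obtain xa where xa: "xa \<in> \<Omega>" using smooth_bounded_domainD(4)[OF sm] by blast
  have lower: "- B \<le> \<mu>" if "\<mu> \<in> \<Lambda>" for \<mu>
  proof (rule ccontr)
    assume "\<not> - B \<le> \<mu>"
    then have m: "\<mu> < xa \<bullet> e" "\<mu> < - B" using Be[OF xa] by auto
    then have "reflect e \<mu> xa \<in> \<Omega>" using that xa by (auto simp: \<Lambda>_def)
    from Be[OF this] have "- B \<le> 2 * \<mu> - xa \<bullet> e" by (simp add: reflect_inner_e[OF e])
    then show False using m by linarith
  qed
  then have bb: "bdd_below \<Lambda>" by (auto simp: bdd_below_def)
  define \<mu> where "\<mu> = Inf \<Lambda>"
  have above: "reflect e \<nu> x \<in> \<Omega>" if \<nu>: "\<nu> > \<mu>" "x \<in> \<Omega>" "x \<bullet> e > \<nu>" for \<nu> x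
  proof -
    obtain k where "k \<in> \<Lambda>" "k < \<nu>" using cInf_lessD[of \<Lambda> \<nu>] BL \<nu>(1) unfolding \<mu>_def by blast
    then show ?thesis using \<nu> by (auto simp: \<Lambda>_def)
  qed
  have refl_lim: "((\<lambda>\<nu>. reflect e \<nu> x) \<longlongrightarrow> reflect e m x) (at m within S)" for x m S
    unfolding reflect_def by (intro tendsto_intros)
  have good: "reflect e \<mu> x \<in> \<Omega>" if x: "x \<in> \<Omega>" "x \<bullet> e > \<mu>" for x
  proof -
    \<comment> \<open>The limit of planes from above yields only the closure of \<Omega>. The
      reflected cap is open, hence in the interior of the closure, which is \<Omega>.\<close>
    define C where "C = {x. reflect e \<mu> x \<in> \<Omega> \<inter> {z. z \<bullet> e > \<mu>}}"
    have "open C" unfolding C_def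
      by (intro open_reflect[OF e] open_Int op open_Collect_less continuous_intros)
    moreover have "C \<subseteq> closure \<Omega>"
    proof
      fix z assume "z \<in> C"
      then have z: "reflect e \<mu> z \<in> \<Omega>" "reflect e \<mu> z \<bullet> e > \<mu>" by (auto simp: C_def)
      have "\<forall>\<^sub>F \<nu> in at_right \<mu>. \<mu> < \<nu> \<and> \<nu> < reflect e \<mu> z \<bullet> e"
        using eventually_at_right_real[OF z(2)] by (auto elim: eventually_mono)
      then have "\<forall>\<^sub>F \<nu> in at_right \<mu>. reflect e \<nu> (reflect e \<mu> z) \<in> closure \<Omega>"
        by eventually_elim (use above[OF _ z(1)] closure_subset[of \<Omega>] in blast)
      from Lim_in_closed_set[OF closed_closure this _ refl_lim] show "z \<in> closure \<Omega>"
        by (simp add: reflect_reflect[OF e])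
    qed
    ultimately have "C \<subseteq> interior (closure \<Omega>)" by (rule interior_maximal[rotated])
    then have "C \<subseteq> \<Omega>" using interior_closure_smooth_domain[OF sm] by simp
    moreover have "reflect e \<mu> x \<in> C" using x by (simp add: C_def reflect_reflect[OF e])
    ultimately show ?thesis by blast
  qed
  interpret MP: moving_plane \<Omega> u \<tau> b c e \<mu>
    by unfold_locales (use e good in auto)
  have good': "reflect e \<nu> x \<in> \<Omega>" if "\<mu> \<le> \<nu>" "x \<in> \<Omega>" "x \<bullet> e > \<nu>" for \<nu> x
    using above[of \<nu> x] good[of x] that by (cases "\<nu> = \<mu>") auto
  have "\<forall>x\<in>\<Omega>. reflect e \<mu> x \<in> \<Omega>"
  proof (rule ccontr)
    assume ns: "\<not> ?thesis"
    \<comment> \<open>Planes just below the critical one fail; a limit point \<open>Q\<close> of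
      their witnesses is either a point whose mirror image touches the frontier, or a frontier point
      on the plane.\<close>
    have "\<exists>\<nu> x. \<mu> - inverse (real (Suc n)) \<le> \<nu> \<and> \<nu> < \<mu> \<and> x \<in> \<Omega> \<and> x \<bullet> e > \<nu> \<and> reflect e \<nu> x \<notin> \<Omega>" for n
    proof -
      have "\<mu> - inverse (real (Suc n)) \<notin> \<Lambda>"
      proof
        assume "\<mu> - inverse (real (Suc n)) \<in> \<Lambda>"
        then have "\<mu> \<le> \<mu> - inverse (real (Suc n))" unfolding \<mu>_def by (rule cInf_lower[OF _ bb])
        moreover have "inverse (real (Suc n)) > 0" by simp
        ultimately show False by linarith
      qed
      then obtain \<nu> x where "\<mu> - inverse (real (Suc n)) \<le> \<nu>" "x \<in> \<Omega>" "x \<bullet> e > \<nu>" "reflect e \<nu> x \<notin> \<Omega>"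
        by (auto simp: \<Lambda>_def)
      moreover from this have "\<nu> < \<mu>" using good'[of \<nu> x] by force
      ultimately show ?thesis by blast
    qed
    then obtain \<nu> x where nx: "\<And>n. \<mu> - inverse (real (Suc n)) \<le> \<nu> n" "\<And>n. \<nu> n < \<mu>" "\<And>n. x n \<in> \<Omega>"
      "\<And>n. x n \<bullet> e > \<nu> n" "\<And>n. reflect e (\<nu> n) (x n) \<notin> \<Omega>" by metis
    have "compact (closure \<Omega>)" using bounded_dom by simp
    then obtain Q s where Q: "Q \<in> closure \<Omega>" "strict_mono s" "(x \<circ> s) \<longlonglongrightarrow> Q"
      using nx(3) closure_subset[of \<Omega>] unfolding compact_def by (metis subsetD)
    have "(\<lambda>n. \<mu> - inverse (real (Suc n))) \<longlonglongrightarrow> \<mu>"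
      using LIMSEQ_inverse_real_of_nat_add_minus[of \<mu>] by simp
    then have "\<nu> \<longlonglongrightarrow> \<mu>"
      by (rule tendsto_sandwich[OF _ _ _ tendsto_const, rotated 2]) (use nx(1,2) in \<open>auto intro!: always_eventually less_imp_le\<close>)
    then have \<nu>s: "(\<lambda>n. \<nu> (s n)) \<longlonglongrightarrow> \<mu>" using LIMSEQ_subseq_LIMSEQ[OF _ Q(2)] by (simp add: o_def)
    have xs: "(\<lambda>n. x (s n)) \<longlonglongrightarrow> Q" using Q(3) by (simp add: o_def)
    have ys: "(\<lambda>n. reflect e (\<nu> (s n)) (x (s n))) \<longlonglongrightarrow> reflect e \<mu> Q"
      unfolding reflect_def rf_def by (intro tendsto_intros xs \<nu>s)
    have RQ: "reflect e \<mu> Q \<notin> \<Omega>"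
    proof -
      have "reflect e \<mu> Q \<in> - \<Omega>"
        by (rule Lim_in_closed_set[OF _ _ _ ys]) (use op nx(5) in \<open>auto simp: closed_Compl\<close>)
      then show ?thesis by simp
    qed
    have Qe: "Q \<bullet> e \<ge> \<mu>"
      by (rule tendsto_le[OF _ tendsto_inner[OF xs tendsto_const] \<nu>s]) (use nx(4) in \<open>auto intro!: always_eventually less_imp_le\<close>)
    show False
    proof (cases "Q \<bullet> e = \<mu>")
      case False
      then have Qgt: "Q \<bullet> e > \<mu>" using Qe by simp
      have "Q \<in> frontier \<Omega>" using Q(1) RQ good[of Q] Qgt by (auto simp: frontier_iff)
      moreover have "reflect e \<mu> Q \<in> frontier \<Omega>" using MP.closure_good[OF Q(1) Qgt] RQ by (simp add: frontier_iff)
      ultimately show False using MP.no_touching[OF ns _ Qgt] by blast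
    next
      case True
      then have Qfr: "Q \<in> frontier \<Omega>" using RQ Q(1) reflect_on_plane[OF e True] by (simp add: frontier_iff)
      obtain U \<rho> where U: "local_defining \<Omega> U \<rho>" "Q \<in> U" using smooth_bounded_domain_local[OF sm Qfr] by blast
      note D = local_definingD[OF U(1)]
      have \<rho>Q: "\<rho> Q = 0" using local_defining_frontier[OF op U] Qfr by simp
      \<comment> \<open>If \<open>e\<close> pointed outwards at \<open>Q\<close>, then \<rho> would
        increase along \<open>e\<close> nearby; but the witness lies in \<Omega> above its mirror
        image, which does not.\<close>
      have 1: "\<not> grad \<rho> Q \<bullet> e > 0"
      proof
        assume pos: "grad \<rho> Q \<bullet> e > 0"
        have "isCont (grad \<rho>) Q" using C2_cont_grad[OF D(1,2)] D(1) U(2) by (simp add: continuous_on_eq_continuous_at)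
        then have "(grad \<rho> \<longlongrightarrow> grad \<rho> Q) (nhds Q)" by (simp add: isCont_def tendsto_nhds_iff)
        then have "((\<lambda>y. grad \<rho> y \<bullet> e) \<longlongrightarrow> grad \<rho> Q \<bullet> e) (nhds Q)" by (intro tendsto_intros)
        then have "\<forall>\<^sub>F y in nhds Q. grad \<rho> y \<bullet> e > 0" using pos by (rule order_tendstoD(1))
        moreover have "\<forall>\<^sub>F y in nhds Q. y \<in> U" using D(1) U(2) by (rule eventually_nhds_in_open)
        ultimately have "\<forall>\<^sub>F y in nhds Q. grad \<rho> y \<bullet> e > 0 \<and> y \<in> U" by (rule eventually_conj)
        then obtain r where r: "r > 0" "\<And>y. y \<in> cball Q r \<Longrightarrow> grad \<rho> y \<bullet> e > 0 \<and> y \<in> U"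
          by (rule eventually_nhds_cball) blast
        have ys': "(\<lambda>n. reflect e (\<nu> (s n)) (x (s n))) \<longlonglongrightarrow> Q" using ys reflect_on_plane[OF e True] by simp
        have "\<forall>\<^sub>F n in sequentially. x (s n) \<in> ball Q r" using topological_tendstoD[OF xs open_ball] r(1) by simp
        moreover have "\<forall>\<^sub>F n in sequentially. reflect e (\<nu> (s n)) (x (s n)) \<in> ball Q r"
          using topological_tendstoD[OF ys' open_ball] r(1) by simp
        ultimately have "\<forall>\<^sub>F n in sequentially. x (s n) \<in> ball Q r \<and> reflect e (\<nu> (s n)) (x (s n)) \<in> ball Q r"
          by (rule eventually_conj)
        then obtain n where n: "x (s n) \<in> ball Q r" "reflect e (\<nu> (s n)) (x (s n)) \<in> ball Q r"
          unfolding eventually_sequentially by blast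
        define p q where "p = x (s n)" and "q = reflect e (\<nu> (s n)) (x (s n))"
        define d where "d = 2 * (p \<bullet> e - \<nu> (s n))"
        have d: "d > 0" using nx(4)[of "s n"] by (simp add: d_def p_def)
        have pq: "p = q + d *\<^sub>R e" by (simp add: q_def p_def d_def reflect_def rf_def algebra_simps)
        have pqc: "p \<in> cball Q r" "q \<in> cball Q r" using n ball_subset_cball by (auto simp: p_def q_def)
        have seg: "q + \<theta> *\<^sub>R e \<in> cball Q r" if "0 \<le> \<theta>" "\<theta> \<le> d" for \<theta>
        proof -
          have "(1 - \<theta> / d) *\<^sub>R q + (\<theta> / d) *\<^sub>R p \<in> cball Q r"
            by (rule convexD[OF convex_cball pqc(2,1)]) (use that d in auto)
          then show ?thesis using d by (simp add: pq algebra_simps)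
        qed
        have "\<exists>z. 0 < z \<and> z < d \<and> \<rho> (q + d *\<^sub>R e) - \<rho> (q + 0 *\<^sub>R e) = (d - 0) * (grad \<rho> (q + z *\<^sub>R e) \<bullet> e)"
        proof (rule MVT2[OF d])
          fix \<theta> assume "0 \<le> \<theta>" "\<theta> \<le> d"
          then have "q + \<theta> *\<^sub>R e \<in> U" using seg r(2) by blast
          moreover have "((\<lambda>\<theta>. q + \<theta> *\<^sub>R e) has_derivative (\<lambda>h. h *\<^sub>R e)) (at \<theta>)" by (auto intro!: derivative_eq_intros)
          ultimately have "((\<lambda>\<theta>. \<rho> (q + \<theta> *\<^sub>R e)) has_derivative (\<lambda>h. grad \<rho> (q + \<theta> *\<^sub>R e) \<bullet> (h *\<^sub>R e))) (at \<theta>)"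
            using has_derivative_compose C2_grad[OF D(1,2)] by blast
          then show "((\<lambda>\<theta>. \<rho> (q + \<theta> *\<^sub>R e)) has_real_derivative grad \<rho> (q + \<theta> *\<^sub>R e) \<bullet> e) (at \<theta>)"
            by (simp add: has_field_derivative_def mult_commute_abs)
        qed
        then obtain z where z: "0 < z" "z < d" "\<rho> p - \<rho> q = d * (grad \<rho> (q + z *\<^sub>R e) \<bullet> e)" unfolding pq by auto
        have "grad \<rho> (q + z *\<^sub>R e) \<bullet> e > 0" using r(2)[OF seg[of z]] z by simp
        then have "\<rho> p > \<rho> q" using z(3) mult_pos_pos[OF d] by fastforce
        moreover have "\<rho> p < 0" using D(3)[of p] r(2)[OF pqc(1)] nx(3)[of "s n"] by (simp add: p_def)
        moreover have "\<not> \<rho> q < 0" using D(3)[of q] r(2)[OF pqc(2)] nx(5)[of "s n"] by (simp add: q_def)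
        ultimately show False by linarith
      qed
      \<comment> \<open>If \<open>e\<close> pointed inwards, points just above \<open>Q\<close>
        would be in \<Omega> and their mirror images just below \<open>Q\<close> outside, against
        \<open>good\<close>.\<close>
      have 2: "\<not> grad \<rho> Q \<bullet> e < 0"
      proof
        assume neg': "grad \<rho> Q \<bullet> e < 0"
        define f where "f = (\<lambda>h. \<rho> (Q + h *\<^sub>R e))"
        have df: "(f has_real_derivative grad \<rho> Q \<bullet> e) (at 0)" unfolding f_def by (rule C2_line_deriv[OF D(1,2) U(2)])
        obtain d1 where d1: "d1 > 0" "\<And>h. 0 < h \<Longrightarrow> h < d1 \<Longrightarrow> f (0 + h) < f 0" using DERIV_neg_dec_right[OF df neg'] by blast
        obtain d2 where d2: "d2 > 0" "\<And>h. 0 < h \<Longrightarrow> h < d2 \<Longrightarrow> f (0 - h) > f 0" using DERIV_neg_dec_left[OF df neg'] by blast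
        obtain r where r: "r > 0" "ball Q r \<subseteq> U" using D(1) U(2) open_contains_ball by blast
        define h where "h = min r (min d1 d2) / 2"
        have h: "h > 0" "h < r" "h < d1" "h < d2" using r(1) d1(1) d2(1) by (auto simp: h_def)
        have inU: "Q + h *\<^sub>R e \<in> U" "Q + (- h) *\<^sub>R e \<in> U" using h(1,2) e r(2) by (auto simp: dist_norm)
        have "\<rho> (Q + h *\<^sub>R e) < 0" using d1(2)[OF h(1,3)] \<rho>Q by (simp add: f_def)
        then have "Q + h *\<^sub>R e \<in> \<Omega>" using D(3)[OF inU(1)] by simp
        moreover have "(Q + h *\<^sub>R e) \<bullet> e > \<mu>" using True h(1) e_sq[OF e] by (simp add: inner_add_left)
        ultimately have "reflect e \<mu> (Q + h *\<^sub>R e) \<in> \<Omega>" by (rule good)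
        moreover have "reflect e \<mu> (Q + h *\<^sub>R e) = Q + (- h) *\<^sub>R e"
          using True e_sq[OF e] by (simp add: reflect_def rf_def inner_add_left algebra_simps flip: scaleR_2)
        ultimately have "\<rho> (Q + (- h) *\<^sub>R e) < 0" using D(3)[OF inU(2)] by simp
        moreover have "\<rho> (Q + (- h) *\<^sub>R e) > 0" using d2(2)[OF h(1,4)] \<rho>Q by (simp add: f_def)
        ultimately show False by simp
      qed
      have "grad \<rho> Q \<bullet> e = 0" using 1 2 by linarith
      then show False using MP.no_corner[OF ns Qfr True U] by blast
    qed
  qed
  with good' show ?thesis using that[of \<mu>] by blast
qed

end

section \<open>From symmetry planes in all directions to a ball\<close>

lemma ball_if_symmetric_planes:
  fixes \<Omega> :: "'a::euclidean_space set"
  assumes op: "open \<Omega>" and bd: "bounded \<Omega>" and ne: "\<Omega> \<noteq> {}"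
    and plane: "\<And>e. norm e = 1 \<Longrightarrow> \<exists>\<mu>. (\<forall>x\<in>\<Omega>. reflect e \<mu> x \<in> \<Omega>) \<and>
       (\<forall>\<nu>\<ge>\<mu>. \<forall>x\<in>\<Omega>. x \<bullet> e > \<nu> \<longrightarrow> reflect e \<nu> x \<in> \<Omega>)"
  shows "\<exists>c r. \<Omega> = ball c r"
proof -
  obtain m where m: "\<And>e x. norm e = 1 \<Longrightarrow> x \<in> \<Omega> \<Longrightarrow> reflect e (m e) x \<in> \<Omega>"
    "\<And>e \<nu> x. norm e = 1 \<Longrightarrow> m e \<le> \<nu> \<Longrightarrow> x \<in> \<Omega> \<Longrightarrow> x \<bullet> e > \<nu> \<Longrightarrow> reflect e \<nu> x \<in> \<Omega>"
    using plane by metis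
  have refl: "reflect e \<nu> x = x + (2 * (\<nu> - x \<bullet> e)) *\<^sub>R e" for e \<nu> and x :: 'a
    by (simp add: reflect_def rf_def algebra_simps)
  \<comment> \<open>The common point of the symmetry planes in the coordinate directions; the
    composition of these reflections is the point reflection in \<open>c\<close>.\<close>
  define c where "c = (\<Sum>i\<in>Basis. m i *\<^sub>R i)"
  have part: "x + (\<Sum>i\<in>S. (2 * (m i - x \<bullet> i)) *\<^sub>R i) \<in> \<Omega>" if "finite S" "S \<subseteq> Basis" "x \<in> \<Omega>" for S x
    using that
  proof (induction S rule: finite_induct)
    case (insert j S)
    define y where "y = x + (\<Sum>i\<in>S. (2 * (m i - x \<bullet> i)) *\<^sub>R i)"
    have y: "y \<in> \<Omega>" using insert by (simp add: y_def)
    have j: "j \<in> Basis" "norm j = 1" using insert by auto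
    have "(\<Sum>i\<in>S. (2 * (m i - x \<bullet> i)) *\<^sub>R i) \<bullet> j = (\<Sum>i\<in>S. 0)"
      unfolding inner_sum_left
    proof (rule sum.cong)
      fix i assume "i \<in> S"
      then have "i \<in> Basis" "i \<noteq> j" using insert.hyps insert.prems(1) by auto
      then show "(2 * (m i - x \<bullet> i)) *\<^sub>R i \<bullet> j = 0" using inner_not_same_Basis[of i j] j(1) by simp
    qed simp
    then have "y \<bullet> j = x \<bullet> j" by (simp add: y_def inner_add_left)
    then have "reflect j (m j) y = x + (\<Sum>i\<in>insert j S. (2 * (m i - x \<bullet> i)) *\<^sub>R i)"
      using insert.hyps by (simp add: refl y_def algebra_simps)
    then show ?case using m(1)[OF j(2) y] by simp
  qed simp
  have point: "2 *\<^sub>R c - x \<in> \<Omega>" if x: "x \<in> \<Omega>" for x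
  proof -
    have "x + (\<Sum>i\<in>Basis. (2 * (m i - x \<bullet> i)) *\<^sub>R i) = 2 *\<^sub>R c - x"
    proof -
      have "(\<Sum>i\<in>Basis. (2 * (m i - x \<bullet> i)) *\<^sub>R i) = 2 *\<^sub>R c - 2 *\<^sub>R (\<Sum>i\<in>Basis. (x \<bullet> i) *\<^sub>R i)"
        by (simp add: c_def scaleR_sum_right sum_subtractf[symmetric] algebra_simps)
      also have "(\<Sum>i\<in>Basis. (x \<bullet> i) *\<^sub>R i) = x" by (rule euclidean_representation)
      finally show ?thesis by (simp add: scaleR_2)
    qed
    then show ?thesis using part[OF finite_Basis order_refl x] by simp
  qed
  have centre: "m e = c \<bullet> e" if e: "norm e = 1" for e
  proof (rule ccontr)
    assume ne': "m e \<noteq> c \<bullet> e"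
    have ee: "e \<bullet> e = 1" using e by (simp add: norm_eq_1)
    \<comment> \<open>A plane at offset m e - c . e, composed with the point reflection in
      \<open>c\<close>, gives a reflection of the line direction undone up to a shift; applying the
      composition twice leaves the pure translation by 4 times the offset.\<close>
    define \<delta> where "\<delta> = 4 * (m e - c \<bullet> e)"
    have step: "x + \<delta> *\<^sub>R e \<in> \<Omega>" if x: "x \<in> \<Omega>" for x
    proof -
      define y where "y = reflect e (m e) (2 *\<^sub>R c - x)"
      have y: "y \<in> \<Omega>" unfolding y_def by (rule m(1)[OF e point[OF x]])
      have "reflect e (m e) (2 *\<^sub>R c - y) \<in> \<Omega>" by (rule m(1)[OF e point[OF y]])
      moreover have "reflect e (m e) (2 *\<^sub>R c - y) = x + \<delta> *\<^sub>R e"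
      proof -
        have y1: "y = 2 *\<^sub>R c - x + (2 * (m e - 2 * (c \<bullet> e) + x \<bullet> e)) *\<^sub>R e"
          unfolding y_def refl by (simp add: inner_diff_left)
        have y2: "y \<bullet> e = 2 * m e - 2 * (c \<bullet> e) + x \<bullet> e"
          unfolding y1 by (simp add: inner_add_left inner_diff_left ee)
        have "reflect e (m e) (2 *\<^sub>R c - y) = 2 *\<^sub>R c - y + (2 * (m e - (2 * (c \<bullet> e) - y \<bullet> e))) *\<^sub>R e"
          unfolding refl by (simp add: inner_diff_left)
        also have "\<dots> = x + (2 * (m e - (2 * (c \<bullet> e) - y \<bullet> e)) - 2 * (m e - 2 * (c \<bullet> e) + x \<bullet> e)) *\<^sub>R e"
          by (subst (1) y1) (simp add: algebra_simps)
        also have "2 * (m e - (2 * (c \<bullet> e) - y \<bullet> e)) - 2 * (m e - 2 * (c \<bullet> e) + x \<bullet> e) = \<delta>"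
          unfolding y2 \<delta>_def by simp
        finally show ?thesis .
      qed
      ultimately show ?thesis by simp
    qed
    obtain x where x: "x \<in> \<Omega>" using ne by blast
    have it: "x + (real n * \<delta>) *\<^sub>R e \<in> \<Omega>" for n
    proof (induction n)
      case (Suc n)
      from step[OF Suc] show ?case by (simp add: algebra_simps)
    qed (simp add: x)
    obtain B where B: "\<And>y. y \<in> \<Omega> \<Longrightarrow> norm y \<le> B" using bd unfolding bounded_iff by blast
    have "\<bar>\<delta>\<bar> > 0" using ne' by (simp add: \<delta>_def)
    then obtain n :: nat where n: "2 * B < real n * \<bar>\<delta>\<bar>" using reals_Archimedean3 by blast
    have "real n * \<bar>\<delta>\<bar> = norm ((x + (real n * \<delta>) *\<^sub>R e) - x)" using e by (simp add: abs_mult)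
    also have "\<dots> \<le> norm (x + (real n * \<delta>) *\<^sub>R e) + norm x" by (rule norm_triangle_ineq4)
    also have "\<dots> \<le> B + B" by (intro add_mono B it x)
    finally show False using n by simp
  qed
  \<comment> \<open>\<open>x\<close> is mapped to \<open>y\<close> by the reflection in their
    perpendicular bisector. As \<open>y\<close> is at least as close to \<open>c\<close>, this
    bisector lies on or beyond the critical plane as seen from \<open>c\<close>, where reflections
    of caps stay in \<Omega>.\<close>
  have down: "y \<in> \<Omega>" if x: "x \<in> \<Omega>" and le: "norm (y - c) \<le> norm (x - c)" for x y
  proof (cases "x = y")
    case False
    define d where "d = norm (x - y)"
    have d: "d > 0" using False by (simp add: d_def)
    define e where "e = (x - y) /\<^sub>R d"
    have e: "norm e = 1" using d by (simp add: e_def d_def)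
    have de: "x - y = d *\<^sub>R e" using d by (simp add: e_def)
    have xy: "(x - y) \<bullet> e = d" using e unfolding de by (simp add: norm_eq_1)
    define \<nu> where "\<nu> = (x \<bullet> e + y \<bullet> e) / 2"
    have "reflect e \<nu> x = y"
    proof -
      have "2 * (\<nu> - x \<bullet> e) = - d" using xy by (simp add: \<nu>_def inner_diff_left)
      then have "reflect e \<nu> x = x - (x - y)" unfolding refl de by simp
      then show ?thesis by simp
    qed
    moreover have "m e \<le> \<nu>"
    proof -
      have "0 \<le> (norm (x - c))\<^sup>2 - (norm (y - c))\<^sup>2" using le by (simp add: power_mono)
      also have "\<dots> = ((x - c) + (y - c)) \<bullet> (x - y)"
        unfolding power2_norm_eq_inner by (simp add: algebra_simps inner_commute)
      also have "\<dots> = d * (((x - c) + (y - c)) \<bullet> e)" unfolding de by simp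
      finally have "0 \<le> ((x - c) + (y - c)) \<bullet> e" using d by (simp add: zero_le_mult_iff)
      then show ?thesis unfolding centre[OF e] \<nu>_def by (simp add: inner_add_left inner_diff_left)
    qed
    moreover have "x \<bullet> e > \<nu>" using xy d by (simp add: \<nu>_def inner_diff_left)
    ultimately show ?thesis using m(2)[OF e _ x, of \<nu>] by simp
  qed (use x in simp)
  define r where "r = (SUP x\<in>\<Omega>. norm (x - c))"
  obtain B where B: "\<And>y. y \<in> \<Omega> \<Longrightarrow> norm y \<le> B" using bd unfolding bounded_iff by blast
  have "norm (x - c) \<le> B + norm c" if "x \<in> \<Omega>" for x
    using norm_triangle_ineq4[of x c] B[OF that] by linarith
  then have bb: "bdd_above ((\<lambda>x. norm (x - c)) ` \<Omega>)" by (rule bdd_aboveI2)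
  have "\<Omega> = ball c r"
  proof (intro equalityI subsetI)
    fix y assume "y \<in> ball c r"
    then have "norm (y - c) < r" by (simp add: dist_norm norm_minus_commute)
    then obtain x where "x \<in> \<Omega>" "norm (y - c) < norm (x - c)"
      unfolding r_def using less_cSUP_iff[OF ne bb] by auto
    then show "y \<in> \<Omega>" using down[of x y] by simp
  next
    fix x assume x: "x \<in> \<Omega>"
    obtain s where s: "s > 0" "cball x s \<subseteq> \<Omega>" using op x open_contains_cball by blast
    obtain v :: 'a where v: "norm v = 1" "x - c = norm (x - c) *\<^sub>R v"
    proof (cases "x = c")
      case True
      obtain b :: 'a where "b \<in> Basis" using nonempty_Basis by blast
      then show ?thesis using that[of b] True by simp
    next
      case False
      then show ?thesis using that[of "(x - c) /\<^sub>R norm (x - c)"] by simp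
    qed
    have "x + s *\<^sub>R v \<in> \<Omega>" using s v(1) by (auto simp: dist_norm)
    then have "norm (x + s *\<^sub>R v - c) \<le> r" unfolding r_def by (rule cSUP_upper[OF _ bb])
    moreover have "x + s *\<^sub>R v - c = (norm (x - c) + s) *\<^sub>R v" using v(2) by (simp add: algebra_simps)
    ultimately have "norm (x - c) + s \<le> r" using v(1) s(1) by simp
    then show "x \<in> ball c r" using s(1) by (simp add: dist_norm norm_minus_commute)
  qed
  then show ?thesis by blast
qed

theorem mainTheorem2:
  fixes \<Omega> :: "'a::euclidean_space set"
    and u :: "'a \<Rightarrow> real \<Rightarrow> real"
    and t b :: "nat \<Rightarrow> real"
  assumes "DIM('a) \<ge> 2"
    and "smooth_bounded_domain \<Omega>"
    and "heat_solution_one \<Omega> u"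
    and "\<And>n. t n > 0"
    and "\<And>n. \<forall>x\<in>frontier \<Omega>. normal_deriv_eq \<Omega> (\<lambda>y. u y (t n)) x (b n)"
    and "0 islimpt range t"
  shows "\<exists>c r. \<Omega> = ball c r"
proof -
  note S = smooth_bounded_domainD[OF assms(2)]
  interpret H: heat_from_one \<Omega> u
    using S negligible_frontier_smooth_domain[OF assms(2)] assms(3) by unfold_locales auto
  have eq: "mean_curv \<rho> P = mean_curv \<rho>' P'"
    if "local_defining \<Omega> U \<rho>" "P \<in> U" "\<rho> P = 0" "local_defining \<Omega> U' \<rho>'" "P' \<in> U'" "\<rho>' P' = 0"
    for U \<rho> P U' \<rho>' P'
    using H.mean_curv_constant[OF that(1-6) assms(4,6,5)] H.mean_curv_constant[OF that(4-6,1-3) assms(4,6,5)]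
    by (rule order_antisym)
  have "\<exists>c. \<forall>U \<rho> x. local_defining \<Omega> U \<rho> \<longrightarrow> x \<in> U \<longrightarrow> \<rho> x = 0 \<longrightarrow> mean_curv \<rho> x = c"
  proof (cases "\<exists>U \<rho> x. local_defining \<Omega> U \<rho> \<and> x \<in> U \<and> \<rho> x = 0")
    case True then show ?thesis using eq by metis
  qed blast
  then obtain c where c: "\<And>U \<rho> x. local_defining \<Omega> U \<rho> \<Longrightarrow> x \<in> U \<Longrightarrow> \<rho> x = 0 \<Longrightarrow> mean_curv \<rho> x = c"
    by blast
  \<comment> \<open>The whole sequence has been used for the curvature; for the moving planes a
    single time is fixed.\<close>
  interpret O: overdetermined_heat \<Omega> u "t 0" "b 0" c
    by unfold_locales (use assms c in auto)
  show ?thesis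
  proof (rule ball_if_symmetric_planes[OF S(1,3,4)])
    fix e :: 'a assume "norm e = 1"
    then obtain \<mu> where "\<And>x. x \<in> \<Omega> \<Longrightarrow> reflect e \<mu> x \<in> \<Omega>"
      "\<And>\<nu> x. \<mu> \<le> \<nu> \<Longrightarrow> x \<in> \<Omega> \<Longrightarrow> x \<bullet> e > \<nu> \<Longrightarrow> reflect e \<nu> x \<in> \<Omega>"
      by (rule O.symmetric_plane) blast
    then show "\<exists>\<mu>. (\<forall>x\<in>\<Omega>. reflect e \<mu> x \<in> \<Omega>) \<and> (\<forall>\<nu>\<ge>\<mu>. \<forall>x\<in>\<Omega>. x \<bullet> e > \<nu> \<longrightarrow> reflect e \<nu> x \<in> \<Omega>)"
      by blast
  qed
qed

end
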